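(* Let $\Omega\subseteq\mathbb{R}^n$ be a bounded convex domain and let $V:\Omega\to\mathbb{R}$ be convex. Then the first Dirichlet eigenfunction $u>0$ of $-\Delta+V$ on $\Omega$ is log-concave, i.e. for all $x_0,x_1\in\Omega$ and $t\in[0,1]$, $$u\big((1-t)x_0+tx_1\big)\ge u(x_0)^{1-t}u(x_1)^t .$$
   Context: A domain is a connected open set. The first Dirichlet eigenvalue of $-\Delta+V$ on $\Omega$ is $$\lambda(\Omega)=\inf\left\{\frac{\int_\Omega |\nabla u|^2+Vu^2\,dx}{\int_\Omega u^2\,dx}: u\in W^{1,2}_0(\Omega)\setminus\{0\}\right\},$$ and the first Dirichlet eigenfunction is the (unique up to scaling) positive minimiser, which satisfies $-\Delta u+Vu=\lambda(\Omega)u$ in $\Omega$ with $u=0$ on $\partial\Omega$. *)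

theory Defs
  imports "HOL-Analysis.Analysis"
begin

definition domain :: "'a::euclidean_space set \<Rightarrow> bool" where
  "domain \<Omega> \<longleftrightarrow> open \<Omega> \<and> connected \<Omega>"

fun C_k :: "nat \<Rightarrow> ('a::euclidean_space \<Rightarrow> real) \<Rightarrow> bool" where
  "C_k 0 f \<longleftrightarrow> continuous_on UNIV f"
| "C_k (Suc k) f \<longleftrightarrow> (\<forall>x. f differentiable (at x)) \<and>
     (\<forall>i\<in>Basis. C_k k (\<lambda>x. frechet_derivative f (at x) i))"

text \<open>The space of smooth functions with compact support in \<open>\<Omega>\<close>, each extended by zero to
  the whole space.\<close>

definition test_function :: "'a::euclidean_space set \<Rightarrow> ('a \<Rightarrow> real) \<Rightarrow> bool" where
  "test_function \<Omega> \<phi> \<longleftrightarrow> (\<forall>k. C_k k \<phi>) \<and>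
     compact (closure {x. \<phi> x \<noteq> 0}) \<and> closure {x. \<phi> x \<noteq> 0} \<subseteq> \<Omega>"

definition locally_integrable ::
    "'a::euclidean_space set \<Rightarrow> ('a \<Rightarrow> 'b::euclidean_space) \<Rightarrow> bool" where
  "locally_integrable \<Omega> f \<longleftrightarrow> (\<forall>K. compact K \<and> K \<subseteq> \<Omega> \<longrightarrow> integrable (lebesgue_on K) f)"

definition is_weak_gradient ::
    "'a::euclidean_space set \<Rightarrow> ('a \<Rightarrow> real) \<Rightarrow> ('a \<Rightarrow> 'a) \<Rightarrow> bool" where
  "is_weak_gradient \<Omega> u g \<longleftrightarrow> locally_integrable \<Omega> u \<and> locally_integrable \<Omega> g \<and>
     (\<forall>\<phi> i. test_function \<Omega> \<phi> \<and> i \<in> Basis \<longrightarrow>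
        (LINT x|lebesgue_on \<Omega>. u x * frechet_derivative \<phi> (at x) i)
          = - (LINT x|lebesgue_on \<Omega>. (g x \<bullet> i) * \<phi> x))"

text \<open>Weak gradients on an open set are unique almost everywhere there, so the choice below does
  not affect any of the integrals over \<open>\<Omega>\<close> in which it is used.\<close>

definition weak_gradient ::
    "'a::euclidean_space set \<Rightarrow> ('a \<Rightarrow> real) \<Rightarrow> 'a \<Rightarrow> 'a" where
  "weak_gradient \<Omega> u = (SOME g. is_weak_gradient \<Omega> u g)"

text \<open>Elements of the Sobolev spaces are represented by functions; values outside \<open>\<Omega>\<close> and on
  null sets are irrelevant.\<close>

definition W12 :: "'a::euclidean_space set \<Rightarrow> ('a \<Rightarrow> real) set" where
  "W12 \<Omega> = {u. u \<in> borel_measurable (lebesgue_on \<Omega>) \<and>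
      integrable (lebesgue_on \<Omega>) (\<lambda>x. (u x)\<^sup>2) \<and>
      (\<exists>g. is_weak_gradient \<Omega> u g \<and> g \<in> borel_measurable (lebesgue_on \<Omega>) \<and>
           integrable (lebesgue_on \<Omega>) (\<lambda>x. (norm (g x))\<^sup>2))}"

definition W12_norm :: "'a::euclidean_space set \<Rightarrow> ('a \<Rightarrow> real) \<Rightarrow> real" where
  "W12_norm \<Omega> u =
     sqrt (LINT x|lebesgue_on \<Omega>. (u x)\<^sup>2 + (norm (weak_gradient \<Omega> u x))\<^sup>2)"

definition W12_0 :: "'a::euclidean_space set \<Rightarrow> ('a \<Rightarrow> real) set" where
  "W12_0 \<Omega> = {u \<in> W12 \<Omega>. \<exists>\<phi> :: nat \<Rightarrow> 'a \<Rightarrow> real.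
      (\<forall>k. test_function \<Omega> (\<phi> k)) \<and>
      (\<lambda>k. W12_norm \<Omega> (\<lambda>x. u x - \<phi> k x)) \<longlonglongrightarrow> 0}"

text \<open>The integral as positive part minus negative part, with values in the extended reals.
  A convex \<open>V\<close> is bounded below on a bounded \<open>\<Omega>\<close> but may blow up at the boundary, so
  the integral of \<open>V u\<^sup>2\<close> may be \<open>+\<infinity>\<close>; the Bochner integral would
  be \<open>0\<close> in that case.\<close>

definition ext_integral :: "'a measure \<Rightarrow> ('a \<Rightarrow> real) \<Rightarrow> ereal" where
  "ext_integral M f =
     enn2ereal (\<integral>\<^sup>+x. ennreal (f x) \<partial>M) - enn2ereal (\<integral>\<^sup>+x. ennreal (- f x) \<partial>M)"

definition rayleigh_quotient ::
    "'a::euclidean_space set \<Rightarrow> ('a \<Rightarrow> real) \<Rightarrow> ('a \<Rightarrow> real) \<Rightarrow> ereal" where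
  "rayleigh_quotient \<Omega> V u =
     ext_integral (lebesgue_on \<Omega>) (\<lambda>x. (norm (weak_gradient \<Omega> u x))\<^sup>2 + V x * (u x)\<^sup>2)
       / ereal (LINT x|lebesgue_on \<Omega>. (u x)\<^sup>2)"

definition W12_0_nonzero :: "'a::euclidean_space set \<Rightarrow> ('a \<Rightarrow> real) set" where
  "W12_0_nonzero \<Omega> = {u \<in> W12_0 \<Omega>. \<not> (AE x in lebesgue_on \<Omega>. u x = 0)}"

definition first_dirichlet_eigenvalue ::
    "'a::euclidean_space set \<Rightarrow> ('a \<Rightarrow> real) \<Rightarrow> ereal" where
  "first_dirichlet_eigenvalue \<Omega> V = (INF u\<in>W12_0_nonzero \<Omega>. rayleigh_quotient \<Omega> V u)"

text \<open>Continuity selects the representative of the Sobolev function \<open>u\<close> whose pointwise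
  values are meant.\<close>

definition first_dirichlet_eigenfunction ::
    "'a::euclidean_space set \<Rightarrow> ('a \<Rightarrow> real) \<Rightarrow> ('a \<Rightarrow> real) \<Rightarrow> bool" where
  "first_dirichlet_eigenfunction \<Omega> V u \<longleftrightarrow>
     u \<in> W12_0_nonzero \<Omega> \<and>
     rayleigh_quotient \<Omega> V u = first_dirichlet_eigenvalue \<Omega> V \<and>
     continuous_on \<Omega> u \<and> (\<forall>x\<in>\<Omega>. u x > 0)"

end

theory Submission
  imports Defs "HOL-Computational_Algebra.Polynomial" "HOL-Probability.Probability" "HOL-Real_Asymp.Real_Asymp"
begin

text \<open>The proof is a Brascamp-Lieb argument in which a discrete semigroup replaces the heat flow. Let \<open>A\<close>
  be the average over a ball of small radius \<open>r\<close> with a fixed radial log-concave density,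
  \<open>c\<close> a suitable multiple of its second moment, and
  \<open>T f = 1\<^sub>W A (exp (- c r\<^sup>2 V) 1\<^sub>\<Omega> A f)\<close>, where \<open>W\<close> is a slightly smaller convex set
  inside \<open>\<Omega>\<close>. Since \<open>V\<close> is convex, the Prekopa-Leindler inequality shows that \<open>T\<close> preserves log-concavity.

  A dilated truncation of \<open>u\<close> shows that the top of the spectrum of \<open>T\<close> is at least
  \<open>1 - c r\<^sup>2 (\<lambda> + \<epsilon>)\<close>, so power iteration started at \<open>1\<^sub>W\<close> yields a log-concave \<open>g\<close> with
  \<open>\<langle>T g, g\<rangle> \<ge> 1 - c r\<^sup>2 (\<lambda> + \<epsilon>)\<close> times \<open>\<langle>g, g\<rangle>\<close>. Conversely the equation for \<open>u\<close> gives
  \<open>T u \<le> (1 - c r\<^sup>2 (\<lambda> - \<epsilon>)) u\<close>. Comparing the two through Lagrange's identity bounds a nonlocal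
  Dirichlet energy of \<open>g / u\<close> by a multiple of \<open>\<epsilon> r\<^sup>2\<close>. Chaining small steps turns this into smallness of
  all differences of \<open>g / u\<close> in \<open>L\<^sup>2\<close>, so \<open>g / u\<close> is nearly constant away from the boundary, while the same
  chaining prevents the mass of \<open>g\<close> from escaping to the boundary. Hence \<open>u\<close> is arbitrarily close to a
  multiple of a log-concave function, and a strict failure of log-concavity is impossible by continuity.\<close>

section \<open>Smooth functions and a smooth bump\<close>

text \<open>No boundary behaviour of \<open>u\<close> is used beyond membership in the Sobolev
  space, and \<open>V\<close> may blow up at the boundary. So the operators act on bounded Borel
  functions with bounded support, and neither parabolic regularity nor a spectral theorem is
  invoked. The constant c is the second moment of the density in a unit direction: one average is 1
  + (c r^2 / 2) Laplacian to leading order, hence average, multiplication by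
  \<open>exp (- c r\<^sup>2 V)\<close> and average again give 1 + c r^2 (Laplacian - V), with value
  1 - c r^2 \<lambda> on \<open>u\<close>. Both spectral bounds must therefore have the sharp
  constant at order r^2, while errors of smaller order are harmless. The obstacle is that bounds on
  \<open>u\<close> and 1 / \<open>u\<close> degenerate as the inner set W exhausts \<Omega>. The
  order of choice avoids a circle: the tightness constants and the compact set on which the
  contradiction is reached are fixed before \<epsilon>, the set W after \<epsilon>, and r last. No
  limit of the functions g is taken; one g with sufficiently small \<epsilon> contradicts a strict
  failure of log-concavity.\<close>

lemma C_k_mono: "C_k (Suc k) f \<Longrightarrow> C_k k f"
proof (induction k arbitrary: f)
  case 0
  then have "\<forall>x. isCont f x"
    by (auto intro: differentiable_imp_continuous_within)
  then show ?case by (simp add: continuous_on_eq_continuous_within)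
next
  case (Suc k)
  then show ?case by (metis C_k.simps(2))
qed

lemma C_k_differentiable: "C_k (Suc k) f \<Longrightarrow> f differentiable (at x)"
  by simp

lemma C_k_const: "C_k k (\<lambda>x. c)"
  by (induction k arbitrary: c) (auto simp: frechet_derivative_const)

lemma C_k_add: "C_k k f \<Longrightarrow> C_k k g \<Longrightarrow> C_k k (\<lambda>x. f x + g x)"
proof (induction k arbitrary: f g)
  case 0
  then show ?case by (auto intro: continuous_on_add)
next
  case (Suc k)
  have "frechet_derivative (\<lambda>x. f x + g x) (at x) i =
      frechet_derivative f (at x) i + frechet_derivative g (at x) i"
    if df: "f differentiable (at x)" "g differentiable (at x)" for x i
  proof -
    have "((\<lambda>x. f x + g x) has_derivative (\<lambda>h. frechet_derivative f (at x) h + frechet_derivative g (at x) h)) (at x)"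
      using df by (intro has_derivative_add) (auto simp: frechet_derivative_works[symmetric])
    note D = this
    show ?thesis using frechet_derivative_at[OF D, symmetric] by simp
  qed
  then show ?case using Suc by (simp add: differentiable_add)
qed

lemma C_k_mult: "C_k k f \<Longrightarrow> C_k k g \<Longrightarrow> C_k k (\<lambda>x. f x * g x)"
proof (induction k arbitrary: f g)
  case 0
  then show ?case by (auto intro: continuous_on_mult)
next
  case (Suc k)
  have d: "f differentiable (at x)" "g differentiable (at x)" for x
    using Suc.prems by auto
  have "frechet_derivative (\<lambda>x. f x * g x) (at x) i =
      f x * frechet_derivative g (at x) i + frechet_derivative f (at x) i * g x" for x i
  proof -
    have "((\<lambda>x. f x * g x) has_derivative (\<lambda>h. f x * frechet_derivative g (at x) h + frechet_derivative f (at x) h * g x)) (at x)"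
      using d[of x] by (intro has_derivative_mult) (auto simp: frechet_derivative_works[symmetric])
    note D = this
    show ?thesis using frechet_derivative_at[OF D, symmetric] by simp
  qed
  moreover have "C_k k f" "C_k k g" using Suc.prems C_k_mono by blast+
  ultimately show ?case using Suc.prems d
    by (auto intro!: C_k_add Suc.IH differentiable_mult)
qed

lemma C_k_linear: 
  assumes "bounded_linear f"
  shows "C_k k f"
proof (cases k)
  case 0
  then show ?thesis using assms by (simp add: linear_continuous_on)
next
  case (Suc m)
  have "frechet_derivative f (at x) = f" for x
    using bounded_linear_imp_has_derivative[OF assms] by (metis frechet_derivative_at)
  then show ?thesis using Suc assms bounded_linear_imp_differentiable
    by (auto simp: C_k_const)
qed

text \<open>Differentiating \<open>\<eta> j (q x)\<close> produces
  \<open>\<eta> (Suc j) (q x)\<close> times a derivative of \<open>q\<close>, so the induction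
  carries the whole sequence of successive derivatives and varies \<open>j\<close>.\<close>

lemma C_k_compose_family:
  fixes \<eta> :: "nat \<Rightarrow> real \<Rightarrow> real" and q :: "'a::euclidean_space \<Rightarrow> real"
  assumes d: "\<And>j s. (\<eta> j has_field_derivative \<eta> (Suc j) s) (at s)"
    and q: "\<And>k. C_k k q"
  shows "C_k k (\<lambda>x. \<eta> j (q x))"
proof (induction k arbitrary: j)
  case 0
  have "continuous_on UNIV (\<eta> j)"
    by (meson d DERIV_isCont continuous_at_imp_continuous_on)
  then show ?case using q[of 0]
    by (auto intro: continuous_on_compose2)
next
  case (Suc k)
  have dq: "q differentiable (at x)" for x using q[of "Suc 0"] by simp
  have D: "((\<lambda>x. \<eta> j (q x)) has_derivative (\<lambda>h. \<eta> (Suc j) (q x) * frechet_derivative q (at x) h)) (at x)" for x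
    using diff_chain_at[OF frechet_derivative_works[THEN iffD1, OF dq] d[of j "q x", unfolded has_field_derivative_def]]
    by (simp add: o_def)
  have "frechet_derivative (\<lambda>x. \<eta> j (q x)) (at x) i = \<eta> (Suc j) (q x) * frechet_derivative q (at x) i" for x i
    using frechet_derivative_at[OF D[of x]] by metis
  moreover have "C_k k (\<lambda>x. frechet_derivative q (at x) i)" if "i \<in> Basis" for i
    using q[of "Suc k"] that by simp
  moreover have "(\<lambda>x. \<eta> j (q x)) differentiable (at x)" for x
    using D differentiable_def by blast
  ultimately show ?case using C_k_mult[OF Suc.IH[of "Suc j"]] unfolding C_k.simps by presburger
qed

text \<open>Put X = 1 / (1 - s), so that X' = X^2. The derivative of p(X) exp(- 2 X) is (p' - 2
  p)(X) X^2 exp(- 2 X), which gives the recursion.\<close>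

fun bump_poly :: "nat \<Rightarrow> real poly" where
  "bump_poly 0 = 1"
| "bump_poly (Suc j) = (pderiv (bump_poly j) - smult 2 (bump_poly j)) * [:0, 0, 1:]"

text \<open>The \<open>j\<close>-th derivative of \<open>s \<mapsto> exp (- 2 / (1 - s))\<close>. The constant 2 makes the first derivative
  log-concave as a function of \<open>\<bar>y\<bar>\<^sup>2 = s\<close>.\<close>

definition bump_profile :: "nat \<Rightarrow> real \<Rightarrow> real" where
  "bump_profile j s = (if s < 1 then poly (bump_poly j) (1 / (1 - s)) * exp (- 2 / (1 - s)) else 0)"

lemma poly_times_exp_tendsto_0:
  "((\<lambda>x::real. poly p x * exp (- 2 * x)) \<longlongrightarrow> 0) at_top"
proof -
  have "((\<lambda>x::real. x ^ k * exp (- 2 * x)) \<longlongrightarrow> 0) at_top" for k :: nat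
    by real_asymp
  then have "((\<lambda>x::real. \<Sum>i\<le>degree p. coeff p i * (x ^ i * exp (- 2 * x))) \<longlongrightarrow> (\<Sum>i\<le>degree p. coeff p i * 0)) at_top"
    by (intro tendsto_sum tendsto_mult tendsto_const)
  then show ?thesis by (simp add: poly_altdef sum_distrib_right mult.assoc)
qed

lemma bump_profile_tendsto_0:
  "((\<lambda>s. poly p (1 / (1 - s)) * exp (- 2 / (1 - s))) \<longlongrightarrow> 0) (at_left (1::real))"
proof -
  have "filterlim (\<lambda>s::real. 1 / (1 - s)) at_top (at_left 1)"
    by real_asymp
  from filterlim_compose[OF poly_times_exp_tendsto_0 this] show ?thesis by simp
qed

lemma bump_profile_deriv:
  "(bump_profile j has_field_derivative bump_profile (Suc j) s) (at s)"
proof -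
  consider "s < 1" | "s = 1" | "s > 1" by linarith
  then show ?thesis
  proof cases
    case 1
    have x: "((\<lambda>s. 1 / (1 - s)) has_field_derivative (1 / (1 - s))\<^sup>2) (at s)"
      using 1 by (auto intro!: derivative_eq_intros simp: power2_eq_square)
    have "((\<lambda>x. poly (bump_poly j) x * exp (- 2 * x)) has_field_derivative
        (poly (pderiv (bump_poly j)) x - 2 * poly (bump_poly j) x) * exp (- 2 * x)) (at x)" for x
      by (auto intro!: derivative_eq_intros simp: algebra_simps)
    from DERIV_chain2[OF this x]
    have "((\<lambda>s. poly (bump_poly j) (1 / (1 - s)) * exp (- 2 / (1 - s))) has_field_derivative bump_profile (Suc j) s) (at s)"
      using 1 by (simp add: bump_profile_def power2_eq_square mult_ac)
    moreover have "\<forall>\<^sub>F t in nhds s. t < 1"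
      using 1 by (simp add: eventually_nhds_in_open[of "{..<1}" s, simplified])
    then have "\<forall>\<^sub>F t in nhds s. bump_profile j t = poly (bump_poly j) (1 / (1 - t)) * exp (- 2 / (1 - t))"
      by eventually_elim (simp add: bump_profile_def)
    ultimately show ?thesis by (subst DERIV_cong_ev[OF refl _ refl])
  next
    case 2
    have z: "bump_profile j 1 = 0" "bump_profile (Suc j) 1 = 0" by (auto simp: bump_profile_def)
    \<comment> \<open>Division by \<open>y - 1\<close> multiplies the polynomial by -X, where X = 1
      / (1 - y). The quotient is again a polynomial in X times exp(- 2 X), so every one-sided
      derivative at the gluing point vanishes.\<close>
    have "((\<lambda>y. (bump_profile j y - bump_profile j 1) / (y - 1)) \<longlongrightarrow> 0) (at_left 1)"
    proof (rule Lim_transform_eventually[OF bump_profile_tendsto_0[of "- (bump_poly j) * [:0,1:]"]])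
      show "\<forall>\<^sub>F x in at_left 1. poly (- bump_poly j * [:0, 1:]) (1 / (1 - x)) * exp (- 2 / (1 - x)) = (bump_profile j x - bump_profile j 1) / (x - 1)"
        unfolding eventually_at_left_field
        by (intro exI[of _ 0]) (auto simp: z, auto simp: bump_profile_def field_simps)
    qed
    moreover have "((\<lambda>y. (bump_profile j y - bump_profile j 1) / (y - 1)) \<longlongrightarrow> 0) (at_right 1)"
      by (rule tendsto_eventually) (auto simp: eventually_at_right_field bump_profile_def intro!: exI[of _ 2])
    ultimately have "((\<lambda>y. (bump_profile j y - bump_profile j 1) / (y - 1)) \<longlongrightarrow> 0) (at 1)"
      using filterlim_split_at by blast
    then show ?thesis using 2 z by (simp add: has_field_derivative_iff)
  next
    case 3
    have "((\<lambda>s. 0) has_field_derivative bump_profile (Suc j) s) (at s)"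
      using 3 by (auto simp: bump_profile_def)
    moreover have "\<forall>\<^sub>F t in nhds s. t > 1"
      using 3 by (simp add: eventually_nhds_in_open[of "{1<..}" s, simplified])
    then have "\<forall>\<^sub>F t in nhds s. bump_profile j t = 0"
      by eventually_elim (simp add: bump_profile_def)
    ultimately show ?thesis by (subst DERIV_cong_ev[OF refl _ refl])
  qed
qed

lemma bump_profile_continuous: "continuous_on S (bump_profile j)"
  by (meson bump_profile_deriv DERIV_isCont continuous_at_imp_continuous_on)

lemma C_k_sqdist: "C_k k (\<lambda>y::'a::euclidean_space. (norm (y - x))\<^sup>2 / \<rho>\<^sup>2)"
proof -
  have *: "C_k k (\<lambda>y. (y - x) \<bullet> i)" for i
    using C_k_add[OF C_k_linear[OF bounded_linear_inner_left, of k i] C_k_const[of k "- (x \<bullet> i)"]]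
    by (simp add: inner_diff_left)
  have "C_k k (\<lambda>y. \<Sum>i\<in>B. ((y - x) \<bullet> i) * ((y - x) \<bullet> i))" if "finite B" for B
    using that by (induction B) (auto simp: C_k_const intro!: C_k_add C_k_mult *)
  from C_k_mult[OF this[OF finite_Basis] C_k_const[of k "1 / \<rho>\<^sup>2"]]
  show ?thesis by (simp add: power2_norm_eq_inner euclidean_inner[symmetric])
qed

definition scaled_bump :: "'a::euclidean_space \<Rightarrow> real \<Rightarrow> 'a \<Rightarrow> real" where
  "scaled_bump x \<rho> y = bump_profile 0 ((norm (y - x))\<^sup>2 / \<rho>\<^sup>2)"

lemma test_function_scaled_bump:
  assumes "\<rho> > 0" "cball x \<rho> \<subseteq> \<Omega>"
  shows "test_function \<Omega> (scaled_bump x \<rho>)"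
proof -
  have "{y. scaled_bump x \<rho> y \<noteq> 0} \<subseteq> cball x \<rho>"
  proof
    fix y assume "y \<in> {y. scaled_bump x \<rho> y \<noteq> 0}"
    then have "(norm (y - x))\<^sup>2 / \<rho>\<^sup>2 < 1"
      by (auto simp: scaled_bump_def bump_profile_def split: if_splits)
    then have "(norm (y - x))\<^sup>2 < \<rho>\<^sup>2" using assms by (simp add: field_simps)
    then show "y \<in> cball x \<rho>" using assms
      using power2_less_imp_less[of "norm (y - x)" \<rho>] by (simp add: dist_norm norm_minus_commute)
  qed
  then have "closure {y. scaled_bump x \<rho> y \<noteq> 0} \<subseteq> cball x \<rho>"
    by (simp add: closure_minimal)
  moreover from this have "compact (closure {y. scaled_bump x \<rho> y \<noteq> 0})"
    by (meson bounded_cball bounded_subset closed_closure compact_eq_bounded_closed)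
  moreover have "C_k k (scaled_bump x \<rho>)" for k
    unfolding scaled_bump_def[abs_def]
    by (rule C_k_compose_family[of bump_profile "\<lambda>y. (norm (y - x))\<^sup>2 / \<rho>\<^sup>2"])
      (rule bump_profile_deriv C_k_sqdist)+
  ultimately show ?thesis using assms by (auto simp: test_function_def)
qed

lemma scaled_bump_frechet:
  assumes "\<rho> > 0"
  shows "((\<lambda>y. bump_profile j ((norm (y - x))\<^sup>2 / \<rho>\<^sup>2)) has_derivative
     (\<lambda>h. bump_profile (Suc j) ((norm (y - x))\<^sup>2 / \<rho>\<^sup>2) * (2 * ((y - x) \<bullet> h) / \<rho>\<^sup>2))) (at y)"
proof -
  have "((\<lambda>y. (norm (y - x))\<^sup>2 / \<rho>\<^sup>2) has_derivative (\<lambda>h. 2 * ((y - x) \<bullet> h) / \<rho>\<^sup>2)) (at y)"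
  proof -
    have "((\<lambda>y. (norm (y - x))\<^sup>2) has_derivative (\<lambda>h. 2 * ((y - x) \<bullet> h))) (at y)"
      unfolding power2_norm_eq_inner
      by (auto intro!: derivative_eq_intros simp: inner_commute)
    from has_derivative_mult_left[OF this, of "1 / \<rho>\<^sup>2"] show ?thesis by simp
  qed
  from diff_chain_at[OF this bump_profile_deriv[of j, unfolded has_field_derivative_def]]
  show ?thesis by (simp add: o_def)
qed

section \<open>Closure properties of test functions\<close>

lemma test_function_mono: "test_function S \<phi> \<Longrightarrow> S \<subseteq> T \<Longrightarrow> test_function T \<phi>"
  by (auto simp: test_function_def)

lemma test_function_mult:
  assumes "test_function \<Omega> \<phi>" "\<And>k. C_k k f"
  shows "test_function \<Omega> (\<lambda>x. f x * \<phi> x)"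
proof -
  have "closure {x. f x * \<phi> x \<noteq> 0} \<subseteq> closure {x. \<phi> x \<noteq> 0}"
    by (intro closure_mono) auto
  then show ?thesis using assms
    by (auto simp: test_function_def compact_closure C_k_mult intro: bounded_subset closure_subset)
qed

lemma closed_subset_of_compact:
  fixes S :: "'a::heine_borel set"
  shows "compact T \<Longrightarrow> closed S \<Longrightarrow> S \<subseteq> T \<Longrightarrow> compact S"
  by (meson bounded_subset compact_eq_bounded_closed)

lemma test_function_add:
  assumes "test_function \<Omega> \<phi>" "test_function \<Omega> \<psi>"
  shows "test_function \<Omega> (\<lambda>x. \<phi> x + \<psi> x)"
proof -
  have *: "closure {x. \<phi> x + \<psi> x \<noteq> 0} \<subseteq> closure {x. \<phi> x \<noteq> 0} \<union> closure {x. \<psi> x \<noteq> 0}"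
    unfolding closure_Un[symmetric] by (intro closure_mono) auto
  moreover have "compact (closure {x. \<phi> x \<noteq> 0} \<union> closure {x. \<psi> x \<noteq> 0})"
    using assms by (auto simp: test_function_def intro!: compact_Un)
  ultimately have "compact (closure {x. \<phi> x + \<psi> x \<noteq> 0})"
    by (rule closed_subset_of_compact[OF _ closed_closure, rotated])
  then show ?thesis using assms * by (auto simp: test_function_def C_k_add)
qed

lemma test_function_cmult: "test_function \<Omega> \<phi> \<Longrightarrow> test_function \<Omega> (\<lambda>x. c * \<phi> x)"
  by (rule test_function_mult) (auto simp: C_k_const)

lemma test_function_C_k: "test_function \<Omega> \<phi> \<Longrightarrow> C_k k \<phi>"
  by (simp add: test_function_def)

lemma test_function_has_derivative:
  assumes "test_function \<Omega> \<phi>"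
  shows "(\<phi> has_derivative frechet_derivative \<phi> (at x)) (at x)"
proof -
  from C_k_differentiable[OF test_function_C_k[OF assms]] show ?thesis by (rule frechet_derivative_works[THEN iffD1])
qed

lemma test_function_vanish:
  assumes "test_function \<Omega> \<phi>" "x \<notin> closure {x. \<phi> x \<noteq> 0}"
  shows "\<phi> x = 0" "frechet_derivative \<phi> (at x) = (\<lambda>h. 0)"
proof -
  show "\<phi> x = 0" using assms(2) closure_subset[of "{x. \<phi> x \<noteq> 0}"] by auto
  have "(\<phi> has_derivative (\<lambda>h. 0)) (at x)"
  proof (rule has_derivative_transform_within_open[of "\<lambda>y. 0" _ _ UNIV "- closure {x. \<phi> x \<noteq> 0}"])
    show "0 = \<phi> y" if "y \<in> - closure {x. \<phi> x \<noteq> 0}" for y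
      using that closure_subset[of "{x. \<phi> x \<noteq> 0}"] by auto
  qed (use assms in auto)
  from frechet_derivative_at[OF this] show "frechet_derivative \<phi> (at x) = (\<lambda>h. 0)" by (rule sym)
qed

lemma test_function_deriv:
  assumes "test_function \<Omega> \<phi>" "i \<in> Basis"
  shows "test_function \<Omega> (\<lambda>x. frechet_derivative \<phi> (at x) i)"
proof -
  have "{x. frechet_derivative \<phi> (at x) i \<noteq> 0} \<subseteq> closure {x. \<phi> x \<noteq> 0}"
    using test_function_vanish(2)[OF assms(1)] by force
  then have *: "closure {x. frechet_derivative \<phi> (at x) i \<noteq> 0} \<subseteq> closure {x. \<phi> x \<noteq> 0}"
    by (simp add: closure_minimal)
  have "C_k k (\<lambda>x. frechet_derivative \<phi> (at x) i)" for k
  proof -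
    show ?thesis using test_function_C_k[OF assms(1), of "Suc k"] assms(2) unfolding C_k.simps by fast
  qed
  moreover have "compact (closure {x. frechet_derivative \<phi> (at x) i \<noteq> 0})"
    using closed_subset_of_compact[OF _ closed_closure *] assms by (auto simp: test_function_def)
  ultimately show ?thesis using assms * by (auto simp: test_function_def)
qed

section \<open>Bounded functions with bounded support\<close>

text \<open>The working class of the proof: it is closed under sums, products and averages, and all
  its members are integrable, which settles nearly all integrability conditions at once. Borel
  rather than Lebesgue measurability is asked for because translates and product measures enter
  throughout.\<close>

definition bbs :: "('a::euclidean_space \<Rightarrow> real) \<Rightarrow> bool" where
  "bbs f \<longleftrightarrow> f \<in> borel_measurable borel \<and> (\<exists>C. \<forall>x. \<bar>f x\<bar> \<le> C) \<and> (\<exists>R. \<forall>x. R < norm x \<longrightarrow> f x = 0)"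

lemma bbsI:
  assumes "f \<in> borel_measurable borel" "\<And>x. \<bar>f x\<bar> \<le> C" "\<And>x. R < norm x \<Longrightarrow> f x = 0"
  shows "bbs f"
  using assms unfolding bbs_def by blast

lemma bbsE:
  assumes "bbs f"
  obtains C R where "f \<in> borel_measurable borel" "\<And>x. \<bar>f x\<bar> \<le> C" "\<And>x. R < norm x \<Longrightarrow> f x = 0" "C \<ge> 0" "R \<ge> 0"
proof -
  from assms obtain C R where *: "f \<in> borel_measurable borel" "\<forall>x. \<bar>f x\<bar> \<le> C" "\<forall>x. R < norm x \<longrightarrow> f x = 0"
    unfolding bbs_def by blast
  show ?thesis
  proof (rule that[of C "max R 0"])
    show "C \<ge> 0" using *(2) by (meson abs_ge_zero order_trans)
  qed (use * in auto)
qed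

lemma bbs_measurable: "bbs f \<Longrightarrow> f \<in> borel_measurable borel"
  by (simp add: bbs_def)

lemma bbs_mult_bounded:
  assumes "bbs f" "g \<in> borel_measurable borel" "\<And>x. f x \<noteq> 0 \<Longrightarrow> \<bar>g x\<bar> \<le> B"
  shows "bbs (\<lambda>x. g x * f x)"
proof -
  obtain C R where *: "f \<in> borel_measurable borel" "\<And>x. \<bar>f x\<bar> \<le> C" "\<And>x. R < norm x \<Longrightarrow> f x = 0" "C \<ge> 0" "R \<ge> 0"
    using bbsE[OF assms(1)] by metis
  show ?thesis
  proof (rule bbsI[where C = "\<bar>B\<bar> * C" and R = R])
    show "\<bar>g x * f x\<bar> \<le> \<bar>B\<bar> * C" for x
      using assms(3)[of x] *(2)[of x] *(4) by (cases "f x = 0") (auto simp: abs_mult intro!: mult_mono)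
  qed (use * assms in auto)
qed

lemma bbs_mult: "bbs f \<Longrightarrow> bbs g \<Longrightarrow> bbs (\<lambda>x. f x * g x)"
proof -
  assume f: "bbs f" and g: "bbs g"
  obtain C where "\<And>x. \<bar>f x\<bar> \<le> C" using bbsE[OF f] by metis
  then show "bbs (\<lambda>x. f x * g x)" using bbs_mult_bounded[OF g bbs_measurable[OF f]] by blast
qed

lemma bbs_cmult: "bbs f \<Longrightarrow> bbs (\<lambda>x. c * f x)"
  by (rule bbs_mult_bounded) auto

lemma bbs_power2: "bbs f \<Longrightarrow> bbs (\<lambda>x. (f x)\<^sup>2)"
  by (simp add: power2_eq_square bbs_mult)

lemma bbs_add:
  assumes "bbs f" "bbs g"
  shows "bbs (\<lambda>x. f x + g x)"
proof -
  obtain C R where *: "f \<in> borel_measurable borel" "\<And>x. \<bar>f x\<bar> \<le> C" "\<And>x. R < norm x \<Longrightarrow> f x = 0" 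
    using bbsE[OF assms(1)] by metis
  obtain C' R' where **: "g \<in> borel_measurable borel" "\<And>x. \<bar>g x\<bar> \<le> C'" "\<And>x. R' < norm x \<Longrightarrow> g x = 0" 
    using bbsE[OF assms(2)] by metis
  show ?thesis
  proof (rule bbsI[where C = "C + C'" and R = "max R R'"])
    show "\<bar>f x + g x\<bar> \<le> C + C'" for x using *(2)[of x] **(2)[of x] by linarith
  qed (use * ** in auto)
qed

lemma bbs_diff: "bbs f \<Longrightarrow> bbs g \<Longrightarrow> bbs (\<lambda>x. f x - g x)"
  using bbs_add[of f "\<lambda>x. (-1) * g x"] bbs_cmult[of g "-1"] by simp

lemma bbs_indicator: "S \<in> sets borel \<Longrightarrow> bounded S \<Longrightarrow> bbs (indicator S)"
proof -
  assume S: "S \<in> sets borel" "bounded S"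
  then obtain R where "\<forall>x\<in>S. norm x \<le> R" unfolding bounded_iff by blast
  then show "bbs (indicator S)"
    using S by (intro bbsI[where C = 1 and R = R]) (auto simp: indicator_def)
qed

lemma bbs_continuous:
  fixes f :: "'a::euclidean_space \<Rightarrow> real"
  assumes "continuous_on UNIV f" "bounded {x. f x \<noteq> 0}"
  shows "bbs f"
proof -
  obtain R where R: "\<And>x. f x \<noteq> 0 \<Longrightarrow> norm x \<le> R" using assms(2) unfolding bounded_iff by auto
  have "compact (f ` cball 0 R)" using assms(1) by (intro compact_continuous_image) (auto intro: continuous_on_subset)
  then obtain C where C: "\<And>x. norm x \<le> R \<Longrightarrow> \<bar>f x\<bar> \<le> C"
  proof -
    obtain C where "\<forall>y\<in>f ` cball 0 R. norm y \<le> C"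
      using compact_imp_bounded[OF \<open>compact (f ` cball 0 R)\<close>] unfolding bounded_iff by blast
    then show ?thesis by (intro that[of C]) auto
  qed
  show ?thesis
  proof (rule bbsI[where C = "\<bar>C\<bar>" and R = R])
    show "f \<in> borel_measurable borel" using assms(1) by (rule borel_measurable_continuous_onI)
    show "\<bar>f x\<bar> \<le> \<bar>C\<bar>" for x using C[of x] R[of x] by (cases "f x = 0") auto
  qed (use R in force)
qed

text \<open>Supplies the hypothesis of Fubini's theorem when the second factor is finite: the
  mollifier as a probability measure, or Lebesgue measure on an interval.\<close>

lemma bbs_pair_integrable:
  fixes F :: "'a::euclidean_space \<times> 'b \<Rightarrow> real"
  assumes "finite_measure N" "F \<in> borel_measurable (lborel \<Otimes>\<^sub>M N)"
    "\<And>x t. \<bar>F (x, t)\<bar> \<le> C" "\<And>x t. t \<in> space N \<Longrightarrow> R < norm x \<Longrightarrow> F (x, t) = 0"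
  shows "integrable (lborel \<Otimes>\<^sub>M N) F"
proof (rule integrableI_bounded_set[where A = "cball 0 R \<times> space N" and B = C])
  interpret N: finite_measure N by fact
  have "emeasure lborel (cball (0::'a) R) * emeasure N (space N) < top"
    using emeasure_lborel_cball_finite[of "0::'a" R] N.emeasure_finite[of "space N"]
      top.not_eq_extremum[of "emeasure N (space N)"] by (auto simp: ennreal_mult_less_top)
  then show "emeasure (lborel \<Otimes>\<^sub>M N) (cball (0::'a) R \<times> space N) < \<infinity>"
    by (subst N.emeasure_pair_measure_Times) auto
  show "AE x\<in>cball (0::'a) R \<times> space N in lborel \<Otimes>\<^sub>M N. norm (F x) \<le> C"
    using assms(3) by (intro AE_I2) (auto simp: split_paired_all)
  show "AE x in lborel \<Otimes>\<^sub>M N. x \<notin> cball (0::'a) R \<times> space N \<longrightarrow> F x = 0"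
  proof (intro AE_I2 impI)
    fix x assume x: "x \<in> space (lborel \<Otimes>\<^sub>M N)" "x \<notin> cball (0::'a) R \<times> space N"
    have "snd x \<in> space N" "R < norm (fst x)"
      using x by (auto simp: space_pair_measure not_le)
    from assms(4)[OF this] show "F x = 0" by simp
  qed
qed (use assms(2) in auto)

lemma bbs_integrable: 
  assumes "bbs f" shows "integrable lborel f"
proof -
  obtain C R where *: "f \<in> borel_measurable borel" "\<And>x. \<bar>f x\<bar> \<le> C" "\<And>x. R < norm x \<Longrightarrow> f x = 0"
    using bbsE[OF assms] by metis
  show ?thesis
  proof (rule integrableI_bounded_set[where A = "cball 0 R" and B = C])
    show "emeasure lborel (cball 0 R) < \<infinity>"
      using emeasure_lborel_cball_finite[of 0 R] by simp
    show "AE x\<in>cball 0 R in lborel. norm (f x) \<le> C" using *(2) by simp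
    show "AE x in lborel. x \<notin> cball 0 R \<longrightarrow> f x = 0" using *(3) by (auto simp: not_le)
  qed (use *(1) in auto)
qed

lemma lborel_integral_translate:
  fixes f :: "'a::euclidean_space \<Rightarrow> real"
  shows "(\<integral>x. f (x + a) \<partial>lborel) = (\<integral>x. f x \<partial>lborel)"
proof -
  have "distr lborel borel ((+) a) = lborel" by (rule lborel_distr_plus)
  then have "(\<integral>x. f x \<partial>lborel) = (\<integral>x. f x \<partial>distr lborel borel ((+) a))" by simp
  show ?thesis
  proof (cases "f \<in> borel_measurable borel")
    case True
    then show ?thesis
      using integral_distr[of "(+) a" lborel borel f] lborel_distr_plus[of a] by (simp add: add.commute)
  next
    case False
    \<comment> \<open>Without measurability both integrals take the default value 0, because
      translating back would make \<open>f\<close> measurable.\<close>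
    have "(\<lambda>x. f (x + a)) \<notin> borel_measurable borel"
    proof
      assume "(\<lambda>x. f (x + a)) \<in> borel_measurable borel"
      then have "(\<lambda>x. f ((x - a) + a)) \<in> borel_measurable borel" by measurable
      with False show False by simp
    qed
    then have "\<not> integrable lborel (\<lambda>x. f (x + a))"
      using borel_measurable_integrable[of lborel "\<lambda>x. f (x + a)"] by auto
    moreover have "\<not> integrable lborel f"
      using False borel_measurable_integrable[of lborel f] by auto
    ultimately show ?thesis by (simp add: not_integrable_integral_eq)
  qed
qed

lemma lborel_nn_integral_translate:
  fixes f :: "'a::euclidean_space \<Rightarrow> ennreal"
  assumes "f \<in> borel_measurable borel"
  shows "(\<integral>\<^sup>+x. f (x + a) \<partial>lborel) = (\<integral>\<^sup>+x. f x \<partial>lborel)"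
  using nn_integral_distr[of "(+) a" lborel borel f] lborel_distr_plus[of a] assms by (simp add: add.commute)

section \<open>Translates and integration by parts\<close>

lemma bbs_test_function: "test_function \<Omega> \<phi> \<Longrightarrow> bbs \<phi>"
proof -
  assume t: "test_function \<Omega> \<phi>"
  then have "bounded {x. \<phi> x \<noteq> 0}"
    using bounded_subset[OF compact_imp_bounded closure_subset] by (auto simp: test_function_def)
  moreover have "continuous_on UNIV \<phi>" using test_function_C_k[OF t, of 0] by simp
  ultimately show "bbs \<phi>" by (intro bbs_continuous)
qed

lemma frechet_derivative_expand:
  fixes \<phi> :: "'a::euclidean_space \<Rightarrow> real"
  assumes "test_function \<Omega> \<phi>"
  shows "frechet_derivative \<phi> (at x) h = (\<Sum>i\<in>Basis. (h \<bullet> i) * frechet_derivative \<phi> (at x) i)"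
proof -
  have l: "linear (frechet_derivative \<phi> (at x))"
    using test_function_has_derivative[OF assms] has_derivative_linear by blast
  have "frechet_derivative \<phi> (at x) (\<Sum>i\<in>Basis. (h \<bullet> i) *\<^sub>R i) = (\<Sum>i\<in>Basis. (h \<bullet> i) * frechet_derivative \<phi> (at x) i)"
    using l by (simp add: linear_sum linear_scale)
  then show ?thesis by (simp add: euclidean_representation)
qed

lemma frechet_derivative_continuous:
  fixes \<phi> :: "'a::euclidean_space \<Rightarrow> real"
  assumes "test_function \<Omega> \<phi>"
  shows "continuous_on UNIV (\<lambda>x. frechet_derivative \<phi> (at x) h)"
  unfolding frechet_derivative_expand[OF assms, of _ h]
  using test_function_C_k[OF test_function_deriv[OF assms], of _ 0]
  by (intro continuous_on_sum continuous_on_mult continuous_on_const) auto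

lemma bbs_frechet_derivative:
  fixes \<phi> :: "'a::euclidean_space \<Rightarrow> real"
  assumes "test_function \<Omega> \<phi>"
  shows "bbs (\<lambda>x. frechet_derivative \<phi> (at x) h)"
proof (rule bbs_continuous[OF frechet_derivative_continuous[OF assms]])
  have "{x. frechet_derivative \<phi> (at x) h \<noteq> 0} \<subseteq> closure {x. \<phi> x \<noteq> 0}"
    using test_function_vanish(2)[OF assms] by fastforce
  then show "bounded {x. frechet_derivative \<phi> (at x) h \<noteq> 0}"
    using assms bounded_subset compact_imp_bounded unfolding test_function_def by blast
qed

text \<open>Parameters along a segment form a probability space, so Jensen's inequality for the
  square is nonnegativity of a variance.\<close>

abbreviation unit_interval_measure :: "real measure" where
  "unit_interval_measure \<equiv> density lborel (\<lambda>t. ennreal (indicator {0..1} t))"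

lemma prob_space_unit_interval: "prob_space unit_interval_measure"
  by (rule prob_spaceI) (simp add: emeasure_density ennreal_indicator)

lemma test_function_increment:
  fixes \<phi> :: "'a::euclidean_space \<Rightarrow> real"
  assumes "test_function \<Omega> \<phi>"
  shows "\<phi> (x + h) - \<phi> x = (\<integral>t. frechet_derivative \<phi> (at (x + t *\<^sub>R h)) h \<partial>unit_interval_measure)"
proof -
  have d: "((\<lambda>t. \<phi> (x + t *\<^sub>R h)) has_real_derivative frechet_derivative \<phi> (at (x + t *\<^sub>R h)) h) (at t)" for t
  proof -
    have "((\<lambda>t. x + t *\<^sub>R h) has_derivative (\<lambda>s. s *\<^sub>R h)) (at t)"
      by (auto intro!: derivative_eq_intros)
    from diff_chain_at[OF this test_function_has_derivative[OF assms]]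
    have "((\<lambda>t. \<phi> (x + t *\<^sub>R h)) has_derivative (\<lambda>s. frechet_derivative \<phi> (at (x + t *\<^sub>R h)) (s *\<^sub>R h))) (at t)"
      by (simp add: o_def)
    moreover have "frechet_derivative \<phi> (at y) (s *\<^sub>R h) = frechet_derivative \<phi> (at y) h * s" for y s
      using has_derivative_linear[OF test_function_has_derivative[OF assms]] by (simp add: linear_scale mult.commute)
    ultimately show ?thesis by (simp add: has_field_derivative_def)
  qed
  have c: "continuous_on UNIV (\<lambda>t. frechet_derivative \<phi> (at (x + t *\<^sub>R h)) h)"
    by (rule continuous_on_compose2[OF frechet_derivative_continuous[OF assms, of h], of UNIV "\<lambda>t. x + t *\<^sub>R h"])
       (auto intro!: continuous_intros)
  have "(\<integral>t. frechet_derivative \<phi> (at (x + t *\<^sub>R h)) h * indicator {0..1} t \<partial>lborel) = \<phi> (x + 1 *\<^sub>R h) - \<phi> (x + 0 *\<^sub>R h)"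
    by (rule integral_FTC_Icc_real[where F = "\<lambda>t. \<phi> (x + t *\<^sub>R h)"])
       (use d c in \<open>auto simp: continuous_on_eq_continuous_at\<close>)
  moreover have "(\<lambda>t. frechet_derivative \<phi> (at (x + t *\<^sub>R h)) h) \<in> borel_measurable borel"
    using c by (rule borel_measurable_continuous_onI)
  ultimately show ?thesis
    by (subst integral_density) (auto simp: mult.commute)
qed

lemma test_function_derivative_shift_measurable [measurable]:
  fixes \<phi> :: "'a::euclidean_space \<Rightarrow> real"
  assumes "test_function \<Omega> \<phi>"
  shows "(\<lambda>(x, t). frechet_derivative \<phi> (at (x + t *\<^sub>R h)) h) \<in> borel_measurable (borel \<Otimes>\<^sub>M borel)"
proof -
  have [measurable]: "(\<lambda>x. frechet_derivative \<phi> (at x) h) \<in> borel_measurable borel"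
    using frechet_derivative_continuous[OF assms] by (rule borel_measurable_continuous_onI)
  show ?thesis by measurable
qed

text \<open>The increment is the mean of the derivative along the segment from x to x + h. Jensen's
  inequality moves the square inside, and after exchanging the integrals every translate has the
  same integral, so the constant is exactly 1.\<close>

lemma test_function_translation_energy:
  fixes \<phi> :: "'a::euclidean_space \<Rightarrow> real"
  assumes "test_function \<Omega> \<phi>"
  shows "(\<integral>\<^sup>+x. ennreal ((\<phi> (x + h) - \<phi> x)\<^sup>2) \<partial>lborel) \<le> (\<integral>\<^sup>+x. ennreal ((frechet_derivative \<phi> (at x) h)\<^sup>2) \<partial>lborel)"
proof -
  interpret U: prob_space unit_interval_measure by (rule prob_space_unit_interval)
  note [measurable] = test_function_derivative_shift_measurable[OF assms, of h]
  obtain C where C: "\<And>x. \<bar>frechet_derivative \<phi> (at x) h\<bar> \<le> C" 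
    using bbsE[OF bbs_frechet_derivative[OF assms]] by metis
  have i: "integrable unit_interval_measure (\<lambda>t. frechet_derivative \<phi> (at (x + t *\<^sub>R h)) h)" for x
    by (rule U.integrable_const_bound[where B = C]) (use C in auto)
  have C2: "(frechet_derivative \<phi> (at x) h)\<^sup>2 \<le> C\<^sup>2" for x
    using C[of x] by (metis abs_ge_zero power2_abs power_mono)
  have i2: "integrable unit_interval_measure (\<lambda>t. (frechet_derivative \<phi> (at (x + t *\<^sub>R h)) h)\<^sup>2)" for x
    by (rule U.integrable_const_bound[where B = "C\<^sup>2"]) (use C2 in auto)
  \<comment> \<open>Square of a mean at most mean of the square, read off from a nonnegative
    variance.\<close>
  have "(\<phi> (x + h) - \<phi> x)\<^sup>2 \<le> (\<integral>t. (frechet_derivative \<phi> (at (x + t *\<^sub>R h)) h)\<^sup>2 \<partial>unit_interval_measure)" for x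
    using U.variance_eq[OF i i2, of x] U.variance_positive[of "\<lambda>t. frechet_derivative \<phi> (at (x + t *\<^sub>R h)) h"]
    unfolding test_function_increment[OF assms] by linarith
  then have "(\<integral>\<^sup>+x. ennreal ((\<phi> (x + h) - \<phi> x)\<^sup>2) \<partial>lborel) \<le>
     (\<integral>\<^sup>+x. (\<integral>\<^sup>+t. ennreal ((frechet_derivative \<phi> (at (x + t *\<^sub>R h)) h)\<^sup>2) \<partial>unit_interval_measure) \<partial>lborel)"
    by (intro nn_integral_mono) (simp add: nn_integral_eq_integral[OF i2] ennreal_leI)
  also have "\<dots> = (\<integral>\<^sup>+t. (\<integral>\<^sup>+x. ennreal ((frechet_derivative \<phi> (at (x + t *\<^sub>R h)) h)\<^sup>2) \<partial>lborel) \<partial>unit_interval_measure)"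
  proof -
    interpret pair_sigma_finite lborel unit_interval_measure ..
    show ?thesis by (rule Fubini'[symmetric]) simp
  qed
  also have "\<dots> = (\<integral>\<^sup>+t. (\<integral>\<^sup>+x. ennreal ((frechet_derivative \<phi> (at x) h)\<^sup>2) \<partial>lborel) \<partial>unit_interval_measure)"
  proof -
    have [measurable]: "(\<lambda>x. frechet_derivative \<phi> (at x) h) \<in> borel_measurable borel"
      using frechet_derivative_continuous[OF assms] by (rule borel_measurable_continuous_onI)
    show ?thesis
      by (subst lborel_nn_integral_translate[of "\<lambda>x. ennreal ((frechet_derivative \<phi> (at x) h)\<^sup>2)"]) auto
  qed
  also have "\<dots> = (\<integral>\<^sup>+x. ennreal ((frechet_derivative \<phi> (at x) h)\<^sup>2) \<partial>lborel)"
    using U.emeasure_space_1 by simp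
  finally show ?thesis .
qed

text \<open>This takes the place of the divergence theorem. Integrating the increment formula over x
  gives 0 on the left by translation invariance, and by Fubini and translation invariance the
  integral of the derivative on the right.\<close>

lemma test_function_integral_derivative:
  fixes \<phi> :: "'a::euclidean_space \<Rightarrow> real"
  assumes "test_function \<Omega> \<phi>"
  shows "(\<integral>x. frechet_derivative \<phi> (at x) h \<partial>lborel) = 0"
proof -
  interpret U: prob_space unit_interval_measure by (rule prob_space_unit_interval)
  interpret pair_sigma_finite lborel unit_interval_measure ..
  note [measurable] = test_function_derivative_shift_measurable[OF assms, of h]
  obtain C R where C: "\<And>x. \<bar>frechet_derivative \<phi> (at x) h\<bar> \<le> C" "\<And>x. R < norm x \<Longrightarrow> frechet_derivative \<phi> (at x) h = 0"
    "C \<ge> 0" "R \<ge> 0"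
    using bbsE[OF bbs_frechet_derivative[OF assms]] by metis
  \<comment> \<open>The indicator repeats the one in the density. It forces bounded support in x for
    every real t, since the measure on t has all of the line as its space.\<close>
  let ?F = "\<lambda>x t. indicator {0..1} t * frechet_derivative \<phi> (at (x + t *\<^sub>R h)) h"
  have b: "bbs \<phi>" by (rule bbs_test_function[OF assms])
  have "integrable lborel (\<lambda>x. \<phi> (x + h))"
    using bbs_integrable[OF b] lborel_integrable_real_affine
    by (subst integrable_distr_eq[of "(+) h" lborel borel \<phi>, unfolded lborel_distr_plus, simplified add.commute[of h], symmetric])
       (auto intro: bbs_measurable[OF b])
  then have "(\<integral>x. \<phi> (x + h) - \<phi> x \<partial>lborel) = 0"
    using bbs_integrable[OF b] by (simp add: lborel_integral_translate)
  moreover have "\<phi> (x + h) - \<phi> x = (\<integral>t. ?F x t \<partial>unit_interval_measure)" for x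
    unfolding test_function_increment[OF assms]
    by (subst (1 2) integral_density) (auto intro!: Bochner_Integration.integral_cong simp: indicator_def)
  moreover have "integrable (lborel \<Otimes>\<^sub>M unit_interval_measure) (case_prod ?F)"
  proof (rule bbs_pair_integrable[where C = C and R = "R + norm h"])
    fix x :: 'a and t :: real
    show "\<bar>case (x, t) of (x, t) \<Rightarrow> ?F x t\<bar> \<le> C" using C(1,3) by (auto simp: indicator_def)
    assume "R + norm h < norm x"
    moreover have "norm x \<le> norm (x + t *\<^sub>R h) + \<bar>t\<bar> * norm h"
      by (metis add_diff_cancel_right' norm_scaleR norm_triangle_ineq4)
    moreover have "\<bar>t\<bar> * norm h \<le> norm h" if "t \<in> {0..1}" using that by (auto intro: mult_left_le_one_le)
    ultimately show "(case (x, t) of (x, t) \<Rightarrow> ?F x t) = 0"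
      using C(2)[of "x + t *\<^sub>R h"] by (auto simp: indicator_def)
  next
    show "finite_measure unit_interval_measure" by (rule U.finite_measure_axioms)
  qed measurable
  ultimately have "0 = (\<integral>t. (\<integral>x. ?F x t \<partial>lborel) \<partial>unit_interval_measure)"
    using Fubini_integral[of ?F] by simp
  also have "\<dots> = (\<integral>t. indicator {0..1} t * (\<integral>x. frechet_derivative \<phi> (at x) h \<partial>lborel) \<partial>unit_interval_measure)"
    by (simp add: lborel_integral_translate[of "\<lambda>x. frechet_derivative \<phi> (at x) h"])
  also have "\<dots> = (\<integral>x. frechet_derivative \<phi> (at x) h \<partial>lborel)"
    by (subst integral_density) (auto simp: mult.assoc[symmetric] simp flip: indicator_inter_arith)
  finally show ?thesis by simp
qed


lemma lborel_distr_uminus_euclidean: "distr lborel borel uminus = (lborel :: 'a::euclidean_space measure)"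
  using lborel_affine[of "-1" "0::'a"] by (simp add: density_1)

lemma lborel_integral_uminus:
  fixes f :: "'a::euclidean_space \<Rightarrow> real"
  assumes "f \<in> borel_measurable borel"
  shows "(\<integral>x. f (- x) \<partial>lborel) = (\<integral>x. f x \<partial>lborel)"
  using integral_distr[of uminus lborel borel f] assms by (simp add: lborel_distr_uminus_euclidean)

lemma bbs_integral_pos:
  fixes f :: "'a::euclidean_space \<Rightarrow> real"
  assumes "bbs f" "\<And>x. 0 \<le> f x" "\<And>x. x \<in> ball a r \<Longrightarrow> k \<le> f x" "0 < k" "0 < r"
  shows "0 < (\<integral>x. f x \<partial>lborel)"
proof -
  have "0 < k * measure lborel (ball a r)"
    using assms content_ball_pos[of r a] by simp
  also have "\<dots> = (\<integral>x. k * indicator (ball a r) x \<partial>lborel)"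
    by simp
  also have "\<dots> \<le> (\<integral>x. f x \<partial>lborel)"
  proof (rule integral_mono)
    show "integrable lborel (\<lambda>x. k * indicator (ball a r) x)"
      by (intro bbs_integrable bbs_cmult bbs_indicator) auto
    show "k * indicator (ball a r) x \<le> f x" for x using assms(2,3)[of x] by (simp add: indicator_def)
  qed (rule bbs_integrable[OF assms(1)])
  finally show ?thesis .
qed

section \<open>The mollifier\<close>

lemma bump_profile_1: "bump_profile (Suc 0) s = (if s < 1 then - 2 * (1 / (1 - s))\<^sup>2 * exp (- 2 / (1 - s)) else 0)"
  by (simp add: bump_profile_def power2_eq_square)

lemma bump_profile_nonpos: "bump_profile (Suc 0) s \<le> 0"
  by (simp add: bump_profile_1)

lemma bbs_radial_bump: "bbs (\<lambda>y::'a::euclidean_space. bump_profile j ((norm y)\<^sup>2))"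
proof (rule bbs_continuous)
  show "continuous_on UNIV (\<lambda>y::'a. bump_profile j ((norm y)\<^sup>2))"
    by (intro continuous_on_compose2[OF bump_profile_continuous] continuous_intros) auto
  have "norm y \<le> 1" if "bump_profile j ((norm y)\<^sup>2) \<noteq> 0" for y :: 'a
  proof (rule ccontr)
    assume "\<not> norm y \<le> 1"
    then have "1 \<le> (norm y)\<^sup>2" by (simp add: power2_eq_square less_1_mult less_imp_le)
    then show False using that by (simp add: bump_profile_def)
  qed
  then show "bounded {y::'a. bump_profile j ((norm y)\<^sup>2) \<noteq> 0}"
    unfolding bounded_iff by blast
qed

definition bump_mass :: "'a::euclidean_space itself \<Rightarrow> real" where
  "bump_mass _ = (\<integral>y. - 2 * bump_profile (Suc 0) ((norm (y :: 'a))\<^sup>2) \<partial>lborel)"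

text \<open>Built from the derivative of the profile rather than from the profile itself, so that
  the mollifier times y is a gradient field. The second moments and the expansion of averages then
  come from a single integration by parts.\<close>

definition mollifier :: "'a::euclidean_space \<Rightarrow> real" where
  "mollifier y = - 2 * bump_profile (Suc 0) ((norm y)\<^sup>2) / bump_mass TYPE('a)"

text \<open>The gradient of the potential at \<open>y\<close> is \<open>- mollifier y *\<^sub>R y\<close>.\<close>

definition potential :: "'a::euclidean_space \<Rightarrow> real" where
  "potential y = bump_profile 0 ((norm y)\<^sup>2) / bump_mass TYPE('a)"

text \<open>Integration by parts identifies this number with the second moment of the mollifier in
  each unit direction, see \<open>mollifier_second_moment\<close>. The form with
  \<open>potential\<close> is the one produced by differentiating averages in the radius.\<close>

definition second_moment :: "'a::euclidean_space itself \<Rightarrow> real" where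
  "second_moment _ = (\<integral>y. potential (y :: 'a) \<partial>lborel)"

lemma norm_half_profile:
  assumes "norm (y::'a::euclidean_space) < 1 / 2 \<or> norm y \<le> 1/2"
  shows "4 * exp (- 3) \<le> - 2 * bump_profile (Suc 0) ((norm y)\<^sup>2)" "exp (- 3) \<le> bump_profile 0 ((norm y)\<^sup>2)"
proof -
  have "norm y * norm y \<le> (1/2) * (1/2)" using assms by (intro mult_mono) auto
  then have s: "(norm y)\<^sup>2 \<le> 1 / 4" by (simp add: power2_eq_square)
  \<comment> \<open>On this ball the exponent is at most 2 / (1 - 1/4) = 8/3 in absolute value,
    whence the bound exp(- 3).\<close>
  have e: "exp (- 3) \<le> exp (- 2 / (1 - (norm y)\<^sup>2))" using s by (simp add: field_simps)
  have "1 \<le> 1 / (1 - (norm y)\<^sup>2)" using s by (simp add: field_simps)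
  then have "1 \<le> (1 / (1 - (norm y)\<^sup>2))\<^sup>2" by (rule one_le_power)
  from mult_mono[OF this e] have "exp (- 3) \<le> (1 / (1 - (norm y)\<^sup>2))\<^sup>2 * exp (- 2 / (1 - (norm y)\<^sup>2))"
    by simp
  then show "4 * exp (- 3) \<le> - 2 * bump_profile (Suc 0) ((norm y)\<^sup>2)"
    using s unfolding bump_profile_1 by auto
  show "exp (- 3) \<le> bump_profile 0 ((norm y)\<^sup>2)"
    using s e by (auto simp: bump_profile_def)
qed

lemma bump_mass_pos: "0 < bump_mass TYPE('a::euclidean_space)"
  unfolding bump_mass_def
proof (rule bbs_integral_pos[where a = 0 and r = "1/2" and k = "4 * exp (- 3)"])
  show "bbs (\<lambda>y::'a. - 2 * bump_profile (Suc 0) ((norm y)\<^sup>2))"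
    by (intro bbs_cmult bbs_radial_bump)
qed (use norm_half_profile(1)[where 'a='a] in \<open>auto simp: bump_profile_nonpos\<close>)

lemma bbs_mollifier: "bbs (mollifier :: 'a::euclidean_space \<Rightarrow> real)"
  using bbs_cmult[OF bbs_radial_bump[of 1], where c = "- 2 / bump_mass TYPE('a)"]
  by (simp add: mollifier_def[abs_def])

lemma bbs_potential: "bbs (potential :: 'a::euclidean_space \<Rightarrow> real)"
  using bbs_cmult[OF bbs_radial_bump[of 0], where c = "1 / bump_mass TYPE('a)"]
  by (simp add: potential_def[abs_def])

lemma mollifier_measurable [measurable]: "mollifier \<in> borel_measurable borel"
  by (rule bbs_measurable[OF bbs_mollifier])

lemma potential_measurable [measurable]: "potential \<in> borel_measurable borel"
  by (rule bbs_measurable[OF bbs_potential])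

lemma mollifier_nonneg: "0 \<le> mollifier y"
  using bump_mass_pos[where 'a='a] unfolding mollifier_def bump_profile_1 by (simp add: divide_nonneg_pos) 

lemma potential_nonneg: "0 \<le> potential y"
  using bump_mass_pos[where 'a='a] unfolding potential_def bump_profile_def by (simp add: divide_nonneg_pos) 

lemma mollifier_minus: "mollifier (- y) = mollifier y"
  by (simp add: mollifier_def)

lemma mollifier_outside: "1 \<le> norm y \<Longrightarrow> mollifier y = 0"
  unfolding mollifier_def bump_profile_1 using abs_square_less_1[of "norm y"] by auto

lemma potential_outside: "1 \<le> norm y \<Longrightarrow> potential y = 0"
  unfolding potential_def bump_profile_def using abs_square_less_1[of "norm y"] by auto

lemma mollifier_integral: "(\<integral>y. mollifier (y :: 'a::euclidean_space) \<partial>lborel) = 1"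
  using bump_mass_pos[where 'a='a] by (simp add: mollifier_def[abs_def]) (simp add: bump_mass_def)

lemma mollifier_lower_bound:
  "\<exists>k>0. \<forall>y::'a::euclidean_space. norm y \<le> 1 / 2 \<longrightarrow> k \<le> mollifier y"
proof (intro exI[of _ "4 * exp (- 3) / bump_mass TYPE('a)"] conjI allI impI)
  fix y :: 'a assume "norm y \<le> 1 / 2"
  then show "4 * exp (- 3) / bump_mass TYPE('a) \<le> mollifier y"
    unfolding mollifier_def using bump_mass_pos[where 'a='a]
    by (intro divide_right_mono norm_half_profile) auto
qed (use bump_mass_pos[where 'a='a] in auto)

lemma second_moment_pos: "0 < second_moment TYPE('a::euclidean_space)"
  unfolding second_moment_def
proof (rule bbs_integral_pos[where a = 0 and r = "1/2" and k = "exp (- 3) / bump_mass TYPE('a)"])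
  show "exp (- 3) / bump_mass TYPE('a) \<le> potential y" if "y \<in> ball 0 (1/2)" for y :: 'a
    using that norm_half_profile(2)[of y] bump_mass_pos[where 'a='a] by (auto simp: potential_def divide_right_mono)
qed (use bump_mass_pos[where 'a='a] in \<open>auto simp: bbs_potential potential_nonneg\<close>)

lemma mollifier_first_moment: "(\<integral>y. mollifier y * (a \<bullet> y) \<partial>lborel) = 0"
proof -
  have "(\<integral>y. mollifier y * (a \<bullet> y) \<partial>lborel) = (\<integral>y. mollifier (- y) * (a \<bullet> (- y)) \<partial>lborel)"
    by (rule lborel_integral_uminus[symmetric]) measurable
  then show ?thesis by (simp add: mollifier_minus)
qed

text \<open>The derivative in direction a of (a . y) f(|y|^2), with f the profile, is |a|^2 f + 2 f'
  (a . y)^2, and its integral vanishes. After normalisation the two terms are the right and the left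
  side.\<close>

lemma mollifier_second_moment:
  fixes a :: "'a::euclidean_space"
  shows "(\<integral>y. mollifier y * (a \<bullet> y)\<^sup>2 \<partial>lborel) = (norm a)\<^sup>2 * second_moment TYPE('a)"
proof -
  let ?l = "\<lambda>y::'a. bump_profile 0 ((norm y)\<^sup>2)"
  have "test_function UNIV (scaled_bump (0::'a) 1)" by (rule test_function_scaled_bump) auto
  then have l: "test_function UNIV ?l" by (simp add: scaled_bump_def[abs_def])
  have t: "test_function UNIV (\<lambda>y. (a \<bullet> y) * ?l y)"
    by (intro test_function_mult[OF l] C_k_linear bounded_linear_inner_right)
  have "((\<lambda>y. (a \<bullet> y) * ?l y) has_derivative (\<lambda>h. (a \<bullet> y) * (bump_profile (Suc 0) ((norm y)\<^sup>2) * (2 * (y \<bullet> h))) + (a \<bullet> h) * ?l y)) (at y)" for y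
    using has_derivative_mult[OF bounded_linear_imp_has_derivative[OF bounded_linear_inner_right[of a]] scaled_bump_frechet[of 1 0 0 y]]
    by simp
  from frechet_derivative_at[OF this, symmetric]
  have fd: "frechet_derivative (\<lambda>y. (a \<bullet> y) * ?l y) (at y) a = (norm a)\<^sup>2 * ?l y - (- 2 * bump_profile (Suc 0) ((norm y)\<^sup>2)) * (a \<bullet> y)\<^sup>2" for y
    by (simp add: power2_norm_eq_inner power2_eq_square[of "a \<bullet> y"] inner_commute)
  have i: "integrable lborel (\<lambda>y. (- 2 * bump_profile (Suc 0) ((norm y)\<^sup>2)) * (a \<bullet> y)\<^sup>2)"
  proof -
    have "bbs (\<lambda>y. (a \<bullet> y)\<^sup>2 * (- 2 * bump_profile (Suc 0) ((norm y)\<^sup>2)))"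
    proof (rule bbs_mult_bounded[where B = "(norm a)\<^sup>2"])
      show "bbs (\<lambda>y::'a. - 2 * bump_profile (Suc 0) ((norm y)\<^sup>2))" by (intro bbs_cmult bbs_radial_bump)
      show "\<bar>(a \<bullet> y)\<^sup>2\<bar> \<le> (norm a)\<^sup>2" if "- 2 * bump_profile (Suc 0) ((norm y)\<^sup>2) \<noteq> 0" for y
      proof -
        have "norm y < 1" using that abs_square_less_1[of "norm y"] by (auto simp: bump_profile_1 split: if_splits)
        then have "\<bar>a \<bullet> y\<bar> \<le> norm a" using Cauchy_Schwarz_ineq2[of a y] mult_left_le[of "norm y" "norm a"] by simp
        then show ?thesis by (metis abs_ge_zero abs_power2 power2_abs power_mono)
      qed
    qed measurable
    from bbs_integrable[OF this] show ?thesis by (simp add: mult.commute)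
  qed
  have "0 = (\<integral>y. (norm a)\<^sup>2 * ?l y - (- 2 * bump_profile (Suc 0) ((norm y)\<^sup>2)) * (a \<bullet> y)\<^sup>2 \<partial>lborel)"
    using test_function_integral_derivative[OF t, of a] unfolding fd by simp
  also have "\<dots> = (norm a)\<^sup>2 * (\<integral>y. ?l y \<partial>lborel) - (\<integral>y. (- 2 * bump_profile (Suc 0) ((norm y)\<^sup>2)) * (a \<bullet> y)\<^sup>2 \<partial>lborel)"
    using i bbs_integrable[OF bbs_radial_bump[of 0, where 'a='a]] by (subst Bochner_Integration.integral_diff) auto
  finally have "(\<integral>y. (- 2 * bump_profile (Suc 0) ((norm y)\<^sup>2)) * (a \<bullet> y)\<^sup>2 \<partial>lborel) = (norm a)\<^sup>2 * (\<integral>y. ?l y \<partial>lborel)"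
    by simp
  moreover have "(\<integral>y. mollifier y * (a \<bullet> y)\<^sup>2 \<partial>lborel) =
      (\<integral>y. (- 2 * bump_profile (Suc 0) ((norm y)\<^sup>2)) * (a \<bullet> y)\<^sup>2 \<partial>lborel) / bump_mass TYPE('a)"
    unfolding mollifier_def times_divide_eq_left by (rule integral_divide_zero)
  ultimately show ?thesis
    by (simp add: second_moment_def potential_def)
qed

text \<open>Functions on the whole space with zeros allowed: as \<open>0 powr s = 0\<close>, the
  inequality has content only where both values are positive, and there it also forces the set of
  positive values to be convex.\<close>

definition log_concave :: "('a::real_vector \<Rightarrow> real) \<Rightarrow> bool" where
  "log_concave f \<longleftrightarrow> (\<forall>x. 0 \<le> f x) \<and>
     (\<forall>x y t. 0 < t \<longrightarrow> t < 1 \<longrightarrow> f x powr (1 - t) * f y powr t \<le> f ((1 - t) *\<^sub>R x + t *\<^sub>R y))"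

text \<open>With X = 1 / (1 - |x|^2) the mollifier inside the unit ball is exp(c + 2 (ln X - X)).
  Here X is convex in x with X \<ge> 1, and ln s - s is concave and decreasing for s \<ge> 1, so the
  exponent is concave. The 2 in the profile balances the square of X that its derivative
  brings.\<close>

lemma log_concave_mollifier: "log_concave (mollifier :: 'a::euclidean_space \<Rightarrow> real)"
  unfolding log_concave_def
proof (intro conjI allI impI)
  fix x y :: 'a and t :: real
  assume t: "0 < t" "t < 1"
  show "mollifier x powr (1 - t) * mollifier y powr t \<le> mollifier ((1 - t) *\<^sub>R x + t *\<^sub>R y)"
  proof (cases "norm x < 1 \<and> norm y < 1")
    case False
    then have "mollifier x = 0 \<or> mollifier y = 0" using mollifier_outside by (meson not_le)
    then show ?thesis using mollifier_nonneg by auto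
  next
    case True
    define X Y Z where "X = 1 / (1 - (norm x)\<^sup>2)" and "Y = 1 / (1 - (norm y)\<^sup>2)"
      and "Z = 1 / (1 - (norm ((1 - t) *\<^sub>R x + t *\<^sub>R y))\<^sup>2)"
    define m where "m = bump_mass TYPE('a)"
    have m: "m > 0" using bump_mass_pos by (simp add: m_def)
    have lt: "(norm x)\<^sup>2 < 1" "(norm y)\<^sup>2 < 1" using True by (auto simp: abs_square_less_1)
    have "norm ((1 - t) *\<^sub>R x + t *\<^sub>R y) \<le> (1 - t) * norm x + t * norm y"
      using norm_triangle_ineq[of "(1 - t) *\<^sub>R x" "t *\<^sub>R y"] t by simp
    then have "(norm ((1 - t) *\<^sub>R x + t *\<^sub>R y))\<^sup>2 \<le> ((1 - t) * norm x + t * norm y)\<^sup>2"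
      by (intro power_mono) auto
    also have "\<dots> = (1 - t) * (norm x)\<^sup>2 + t * (norm y)\<^sup>2 - t * (1 - t) * (norm x - norm y)\<^sup>2"
      by (simp add: power2_eq_square algebra_simps)
    also have "\<dots> \<le> (1 - t) * (norm x)\<^sup>2 + t * (norm y)\<^sup>2" using t by simp
    finally have s: "(1 - t) * (1 - (norm x)\<^sup>2) + t * (1 - (norm y)\<^sup>2) \<le> 1 - (norm ((1 - t) *\<^sub>R x + t *\<^sub>R y))\<^sup>2"
      by (simp add: algebra_simps)
    have p: "0 < (1 - t) * (1 - (norm x)\<^sup>2) + t * (1 - (norm y)\<^sup>2)"
      using lt t by (intro add_pos_pos mult_pos_pos) auto
    have XY: "1 \<le> X" "1 \<le> Y" using lt by (auto simp: X_def Y_def)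
    have Z1: "1 \<le> Z" using s p by (auto simp: Z_def)
    have "Z \<le> inverse ((1 - t) * (1 - (norm x)\<^sup>2) + t * (1 - (norm y)\<^sup>2))"
      using s p by (simp add: Z_def inverse_eq_divide frac_le)
    also have "\<dots> \<le> (1 - t) * inverse (1 - (norm x)\<^sup>2) + t * inverse (1 - (norm y)\<^sup>2)"
      using convex_onD[OF convex_on_inverse[of "{0<..}"], of t "1 - (norm x)\<^sup>2" "1 - (norm y)\<^sup>2"] lt t by simp
    finally have ZW: "Z \<le> (1 - t) * X + t * Y" by (simp add: X_def Y_def inverse_eq_divide)
    define W where "W = (1 - t) * X + t * Y"
    have W: "0 < W" using Z1 ZW by (simp add: W_def)
    \<comment> \<open>Monotonicity of ln s - s on s \<ge> 1, obtained from ln s \<le> s - 1 at s = W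
      / Z.\<close>
    have "ln W - ln Z = ln (W / Z)" using W Z1 by (simp add: ln_div)
    also have "\<dots> \<le> W / Z - 1" using W Z1 by (intro ln_le_minus_one) auto
    also have "\<dots> = (W - Z) / Z" using Z1 by (simp add: field_simps)
    also have "\<dots> \<le> W - Z" using Z1 ZW by (simp add: W_def[symmetric] divide_le_eq mult_left_le[of 1 "W - Z"] mult_le_cancel_left1)
    finally have "ln W - W \<le> ln Z - Z" by simp
    moreover have "(1 - t) * ln X + t * ln Y \<le> ln W"
      using concave_onD[OF ln_concave, of t X Y] XY t by (simp add: W_def)
    ultimately have *: "(1 - t) * (ln X - X) + t * (ln Y - Y) \<le> ln Z - Z"
      by (simp add: W_def algebra_simps)
    define c where "c = ln (4 / m)"
    have e: "4 * V\<^sup>2 * exp (- 2 * V) / m = exp (c + 2 * (ln V - V))" if "1 \<le> V" for V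
    proof -
      have "exp (c + 2 * (ln V - V)) = exp c * (exp (ln V))\<^sup>2 * exp (- 2 * V)"
        by (simp add: exp_add[symmetric] power2_eq_square algebra_simps)
      then show ?thesis using that m by (simp add: c_def)
    qed
    have mx: "mollifier x = exp (c + 2 * (ln X - X))" 
      using e[OF XY(1)] lt unfolding mollifier_def bump_profile_1 X_def m_def by simp
    have my: "mollifier y = exp (c + 2 * (ln Y - Y))" 
      using e[OF XY(2)] lt unfolding mollifier_def bump_profile_1 Y_def m_def by simp
    have mz: "mollifier ((1 - t) *\<^sub>R x + t *\<^sub>R y) = exp (c + 2 * (ln Z - Z))" 
      using e[OF Z1] s p unfolding mollifier_def bump_profile_1 Z_def m_def by simp
    have "(1 - t) * (c + 2 * (ln X - X)) + t * (c + 2 * (ln Y - Y)) \<le> c + 2 * (ln Z - Z)"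
      using * by (simp add: algebra_simps)
    then show ?thesis unfolding mx my mz by (simp add: powr_def exp_add[symmetric])
  qed
qed (rule mollifier_nonneg)

section \<open>The Prekopa-Leindler inequality\<close>

lemma emeasure_affine_image_real:
  fixes A :: "real set"
  assumes "compact A"
  shows "emeasure lborel ((\<lambda>x. c * x + d) ` A) = ennreal \<bar>c\<bar> * emeasure lborel A"
proof -
  have "compact ((\<lambda>x. c * x + d) ` A)"
    using assms by (intro compact_continuous_image) (auto intro!: continuous_intros)
  then show ?thesis
    using emeasure_lebesgue_affine[of c d A] assms by (simp add: borel_compact)
qed

text \<open>Shift (1 - t) A by t min B and t B by (1 - t) max A. Both sets consist of admissible
  combinations, and they meet in at most the one point built from max A and min B, so their measures
  add up inside C.\<close>

lemma compact_brunn_minkowski_real: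
  fixes A B C :: "real set"
  assumes "compact A" "compact B" "A \<noteq> {}" "B \<noteq> {}" "C \<in> sets borel" "0 < t" "t < 1"
    and C: "\<And>a b. a \<in> A \<Longrightarrow> b \<in> B \<Longrightarrow> (1 - t) * a + t * b \<in> C"
  shows "ennreal (1 - t) * emeasure lborel A + ennreal t * emeasure lborel B \<le> emeasure lborel C"
proof -
  obtain a where a: "a \<in> A" "\<And>x. x \<in> A \<Longrightarrow> x \<le> a"
    using compact_attains_sup[OF assms(1,3)] by blast
  obtain b where b: "b \<in> B" "\<And>x. x \<in> B \<Longrightarrow> b \<le> x"
    using compact_attains_inf[OF assms(2,4)] by blast
  let ?A = "(\<lambda>x. (1 - t) * x + t * b) ` A" and ?B = "(\<lambda>x. t * x + (1 - t) * a) ` B"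
  have cA: "compact ?A" and cB: "compact ?B"
    using assms by (auto intro!: compact_continuous_image continuous_intros)
  have "?A \<inter> ?B \<subseteq> {(1 - t) * a + t * b}"
  proof
    fix z assume "z \<in> ?A \<inter> ?B"
    then obtain x y where "x \<in> A" "z = (1 - t) * x + t * b" "y \<in> B" "z = t * y + (1 - t) * a"
      unfolding image_iff Int_iff Bex_def by (elim conjE exE) (rule that)
    moreover from this have "(1 - t) * x \<le> (1 - t) * a" "t * b \<le> t * y" using a b assms by auto
    ultimately show "z \<in> {(1 - t) * a + t * b}" by (simp only: singleton_iff)
  qed
  then have "?A \<inter> ?B \<in> null_sets lborel"
    by (intro countable_imp_null_set_lborel) (rule countable_subset, assumption, simp)
  then have "emeasure lborel (?A \<union> ?B) = emeasure lborel ?A + emeasure lborel ?B"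
    using cA cB by (intro emeasure_Un') (auto simp: borel_compact)
  moreover have "emeasure lborel (?A \<union> ?B) \<le> emeasure lborel C"
    using a b C assms by (intro emeasure_mono) (auto simp: add.commute)
  ultimately show ?thesis
    using assms by (simp add: emeasure_affine_image_real)
qed

lemma compact_inner_approx:
  fixes A :: "real set"
  assumes "A \<in> sets borel" "bounded A" "A \<noteq> {}" "e > 0"
  obtains K where "compact K" "K \<noteq> {}" "K \<subseteq> A" "emeasure lborel A \<le> emeasure lborel K + ennreal e"
proof -
  obtain T where T: "closed T" "T \<subseteq> A" "A - T \<in> lmeasurable" "emeasure lebesgue (A - T) < ennreal e"
    using sets_lebesgue_inner_closed[of A e] assms by auto
  obtain a where "a \<in> A" using assms by blast
  \<comment> \<open>The extra point keeps the approximating set nonempty even if T is empty.\<close>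
  have K: "compact (insert a T)"
    using T assms by (auto simp: compact_eq_bounded_closed intro: bounded_subset)
  have "emeasure lborel A \<le> emeasure lborel (insert a T) + emeasure lborel (A - T)"
    using assms T K by (intro order_trans[OF _ emeasure_subadditive] emeasure_mono) (auto simp: borel_compact)
  also have "emeasure lborel (A - T) \<le> ennreal e"
    using T assms by (simp add: less_imp_le)
  finally show ?thesis using that[of "insert a T"] T K \<open>a \<in> A\<close> by (auto simp: add_left_mono)
qed

text \<open>C is a Borel set containing the Minkowski combination rather than the combination
  itself, which may fail to be Borel. Inner approximation reduces to compact sets at the cost of
  e.\<close>

lemma brunn_minkowski_real:
  fixes A B C :: "real set"
  assumes "A \<in> sets borel" "B \<in> sets borel" "bounded A" "bounded B" "A \<noteq> {}" "B \<noteq> {}"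
    and "C \<in> sets borel" "0 < t" "t < 1"
    and C: "\<And>a b. a \<in> A \<Longrightarrow> b \<in> B \<Longrightarrow> (1 - t) * a + t * b \<in> C"
  shows "ennreal (1 - t) * emeasure lborel A + ennreal t * emeasure lborel B \<le> emeasure lborel C"
proof (rule ennreal_le_epsilon)
  fix e :: real assume "e > 0"
  obtain K where K: "compact K" "K \<noteq> {}" "K \<subseteq> A" "emeasure lborel A \<le> emeasure lborel K + ennreal e"
    using compact_inner_approx[OF assms(1,3,5) \<open>e > 0\<close>] .
  obtain L where L: "compact L" "L \<noteq> {}" "L \<subseteq> B" "emeasure lborel B \<le> emeasure lborel L + ennreal e"
    using compact_inner_approx[OF assms(2,4,6) \<open>e > 0\<close>] .
  have "ennreal (1 - t) * emeasure lborel A + ennreal t * emeasure lborel B \<le>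
      ennreal (1 - t) * (emeasure lborel K + ennreal e) + ennreal t * (emeasure lborel L + ennreal e)"
    using K L by (intro add_mono mult_left_mono) auto
  also have "\<dots> = (ennreal (1 - t) * emeasure lborel K + ennreal t * emeasure lborel L) + (ennreal (1 - t) * ennreal e + ennreal t * ennreal e)"
    by (simp add: distrib_left ac_simps)
  also have "ennreal (1 - t) * ennreal e + ennreal t * ennreal e = ennreal e"
    using assms \<open>e > 0\<close> by (simp add: ennreal_mult[symmetric] ennreal_plus[symmetric] algebra_simps del: ennreal_plus)
  also have "ennreal (1 - t) * emeasure lborel K + ennreal t * emeasure lborel L \<le> emeasure lborel C"
    using K L C assms by (intro compact_brunn_minkowski_real) auto
  finally show "ennreal (1 - t) * emeasure lborel A + ennreal t * emeasure lborel B \<le> emeasure lborel C + ennreal e"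
    by (simp add: add_right_mono)
qed

text \<open>Tonelli on the region F s < f x, 0 < s < 1. The truncation at 1 disappears if F bounds
  f; for a function exceeding its level it still leaves an upper bound, which is how
  \<open>h\<close> is treated below.\<close>

lemma layer_cake_unit:
  fixes f :: "real \<Rightarrow> real"
  assumes [measurable]: "f \<in> borel_measurable borel" and "\<And>x. 0 \<le> f x" "0 < F"
  shows "(\<integral>\<^sup>+s. emeasure lborel {x. F * s < f x} * indicator {0<..<1} s \<partial>lborel) =
    (\<integral>\<^sup>+x. ennreal (min (f x / F) 1) \<partial>lborel)"
proof -
  have "(\<integral>\<^sup>+s. emeasure lborel {x. F * s < f x} * indicator {0<..<1} s \<partial>lborel) =
      (\<integral>\<^sup>+s. (\<integral>\<^sup>+x. indicator {(x, s). F * s < f x \<and> 0 < s \<and> s < 1} (x, s) \<partial>lborel) \<partial>lborel)"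
  proof (intro nn_integral_cong)
    fix s :: real
    have "(\<integral>\<^sup>+x. indicator {(x, s). F * s < f x \<and> 0 < s \<and> s < 1} (x, s) \<partial>lborel) =
        (\<integral>\<^sup>+x. indicator {x. F * s < f x} x * indicator {0<..<1} s \<partial>lborel)"
      by (intro nn_integral_cong) (auto simp: indicator_def)
    also have "\<dots> = emeasure lborel {x. F * s < f x} * indicator {0<..<1} s"
      by (subst nn_integral_multc) auto
    finally show "emeasure lborel {x. F * s < f x} * indicator {0<..<1} s =
      (\<integral>\<^sup>+x. indicator {(x, s). F * s < f x \<and> 0 < s \<and> s < 1} (x, s) \<partial>lborel)" ..
  qed
  also have "\<dots> = (\<integral>\<^sup>+x. (\<integral>\<^sup>+s. indicator {(x, s). F * s < f x \<and> 0 < s \<and> s < 1} (x, s) \<partial>lborel) \<partial>lborel)"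
    by (rule lborel_pair.Fubini) measurable
  also have "\<dots> = (\<integral>\<^sup>+x. ennreal (min (f x / F) 1) \<partial>lborel)"
  proof (intro nn_integral_cong)
    fix x
    have "(\<integral>\<^sup>+s. indicator {(x, s). F * s < f x \<and> 0 < s \<and> s < 1} (x, s) \<partial>lborel) =
        (\<integral>\<^sup>+s. indicator {0<..<min (f x / F) 1} s \<partial>lborel)"
      using \<open>F > 0\<close> by (intro nn_integral_cong) (auto simp: indicator_def field_simps)
    also have "\<dots> = ennreal (min (f x / F) 1)"
      using assms by (simp add: divide_nonneg_pos)
    finally show "(\<integral>\<^sup>+s. indicator {(x, s). F * s < f x \<and> 0 < s \<and> s < 1} (x, s) \<partial>lborel) = ennreal (min (f x / F) 1)" .
  qed
  finally show ?thesis .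
qed

text \<open>Superlevel sets at relative height s satisfy the one-dimensional Brunn-Minkowski
  inequality. Integrating over 0 < s < 1 gives an arithmetic mean of the normalised integrals, and
  the arithmetic-geometric inequality turns it into the product.\<close>

lemma prekopa_leindler_real:
  fixes f g h :: "real \<Rightarrow> real"
  assumes bbs: "bbs f" "bbs g" "bbs h"
    and nonneg: "\<And>x. 0 \<le> f x" "\<And>x. 0 \<le> g x" "\<And>x. 0 \<le> h x" and t: "0 < t" "t < 1"
    and le: "\<And>a b. f a powr (1 - t) * g b powr t \<le> h ((1 - t) * a + t * b)"
  shows "(\<integral>x. f x \<partial>lborel) powr (1 - t) * (\<integral>x. g x \<partial>lborel) powr t \<le> (\<integral>x. h x \<partial>lborel)"
proof (cases "(\<integral>x. f x \<partial>lborel) = 0 \<or> (\<integral>x. g x \<partial>lborel) = 0")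
  case True
  then show ?thesis using nonneg by (auto intro!: integral_nonneg_AE)
next
  case False
  have [measurable]: "f \<in> borel_measurable borel" "g \<in> borel_measurable borel" "h \<in> borel_measurable borel"
    using bbs by (auto dest: bbs_measurable)
  have int: "integrable lborel f" "integrable lborel g" "integrable lborel h" using bbs by (auto intro: bbs_integrable)
  have pos: "0 < (\<integral>x. f x \<partial>lborel)" "0 < (\<integral>x. g x \<partial>lborel)"
    using False nonneg by (auto simp: less_le intro!: integral_nonneg_AE)
  \<comment> \<open>Normalising by the suprema makes the superlevel sets of \<open>f\<close> and
    \<open>g\<close> nonempty at every relative height below 1, as Brunn-Minkowski requires.\<close>
  define F G where "F = (SUP x. f x)" and "G = (SUP x. g x)"
  have bdd: "bdd_above (range f)" "bdd_above (range g)"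
  proof -
    obtain C where "\<And>x. \<bar>f x\<bar> \<le> C" using bbsE[OF bbs(1)] by metis
    then show "bdd_above (range f)" by (auto intro!: bdd_aboveI[of _ C] simp: abs_le_iff)
    obtain C where "\<And>x. \<bar>g x\<bar> \<le> C" using bbsE[OF bbs(2)] by metis
    then show "bdd_above (range g)" by (auto intro!: bdd_aboveI[of _ C] simp: abs_le_iff)
  qed
  have le_sup: "f x \<le> F" "g x \<le> G" for x
    unfolding F_def G_def using bdd by (auto intro: cSUP_upper)
  have "\<exists>x. f x > 0" "\<exists>x. g x > 0"
  proof -
    show "\<exists>x. f x > 0"
    proof (rule ccontr)
      assume "\<not> ?thesis"
      then have "f x = 0" for x using nonneg(1)[of x] by (meson antisym not_le)
      then show False using pos by simp
    qed
    show "\<exists>x. g x > 0"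
    proof (rule ccontr)
      assume "\<not> ?thesis"
      then have "g x = 0" for x using nonneg(2)[of x] by (meson antisym not_le)
      then show False using pos by simp
    qed
  qed
  then have FG: "0 < F" "0 < G" using le_sup by (meson less_le_trans)+
  define H where "H = F powr (1 - t) * G powr t"
  have H: "0 < H" using FG by (simp add: H_def)
  have bm: "ennreal (1 - t) * emeasure lborel {x. F * s < f x} + ennreal t * emeasure lborel {x. G * s < g x}
      \<le> emeasure lborel {x. H * s < h x}" if s: "0 < s" "s < 1" for s
  proof (rule brunn_minkowski_real)
    obtain R where "\<And>x. R < norm x \<Longrightarrow> f x = 0" using bbsE[OF bbs(1)] by metis
    then show "bounded {x. F * s < f x}"
      unfolding bounded_iff using s FG by (intro exI[of _ R]) (metis mem_Collect_eq mult_pos_pos not_le order.asym)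
    obtain R where "\<And>x. R < norm x \<Longrightarrow> g x = 0" using bbsE[OF bbs(2)] by metis
    then show "bounded {x. G * s < g x}"
      unfolding bounded_iff using s FG by (intro exI[of _ R]) (metis mem_Collect_eq mult_pos_pos not_le order.asym)
    have "F * s < F" "G * s < G" using s FG by auto
    then show "{x. F * s < f x} \<noteq> {}" "{x. G * s < g x} \<noteq> {}"
      unfolding F_def G_def using bdd by (auto simp: less_cSUP_iff)
    show "(1 - t) * a + t * b \<in> {x. H * s < h x}" if "a \<in> {x. F * s < f x}" "b \<in> {x. G * s < g x}" for a b
    proof -
      have "H * s = (F * s) powr (1 - t) * (G * s) powr t"
        using s FG by (simp add: H_def powr_mult powr_add[symmetric])
      also have "\<dots> < f a powr (1 - t) * g b powr t"
        using that s FG t by (intro mult_strict_mono powr_less_mono2) (auto simp: mult_less_0_iff)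
      also have "\<dots> \<le> h ((1 - t) * a + t * b)" by (rule le)
      finally show ?thesis by simp
    qed
  qed (use t in auto)
  have lf: "(\<integral>\<^sup>+s. emeasure lborel {x. F * s < f x} * indicator {0<..<1} s \<partial>lborel) = ennreal ((\<integral>x. f x \<partial>lborel) / F)"
    and lg: "(\<integral>\<^sup>+s. emeasure lborel {x. G * s < g x} * indicator {0<..<1} s \<partial>lborel) = ennreal ((\<integral>x. g x \<partial>lborel) / G)"
  proof -
    have *: "(\<integral>\<^sup>+s. emeasure lborel {x. K * s < k x} * indicator {0<..<1} s \<partial>lborel) = ennreal ((\<integral>x. k x \<partial>lborel) / K)"
      if k: "bbs k" "\<And>x. 0 \<le> k x" "\<And>x. k x \<le> K" "0 < K" for k :: "real \<Rightarrow> real" and K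
    proof -
      have "(\<integral>\<^sup>+s. emeasure lborel {x. K * s < k x} * indicator {0<..<1} s \<partial>lborel) = (\<integral>\<^sup>+x. ennreal (min (k x / K) 1) \<partial>lborel)"
        by (rule layer_cake_unit[OF bbs_measurable[OF k(1)] k(2,4)])
      also have "\<dots> = (\<integral>\<^sup>+x. ennreal (k x / K) \<partial>lborel)"
        using k(3,4) by (intro nn_integral_cong arg_cong[where f = ennreal]) (simp add: min_absorb1)
      also have "\<dots> = ennreal (\<integral>x. k x / K \<partial>lborel)"
        using bbs_integrable[OF k(1)] k(2,4) by (intro nn_integral_eq_integral) auto
      finally show ?thesis by simp
    qed
    show "(\<integral>\<^sup>+s. emeasure lborel {x. F * s < f x} * indicator {0<..<1} s \<partial>lborel) = ennreal ((\<integral>x. f x \<partial>lborel) / F)"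
      by (rule *[OF bbs(1) nonneg(1) le_sup(1) FG(1)])
    show "(\<integral>\<^sup>+s. emeasure lborel {x. G * s < g x} * indicator {0<..<1} s \<partial>lborel) = ennreal ((\<integral>x. g x \<partial>lborel) / G)"
      by (rule *[OF bbs(2) nonneg(2) le_sup(2) FG(2)])
  qed
  have "ennreal ((1 - t) * ((\<integral>x. f x \<partial>lborel) / F) + t * ((\<integral>x. g x \<partial>lborel) / G)) =
      ennreal (1 - t) * (\<integral>\<^sup>+s. emeasure lborel {x. F * s < f x} * indicator {0<..<1} s \<partial>lborel) +
      ennreal t * (\<integral>\<^sup>+s. emeasure lborel {x. G * s < g x} * indicator {0<..<1} s \<partial>lborel)"
    unfolding lf lg using t FG pos by (simp add: ennreal_mult[symmetric] ennreal_plus[symmetric] del: ennreal_plus)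
  also have "\<dots> = (\<integral>\<^sup>+s. (ennreal (1 - t) * emeasure lborel {x. F * s < f x} + ennreal t * emeasure lborel {x. G * s < g x}) * indicator {0<..<1} s \<partial>lborel)"
    by (simp add: nn_integral_cmult[symmetric] nn_integral_add[symmetric] distrib_right mult.assoc)
  also have "\<dots> \<le> (\<integral>\<^sup>+s. emeasure lborel {x. H * s < h x} * indicator {0<..<1} s \<partial>lborel)"
    by (intro nn_integral_mono) (use bm in \<open>auto simp: indicator_def\<close>)
  also have "\<dots> = (\<integral>\<^sup>+x. ennreal (min (h x / H) 1) \<partial>lborel)"
    using nonneg H by (simp add: layer_cake_unit)
  also have "\<dots> \<le> (\<integral>\<^sup>+x. ennreal (h x / H) \<partial>lborel)"
    by (intro nn_integral_mono ennreal_leI) simp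
  also have "\<dots> = ennreal ((\<integral>x. h x \<partial>lborel) / H)"
    using int(3) nonneg(3) H by (subst nn_integral_eq_integral) auto
  finally have *: "(1 - t) * ((\<integral>x. f x \<partial>lborel) / F) + t * ((\<integral>x. g x \<partial>lborel) / G) \<le> (\<integral>x. h x \<partial>lborel) / H"
    using nonneg(3) H by (subst (asm) ennreal_le_iff) (auto intro!: divide_nonneg_pos integral_nonneg_AE)
  \<comment> \<open>Weighted arithmetic-geometric mean; the normalising factors recombine to
    H.\<close>
  have "((\<integral>x. f x \<partial>lborel) / F) powr (1 - t) * ((\<integral>x. g x \<partial>lborel) / G) powr t \<le> (\<integral>x. h x \<partial>lborel) / H"
    using Youngs_inequality_0[of "1 - t" t "(\<integral>x. f x \<partial>lborel) / F" "(\<integral>x. g x \<partial>lborel) / G"] * t pos FG by auto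
  moreover have "((\<integral>x. f x \<partial>lborel) / F) powr (1 - t) * ((\<integral>x. g x \<partial>lborel) / G) powr t =
      (\<integral>x. f x \<partial>lborel) powr (1 - t) * (\<integral>x. g x \<partial>lborel) powr t / H"
    using pos FG by (simp add: powr_divide H_def)
  ultimately show ?thesis using H by (simp add: divide_le_cancel)
qed


section \<open>Several variables, by integrating out one coordinate at a time\<close>

definition box_bounded :: "'i set \<Rightarrow> (('i \<Rightarrow> real) \<Rightarrow> real) \<Rightarrow> bool" where
  "box_bounded I f \<longleftrightarrow> f \<in> borel_measurable (PiM I (\<lambda>_. lborel)) \<and> (\<forall>v. 0 \<le> f v) \<and>
     (\<exists>C. \<forall>v. f v \<le> C) \<and> (\<exists>R. \<forall>v. (\<exists>i\<in>I. R < \<bar>v i\<bar>) \<longrightarrow> f v = 0)"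

lemma measurable_fun_upd_PiM:
  "v \<in> space (PiM I (\<lambda>_. lborel)) \<Longrightarrow> (\<lambda>y. (fun_upd v i y)) \<in> measurable lborel (PiM (insert i I) (\<lambda>_. lborel :: real measure))"
  by (drule measurable_compose[OF measurable_Pair1' measurable_add_dim[of i I "\<lambda>_. lborel :: real measure"]]) simp

lemma bbs_section:
  assumes "box_bounded (insert i I) f" "v \<in> space (PiM I (\<lambda>_. lborel))"
  shows "bbs (\<lambda>y. f (fun_upd v i y))"
proof -
  obtain C R where "f \<in> borel_measurable (PiM (insert i I) (\<lambda>_. lborel))" "\<forall>v. 0 \<le> f v" "\<forall>v. f v \<le> C"
    "\<forall>v. (\<exists>j\<in>insert i I. R < \<bar>v j\<bar>) \<longrightarrow> f v = 0"
    using assms(1) unfolding box_bounded_def by blast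
  then show ?thesis
    using measurable_compose[OF measurable_fun_upd_PiM[OF assms(2), of i], of f borel]
    by (intro bbsI[where C = C and R = R]) auto
qed

text \<open>The bounds in \<open>box_bounded\<close> range over all functions v, whereas a section
  is known to be integrable only for v in the space of the product. The indicator of that space
  reconciles the two and is invisible to the integral.\<close>

lemma box_bounded_marginal:
  assumes f: "box_bounded (insert i I) f" and "i \<notin> I"
  shows "box_bounded I (\<lambda>v. indicator (space (PiM I (\<lambda>_. lborel))) v * (\<integral>y. f (fun_upd v i y) \<partial>lborel))" (is "box_bounded I ?g")
proof -
  obtain C R where *: "f \<in> borel_measurable (PiM (insert i I) (\<lambda>_. lborel))" "\<And>v. 0 \<le> f v" "\<And>v. f v \<le> C"
    "\<And>v j. j \<in> insert i I \<Longrightarrow> R < \<bar>v j\<bar> \<Longrightarrow> f v = 0"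
    using f unfolding box_bounded_def by blast
  have C: "0 \<le> C" using *(2,3) order_trans by blast
  have "(\<lambda>v. \<integral>y. f (fun_upd v i y) \<partial>lborel) \<in> borel_measurable (PiM I (\<lambda>_. lborel))"
    using measurable_compose[OF measurable_add_dim *(1)]
    by (intro lborel.borel_measurable_lebesgue_integral) (simp add: split_beta')
  then have m: "?g \<in> borel_measurable (PiM I (\<lambda>_. lborel))" by measurable
  have b: "?g v \<le> C * measure lborel (cball (0::real) \<bar>R\<bar>)" for v
  proof (cases "v \<in> space (PiM I (\<lambda>_. lborel))")
    case True
    have "(\<integral>y. f (fun_upd v i y) \<partial>lborel) \<le> (\<integral>y. C * indicator (cball (0::real) \<bar>R\<bar>) y \<partial>lborel)"
    proof (rule Bochner_Integration.integral_mono[of lborel "\<lambda>y. f (fun_upd v i y)" "\<lambda>y. C * indicator (cball (0::real) \<bar>R\<bar>) y"])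
      show "integrable lborel (\<lambda>y. f (fun_upd v i y))" by (rule bbs_integrable[OF bbs_section[OF f True]])
      show "integrable lborel (\<lambda>y::real. C * indicator (cball (0::real) \<bar>R\<bar>) y)"
        by (intro bbs_integrable bbs_cmult bbs_indicator) auto
      show "f (fun_upd v i y) \<le> C * indicator (cball (0::real) \<bar>R\<bar>) y" for y
        using *(3)[of "(fun_upd v i y)"] *(4)[of i "(fun_upd v i y)"] C by (cases "R < \<bar>y\<bar>") (auto simp: indicator_def)
    qed
    then show ?thesis using True by simp
  qed (use C in auto)
  have z: "?g v = 0" if "j \<in> I" "R < \<bar>v j\<bar>" for j v
  proof -
    have "f (fun_upd v i y) = 0" for y 
    proof (rule *(4)[of j])
      have "j \<noteq> i" using that \<open>i \<notin> I\<close> by blast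
      then show "R < \<bar>(fun_upd v i y) j\<bar>" using that by simp
    qed (use that in simp)
    then show ?thesis by simp
  qed
  show ?thesis unfolding box_bounded_def
    using m b z *(2) by (auto intro!: mult_nonneg_nonneg integral_nonneg_AE)
qed

lemma nn_integral_marginal:
  assumes f: "box_bounded (insert i I) f" and "i \<notin> I" "finite I"
  shows "(\<integral>\<^sup>+v. ennreal (f v) \<partial>PiM (insert i I) (\<lambda>_. lborel)) =
    (\<integral>\<^sup>+v. ennreal (indicator (space (PiM I (\<lambda>_. lborel))) v * (\<integral>y. f (fun_upd v i y) \<partial>lborel)) \<partial>PiM I (\<lambda>_. lborel))"
proof -
  interpret product_sigma_finite "\<lambda>_. lborel :: real measure" ..
  have [measurable]: "f \<in> borel_measurable (PiM (insert i I) (\<lambda>_. lborel))" and nn: "\<And>v. 0 \<le> f v"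
    using f by (auto simp: box_bounded_def)
  have "(\<integral>\<^sup>+v. ennreal (f v) \<partial>PiM (insert i I) (\<lambda>_. lborel)) =
     (\<integral>\<^sup>+v. (\<integral>\<^sup>+y. ennreal (f (fun_upd v i y)) \<partial>lborel) \<partial>PiM I (\<lambda>_. lborel))"
    using assms by (subst product_nn_integral_insert) auto
  also have "\<dots> = (\<integral>\<^sup>+v. ennreal (indicator (space (PiM I (\<lambda>_. lborel))) v * (\<integral>y. f (fun_upd v i y) \<partial>lborel)) \<partial>PiM I (\<lambda>_. lborel))"
    using bbs_integrable[OF bbs_section[OF f]] nn
    by (intro nn_integral_cong) (simp add: nn_integral_eq_integral)
  finally show ?thesis .
qed

text \<open>For fixed remaining coordinates the one-dimensional inequality in the new coordinate
  says that the marginals again satisfy the hypothesis, so the induction closes.\<close>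

lemma prekopa_leindler_PiM:
  assumes "finite I" "box_bounded I f" "box_bounded I g" "box_bounded I h" and t: "0 < t" "t < 1"
    and "\<And>v v'. v \<in> space (PiM I (\<lambda>_. lborel)) \<Longrightarrow> v' \<in> space (PiM I (\<lambda>_. lborel)) \<Longrightarrow>
      f v powr (1 - t) * g v' powr t \<le> h (\<lambda>i\<in>I. (1 - t) * v i + t * v' i)"
  shows "ennreal (enn2real (\<integral>\<^sup>+v. f v \<partial>PiM I (\<lambda>_. lborel)) powr (1 - t) * enn2real (\<integral>\<^sup>+v. g v \<partial>PiM I (\<lambda>_. lborel)) powr t)
     \<le> (\<integral>\<^sup>+v. h v \<partial>PiM I (\<lambda>_. lborel))"
  using assms(1-4,7)
proof (induction I arbitrary: f g h rule: finite_induct)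
  case empty
  interpret product_sigma_finite "\<lambda>_. lborel :: real measure" ..
  \<comment> \<open>The empty product is a unit mass at \<open>\<lambda>_. undefined\<close>, so the
    claim is the hypothesis at that point.\<close>
  have "f (\<lambda>_. undefined) powr (1 - t) * g (\<lambda>_. undefined) powr t \<le> h (\<lambda>_. undefined)"
    using empty.prems(4)[of "\<lambda>_. undefined" "\<lambda>_. undefined"] by (simp add: space_PiM restrict_def)
  then show ?case using empty.prems by (simp add: nn_integral_empty box_bounded_def ennreal_leI)
next
  case (insert i I)
  have nn: "0 \<le> f v" "0 \<le> g v" "0 \<le> h v" for v
    using insert.prems(1-3) unfolding box_bounded_def by blast+
  let ?m = "\<lambda>f v. indicator (space (PiM I (\<lambda>_. lborel))) v * (\<integral>y. f (fun_upd v i y) \<partial>lborel)"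
  have "ennreal (enn2real (\<integral>\<^sup>+v. ?m f v \<partial>PiM I (\<lambda>_. lborel)) powr (1 - t) * enn2real (\<integral>\<^sup>+v. ?m g v \<partial>PiM I (\<lambda>_. lborel)) powr t)
     \<le> (\<integral>\<^sup>+v. ?m h v \<partial>PiM I (\<lambda>_. lborel))"
  proof (rule insert.IH)
    fix v v' assume w: "v \<in> space (PiM I (\<lambda>_. lborel :: real measure))" "v' \<in> space (PiM I (\<lambda>_. lborel :: real measure))"
    let ?w = "\<lambda>j\<in>I. (1 - t) * v j + t * v' j"
    have w'': "?w \<in> space (PiM I (\<lambda>_. lborel :: real measure))" by (simp add: space_PiM)
    have up: "(fun_upd x i y) \<in> space (PiM (insert i I) (\<lambda>_. lborel :: real measure))" if "x \<in> space (PiM I (\<lambda>_. lborel :: real measure))" for x y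
      using that insert.hyps by (auto simp: space_PiM PiE_iff extensional_def)
    have "(\<integral>y. f (fun_upd v i y) \<partial>lborel) powr (1 - t) * (\<integral>y. g (fun_upd v' i y) \<partial>lborel) powr t \<le> (\<integral>y. h (fun_upd ?w i y) \<partial>lborel)"
    proof (rule prekopa_leindler_real)
      fix a b
      have "(\<lambda>j\<in>insert i I. (1 - t) * (fun_upd v i a) j + t * (fun_upd v' i b) j) = (fun_upd ?w i ((1 - t) * a + t * b))"
        using insert.hyps by (auto simp: restrict_def fun_eq_iff)
      then show "f (fun_upd v i a) powr (1 - t) * g (fun_upd v' i b) powr t \<le> h (fun_upd ?w i ((1 - t) * a + t * b))"
        using insert.prems(4)[OF up[OF w(1), of a] up[OF w(2), of b]] by (simp only:)
    qed (rule t nn bbs_section[OF insert.prems(1) w(1)] bbs_section[OF insert.prems(2) w(2)] bbs_section[OF insert.prems(3) w''])+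
    then show "?m f v powr (1 - t) * ?m g v' powr t \<le> ?m h ?w"
      using w w'' by simp
  qed (rule box_bounded_marginal[OF insert.prems(1) insert.hyps(2)] box_bounded_marginal[OF insert.prems(2) insert.hyps(2)]
      box_bounded_marginal[OF insert.prems(3) insert.hyps(2)])+
  then show ?case
    unfolding nn_integral_marginal[OF insert.prems(1) insert.hyps(2,1)] nn_integral_marginal[OF insert.prems(2) insert.hyps(2,1)]
      nn_integral_marginal[OF insert.prems(3) insert.hyps(2,1)] .
qed

text \<open>Lebesgue measure is the image of the product measure under the coordinate map, and that
  map respects convex combinations.\<close>

theorem prekopa_leindler:
  fixes f g h :: "'a::euclidean_space \<Rightarrow> real"
  assumes bbs: "bbs f" "bbs g" "bbs h"
    and nonneg: "\<And>x. 0 \<le> f x" "\<And>x. 0 \<le> g x" "\<And>x. 0 \<le> h x" and t: "0 < t" "t < 1"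
    and le: "\<And>a b. f a powr (1 - t) * g b powr t \<le> h ((1 - t) *\<^sub>R a + t *\<^sub>R b)"
  shows "(\<integral>x. f x \<partial>lborel) powr (1 - t) * (\<integral>x. g x \<partial>lborel) powr t \<le> (\<integral>x. h x \<partial>lborel)"
proof -
  let ?s = "\<lambda>v. \<Sum>b\<in>Basis. v b *\<^sub>R b :: 'a"
  have [measurable]: "?s \<in> measurable (PiM Basis (\<lambda>_. lborel)) borel" by measurable
  have bb: "box_bounded Basis (\<lambda>v. k (?s v))" if k: "bbs k" "\<And>x. 0 \<le> k x" for k
  proof -
    obtain C R where *: "k \<in> borel_measurable borel" "\<And>x. \<bar>k x\<bar> \<le> C" "\<And>x. R < norm x \<Longrightarrow> k x = 0"
      using bbsE[OF k(1)] by metis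
    have "k (?s v) = 0" if "b \<in> Basis" "R < \<bar>v b\<bar>" for v b
    proof -
      have "v b = ?s v \<bullet> b" using that by simp
      then have "\<bar>v b\<bar> \<le> norm (?s v)" using Basis_le_norm[OF that(1), of "?s v"] by simp
      with that show ?thesis by (intro *(3)) simp
    qed
    moreover have "k (?s v) \<le> C" for v using *(2)[of "?s v"] by linarith
    moreover have "(\<lambda>v. k (?s v)) \<in> borel_measurable (PiM Basis (\<lambda>_. lborel))" using *(1) by measurable
    ultimately show ?thesis unfolding box_bounded_def using k(2) by blast
  qed
  have eq: "(\<integral>\<^sup>+v. ennreal (k (?s v)) \<partial>PiM Basis (\<lambda>_. lborel)) = ennreal (\<integral>x. k x \<partial>lborel)" if k: "bbs k" "\<And>x. 0 \<le> k x" for k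
  proof -
    have [measurable]: "k \<in> borel_measurable borel" using k by (rule_tac bbs_measurable)
    have "ennreal (\<integral>x. k x \<partial>lborel) = (\<integral>\<^sup>+x. ennreal (k x) \<partial>lborel)"
      using k by (subst nn_integral_eq_integral) (auto intro: bbs_integrable)
    also have "\<dots> = (\<integral>\<^sup>+x. ennreal (k x) \<partial>distr (PiM Basis (\<lambda>_. lborel)) borel ?s)"
      using lborel_eq[where 'a='a] by simp
    also have "\<dots> = (\<integral>\<^sup>+v. ennreal (k (?s v)) \<partial>PiM Basis (\<lambda>_. lborel))"
      by (rule nn_integral_distr) auto
    finally show ?thesis ..
  qed
  have "ennreal (enn2real (\<integral>\<^sup>+v. ennreal (f (?s v)) \<partial>PiM Basis (\<lambda>_. lborel)) powr (1 - t) *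
       enn2real (\<integral>\<^sup>+v. ennreal (g (?s v)) \<partial>PiM Basis (\<lambda>_. lborel)) powr t)
     \<le> (\<integral>\<^sup>+v. ennreal (h (?s v)) \<partial>PiM Basis (\<lambda>_. lborel))"
  proof (rule prekopa_leindler_PiM)
    fix v v' :: "'a \<Rightarrow> real"
    have "?s (\<lambda>i\<in>Basis. (1 - t) * v i + t * v' i) = (1 - t) *\<^sub>R ?s v + t *\<^sub>R ?s v'"
      by (simp add: scaleR_sum_right sum.distrib[symmetric] scaleR_add_left)
    then show "f (?s v) powr (1 - t) * g (?s v') powr t \<le> h (?s (\<lambda>i\<in>Basis. (1 - t) * v i + t * v' i))"
      using le by simp
  qed (rule finite_Basis t bb[OF bbs(1) nonneg(1)] bb[OF bbs(2) nonneg(2)] bb[OF bbs(3) nonneg(3)])+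
  moreover have "0 \<le> (\<integral>x. f x \<partial>lborel)" "0 \<le> (\<integral>x. g x \<partial>lborel)" "0 \<le> (\<integral>x. h x \<partial>lborel)"
    using nonneg by (auto intro!: integral_nonneg_AE)
  ultimately show ?thesis
    unfolding eq[OF bbs(1) nonneg(1)] eq[OF bbs(2) nonneg(2)] eq[OF bbs(3) nonneg(3)]
    by (simp add: ennreal_le_iff)
qed

section \<open>Averaging operators\<close>

text \<open>As a probability measure the mollifier makes averages into expectations, so that defects
  in Cauchy-Schwarz inequalities become double integrals over two independent displacements.\<close>

definition mol_measure :: "'a::euclidean_space measure" where
  "mol_measure = density lborel (\<lambda>z. ennreal (mollifier z))"

lemma sets_mol_measure [simp, measurable_cong]: "sets mol_measure = sets borel"
  by (simp add: mol_measure_def)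

lemma space_mol_measure [simp]: "space mol_measure = UNIV"
  by (simp add: mol_measure_def)

interpretation mol: prob_space "mol_measure :: 'a::euclidean_space measure"
proof (rule prob_spaceI)
  have "emeasure (mol_measure :: 'a measure) (space mol_measure) = (\<integral>\<^sup>+z. ennreal (mollifier (z :: 'a)) \<partial>lborel)"
    by (simp add: mol_measure_def emeasure_density)
  also have "\<dots> = 1"
    using bbs_integrable[OF bbs_mollifier] mollifier_nonneg mollifier_integral
    by (subst nn_integral_eq_integral) auto
  finally show "emeasure (mol_measure :: 'a measure) (space mol_measure) = 1" .
qed

lemma mol_integral:
  "f \<in> borel_measurable borel \<Longrightarrow> (\<integral>z. f z \<partial>mol_measure) = (\<integral>z. mollifier z * f z \<partial>lborel)"
  unfolding mol_measure_def using mollifier_nonneg by (subst integral_density) auto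

lemma mol_AE: "AE z in (mol_measure :: 'a::euclidean_space measure). norm z < 1"
proof -
  have "norm z < 1" if "0 < ennreal (mollifier z)" for z :: 'a
    using that mollifier_outside[of z] by (cases "norm z < 1") auto
  then show ?thesis
    unfolding mol_measure_def by (subst AE_density) auto
qed

lemma mol_integral_uminus:
  fixes f :: "'a::euclidean_space \<Rightarrow> real"
  assumes [measurable]: "f \<in> borel_measurable borel"
  shows "(\<integral>z. f (- z) \<partial>mol_measure) = (\<integral>z. f z \<partial>mol_measure)"
  using lborel_integral_uminus[of "\<lambda>z. mollifier z * f z"] by (simp add: mol_integral mollifier_minus)

lemma mol_integrable_bounded:
  fixes f :: "'a::euclidean_space \<Rightarrow> real"
  assumes "f \<in> borel_measurable borel" "\<And>x. norm x < 1 \<Longrightarrow> \<bar>f x\<bar> \<le> C"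
  shows "integrable mol_measure f"
proof (rule mol.integrable_const_bound[where B = C])
  show "AE x in mol_measure. norm (f x) \<le> C"
    using mol_AE by eventually_elim (use assms(2) in simp)
qed (use assms(1) in measurable)

definition avg :: "real \<Rightarrow> ('a::euclidean_space \<Rightarrow> real) \<Rightarrow> 'a \<Rightarrow> real" where
  "avg r f x = (\<integral>z. f (x + r *\<^sub>R z) \<partial>mol_measure)"

lemma avg_measurable [measurable]:
  assumes [measurable]: "f \<in> borel_measurable borel"
  shows "avg r f \<in> borel_measurable borel"
  unfolding avg_def[abs_def] by measurable

lemma bbs_mol_integrable:
  fixes f :: "'a::euclidean_space \<Rightarrow> real"
  assumes "bbs f"
  shows "integrable mol_measure (\<lambda>z. f (x + r *\<^sub>R z))"
proof -
  obtain C where C: "f \<in> borel_measurable borel" "\<And>x. \<bar>f x\<bar> \<le> C" using bbsE[OF assms] by metis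
  note [measurable] = C(1)
  show ?thesis by (rule mol_integrable_bounded[where C = C]) (use C(2) in auto)
qed

lemma avg_bound:
  fixes f :: "'a::euclidean_space \<Rightarrow> real"
  assumes "f \<in> borel_measurable borel" "0 < r" "\<And>y. dist x y < r \<Longrightarrow> \<bar>f y\<bar> \<le> C"
  shows "\<bar>avg r f x\<bar> \<le> C"
proof -
  note [measurable] = assms(1)
  have *: "\<bar>f (x + r *\<^sub>R z)\<bar> \<le> C" if "norm z < 1" for z
    using that assms(2) by (intro assms(3)) (simp add: dist_norm)
  have i: "integrable mol_measure (\<lambda>z. f (x + r *\<^sub>R z))"
    by (rule mol_integrable_bounded[where C = C]) (use * in auto)
  have "\<bar>avg r f x\<bar> \<le> (\<integral>z. \<bar>f (x + r *\<^sub>R z)\<bar> \<partial>mol_measure)" unfolding avg_def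
    by (rule integral_abs_bound)
  also have "\<dots> \<le> (\<integral>z. C \<partial>(mol_measure :: 'a measure))"
    using i mol_AE by (intro integral_mono_AE) (auto elim!: eventually_mono intro: *)
  moreover have "measure (mol_measure :: 'a measure) UNIV = 1" by (metis mol.prob_space space_mol_measure)
  ultimately show ?thesis by simp
qed

lemma bbs_avg:
  fixes f :: "'a::euclidean_space \<Rightarrow> real"
  assumes "bbs f" "0 < r"
  shows "bbs (avg r f)"
proof -
  obtain C R where *: "f \<in> borel_measurable borel" "\<And>x. \<bar>f x\<bar> \<le> C" "\<And>x. R < norm x \<Longrightarrow> f x = 0" using bbsE[OF assms(1)] by metis
  show ?thesis
  proof (rule bbsI[where C = C and R = "R + r"])
    show "\<bar>avg r f x\<bar> \<le> C" for x using * assms by (intro avg_bound) auto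
    show "avg r f x = 0" if "R + r < norm x" for x
    proof -
      have "f y = 0" if "dist x y < r" for y
      proof (rule *(3))
        have "norm x \<le> norm y + dist x y" by (metis dist_norm norm_triangle_sub)
        then show "R < norm y" using that \<open>R + r < norm x\<close> by linarith
      qed
      then have "\<bar>avg r f x\<bar> \<le> 0" using * assms by (intro avg_bound) auto
      then show ?thesis by simp
    qed
  qed (use * in measurable)
qed

lemma avg_mono:
  fixes f :: "'a::euclidean_space \<Rightarrow> real"
  assumes "integrable mol_measure (\<lambda>z. f (x + r *\<^sub>R z))" "integrable mol_measure (\<lambda>z. g (x + r *\<^sub>R z))"
    and "0 < r" "\<And>y. dist x y < r \<Longrightarrow> f y \<le> g y"
  shows "avg r f x \<le> avg r g x"
  unfolding avg_def using assms(1,2)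
proof (rule integral_mono_AE)
  show "AE z in mol_measure. f (x + r *\<^sub>R z) \<le> g (x + r *\<^sub>R z)"
    using mol_AE by eventually_elim (use assms in \<open>auto simp: dist_norm\<close>)
qed

lemma avg_nonneg:
  assumes "\<And>x. 0 \<le> f x"
  shows "0 \<le> avg r f x"
  unfolding avg_def using assms by (intro integral_nonneg_AE) auto

text \<open>After Fubini, translating x by r z moves the displacement to \<open>g\<close> with
  opposite sign, and the mollifier is even.\<close>

lemma avg_self_adjoint:
  fixes f :: "'a::euclidean_space \<Rightarrow> real"
  assumes f: "bbs f" and g: "bbs g" and r: "0 < r"
  shows "(\<integral>x. avg r f x * g x \<partial>lborel) = (\<integral>x. f x * avg r g x \<partial>lborel)"
proof -
  interpret P: pair_sigma_finite "lborel :: 'a measure" "mol_measure :: 'a measure" ..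
  have [measurable]: "f \<in> borel_measurable borel" "g \<in> borel_measurable borel"
    using f g by (auto dest: bbs_measurable)
  have *: "integrable (lborel \<Otimes>\<^sub>M mol_measure) (\<lambda>(x, z). a (x + r *\<^sub>R z) * b x)" if ab: "bbs a" "bbs b" for a b :: "'a \<Rightarrow> real"
  proof -
    obtain A where A: "a \<in> borel_measurable borel" "\<And>x. \<bar>a x\<bar> \<le> A" "0 \<le> A" using bbsE[OF ab(1)] by metis
    obtain B R where B: "b \<in> borel_measurable borel" "\<And>x. \<bar>b x\<bar> \<le> B" "\<And>x. R < norm x \<Longrightarrow> b x = 0" using bbsE[OF ab(2)] by metis
    note [measurable] = A(1) B(1)
    show ?thesis
    proof (rule bbs_pair_integrable[where C = "A * B" and R = R])
      show "finite_measure (mol_measure :: 'a measure)" by (rule mol.finite_measure_axioms)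
      show "\<bar>case (x, z) of (x, z) \<Rightarrow> a (x + r *\<^sub>R z) * b x\<bar> \<le> A * B" for x z
        using A(2)[of "x + r *\<^sub>R z"] B(2)[of x] A(3) by (auto simp: abs_mult intro: mult_mono)
    qed (use B(3) in auto)
  qed
  have "(\<integral>x. avg r f x * g x \<partial>lborel) = (\<integral>x. (\<integral>z. f (x + r *\<^sub>R z) * g x \<partial>mol_measure) \<partial>lborel)"
    unfolding avg_def using bbs_mol_integrable[OF f] by simp
  also have "\<dots> = (\<integral>z. (\<integral>x. f (x + r *\<^sub>R z) * g x \<partial>lborel) \<partial>mol_measure)"
    using P.Fubini_integral[OF *[OF f g]] by simp
  also have "\<dots> = (\<integral>z. (\<integral>x. f x * g (x - r *\<^sub>R z) \<partial>lborel) \<partial>mol_measure)"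
    using lborel_integral_translate[of "\<lambda>x. f x * g (x - r *\<^sub>R z)" "r *\<^sub>R z" for z] by simp
  also have "\<dots> = (\<integral>z. (\<integral>x. f x * g (x + r *\<^sub>R z) \<partial>lborel) \<partial>mol_measure)"
    using mol_integral_uminus[of "\<lambda>z. (\<integral>x. f x * g (x + r *\<^sub>R z) \<partial>lborel)"] by simp
  also have "\<dots> = (\<integral>x. (\<integral>z. g (x + r *\<^sub>R z) * f x \<partial>mol_measure) \<partial>lborel)"
    using P.Fubini_integral[OF *[OF g f]] by (simp add: mult.commute)
  also have "\<dots> = (\<integral>x. f x * avg r g x \<partial>lborel)"
    unfolding avg_def using bbs_mol_integrable[OF g] by (simp add: mult.commute)
  finally show ?thesis .
qed

lemma log_concave_nonneg: "log_concave f \<Longrightarrow> 0 \<le> f x"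
  by (simp add: log_concave_def)

lemma log_concaveD:
  "log_concave f \<Longrightarrow> 0 < t \<Longrightarrow> t < 1 \<Longrightarrow> f x powr (1 - t) * f y powr t \<le> f ((1 - t) *\<^sub>R x + t *\<^sub>R y)"
  by (simp add: log_concave_def)

lemma log_concave_mult:
  assumes "log_concave f" "log_concave g"
  shows "log_concave (\<lambda>x. f x * g x)"
  unfolding log_concave_def
proof (intro conjI allI impI)
  fix x y t assume t: "0 < t" "(t::real) < 1"
  have "(f x * g x) powr (1 - t) * (f y * g y) powr t = (f x powr (1 - t) * f y powr t) * (g x powr (1 - t) * g y powr t)"
    using assms by (simp add: powr_mult log_concave_nonneg)
  also have "\<dots> \<le> f ((1 - t) *\<^sub>R x + t *\<^sub>R y) * g ((1 - t) *\<^sub>R x + t *\<^sub>R y)"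
    using assms t by (intro mult_mono log_concaveD) (auto simp: log_concave_nonneg)
  finally show "(f x * g x) powr (1 - t) * (f y * g y) powr t \<le> f ((1 - t) *\<^sub>R x + t *\<^sub>R y) * g ((1 - t) *\<^sub>R x + t *\<^sub>R y)" .
qed (use assms in \<open>auto simp: log_concave_nonneg\<close>)

lemma log_concave_indicator:
  assumes "convex S"
  shows "log_concave (indicator S)"
  using assms by (auto simp: log_concave_def indicator_def convex_alt)

text \<open>For base points x, y and their combination the integrands in the displacement are
  products of two log-concave factors, and displacements combine with the same weight t. This is the
  hypothesis of the Prekopa-Leindler inequality.\<close>

lemma log_concave_avg:
  fixes f :: "'a::euclidean_space \<Rightarrow> real"
  assumes f: "bbs f" "log_concave f"
  shows "log_concave (avg r f)"
  unfolding log_concave_def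
proof (intro conjI allI impI)
  have [measurable]: "f \<in> borel_measurable borel" using f by (rule_tac bbs_measurable)
  show "0 \<le> avg r f x" for x using f by (intro avg_nonneg) (simp add: log_concave_nonneg)
  have b: "bbs (\<lambda>z. mollifier z * f (x + r *\<^sub>R z))" for x
  proof -
    obtain C where C: "\<And>x. \<bar>f x\<bar> \<le> C" using bbsE[OF f(1)] by metis
    have "bbs (\<lambda>z. f (x + r *\<^sub>R z) * mollifier z)"
      by (rule bbs_mult_bounded[OF bbs_mollifier, where B = C]) (use C in auto)
    then show ?thesis by (simp add: mult.commute)
  qed
  have e: "avg r f x = (\<integral>z. mollifier z * f (x + r *\<^sub>R z) \<partial>lborel)" for x
    unfolding avg_def by (rule mol_integral) measurable
  fix x y :: 'a and t :: real assume t: "0 < t" "t < 1"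
  show "avg r f x powr (1 - t) * avg r f y powr t \<le> avg r f ((1 - t) *\<^sub>R x + t *\<^sub>R y)"
    unfolding e
  proof (rule prekopa_leindler[OF b b b _ _ _ t])
    fix a b
    have "(mollifier a * f (x + r *\<^sub>R a)) powr (1 - t) * (mollifier b * f (y + r *\<^sub>R b)) powr t =
       (mollifier a powr (1 - t) * mollifier b powr t) * (f (x + r *\<^sub>R a) powr (1 - t) * f (y + r *\<^sub>R b) powr t)"
      using f by (simp add: powr_mult log_concave_nonneg mollifier_nonneg)
    also have "\<dots> \<le> mollifier ((1 - t) *\<^sub>R a + t *\<^sub>R b) * f ((1 - t) *\<^sub>R (x + r *\<^sub>R a) + t *\<^sub>R (y + r *\<^sub>R b))"
      using f t log_concave_mollifier by (intro mult_mono log_concaveD) (auto simp: log_concave_nonneg mollifier_nonneg)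
    also have "(1 - t) *\<^sub>R (x + r *\<^sub>R a) + t *\<^sub>R (y + r *\<^sub>R b) = ((1 - t) *\<^sub>R x + t *\<^sub>R y) + r *\<^sub>R ((1 - t) *\<^sub>R a + t *\<^sub>R b)"
      by (simp add: algebra_simps)
    finally show "(mollifier a * f (x + r *\<^sub>R a)) powr (1 - t) * (mollifier b * f (y + r *\<^sub>R b)) powr t
       \<le> mollifier ((1 - t) *\<^sub>R a + t *\<^sub>R b) * f ((1 - t) *\<^sub>R x + t *\<^sub>R y + r *\<^sub>R ((1 - t) *\<^sub>R a + t *\<^sub>R b))" .
  qed (use f in \<open>auto simp: log_concave_nonneg mollifier_nonneg\<close>)
qed

text \<open>Expanding (q z - q z')^2 and integrating gives twice the defect of the Cauchy-Schwarz
  inequality with weight \<open>p\<close>, as an equality. With \<open>p\<close> equal to 1 it is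
  the variance formula.\<close>

lemma lagrange_identity:
  fixes p q :: "'a \<Rightarrow> real"
  assumes "prob_space N" "p \<in> borel_measurable N" "q \<in> borel_measurable N" "\<And>x. \<bar>p x\<bar> \<le> C" "\<And>x. \<bar>q x\<bar> \<le> C"
  shows "(\<integral>z. p z * q z \<partial>N)\<^sup>2 = (\<integral>z. p z \<partial>N) * (\<integral>z. p z * (q z)\<^sup>2 \<partial>N)
     - (\<integral>z. (\<integral>z'. p z * p z' * (q z - q z')\<^sup>2 \<partial>N) \<partial>N) / 2"
proof -
  interpret prob_space N by fact
  note [measurable] = assms(2,3)
  have C: "0 \<le> C" using assms(4) abs_ge_zero order_trans by blast
  have i: "integrable N p" by (rule integrable_const_bound[where B = C]) (use assms in auto)
  have i1: "integrable N (\<lambda>z. p z * q z)"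
    by (rule integrable_const_bound[where B = "C * C"]) (use assms C in \<open>auto simp: abs_mult intro!: mult_mono\<close>)
  have i2: "integrable N (\<lambda>z. p z * (q z)\<^sup>2)"
  proof (rule integrable_const_bound[where B = "C * C\<^sup>2"])
    have "\<bar>p x * (q x)\<^sup>2\<bar> \<le> C * C\<^sup>2" for x
      using mult_mono[OF assms(4)[of x] power_mono[OF assms(5)[of x] abs_ge_zero, of 2]] C by (simp add: abs_mult)
    then show "AE x in N. norm (p x * (q x)\<^sup>2) \<le> C * C\<^sup>2" by simp
  qed measurable
  define a b c where "a = (\<integral>z. p z \<partial>N)" and "b = (\<integral>z. p z * q z \<partial>N)" and "c = (\<integral>z. p z * (q z)\<^sup>2 \<partial>N)"
  have "(\<integral>z'. p z * p z' * (q z - q z')\<^sup>2 \<partial>N) = p z * (q z)\<^sup>2 * a - 2 * (p z * q z) * b + p z * c" for z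
  proof -
    have "(\<integral>z'. p z * p z' * (q z - q z')\<^sup>2 \<partial>N) =
        (\<integral>z'. p z * (q z)\<^sup>2 * p z' - 2 * (p z * q z) * (p z' * q z') + p z * (p z' * (q z')\<^sup>2) \<partial>N)"
      by (intro Bochner_Integration.integral_cong) (auto simp: power2_eq_square algebra_simps)
    also have "\<dots> = p z * (q z)\<^sup>2 * a - 2 * (p z * q z) * b + p z * c"
      using i i1 i2 by (simp add: a_def b_def c_def)
    finally show ?thesis .
  qed
  then have "(\<integral>z. (\<integral>z'. p z * p z' * (q z - q z')\<^sup>2 \<partial>N) \<partial>N) = (\<integral>z. (p z * (q z)\<^sup>2) * a - 2 * b * (p z * q z) + p z * c \<partial>N)"
    by (simp add: mult_ac)
  also have "\<dots> = c * a - 2 * b * b + a * c"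
    using i i1 i2 by (simp add: a_def b_def c_def)
  finally show ?thesis
    unfolding a_def[symmetric] b_def[symmetric] c_def[symmetric] by (simp add: power2_eq_square field_simps)
qed


section \<open>Power iteration\<close>

lemma quadratic_discriminant:
  fixes a b c :: real
  assumes "\<And>t. 0 \<le> a + 2 * t * b + t\<^sup>2 * c" "0 \<le> c"
  shows "b\<^sup>2 \<le> a * c"
proof (cases "c = 0")
  case True
  have "b = 0"
  proof (rule ccontr)
    assume "b \<noteq> 0"
    then show False using assms(1)[of "- (a + 1) / (2 * b)"] True by (simp add: field_simps)
  qed
  then show ?thesis using True by simp
next
  case False
  then have c: "0 < c" using assms by simp
  have "0 \<le> (a + 2 * (- b / c) * b + (- b / c)\<^sup>2 * c) * c" using assms(1)[of "- b / c"] c by simp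
  also have "\<dots> = a * c - b\<^sup>2" using c by (simp add: field_simps power2_eq_square)
  finally show ?thesis by simp
qed

lemma weighted_Cauchy_Schwarz:
  fixes m f g :: "'a::euclidean_space \<Rightarrow> real"
  assumes "bbs f" "bbs g" "m \<in> borel_measurable borel" "\<And>x. 0 \<le> m x" "\<And>x. m x \<le> B"
  shows "(\<integral>x. m x * (f x * g x) \<partial>lborel)\<^sup>2 \<le> (\<integral>x. m x * (f x)\<^sup>2 \<partial>lborel) * (\<integral>x. m x * (g x)\<^sup>2 \<partial>lborel)"
proof (rule quadratic_discriminant)
  have i: "integrable lborel (\<lambda>x. m x * h x)" if "bbs h" for h
    using assms that by (intro bbs_integrable bbs_mult_bounded[where B = B]) auto
  show "0 \<le> (\<integral>x. m x * (g x)\<^sup>2 \<partial>lborel)" using assms by (intro integral_nonneg_AE) auto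
  fix t
  have "0 \<le> (\<integral>x. m x * (f x + t * g x)\<^sup>2 \<partial>lborel)" using assms by (intro integral_nonneg_AE) auto
  also have "\<dots> = (\<integral>x. m x * (f x)\<^sup>2 + 2 * t * (m x * (f x * g x)) + t\<^sup>2 * (m x * (g x)\<^sup>2) \<partial>lborel)"
    by (intro Bochner_Integration.integral_cong) (auto simp: power2_eq_square algebra_simps)
  also have "\<dots> = (\<integral>x. m x * (f x)\<^sup>2 \<partial>lborel) + 2 * t * (\<integral>x. m x * (f x * g x) \<partial>lborel) + t\<^sup>2 * (\<integral>x. m x * (g x)\<^sup>2 \<partial>lborel)"
    using assms by (simp add: i bbs_mult bbs_power2)
  finally show "0 \<le> (\<integral>x. m x * (f x)\<^sup>2 \<partial>lborel) + 2 * t * (\<integral>x. m x * (f x * g x) \<partial>lborel) + t\<^sup>2 * (\<integral>x. m x * (g x)\<^sup>2 \<partial>lborel)" .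
qed

section \<open>Growth rates of log-convex sequences\<close>

lemma log_convex_sequence:
  fixes a :: "nat \<Rightarrow> real"
  assumes "0 < a 0" "0 < a 1" "\<And>k. (a (Suc k))\<^sup>2 \<le> a k * a (Suc (Suc k))"
  shows "0 < a k" "a (Suc k) / a k \<le> a (Suc (Suc k)) / a (Suc k)"
proof -
  have pos: "0 < a k \<and> 0 < a (Suc k)" for k
  proof (induction k)
    case (Suc k)
    then have "0 < a k * a (Suc (Suc k))" using assms(3)[of k] by (smt (verit) zero_less_power2)
    with Suc show ?case by (simp add: zero_less_mult_iff)
  qed (use assms in simp)
  then show "0 < a k" by blast
  show "a (Suc k) / a k \<le> a (Suc (Suc k)) / a (Suc k)"
    using assms(3)[of k] pos[of k] by (simp add: field_simps power2_eq_square)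
qed

text \<open>Ratios of successive terms never decrease. If all ratios of \<open>a\<close> at even
  indices were below q, then \<open>a\<close> would grow at most like q^k, while \<open>b\<close>
  grows at least like (b 1 / b 0)^k with a base larger than q; this contradicts the domination of
  \<open>b\<close> by \<open>a\<close>.\<close>

lemma log_convex_sequence_growth:
  fixes a b :: "nat \<Rightarrow> real"
  assumes a: "0 < a 0" "0 < a 1" "\<And>k. (a (Suc k))\<^sup>2 \<le> a k * a (Suc (Suc k))"
    and b: "0 < b 0" "0 < b 1" "\<And>k. (b (Suc k))\<^sup>2 \<le> b k * b (Suc (Suc k))"
    and ab: "\<And>k. b k \<le> C * a k" and q: "0 < q" "q * b 0 < b 1"
  shows "\<exists>N. q * a (2 * N) \<le> a (2 * N + 1)"
proof (rule ccontr)
  assume "\<not> ?thesis"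
  then have N: "a (2 * N + 1) < q * a (2 * N)" for N by (meson not_le)
  have r: "incseq (\<lambda>k. a (Suc k) / a k)" "incseq (\<lambda>k. b (Suc k) / b k)"
    by (rule incseq_SucI, rule log_convex_sequence[OF a])
       (rule incseq_SucI, rule log_convex_sequence[OF b])
  have pa: "0 < a k" and pb: "0 < b k" for k
    by (rule log_convex_sequence[OF a]) (rule log_convex_sequence[OF b])
  \<comment> \<open>By monotonicity the ratio at k is at most the one at 2 k, so control at even
    indices suffices. Even indices are the ones at which moments are squared norms.\<close>
  have a_step: "a (Suc k) \<le> q * a k" for k
  proof -
    have "a (Suc k) / a k \<le> a (Suc (2 * k)) / a (2 * k)" using incseqD[OF r(1), of k "2 * k"] by simp
    also have "\<dots> \<le> q" using N[of k] pa[of "2 * k"] by (simp add: divide_le_eq)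
    finally show ?thesis using pa[of k] by (simp add: divide_le_eq)
  qed
  define p where "p = b 1 / b 0"
  have b_step: "p * b k \<le> b (Suc k)" for k
    using incseqD[OF r(2), of 0 k] pb[of k] by (simp add: p_def le_divide_eq)
  have A: "a k \<le> a 0 * q ^ k" for k
  proof (induction k)
    case (Suc k)
    have "q * a k \<le> q * (a 0 * q ^ k)" using Suc q by simp
    then show ?case using a_step[of k] by (simp add: mult_ac)
  qed simp
  have p: "q < p" using q b by (simp add: p_def less_divide_eq)
  have B: "b 0 * p ^ k \<le> b k" for k
  proof (induction k)
    case (Suc k)
    have "p * (b 0 * p ^ k) \<le> p * b k" using Suc p q by simp
    then show ?case using b_step[of k] by (simp add: mult_ac)
  qed simp
  have C: "0 < C" using ab[of 0] pb[of 0] pa[of 0] by (smt (verit) mult_nonpos_nonneg)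
  have "1 < p / q" using p q by simp
  then obtain k where k: "C * a 0 / b 0 < (p / q) ^ k" using real_arch_pow by blast
  have "b 0 * p ^ k \<le> C * (a 0 * q ^ k)"
    using B[of k] ab[of k] A[of k] C by (meson mult_left_mono less_imp_le order_trans)
  then have "b 0 * (p / q) ^ k \<le> C * a 0"
    using q by (simp add: power_divide divide_le_eq mult_ac)
  with k pb[of 0] show False by (simp add: divide_less_eq mult.commute)
qed

locale smoothing_operator =
  fixes W :: "'a::euclidean_space set" and m :: "'a \<Rightarrow> real" and r B :: real
  assumes W: "W \<in> sets borel" "bounded W"
    and m: "m \<in> borel_measurable borel" "\<And>x. 0 \<le> m x" "\<And>x. m x \<le> B"
    and r: "0 < r"
begin

definition T :: "('a \<Rightarrow> real) \<Rightarrow> 'a \<Rightarrow> real" where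
  "T f x = indicator W x * avg r (\<lambda>y. m y * avg r f y) x"

text \<open>The quadratic form of \<open>T\<close> on functions supported in W. Unlike
  \<open>T\<close> itself it is visibly symmetric, and it is positive semidefinite because m is
  nonnegative.\<close>

definition energy :: "('a \<Rightarrow> real) \<Rightarrow> ('a \<Rightarrow> real) \<Rightarrow> real" where
  "energy f g = (\<integral>x. m x * (avg r f x * avg r g x) \<partial>lborel)"

lemma bbs_m_mult: "bbs f \<Longrightarrow> bbs (\<lambda>x. m x * f x)"
  using m by (intro bbs_mult_bounded[where B = B]) auto

lemma bbs_T: "bbs f \<Longrightarrow> bbs (T f)"
  unfolding T_def[abs_def] using W r by (intro bbs_mult bbs_indicator bbs_avg bbs_m_mult)

lemma T_outside: "x \<notin> W \<Longrightarrow> T f x = 0"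
  by (simp add: T_def)

lemma T_energy:
  assumes "bbs f" "bbs g" "\<And>x. x \<notin> W \<Longrightarrow> g x = 0"
  shows "(\<integral>x. T f x * g x \<partial>lborel) = energy f g"
proof -
  have "(\<integral>x. T f x * g x \<partial>lborel) = (\<integral>x. avg r (\<lambda>y. m y * avg r f y) x * g x \<partial>lborel)"
    using assms(3) by (intro Bochner_Integration.integral_cong) (auto simp: T_def indicator_def)
  also have "\<dots> = energy f g"
    using assms r by (subst avg_self_adjoint) (auto simp: energy_def mult.assoc intro: bbs_m_mult bbs_avg)
  finally show ?thesis .
qed

lemma energy_commute: "energy f g = energy g f"
  by (simp add: energy_def mult.commute)

lemma T_mono:
  assumes "bbs f" "bbs g" "\<And>x. f x \<le> g x"
  shows "T f x \<le> T g x"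
  unfolding T_def using assms r m(2)
  by (intro mult_left_mono avg_mono bbs_mol_integrable bbs_m_mult bbs_avg) auto

lemma T_cmult: "bbs f \<Longrightarrow> T (\<lambda>x. c * f x) x = c * T f x"
  unfolding T_def avg_def by (simp add: mult_ac)

lemma T_nonneg: "(\<And>x. 0 \<le> f x) \<Longrightarrow> 0 \<le> T f x"
  unfolding T_def using m by (intro mult_nonneg_nonneg avg_nonneg) auto

lemma bbs_iterate: "bbs f \<Longrightarrow> bbs ((T ^^ k) f)"
  by (induction k) (auto intro: bbs_T)

lemma iterate_outside: "(\<And>x. x \<notin> W \<Longrightarrow> f x = 0) \<Longrightarrow> x \<notin> W \<Longrightarrow> (T ^^ k) f x = 0"
  by (cases k) (auto simp: T_outside)

lemma iterate_nonneg: "(\<And>x. 0 \<le> f x) \<Longrightarrow> 0 \<le> (T ^^ k) f x"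
  by (induction k arbitrary: x) (auto intro: T_nonneg)

lemma iterate_mono:
  assumes "bbs f" "bbs g" "\<And>x. f x \<le> c * g x"
  shows "(T ^^ k) f x \<le> c * (T ^^ k) g x"
proof (induction k arbitrary: x)
  case (Suc k)
  have "T ((T ^^ k) f) x \<le> T (\<lambda>x. c * (T ^^ k) g x) x"
    using assms Suc by (intro T_mono bbs_iterate bbs_cmult) auto
  then show ?case using assms by (simp add: T_cmult bbs_iterate)
qed (use assms in simp)

definition moment :: "('a \<Rightarrow> real) \<Rightarrow> nat \<Rightarrow> real" where
  "moment f k = (\<integral>x. (T ^^ k) f x * f x \<partial>lborel)"

text \<open>On functions vanishing off W the operator is self-adjoint, so factors of
  \<open>T\<close> move from one side to the other and only their total number counts.\<close>

lemma moment_add: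
  assumes "bbs f" "\<And>x. x \<notin> W \<Longrightarrow> f x = 0"
  shows "(\<integral>x. (T ^^ i) f x * (T ^^ j) f x \<partial>lborel) = moment f (i + j)"
proof (induction j arbitrary: i)
  case (Suc j)
  have "(\<integral>x. (T ^^ i) f x * (T ^^ Suc j) f x \<partial>lborel) = energy ((T ^^ j) f) ((T ^^ i) f)"
    using assms by (simp add: mult.commute[of "(T ^^ i) f _"] T_energy bbs_iterate iterate_outside)
  also have "\<dots> = (\<integral>x. (T ^^ Suc i) f x * (T ^^ j) f x \<partial>lborel)"
    using assms by (simp add: energy_commute[of "(T ^^ j) f"] T_energy bbs_iterate iterate_outside)
  also have "\<dots> = moment f (Suc i + j)" by (rule Suc.IH)
  finally show ?case by simp
qed (simp add: moment_def)

lemma moment_even: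
  assumes "bbs f" "\<And>x. x \<notin> W \<Longrightarrow> f x = 0"
  shows "moment f (2 * k) = (\<integral>x. ((T ^^ k) f x)\<^sup>2 \<partial>lborel)"
  using moment_add[OF assms, of k k] by (simp add: power2_eq_square mult_2)

lemma moment_odd:
  assumes "bbs f" "\<And>x. x \<notin> W \<Longrightarrow> f x = 0"
  shows "moment f (2 * k + 1) = energy ((T ^^ k) f) ((T ^^ k) f)"
  using moment_add[OF assms, of "Suc k" k] assms
  by (simp add: mult_2 T_energy bbs_iterate iterate_outside)

lemma energy_Cauchy_Schwarz:
  assumes "bbs f" "bbs g"
  shows "(energy f g)\<^sup>2 \<le> energy f f * energy g g"
  using weighted_Cauchy_Schwarz[OF bbs_avg[OF assms(1) r] bbs_avg[OF assms(2) r] m]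
  by (simp add: energy_def power2_eq_square)

text \<open>Two Cauchy-Schwarz inequalities interlace: in the L^2 product when k is even, in the
  semidefinite form \<open>energy\<close> when k is odd.\<close>

lemma moment_log_convex:
  assumes f: "bbs f" "\<And>x. x \<notin> W \<Longrightarrow> f x = 0"
  shows "(moment f (Suc k))\<^sup>2 \<le> moment f k * moment f (Suc (Suc k))"
proof (cases "even k")
  case True
  then obtain j where j: "k = 2 * j" by blast
  have "(\<integral>x. (T ^^ j) f x * (T ^^ Suc j) f x \<partial>lborel)\<^sup>2 \<le> (\<integral>x. ((T ^^ j) f x)\<^sup>2 \<partial>lborel) * (\<integral>x. ((T ^^ Suc j) f x)\<^sup>2 \<partial>lborel)"
    using weighted_Cauchy_Schwarz[OF bbs_iterate[OF f(1)] bbs_iterate[OF f(1)], of "\<lambda>_. 1" 1 j "Suc j"] by simp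
  then show ?thesis
    using moment_add[OF f, of j "Suc j"] moment_even[OF f, of j] moment_even[OF f, of "Suc j"] by (simp add: j mult_2)
next
  case False
  then obtain j where j: "k = 2 * j + 1" by (elim oddE)
  have "moment f (Suc k) = energy ((T ^^ j) f) ((T ^^ Suc j) f)"
  proof -
    have "moment f (Suc k) = (\<integral>x. (T ^^ Suc j) f x * (T ^^ Suc j) f x \<partial>lborel)"
      using moment_add[OF f, of "Suc j" "Suc j"] by (simp add: j mult_2)
    also have "\<dots> = energy ((T ^^ j) f) ((T ^^ Suc j) f)"
      using f by (simp add: T_energy bbs_iterate bbs_T T_outside)
    finally show ?thesis .
  qed
  then show ?thesis
    using energy_Cauchy_Schwarz[OF bbs_iterate[OF f(1), of j] bbs_iterate[OF f(1), of "Suc j"]]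
      moment_odd[OF f, of j] moment_odd[OF f, of "Suc j"] by (simp add: j)
qed

text \<open>Replaces the spectral theorem. Positivity of \<open>T\<close> carries the bound of
  \<open>g\<close> by \<open>C * f\<close> to all iterates, hence the moments of \<open>g\<close>
  are dominated by those of \<open>f\<close>. The Rayleigh quotient of \<open>g\<close> exceeds q,
  so the moments of \<open>f\<close> must grow by a factor of at least q at some even index, which
  is a Rayleigh quotient of an iterate of \<open>f\<close>.\<close>

lemma power_iteration:
  assumes f: "bbs f" "\<And>x. x \<notin> W \<Longrightarrow> f x = 0"
    and g: "bbs g" "\<And>x. x \<notin> W \<Longrightarrow> g x = 0"
    and fg: "\<And>x. 0 \<le> g x" "\<And>x. g x \<le> C * f x" "0 < C"
    and q: "0 < q" "0 < (\<integral>x. (g x)\<^sup>2 \<partial>lborel)" "q * (\<integral>x. (g x)\<^sup>2 \<partial>lborel) < energy g g"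
  shows "\<exists>N. 0 < (\<integral>x. ((T ^^ N) f x)\<^sup>2 \<partial>lborel) \<and>
    q * (\<integral>x. ((T ^^ N) f x)\<^sup>2 \<partial>lborel) \<le> energy ((T ^^ N) f) ((T ^^ N) f)"
proof -
  have f0: "0 \<le> f x" for x using fg(1,2)[of x] fg(3) by (smt (verit) mult_pos_neg)
  have le: "moment g k \<le> C\<^sup>2 * moment f k" for k
  proof -
    have "moment g k \<le> (\<integral>x. C\<^sup>2 * ((T ^^ k) f x * f x) \<partial>lborel)"
      unfolding moment_def
    proof (rule integral_mono)
      fix x
      have "(T ^^ k) g x * g x \<le> (C * (T ^^ k) f x) * (C * f x)"
        using fg f0 iterate_mono[OF g(1) f(1) fg(2), of k x] iterate_nonneg[of f k x]
        by (intro mult_mono) auto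
      then show "(T ^^ k) g x * g x \<le> C\<^sup>2 * ((T ^^ k) f x * f x)" by (simp add: power2_eq_square mult_ac)
    qed (use f g in \<open>auto intro!: bbs_integrable bbs_cmult bbs_mult bbs_iterate\<close>)
    then show ?thesis by (simp add: moment_def)
  qed
  have b0: "moment g 0 = (\<integral>x. (g x)\<^sup>2 \<partial>lborel)" using moment_even[OF g, of 0] by simp
  have b1: "moment g 1 = energy g g" using moment_odd[OF g, of 0] by simp
  have pb: "0 < moment g 0" "0 < moment g 1"
    using q unfolding b0 b1 by (auto intro: less_trans[OF mult_pos_pos])
  have "0 < C\<^sup>2 * moment f 0" "0 < C\<^sup>2 * moment f 1"
    using le[of 0] le[of 1] pb by linarith+
  then have pa: "0 < moment f 0" "0 < moment f 1" using fg(3) by (auto simp: zero_less_mult_iff)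
  obtain N where N: "q * moment f (2 * N) \<le> moment f (2 * N + 1)"
    using log_convex_sequence_growth[OF pa moment_log_convex[OF f] pb moment_log_convex[OF g] le q(1)] q(3) b0 b1 by auto
  moreover have "0 < moment f (2 * N)" by (rule log_convex_sequence(1)[OF pa moment_log_convex[OF f]])
  ultimately show ?thesis
    using moment_even[OF f, of N] moment_odd[OF f, of N] by auto
qed

lemma log_concave_iterate:
  assumes "bbs f" "log_concave f" "log_concave m" "convex W"
  shows "log_concave ((T ^^ k) f)"
proof (induction k)
  case (Suc k)
  have "log_concave (T ((T ^^ k) f))"
    unfolding T_def[of "(T ^^ k) f", abs_def]
    using assms Suc r by (intro log_concave_mult log_concave_indicator log_concave_avg bbs_m_mult bbs_avg bbs_iterate)
  then show ?case by simp
qed (use assms in simp)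

end

section \<open>Nonlocal energies\<close>

definition shift_energy :: "'a::euclidean_space set \<Rightarrow> ('a \<Rightarrow> real) \<Rightarrow> 'a \<Rightarrow> ennreal" where
  "shift_energy Q f h = (\<integral>\<^sup>+x. ennreal (indicator Q x * indicator Q (x + h) * (f (x + h) - f x)\<^sup>2) \<partial>lborel)"

text \<open>Differences are taken between two displacements from a common centre x because this is
  the shape in which Lagrange's identity yields its defect. Requiring the centre to lie in P as well
  restricts to places where all quantities are controlled.\<close>

definition nonlocal_energy :: "'a::euclidean_space set \<Rightarrow> real \<Rightarrow> ('a \<Rightarrow> real) \<Rightarrow> ennreal" where
  "nonlocal_energy P r f = (\<integral>\<^sup>+x. (\<integral>\<^sup>+z. (\<integral>\<^sup>+z'. ennreal (indicator P x * indicator P (x + r *\<^sub>R z) * indicator P (x + r *\<^sub>R z') *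
     (f (x + r *\<^sub>R z) - f (x + r *\<^sub>R z'))\<^sup>2) \<partial>mol_measure) \<partial>mol_measure) \<partial>lborel)"

lemma nn_integral_avg:
  fixes F :: "'a::euclidean_space \<Rightarrow> ennreal"
  assumes [measurable]: "F \<in> borel_measurable borel"
  shows "(\<integral>\<^sup>+x. (\<integral>\<^sup>+z. F (x + r *\<^sub>R z) \<partial>mol_measure) \<partial>lborel) = (\<integral>\<^sup>+x. F x \<partial>lborel)"
proof -
  interpret pair_sigma_finite "lborel :: 'a measure" "mol_measure :: 'a measure" ..
  have "(\<integral>\<^sup>+x. (\<integral>\<^sup>+z. F (x + r *\<^sub>R z) \<partial>mol_measure) \<partial>lborel) = (\<integral>\<^sup>+z. (\<integral>\<^sup>+x. F (x + r *\<^sub>R z) \<partial>lborel) \<partial>mol_measure)"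
    by (rule Fubini'[symmetric]) measurable
  also have "\<dots> = (\<integral>\<^sup>+z. (\<integral>\<^sup>+x. F x \<partial>lborel) \<partial>(mol_measure :: 'a measure))"
    by (simp add: lborel_nn_integral_translate)
  also have "\<dots> = (\<integral>\<^sup>+x. F x \<partial>lborel)"
    using mol.emeasure_space_1[where 'a = 'a] by simp
  finally show ?thesis .
qed

lemma nn_integral_mol_double:
  fixes G :: "'a::euclidean_space \<Rightarrow> 'a \<Rightarrow> real"
  assumes [measurable]: "case_prod G \<in> borel_measurable (borel \<Otimes>\<^sub>M borel)"
    and G: "\<And>z z'. 0 \<le> G z z'" "\<And>z z'. G z z' \<le> C"
  shows "(\<integral>\<^sup>+z. (\<integral>\<^sup>+z'. ennreal (G z z') \<partial>mol_measure) \<partial>mol_measure) = ennreal (\<integral>z. (\<integral>z'. G z z' \<partial>mol_measure) \<partial>mol_measure)"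
proof -
  have i: "integrable mol_measure (G z)" for z
    by (rule mol_integrable_bounded[where C = C]) (use G in auto)
  have b: "\<bar>\<integral>z'. G z z' \<partial>mol_measure\<bar> \<le> C" for z
  proof -
    have "(\<integral>z'. G z z' \<partial>mol_measure) \<le> (\<integral>z'. C \<partial>(mol_measure :: 'a measure))"
      using i by (intro integral_mono) (auto simp: G)
    moreover have "measure (mol_measure :: 'a measure) UNIV = 1" by (metis mol.prob_space space_mol_measure)
    moreover have "0 \<le> (\<integral>z'. G z z' \<partial>mol_measure)" using G by (intro integral_nonneg_AE) auto
    ultimately show ?thesis by simp
  qed
  have i2: "integrable mol_measure (\<lambda>z. (\<integral>z'. G z z' \<partial>mol_measure))"
    by (rule mol_integrable_bounded[where C = C]) (use b in auto)
  have "(\<integral>\<^sup>+z. (\<integral>\<^sup>+z'. ennreal (G z z') \<partial>mol_measure) \<partial>mol_measure) = (\<integral>\<^sup>+z. ennreal (\<integral>z'. G z z' \<partial>mol_measure) \<partial>mol_measure)"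
    using i G by (simp add: nn_integral_eq_integral)
  also have "\<dots> = ennreal (\<integral>z. (\<integral>z'. G z z' \<partial>mol_measure) \<partial>mol_measure)"
    using i2 G by (intro nn_integral_eq_integral) (auto intro!: integral_nonneg_AE)
  finally show ?thesis .
qed

lemma avg_power2:
  fixes f :: "'a::euclidean_space \<Rightarrow> real"
  assumes "bbs f"
  shows "(avg r f x)\<^sup>2 = avg r (\<lambda>x. (f x)\<^sup>2) x -
    (\<integral>z. (\<integral>z'. (f (x + r *\<^sub>R z) - f (x + r *\<^sub>R z'))\<^sup>2 \<partial>mol_measure) \<partial>mol_measure) / 2"
proof -
  obtain C where C: "f \<in> borel_measurable borel" "\<And>x. \<bar>f x\<bar> \<le> C" using bbsE[OF assms] by metis
  note [measurable] = C(1)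
  have "measure (mol_measure :: 'a measure) UNIV = 1" by (metis mol.prob_space space_mol_measure)
  moreover have "\<bar>f x\<bar> \<le> max 1 C" for x using C(2)[of x] by simp
  ultimately show ?thesis
    using lagrange_identity[OF mol.prob_space_axioms, of "\<lambda>_. 1" "\<lambda>z. f (x + r *\<^sub>R z)" "max 1 C"]
    by (simp add: avg_def)
qed

text \<open>The inner double integral at x is twice the variance of f under the average there, and
  averaging preserves the integral of f^2.\<close>

lemma nonlocal_energy_UNIV:
  fixes f :: "'a::euclidean_space \<Rightarrow> real"
  assumes f: "bbs f" and r: "0 < r"
  shows "nonlocal_energy UNIV r f = ennreal (2 * ((\<integral>x. (f x)\<^sup>2 \<partial>lborel) - (\<integral>x. (avg r f x)\<^sup>2 \<partial>lborel)))"
    and "(\<integral>x. (avg r f x)\<^sup>2 \<partial>lborel) \<le> (\<integral>x. (f x)\<^sup>2 \<partial>lborel)"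
proof -
  obtain C where C: "f \<in> borel_measurable borel" "\<And>x. \<bar>f x\<bar> \<le> C" using bbsE[OF assms(1)] by metis
  note [measurable] = C(1)
  have f2: "(f x - f y)\<^sup>2 \<le> (2 * C)\<^sup>2" for x y
  proof -
    have "\<bar>f x - f y\<bar> \<le> \<bar>2 * C\<bar>" using C(2)[of x] C(2)[of y] by linarith
    then show ?thesis by (simp add: abs_le_square_iff)
  qed
  have eq: "(\<integral>z. (\<integral>z'. (f (x + r *\<^sub>R z) - f (x + r *\<^sub>R z'))\<^sup>2 \<partial>mol_measure) \<partial>mol_measure) = 2 * (avg r (\<lambda>x. (f x)\<^sup>2) x - (avg r f x)\<^sup>2)" for x
    unfolding avg_power2[OF f] by simp
  have nn: "0 \<le> avg r (\<lambda>x. (f x)\<^sup>2) x - (avg r f x)\<^sup>2" for x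
  proof -
    have "0 \<le> (\<integral>z. (\<integral>z'. (f (x + r *\<^sub>R z) - f (x + r *\<^sub>R z'))\<^sup>2 \<partial>mol_measure) \<partial>mol_measure)"
      by (intro integral_nonneg_AE AE_I2) auto
    then show ?thesis unfolding eq by simp
  qed
  have i: "integrable lborel (avg r (\<lambda>x. (f x)\<^sup>2))" "integrable lborel (\<lambda>x. (avg r f x)\<^sup>2)"
    using f r by (auto intro!: bbs_integrable bbs_avg bbs_power2)
  have "(\<integral>\<^sup>+x. ennreal (avg r (\<lambda>x. (f x)\<^sup>2) x) \<partial>lborel) = (\<integral>\<^sup>+x. (\<integral>\<^sup>+z. ennreal ((f (x + r *\<^sub>R z))\<^sup>2) \<partial>mol_measure) \<partial>lborel)"
    unfolding avg_def using bbs_mol_integrable[OF bbs_power2[OF f], of _ r]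
    by (simp add: nn_integral_eq_integral)
  also have "\<dots> = (\<integral>\<^sup>+x. ennreal ((f x)\<^sup>2) \<partial>lborel)"
    by (rule nn_integral_avg) measurable
  finally have "ennreal (\<integral>x. avg r (\<lambda>x. (f x)\<^sup>2) x \<partial>lborel) = ennreal (\<integral>x. (f x)\<^sup>2 \<partial>lborel)"
    using i bbs_integrable[OF bbs_power2[OF f]] by (simp add: nn_integral_eq_integral avg_nonneg)
  then have A: "(\<integral>x. avg r (\<lambda>x. (f x)\<^sup>2) x \<partial>lborel) = (\<integral>x. (f x)\<^sup>2 \<partial>lborel)"
    by (subst (asm) ennreal_inj) (auto intro!: integral_nonneg_AE avg_nonneg)
  have "nonlocal_energy UNIV r f = (\<integral>\<^sup>+x. ennreal (2 * (avg r (\<lambda>x. (f x)\<^sup>2) x - (avg r f x)\<^sup>2)) \<partial>lborel)"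
    unfolding nonlocal_energy_def eq[symmetric]
    by (intro nn_integral_cong) (simp, rule nn_integral_mol_double[where C = "(2 * C)\<^sup>2"], use f2 in auto)
  also have "\<dots> = ennreal (\<integral>x. 2 * (avg r (\<lambda>x. (f x)\<^sup>2) x - (avg r f x)\<^sup>2) \<partial>lborel)"
    using i nn by (intro nn_integral_eq_integral) auto
  also have "(\<integral>x. 2 * (avg r (\<lambda>x. (f x)\<^sup>2) x - (avg r f x)\<^sup>2) \<partial>lborel) = 2 * ((\<integral>x. (f x)\<^sup>2 \<partial>lborel) - (\<integral>x. (avg r f x)\<^sup>2 \<partial>lborel))"
    using i A by simp
  finally show "nonlocal_energy UNIV r f = ennreal (2 * ((\<integral>x. (f x)\<^sup>2 \<partial>lborel) - (\<integral>x. (avg r f x)\<^sup>2 \<partial>lborel)))" .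
  show "(\<integral>x. (avg r f x)\<^sup>2 \<partial>lborel) \<le> (\<integral>x. (f x)\<^sup>2 \<partial>lborel)"
    unfolding A[symmetric] using i nn by (intro integral_mono) (auto simp: algebra_simps)
qed

text \<open>The slice with both displacements fixed. Translating by r z turns it into an energy of
  the single shift r (z' - z), the bridge to \<open>shift_energy\<close>.\<close>

definition section_energy :: "'a::euclidean_space set \<Rightarrow> real \<Rightarrow> ('a \<Rightarrow> real) \<Rightarrow> 'a \<Rightarrow> 'a \<Rightarrow> ennreal" where
  "section_energy P r f z z' = (\<integral>\<^sup>+x. ennreal (indicator P x * indicator P (x + r *\<^sub>R z) * indicator P (x + r *\<^sub>R z') *
     (f (x + r *\<^sub>R z) - f (x + r *\<^sub>R z'))\<^sup>2) \<partial>lborel)"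

lemma section_energy_measurable [measurable]:
  assumes [measurable]: "P \<in> sets borel" "f \<in> borel_measurable borel"
  shows "case_prod (section_energy P r f) \<in> borel_measurable (borel \<Otimes>\<^sub>M borel)"
  unfolding section_energy_def by measurable

lemma nonlocal_energy_Tonelli:
  fixes f :: "'a::euclidean_space \<Rightarrow> real"
  assumes [measurable]: "P \<in> sets borel" "f \<in> borel_measurable borel"
  shows "nonlocal_energy P r f = (\<integral>\<^sup>+z. (\<integral>\<^sup>+z'. section_energy P r f z z' \<partial>mol_measure) \<partial>mol_measure)"
proof -
  interpret pair_sigma_finite "lborel :: 'a measure" "mol_measure :: 'a measure" ..
  let ?G = "\<lambda>x z z'. ennreal (indicator P x * indicator P (x + r *\<^sub>R z) * indicator P (x + r *\<^sub>R z') *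
     (f (x + r *\<^sub>R z) - f (x + r *\<^sub>R z'))\<^sup>2)"
  have "nonlocal_energy P r f = (\<integral>\<^sup>+z. (\<integral>\<^sup>+x. (\<integral>\<^sup>+z'. ?G x z z' \<partial>mol_measure) \<partial>lborel) \<partial>mol_measure)"
    unfolding nonlocal_energy_def by (rule Fubini'[symmetric]) measurable
  also have "\<dots> = (\<integral>\<^sup>+z. (\<integral>\<^sup>+z'. (\<integral>\<^sup>+x. ?G x z z' \<partial>lborel) \<partial>mol_measure) \<partial>mol_measure)"
    by (intro nn_integral_cong Fubini'[symmetric]) measurable
  finally show ?thesis by (simp add: section_energy_def)
qed

lemma section_energy_UNIV:
  fixes f :: "'a::euclidean_space \<Rightarrow> real"
  assumes [measurable]: "f \<in> borel_measurable borel"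
  shows "section_energy UNIV r f z z' = shift_energy UNIV f (r *\<^sub>R (z' - z))"
proof -
  have "section_energy UNIV r f z z' = (\<integral>\<^sup>+x. ennreal ((f x - f (x + r *\<^sub>R (z' - z)))\<^sup>2) \<partial>lborel)"
    unfolding section_energy_def
    using lborel_nn_integral_translate[of "\<lambda>x. ennreal ((f x - f (x + r *\<^sub>R (z' - z)))\<^sup>2)" "r *\<^sub>R z"]
    by (simp add: algebra_simps)
  then show ?thesis by (simp add: shift_energy_def power2_commute)
qed

section \<open>From nonlocal energies to energies of short and long shifts\<close>

lemma square_le_two_squares: "(a - b)\<^sup>2 \<le> 2 * (a - c)\<^sup>2 + 2 * (c - (b::real))\<^sup>2"
proof -
  have "2 * (a - c)\<^sup>2 + 2 * (c - b)\<^sup>2 - (a - b)\<^sup>2 = (a - 2 * c + b)\<^sup>2"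
    by (simp add: power2_eq_square algebra_simps)
  then show ?thesis by (smt (verit) zero_le_power2)
qed

lemma mol_lower_bound:
  fixes F :: "'a::euclidean_space \<Rightarrow> ennreal"
  assumes [measurable]: "F \<in> borel_measurable borel" and k: "0 < k" "\<And>y::'a. norm y \<le> 1 / 2 \<Longrightarrow> k \<le> mollifier y"
  shows "ennreal k * (\<integral>\<^sup>+z. indicator (cball 0 (1/2)) z * F z \<partial>lborel) \<le> (\<integral>\<^sup>+z. F z \<partial>mol_measure)"
proof -
  have [measurable]: "cball (0::'a) (1/2) \<in> sets borel" by simp
  have "ennreal k * (\<integral>\<^sup>+z. indicator (cball 0 (1/2)) z * F z \<partial>lborel) = (\<integral>\<^sup>+z. ennreal k * (indicator (cball 0 (1/2)) z * F z) \<partial>lborel)"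
    by (rule nn_integral_cmult[symmetric]) measurable
  also have "\<dots> \<le> (\<integral>\<^sup>+z. ennreal (mollifier z) * F z \<partial>lborel)"
    using k by (intro nn_integral_mono) (auto simp: indicator_def intro!: mult_right_mono ennreal_leI)
  also have "\<dots> = (\<integral>\<^sup>+z. F z \<partial>mol_measure)"
    unfolding mol_measure_def by (rule nn_integral_density[symmetric]) measurable
  finally show ?thesis .
qed

text \<open>Take x - r z as centre: then x has displacement z, x + h has displacement z + h / r, and
  a third point with displacement z' mediates between them. Averaging over z, z' in the ball of
  radius 1/4 keeps all displacements within 1/2, where the density is at least k.\<close>

lemma small_shift:
  fixes f :: "'a::euclidean_space \<Rightarrow> real"
  assumes [measurable]: "P \<in> sets borel" "Q \<in> sets borel" "f \<in> borel_measurable borel"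
    and r: "0 < r" and h: "norm h \<le> r / 4" and Q: "\<And>x y. x \<in> Q \<Longrightarrow> dist x y \<le> r \<Longrightarrow> y \<in> P"
    and k: "0 < k" "\<And>y::'a. norm y \<le> 1 / 2 \<Longrightarrow> k \<le> mollifier y"
  shows "ennreal ((k * measure lborel (ball (0::'a) (1/4)))\<^sup>2) * shift_energy Q f h \<le> 4 * nonlocal_energy P r f"
proof -
  let ?B = "ball (0::'a) (1/4)" and ?H = "cball (0::'a) (1/2)"
  define b where "b = measure lborel ?B"
  have b: "emeasure lborel ?B = ennreal b" "0 \<le> b"
    using emeasure_lborel_ball_finite[of "0::'a" "1/4"]
    by (auto simp: b_def intro!: emeasure_eq_ennreal_measure)
  have [measurable]: "?B \<in> sets borel" "?H \<in> sets borel" by auto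
  let ?S = "section_energy P r f"
  let ?I = "\<integral>\<^sup>+z. (\<integral>\<^sup>+z'. indicator ?H z * (indicator ?H z' * ?S z z') \<partial>lborel) \<partial>lborel"
  have [measurable]: "shift_energy Q f \<in> borel_measurable borel"
    unfolding shift_energy_def[abs_def] by measurable
  have sm [measurable]: "?S z \<in> borel_measurable borel" for z
    using measurable_compose[OF measurable_Pair1' section_energy_measurable[OF assms(1,3), of r], of z] by simp
  have hr: "r *\<^sub>R ((1 / r) *\<^sub>R h) = h" using r by simp
  have point: "shift_energy Q f h \<le> 2 * ?S (z + (1 / r) *\<^sub>R h) z' + 2 * ?S z z'"
    if z: "z \<in> ?B" "z' \<in> ?B" for z z'
  proof -
    have nz: "norm (r *\<^sub>R z) \<le> r / 4" "norm (r *\<^sub>R z') \<le> r / 4" using z r by (auto simp: field_simps)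
    have "shift_energy Q f h \<le>
      (\<integral>\<^sup>+x. ennreal (indicator Q x * indicator Q (x + h) * (2 * (f (x + h) - f (x - r *\<^sub>R z + r *\<^sub>R z'))\<^sup>2 + 2 * (f (x - r *\<^sub>R z + r *\<^sub>R z') - f x)\<^sup>2)) \<partial>lborel)"
      unfolding shift_energy_def
      by (intro nn_integral_mono ennreal_leI mult_left_mono square_le_two_squares) auto
    also have "\<dots> \<le> (\<integral>\<^sup>+x. 2 * ennreal (indicator P (x - r *\<^sub>R z) * indicator P (x - r *\<^sub>R z + r *\<^sub>R (z + (1 / r) *\<^sub>R h)) * indicator P (x - r *\<^sub>R z + r *\<^sub>R z') *
        (f (x - r *\<^sub>R z + r *\<^sub>R (z + (1 / r) *\<^sub>R h)) - f (x - r *\<^sub>R z + r *\<^sub>R z'))\<^sup>2)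
      + 2 * ennreal (indicator P (x - r *\<^sub>R z) * indicator P (x - r *\<^sub>R z + r *\<^sub>R z) * indicator P (x - r *\<^sub>R z + r *\<^sub>R z') *
        (f (x - r *\<^sub>R z + r *\<^sub>R z) - f (x - r *\<^sub>R z + r *\<^sub>R z'))\<^sup>2) \<partial>lborel)"
    proof (intro nn_integral_mono)
      fix x
      show "ennreal (indicator Q x * indicator Q (x + h) * (2 * (f (x + h) - f (x - r *\<^sub>R z + r *\<^sub>R z'))\<^sup>2 + 2 * (f (x - r *\<^sub>R z + r *\<^sub>R z') - f x)\<^sup>2))
       \<le> 2 * ennreal (indicator P (x - r *\<^sub>R z) * indicator P (x - r *\<^sub>R z + r *\<^sub>R (z + (1 / r) *\<^sub>R h)) * indicator P (x - r *\<^sub>R z + r *\<^sub>R z') *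
        (f (x - r *\<^sub>R z + r *\<^sub>R (z + (1 / r) *\<^sub>R h)) - f (x - r *\<^sub>R z + r *\<^sub>R z'))\<^sup>2)
      + 2 * ennreal (indicator P (x - r *\<^sub>R z) * indicator P (x - r *\<^sub>R z + r *\<^sub>R z) * indicator P (x - r *\<^sub>R z + r *\<^sub>R z') *
        (f (x - r *\<^sub>R z + r *\<^sub>R z) - f (x - r *\<^sub>R z + r *\<^sub>R z'))\<^sup>2)"
      proof (cases "x \<in> Q \<and> x + h \<in> Q")
        case True
        have "dist x (x - r *\<^sub>R z) \<le> r" using nz r by (simp add: dist_norm)
        moreover have "dist x (x - r *\<^sub>R z + r *\<^sub>R z') \<le> r"
        proof -
          have "dist x (x - r *\<^sub>R z + r *\<^sub>R z') = norm (r *\<^sub>R z - r *\<^sub>R z')" by (simp add: dist_norm)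
          then show ?thesis using nz r norm_triangle_ineq4[of "r *\<^sub>R z" "r *\<^sub>R z'"] by linarith
        qed
        moreover have "x \<in> P" "x + h \<in> P" using True Q[of x x] Q[of "x + h" "x + h"] r by auto
        ultimately have in_P: "x - r *\<^sub>R z \<in> P" "x - r *\<^sub>R z + r *\<^sub>R z' \<in> P" "x \<in> P" "x + h \<in> P" using True Q by blast+
        have e: "x - r *\<^sub>R z + r *\<^sub>R (z + (1 / r) *\<^sub>R h) = x + h" "x - r *\<^sub>R z + r *\<^sub>R z = x"
          using hr by (simp_all add: scaleR_add_right)
        have "ennreal (2 * a + 2 * c) = 2 * ennreal a + 2 * ennreal c" if "0 \<le> a" "0 \<le> c" for a c :: real
          using that by (simp add: ennreal_mult)
        then show ?thesis unfolding e using in_P True by (simp add: power2_commute[of "f x"])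
      qed auto
    qed
    also have "\<dots> = (\<integral>\<^sup>+x. 2 * ennreal (indicator P x * indicator P (x + r *\<^sub>R (z + (1 / r) *\<^sub>R h)) * indicator P (x + r *\<^sub>R z') *
        (f (x + r *\<^sub>R (z + (1 / r) *\<^sub>R h)) - f (x + r *\<^sub>R z'))\<^sup>2)
      + 2 * ennreal (indicator P x * indicator P (x + r *\<^sub>R z) * indicator P (x + r *\<^sub>R z') *
        (f (x + r *\<^sub>R z) - f (x + r *\<^sub>R z'))\<^sup>2) \<partial>lborel)"
      by (subst lborel_nn_integral_translate[of _ "- (r *\<^sub>R z)", simplified, symmetric]) (auto intro!: nn_integral_cong)
    also have "\<dots> = 2 * ?S (z + (1 / r) *\<^sub>R h) z' + 2 * ?S z z'"
      unfolding section_energy_def by (subst nn_integral_add) (auto simp: nn_integral_cmult)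
    finally show ?thesis .
  qed
  have I1: "(\<integral>\<^sup>+z. (\<integral>\<^sup>+z'. indicator ?B z * (indicator ?B z' * ?S z z') \<partial>lborel) \<partial>lborel) \<le> ?I"
    by (intro nn_integral_mono mult_mono) (auto simp: indicator_def)
  \<comment> \<open>Since |h| / r \<le> 1/4, moving z by h / r sends the quarter ball into the half
    ball; translation invariance then returns \<open>?I\<close>.\<close>
  have I2: "(\<integral>\<^sup>+z. (\<integral>\<^sup>+z'. indicator ?B z * (indicator ?B z' * ?S (z + (1 / r) *\<^sub>R h) z') \<partial>lborel) \<partial>lborel) \<le> ?I"
  proof -
    have "(\<integral>\<^sup>+z. (\<integral>\<^sup>+z'. indicator ?B z * (indicator ?B z' * ?S (z + (1 / r) *\<^sub>R h) z') \<partial>lborel) \<partial>lborel)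
      \<le> (\<integral>\<^sup>+z. (\<integral>\<^sup>+z'. indicator ?H (z + (1 / r) *\<^sub>R h) * (indicator ?H z' * ?S (z + (1 / r) *\<^sub>R h) z') \<partial>lborel) \<partial>lborel)"
    proof (intro nn_integral_mono mult_mono)
      fix z z' :: 'a
      have "z + (1 / r) *\<^sub>R h \<in> ?H" if "z \<in> ?B"
      proof -
        have "norm ((1 / r) *\<^sub>R h) \<le> 1 / 4" using h r by (simp add: field_simps)
        moreover have "norm z < 1 / 4" using that by simp
        ultimately have "norm (z + (1 / r) *\<^sub>R h) \<le> 1 / 2"
          using norm_triangle_ineq[of z "(1 / r) *\<^sub>R h"] by linarith
        then show ?thesis by (simp only: mem_cball_0)
      qed
      then show "(indicator ?B z :: ennreal) \<le> indicator ?H (z + (1 / r) *\<^sub>R h)" by (auto simp: indicator_def)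
      show "(indicator ?B z' :: ennreal) \<le> indicator ?H z'" by (auto simp: indicator_def)
    qed auto
    also have "\<dots> = ?I"
      by (rule lborel_nn_integral_translate[of "\<lambda>z. \<integral>\<^sup>+z'. indicator ?H z * (indicator ?H z' * ?S z z') \<partial>lborel"]) measurable
    finally show ?thesis .
  qed
  have "ennreal (b\<^sup>2) * shift_energy Q f h = (\<integral>\<^sup>+z. (\<integral>\<^sup>+z'. indicator ?B z * (indicator ?B z' * shift_energy Q f h) \<partial>lborel) \<partial>lborel)"
    using b by (simp add: nn_integral_cmult nn_integral_multc power2_eq_square ennreal_mult mult.assoc)
  also have "\<dots> \<le> (\<integral>\<^sup>+z. (\<integral>\<^sup>+z'. 2 * (indicator ?B z * (indicator ?B z' * ?S (z + (1 / r) *\<^sub>R h) z')) + 2 * (indicator ?B z * (indicator ?B z' * ?S z z')) \<partial>lborel) \<partial>lborel)"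
    by (intro nn_integral_mono) (use point in \<open>auto simp: indicator_def\<close>)
  also have "\<dots> = 2 * (\<integral>\<^sup>+z. (\<integral>\<^sup>+z'. indicator ?B z * (indicator ?B z' * ?S (z + (1 / r) *\<^sub>R h) z') \<partial>lborel) \<partial>lborel) +
      2 * (\<integral>\<^sup>+z. (\<integral>\<^sup>+z'. indicator ?B z * (indicator ?B z' * ?S z z') \<partial>lborel) \<partial>lborel)"
    by (simp add: nn_integral_add nn_integral_cmult)
  also have "\<dots> \<le> 2 * ?I + 2 * ?I"
    using I1 I2 by (intro add_mono mult_left_mono) auto
  also have "\<dots> = 4 * ?I" by (simp add: distrib_right[symmetric])
  finally have main: "ennreal (b\<^sup>2) * shift_energy Q f h \<le> 4 * ?I" .
  have "ennreal (k\<^sup>2) * ?I = ennreal k * (\<integral>\<^sup>+z. indicator ?H z * (ennreal k * (\<integral>\<^sup>+z'. indicator ?H z' * ?S z z' \<partial>lborel)) \<partial>lborel)"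
  proof -
    have "?I = (\<integral>\<^sup>+z. indicator ?H z * (\<integral>\<^sup>+z'. indicator ?H z' * ?S z z' \<partial>lborel) \<partial>lborel)"
      by (intro nn_integral_cong nn_integral_cmult) measurable
    moreover have "ennreal k * (\<integral>\<^sup>+z. indicator ?H z * (\<integral>\<^sup>+z'. indicator ?H z' * ?S z z' \<partial>lborel) \<partial>lborel) =
        (\<integral>\<^sup>+z. ennreal k * (indicator ?H z * (\<integral>\<^sup>+z'. indicator ?H z' * ?S z z' \<partial>lborel)) \<partial>lborel)"
      by (rule nn_integral_cmult[symmetric]) measurable
    ultimately show ?thesis
      using k by (simp add: power2_eq_square ennreal_mult mult.assoc mult.left_commute[of "ennreal k"])
  qed
  also have "\<dots> \<le> ennreal k * (\<integral>\<^sup>+z. indicator ?H z * (\<integral>\<^sup>+z'. ?S z z' \<partial>mol_measure) \<partial>lborel)"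
    using k by (intro mult_left_mono nn_integral_mono mol_lower_bound) auto
  also have "\<dots> \<le> (\<integral>\<^sup>+z. (\<integral>\<^sup>+z'. ?S z z' \<partial>mol_measure) \<partial>mol_measure)"
    using k by (intro mol_lower_bound) auto
  also have "\<dots> = nonlocal_energy P r f" by (simp add: nonlocal_energy_Tonelli)
  finally have "ennreal (k\<^sup>2) * ?I \<le> nonlocal_energy P r f" .
  then have "4 * (ennreal (k\<^sup>2) * ?I) \<le> 4 * nonlocal_energy P r f" by (rule mult_left_mono) auto
  moreover have "ennreal (k\<^sup>2) * (ennreal (b\<^sup>2) * shift_energy Q f h) \<le> ennreal (k\<^sup>2) * (4 * ?I)"
    using main by (rule mult_left_mono) auto
  ultimately show ?thesis
    unfolding b_def[symmetric] using k b by (simp add: power_mult_distrib ennreal_mult mult_ac)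
qed

text \<open>Convexity keeps the intermediate points x + i h in Q. Cauchy-Schwarz on the telescoping
  sum costs one factor N, and the N translated terms of equal integral cost another.\<close>

lemma long_shift:
  fixes f :: "'a::euclidean_space \<Rightarrow> real"
  assumes [measurable]: "Q \<in> sets borel" "f \<in> borel_measurable borel" and Q: "convex Q"
  shows "shift_energy Q f (real N *\<^sub>R h) \<le> ennreal ((real N)\<^sup>2) * shift_energy Q f h"
proof -
  let ?F = "\<lambda>x. ennreal (indicator Q x * indicator Q (x + h) * (f (x + h) - f x)\<^sup>2)"
  have "shift_energy Q f (real N *\<^sub>R h) \<le> (\<integral>\<^sup>+x. ennreal (real N) * (\<Sum>i<N. ?F (x + real i *\<^sub>R h)) \<partial>lborel)"
    unfolding shift_energy_def
  proof (intro nn_integral_mono)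
    fix x
    show "ennreal (indicator Q x * indicator Q (x + real N *\<^sub>R h) * (f (x + real N *\<^sub>R h) - f x)\<^sup>2)
      \<le> ennreal (real N) * (\<Sum>i<N. ?F (x + real i *\<^sub>R h))"
    proof (cases "x \<in> Q \<and> x + real N *\<^sub>R h \<in> Q")
      case True
      have in_Q: "x + real i *\<^sub>R h \<in> Q" if "i \<le> N" for i
      proof (cases "N = 0")
        case False
        have "(1 - real i / real N) *\<^sub>R x + (real i / real N) *\<^sub>R (x + real N *\<^sub>R h) \<in> Q"
          using Q True that False by (intro convexD_alt) auto
        also have "(1 - real i / real N) *\<^sub>R x + (real i / real N) *\<^sub>R (x + real N *\<^sub>R h) = x + real i *\<^sub>R h"
          using False by (simp add: algebra_simps)
        finally show ?thesis .
      qed (use True that in simp)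
      have in_Q': "x + real i *\<^sub>R h + h \<in> Q" if "i < N" for i
        using in_Q[of "Suc i"] that by (simp add: algebra_simps)
      have "f (x + real N *\<^sub>R h) - f x = (\<Sum>i<N. f (x + real (Suc i) *\<^sub>R h) - f (x + real i *\<^sub>R h))"
        by (subst sum_lessThan_telescope) simp
      also have "\<dots> = (\<Sum>i<N. f (x + real i *\<^sub>R h + h) - f (x + real i *\<^sub>R h))"
        by (simp add: algebra_simps)
      finally have "(f (x + real N *\<^sub>R h) - f x)\<^sup>2 \<le> (\<Sum>i<N. (f (x + real i *\<^sub>R h + h) - f (x + real i *\<^sub>R h))\<^sup>2) * real N"
        using sum_squared_le_sum_of_squares[of "\<lambda>i. f (x + real i *\<^sub>R h + h) - f (x + real i *\<^sub>R h)" "{..<N}"] by simp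
      then have "ennreal ((f (x + real N *\<^sub>R h) - f x)\<^sup>2) \<le> ennreal (real N * (\<Sum>i<N. (f (x + real i *\<^sub>R h + h) - f (x + real i *\<^sub>R h))\<^sup>2))"
        by (intro ennreal_leI) (simp add: mult.commute)
      also have "\<dots> = ennreal (real N) * (\<Sum>i<N. ennreal ((f (x + real i *\<^sub>R h + h) - f (x + real i *\<^sub>R h))\<^sup>2))"
        by (simp add: ennreal_mult sum_nonneg)
      also have "\<dots> = ennreal (real N) * (\<Sum>i<N. ?F (x + real i *\<^sub>R h))"
        using in_Q in_Q' by (intro arg_cong2[where f = "(*)"] sum.cong) auto
      finally show ?thesis using True by simp
    qed auto
  qed
  also have "\<dots> = ennreal (real N) * (\<Sum>i<N. (\<integral>\<^sup>+x. ?F (x + real i *\<^sub>R h) \<partial>lborel))"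
    by (subst nn_integral_cmult, measurable) (subst nn_integral_sum, measurable)
  also have "(\<Sum>i<N. (\<integral>\<^sup>+x. ?F (x + real i *\<^sub>R h) \<partial>lborel)) = (\<Sum>i<N. shift_energy Q f h)"
    unfolding shift_energy_def by (intro sum.cong lborel_nn_integral_translate) auto
  also have "ennreal (real N) * (\<Sum>i<N. shift_energy Q f h) = ennreal ((real N)\<^sup>2) * shift_energy Q f h"
    by (simp add: power2_eq_square ennreal_mult mult.assoc ennreal_of_nat_eq_real_of_nat[symmetric])
  finally show ?thesis .
qed

text \<open>About 4 |h| / r steps of length at most r / 4 lead along h. Their number squared cancels
  the r^2 in the energy bound, so the result does not deteriorate as r tends to 0. The constant
  depends only on the dimension.\<close>

lemma chain_inequality:
  "\<exists>K>0. \<forall>(P :: 'a::euclidean_space set) Q f r \<eta> h. P \<in> sets borel \<longrightarrow> Q \<in> sets borel \<longrightarrow> convex Q \<longrightarrow>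
     f \<in> borel_measurable borel \<longrightarrow> 0 < r \<longrightarrow> 0 \<le> \<eta> \<longrightarrow> (\<forall>x\<in>Q. \<forall>y. dist x y \<le> r \<longrightarrow> y \<in> P) \<longrightarrow>
     nonlocal_energy P r f \<le> ennreal (\<eta> * r\<^sup>2) \<longrightarrow> shift_energy Q f h \<le> ennreal (K * \<eta> * (norm h + r)\<^sup>2)"
proof -
  obtain k where k: "0 < k" "\<And>y::'a. norm y \<le> 1 / 2 \<Longrightarrow> k \<le> mollifier y"
    using mollifier_lower_bound[where 'a='a] by auto
  define c where "c = (k * measure lborel (ball (0::'a) (1/4)))\<^sup>2"
  have c: "0 < c" using k content_ball_pos[of "1/4" "0::'a"] by (simp add: c_def)
  show ?thesis
  \<comment> \<open>64 = 4 * 4^2: the factor of \<open>small_shift\<close>, and the square of the 4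
    in N r \<le> 4 (|h| + r).\<close>
  proof (intro exI[of _ "64 / c"] conjI allI impI)
    fix P Q :: "'a set" and f :: "'a \<Rightarrow> real" and r \<eta> :: real and h :: 'a
    assume *: "P \<in> sets borel" "Q \<in> sets borel" "convex Q" "f \<in> borel_measurable borel" "0 < r" "0 \<le> \<eta>"
      "\<forall>x\<in>Q. \<forall>y. dist x y \<le> r \<longrightarrow> y \<in> P" "nonlocal_energy P r f \<le> ennreal (\<eta> * r\<^sup>2)"
    \<comment> \<open>The added 1 keeps N positive when h = 0.\<close>
    define N where "N = nat \<lceil>4 * norm h / r\<rceil> + 1"
    have N: "4 * norm h / r \<le> real N" "real N \<le> 4 * norm h / r + 2" "0 < N"
    proof -
      have "0 \<le> 4 * norm h / r" using *(5) by simp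
      then have "real N = real_of_int \<lceil>4 * norm h / r\<rceil> + 1" by (simp add: N_def)
      then show "4 * norm h / r \<le> real N" "real N \<le> 4 * norm h / r + 2"
        using of_int_ceiling_le_add_one[of "4 * norm h / r"] le_of_int_ceiling[of "4 * norm h / r"] by linarith+
    qed (simp add: N_def)
    define h' where "h' = (1 / real N) *\<^sub>R h"
    have hN: "h = real N *\<^sub>R h'" using N by (simp add: h'_def)
    have "norm h' \<le> r / 4" using N *(5) by (simp add: h'_def field_simps)
    then have "ennreal c * shift_energy Q f h' \<le> 4 * nonlocal_energy P r f"
      unfolding c_def using * by (intro small_shift k) auto
    also have "\<dots> \<le> 4 * ennreal (\<eta> * r\<^sup>2)" using *(8) by (rule mult_left_mono) auto
    finally have "ennreal (1 / c) * (ennreal c * shift_energy Q f h') \<le> ennreal (1 / c) * (4 * ennreal (\<eta> * r\<^sup>2))"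
      by (rule mult_left_mono) auto
    moreover have "ennreal (1 / c) * (ennreal c * shift_energy Q f h') = shift_energy Q f h'"
      using c by (simp add: mult.assoc[symmetric] ennreal_mult[symmetric])
    moreover have "ennreal (1 / c) * (4 * ennreal (\<eta> * r\<^sup>2)) = ennreal (4 / c * (\<eta> * r\<^sup>2))"
    proof -
      have "4 * ennreal (\<eta> * r\<^sup>2) = ennreal (4 * (\<eta> * r\<^sup>2))" using *(6) by (simp add: ennreal_mult)
      then show ?thesis using c *(6) by (simp add: ennreal_mult[symmetric])
    qed
    ultimately have s: "shift_energy Q f h' \<le> ennreal (4 / c * (\<eta> * r\<^sup>2))" by simp
    have "shift_energy Q f h \<le> ennreal ((real N)\<^sup>2) * shift_energy Q f h'"
      unfolding hN using * by (intro long_shift) auto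
    also have "\<dots> \<le> ennreal ((real N)\<^sup>2) * ennreal (4 / c * (\<eta> * r\<^sup>2))"
      using s by (rule mult_left_mono) auto
    also have "\<dots> = ennreal (4 / c * \<eta> * (real N * r)\<^sup>2)"
      using c *(6) by (simp add: ennreal_mult[symmetric] power_mult_distrib mult_ac)
    also have "\<dots> \<le> ennreal (4 / c * \<eta> * (4 * (norm h + r))\<^sup>2)"
    proof (intro ennreal_leI mult_left_mono power_mono)
      have "real N * r \<le> (4 * norm h / r + 2) * r" using N *(5) by (intro mult_right_mono) auto
      also have "\<dots> = 4 * norm h + 2 * r" using *(5) by (simp add: field_simps)
      also have "\<dots> \<le> 4 * (norm h + r)" using *(5) by simp
      finally show "real N * r \<le> 4 * (norm h + r)" .
    qed (use c * in auto)
    also have "4 / c * \<eta> * (4 * (norm h + r))\<^sup>2 = 64 / c * \<eta> * (norm h + r)\<^sup>2"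
      unfolding power_mult_distrib by simp
    finally show "shift_energy Q f h \<le> ennreal (64 / c * \<eta> * (norm h + r)\<^sup>2)" .
  qed (use c in simp)
qed

section \<open>Uniqueness of weak gradients\<close>

lemma C_k_prod: "finite I \<Longrightarrow> (\<And>i. i \<in> I \<Longrightarrow> C_k k (f i)) \<Longrightarrow> C_k k (\<lambda>x. \<Prod>i\<in>I. f i x)"
  by (induction I rule: finite_induct) (auto simp: C_k_const intro!: C_k_mult)

text \<open>\<open>bump_profile 0 (1 - s)\<close> is exp(- 2 / s) for positive s and 0 otherwise, so
  every face of the box contributes a smooth one-sided cutoff. For large m the product tends to the
  indicator of the open box.\<close>

definition box_cutoff :: "real \<Rightarrow> 'a::euclidean_space \<Rightarrow> 'a \<Rightarrow> 'a \<Rightarrow> real" where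
  "box_cutoff m a b x = (\<Prod>i\<in>Basis. bump_profile 0 (1 - m * ((x - a) \<bullet> i)) * bump_profile 0 (1 - m * ((b - x) \<bullet> i)))"

lemma bump_profile_0: "bump_profile 0 (1 - s) = (if 0 < s then exp (- 2 / s) else 0)"
  by (simp add: bump_profile_def)

lemma C_k_box_cutoff: "C_k k (box_cutoff m a b)"
  unfolding box_cutoff_def[abs_def]
proof (intro C_k_prod C_k_mult finite_Basis)
  fix i :: 'a assume "i \<in> Basis"
  have lin: "C_k k (\<lambda>x. c + d * (x \<bullet> i))" for c d k
    by (intro C_k_add C_k_mult C_k_const C_k_linear bounded_linear_inner_left)
  have 1: "C_k k (\<lambda>x. 1 - m * ((x - a) \<bullet> i))" for k
    using lin[of k "1 + m * (a \<bullet> i)" "- m"] by (simp add: algebra_simps inner_diff_left)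
  have 2: "C_k k (\<lambda>x. 1 - m * ((b - x) \<bullet> i))" for k
    using lin[of k "1 - m * (b \<bullet> i)" "m"] by (simp add: algebra_simps inner_diff_left)
  show "C_k k (\<lambda>x. bump_profile 0 (1 - m * ((x - a) \<bullet> i)))"
    by (rule C_k_compose_family[of bump_profile "\<lambda>x. 1 - m * ((x - a) \<bullet> i)"]) (rule bump_profile_deriv 1)+
  show "C_k k (\<lambda>x. bump_profile 0 (1 - m * ((b - x) \<bullet> i)))"
    by (rule C_k_compose_family[of bump_profile "\<lambda>x. 1 - m * ((b - x) \<bullet> i)"]) (rule bump_profile_deriv 2)+
qed

lemma box_cutoff_bounds: "0 \<le> box_cutoff m a b x" "box_cutoff m a b x \<le> 1"
proof -
  have "0 \<le> bump_profile 0 (1 - s)" "bump_profile 0 (1 - s) \<le> 1" for s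
    by (auto simp: bump_profile_0)
  then show "0 \<le> box_cutoff m a b x" "box_cutoff m a b x \<le> 1"
    unfolding box_cutoff_def by (auto intro!: prod_nonneg prod_le_1 mult_le_one)
qed

lemma box_cutoff_outside: "0 < m \<Longrightarrow> x \<notin> box a b \<Longrightarrow> box_cutoff m a b x = 0"
proof -
  assume m: "0 < m" and "x \<notin> box a b"
  then obtain i where i: "i \<in> Basis" "\<not> (a \<bullet> i < x \<bullet> i \<and> x \<bullet> i < b \<bullet> i)" by (auto simp: mem_box)
  then have "\<not> 0 < m * ((x - a) \<bullet> i) \<or> \<not> 0 < m * ((b - x) \<bullet> i)"
    using m by (auto simp: zero_less_mult_iff inner_diff_left)
  then have "bump_profile 0 (1 - m * ((x - a) \<bullet> i)) * bump_profile 0 (1 - m * ((b - x) \<bullet> i)) = 0"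
    unfolding bump_profile_0 by auto
  then show "box_cutoff m a b x = 0"
    unfolding box_cutoff_def using i(1) by (intro prod_zero) auto
qed

lemma box_cutoff_tendsto: "(\<lambda>k. box_cutoff (real (Suc k)) a b x) \<longlonglongrightarrow> indicator (box a b) x"
proof (cases "x \<in> box a b")
  case False
  then show ?thesis by (simp add: box_cutoff_outside)
next
  case True
  have *: "(\<lambda>k. bump_profile 0 (1 - real (Suc k) * s)) \<longlonglongrightarrow> 1" if "0 < s" for s
  proof -
    have "(\<lambda>k. exp (- 2 / (real (Suc k) * s))) \<longlonglongrightarrow> 1" using that by real_asymp
    then show ?thesis using that by (simp add: bump_profile_0)
  qed
  have "(\<lambda>k. box_cutoff (real (Suc k)) a b x) \<longlonglongrightarrow> (\<Prod>i\<in>(Basis::'a set). 1 * 1)"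
    unfolding box_cutoff_def using True
    by (intro tendsto_prod tendsto_mult *) (auto simp: mem_box inner_diff_left)
  then show ?thesis using True by simp
qed

lemma test_function_box_cutoff:
  assumes "0 < m" "cbox a b \<subseteq> \<Omega>"
  shows "test_function \<Omega> (box_cutoff m a b)"
proof -
  have "{x. box_cutoff m a b x \<noteq> 0} \<subseteq> cbox a b"
    using box_cutoff_outside[OF assms(1)] box_subset_cbox by blast
  then have *: "closure {x. box_cutoff m a b x \<noteq> 0} \<subseteq> cbox a b"
    by (simp add: closure_minimal closed_cbox)
  then show ?thesis
    using assms C_k_box_cutoff closed_subset_of_compact[OF compact_cbox closed_closure *]
    by (auto simp: test_function_def)
qed

section \<open>The fundamental lemma of the calculus of variations\<close>

lemma enn2real_eq_imp_eq: "a \<noteq> \<infinity> \<Longrightarrow> b \<noteq> \<infinity> \<Longrightarrow> enn2real a = enn2real b \<Longrightarrow> a = b"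
  by (cases a; cases b) auto

text \<open>Positive and negative part of H on the large box are densities of two measures that
  agree on all boxes. Boxes form an intersection-stable generator, so the measures coincide and with
  them the densities almost everywhere.\<close>

lemma AE_zero_of_box_integrals:
  fixes H :: "'a::euclidean_space \<Rightarrow> real"
  assumes int: "integrable lborel H"
    and z: "\<And>a b. box a b \<subseteq> box a0 b0 \<Longrightarrow> (\<integral>x. indicator (box a b) x * H x \<partial>lborel) = 0"
  shows "AE x in lborel. x \<in> box a0 b0 \<longrightarrow> H x = 0"
proof -
  have [measurable]: "H \<in> borel_measurable borel" using borel_measurable_integrable[OF int] by simp
  let ?f = "\<lambda>x. ennreal (H x) * indicator (box a0 b0) x" and ?g = "\<lambda>x. ennreal (- H x) * indicator (box a0 b0) x"
  have eq: "emeasure (density lborel ?f) (box a b) = emeasure (density lborel ?g) (box a b)"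
    and fin: "emeasure (density lborel ?f) (box a b) \<noteq> \<infinity>" for a b
  proof -
    obtain c d where cd: "box a b \<inter> box a0 b0 = box c d" by (rule that[OF box_Int_box])
    have i: "integrable lborel (\<lambda>x. indicator (box c d) x * H x)"
      using int by (intro integrable_mult_indicator[where 'b = real, simplified]) auto
    have e1: "emeasure (density lborel ?f) (box a b) = (\<integral>\<^sup>+x. ennreal (indicator (box c d) x * H x) \<partial>lborel)"
      unfolding cd[symmetric]
      by (subst emeasure_density) (auto intro!: nn_integral_cong simp: indicator_def)
    have e2: "emeasure (density lborel ?g) (box a b) = (\<integral>\<^sup>+x. ennreal (- (indicator (box c d) x * H x)) \<partial>lborel)"
      unfolding cd[symmetric]
      by (subst emeasure_density) (auto intro!: nn_integral_cong simp: indicator_def)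
    have f1: "(\<integral>\<^sup>+x. ennreal (indicator (box c d) x * H x) \<partial>lborel) \<noteq> \<infinity>"
      and f2: "(\<integral>\<^sup>+x. ennreal (- (indicator (box c d) x * H x)) \<partial>lborel) \<noteq> \<infinity>"
      using integrableD(2,3)[OF i] by auto
    have "(\<integral>x. indicator (box c d) x * H x \<partial>lborel) = 0" using cd by (intro z) blast
    then have "enn2real (\<integral>\<^sup>+x. ennreal (indicator (box c d) x * H x) \<partial>lborel) = enn2real (\<integral>\<^sup>+x. ennreal (- (indicator (box c d) x * H x)) \<partial>lborel)"
      using real_lebesgue_integral_def[OF i] by simp
    then show "emeasure (density lborel ?f) (box a b) = emeasure (density lborel ?g) (box a b)"
      unfolding e1 e2 by (rule enn2real_eq_imp_eq[OF f1 f2])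
    show "emeasure (density lborel ?f) (box a b) \<noteq> \<infinity>" unfolding e1 by (rule f1)
  qed
  have "density lborel ?f = density lborel ?g"
  proof (rule measure_eqI_generator_eq)
    let ?E = "range (\<lambda>(a, b). box a b :: 'a set)"
    let ?A = "\<lambda>n::nat. box (- (real n *\<^sub>R One)) (real n *\<^sub>R One) :: 'a set"
    show "Int_stable ?E" by (auto simp: Int_stable_def box_Int_box)
    show "?E \<subseteq> Pow UNIV" "sets (density lborel ?f) = sigma_sets UNIV ?E" "sets (density lborel ?g) = sigma_sets UNIV ?E"
      by (simp_all add: borel_eq_box sets_measure_of)
    show "range ?A \<subseteq> ?E" by auto
    show "(\<Union>i. ?A i) = UNIV" by (rule UN_box_eq_UNIV)
    show "emeasure (density lborel ?f) (?A n) \<noteq> \<infinity>" for n by (rule fin)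
    show "emeasure (density lborel ?f) X = emeasure (density lborel ?g) X" if "X \<in> ?E" for X
      using that eq by auto
  qed
  then have "AE x in lborel. ?f x = ?g x"
    by (intro sigma_finite_measure.density_unique[OF sigma_finite_lborel]) auto
  then show ?thesis
  proof eventually_elim
    case (elim x)
    then show ?case by (cases "0 \<le> H x") (auto simp: ennreal_neg)
  qed
qed

lemma integrable_bounded_mult:
  fixes f g :: "'a \<Rightarrow> real"
  assumes "integrable M f" "g \<in> borel_measurable M" "\<And>x. x \<in> space M \<Longrightarrow> \<bar>g x\<bar> \<le> C"
  shows "integrable M (\<lambda>x. f x * g x)"
proof (rule Bochner_Integration.integrable_bound)
  show "integrable M (\<lambda>x. C * f x)" using assms(1) by simp
  show "AE x in M. norm (f x * g x) \<le> norm (C * f x)"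
  proof (rule AE_I2)
    fix x assume "x \<in> space M"
    then have "\<bar>g x\<bar> \<le> \<bar>C\<bar>" using assms(3)[of x] by linarith
    then show "norm (f x * g x) \<le> norm (C * f x)"
      using mult_left_mono[of "\<bar>g x\<bar>" "\<bar>C\<bar>" "\<bar>f x\<bar>"] by (simp add: abs_mult mult.commute)
  qed
qed (use assms in measurable)

lemma lebesgue_on_measurable:
  fixes F :: "'a::euclidean_space \<Rightarrow> real"
  assumes "F \<in> borel_measurable borel"
  shows "F \<in> borel_measurable (lebesgue_on S)"
  using assms by (intro measurable_restrict_space1 measurable_completion) simp

text \<open>Sobolev notions live on \<open>lebesgue_on\<close>, averages and Fubini arguments on
  \<open>lborel\<close>. For Borel functions that vanish off \<Omega> the two settings
  agree.\<close>

lemma lebesgue_on_eq_lborel: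
  fixes F :: "'a::euclidean_space \<Rightarrow> real"
  assumes \<Omega>: "open \<Omega>" and F: "F \<in> borel_measurable borel" "\<And>x. x \<notin> \<Omega> \<Longrightarrow> F x = 0"
  shows "(LINT x|lebesgue_on \<Omega>. F x) = (LINT x|lborel. F x)"
    and "integrable (lebesgue_on \<Omega>) F \<longleftrightarrow> integrable lborel F"
    and "(\<integral>\<^sup>+x. ennreal (F x) \<partial>lebesgue_on \<Omega>) = (\<integral>\<^sup>+x. ennreal (F x) \<partial>lborel)"
proof -
  have s: "\<Omega> \<inter> space lebesgue \<in> sets lebesgue" using \<Omega> by simp
  have e: "(\<lambda>x. indicator \<Omega> x *\<^sub>R F x) = F" using F(2) by (auto simp: indicator_def fun_eq_iff)
  have e': "(\<lambda>x. ennreal (F x) * indicator \<Omega> x) = (\<lambda>x. ennreal (F x))" using F(2) by (auto simp: indicator_def fun_eq_iff)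
  show "(LINT x|lebesgue_on \<Omega>. F x) = (LINT x|lborel. F x)"
    using F(1) by (simp only: integral_restrict_space[OF s] e) (simp add: integral_completion)
  show "integrable (lebesgue_on \<Omega>) F \<longleftrightarrow> integrable lborel F"
    using F(1) by (simp only: integrable_restrict_space[OF s] e) (simp add: integrable_completion)
  show "(\<integral>\<^sup>+x. ennreal (F x) \<partial>lebesgue_on \<Omega>) = (\<integral>\<^sup>+x. ennreal (F x) \<partial>lborel)"
    by (simp only: nn_integral_restrict_space[OF s] e') (simp add: nn_integral_completion)
qed

lemma locally_integrable_mult:
  fixes h :: "'a::euclidean_space \<Rightarrow> real"
  assumes h: "locally_integrable \<Omega> h" and \<Omega>: "open \<Omega>" and \<phi>: "test_function \<Omega> \<phi>"
  shows "integrable (lebesgue_on \<Omega>) (\<lambda>x. h x * \<phi> x)"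
proof -
  let ?K = "closure {x. \<phi> x \<noteq> 0}"
  have K: "compact ?K" "?K \<subseteq> \<Omega>" using \<phi> by (auto simp: test_function_def)
  obtain C where C: "\<phi> \<in> borel_measurable borel" "\<And>x. \<bar>\<phi> x\<bar> \<le> C"
    using bbsE[OF bbs_test_function[OF \<phi>]] by metis
  have k: "?K \<inter> space lebesgue \<in> sets lebesgue" by simp
  have s: "\<Omega> \<inter> space lebesgue \<in> sets lebesgue" using \<Omega> by simp
  have "integrable lebesgue (\<lambda>x. indicator ?K x *\<^sub>R h x)"
    using h K integrable_restrict_space[OF k, of h] by (auto simp: locally_integrable_def)
  then have "integrable lebesgue (\<lambda>x. (indicator ?K x *\<^sub>R h x) * \<phi> x)"
    using C by (intro integrable_bounded_mult[where C = C] measurable_completion) auto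
  also have "(\<lambda>x. (indicator ?K x *\<^sub>R h x) * \<phi> x) = (\<lambda>x. indicator \<Omega> x *\<^sub>R (h x * \<phi> x))"
  proof
    fix x
    show "(indicator ?K x *\<^sub>R h x) * \<phi> x = indicator \<Omega> x *\<^sub>R (h x * \<phi> x)"
    proof (cases "x \<in> ?K")
      case True
      then have "x \<in> \<Omega>" using K(2) by blast
      with True show ?thesis by simp
    next
      case False
      from test_function_vanish(1)[OF \<phi> this] show ?thesis by simp
    qed
  qed
  finally show ?thesis by (simp only: integrable_restrict_space[OF s])
qed

text \<open>Testing against box cutoffs and passing to the limit by dominated convergence makes the
  integrals over all small boxes vanish. Countably many closed boxes then cover \<Omega>.\<close>

lemma fundamental_lemma:
  fixes h :: "'a::euclidean_space \<Rightarrow> real"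
  assumes h: "locally_integrable \<Omega> h" and \<Omega>: "open \<Omega>"
    and z: "\<And>\<phi>. test_function \<Omega> \<phi> \<Longrightarrow> (LINT x|lebesgue_on \<Omega>. h x * \<phi> x) = 0"
  shows "AE x in lebesgue_on \<Omega>. h x = 0"
proof -
  have s: "\<Omega> \<inter> space lebesgue \<in> sets lebesgue" using \<Omega> by simp
  have local: "AE x in lebesgue. x \<in> cbox a b \<longrightarrow> h x = 0" if ab: "cbox a b \<subseteq> \<Omega>" for a b
  proof -
    have "integrable (lebesgue_on (cbox a b)) h" using h ab by (auto simp: locally_integrable_def)
    then have i: "integrable lebesgue (\<lambda>x. indicator (cbox a b) x * h x)"
      using integrable_restrict_space[of "cbox a b" lebesgue h] by simp
    \<comment> \<open>On a compact box h is only Lebesgue measurable; a Borel representative is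
      needed to compare measures on the Borel sets.\<close>
    then obtain H where H: "H \<in> borel_measurable lborel" "AE x in lborel. indicator (cbox a b) x * h x = H x"
      using completion_ex_borel_measurable_real[OF borel_measurable_integrable[OF i]] by blast
    note [measurable] = H(1)
    have ae: "AE x in lebesgue. indicator (cbox a b) x * h x = H x" by (rule AE_completion[OF H(2)])
    have HM: "H \<in> borel_measurable lebesgue" using H(1) by (rule measurable_completion)
    have "integrable lebesgue H"
      using i integrable_cong_AE[OF borel_measurable_integrable[OF i] HM ae] by simp
    then have iH: "integrable lborel H" using H(1) by (simp add: integrable_completion)
    have "AE x in lborel. x \<in> box a b \<longrightarrow> H x = 0"
    proof (rule AE_zero_of_box_integrals[OF iH])
      fix c d :: 'a assume cd: "box c d \<subseteq> box a b"
      show "(\<integral>x. indicator (box c d) x * H x \<partial>lborel) = 0"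
      proof (cases "box c d = {}")
        case False
        then have cd': "cbox c d \<subseteq> cbox a b" using cd closure_mono[OF cd] by (metis closure_box closure_empty cd subset_empty)
        have t: "test_function (cbox a b) (box_cutoff (real (Suc k)) c d)" for k
          using cd' by (intro test_function_box_cutoff) auto
        have zero: "(\<integral>x. box_cutoff (real (Suc k)) c d x * H x \<partial>lborel) = 0" for k
        proof -
          let ?\<phi> = "box_cutoff (real (Suc k)) c d"
          have "?\<phi> \<in> borel_measurable lborel" using bbs_measurable[OF bbs_test_function[OF t[of k]]] by simp
          from borel_measurable_times[OF this H(1)] have M: "(\<lambda>x. ?\<phi> x * H x) \<in> borel_measurable lborel" .
          have "(\<integral>x. ?\<phi> x * H x \<partial>lborel) = (\<integral>x. ?\<phi> x * H x \<partial>lebesgue)"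
            by (rule integral_completion[OF M, symmetric])
          also have "\<dots> = (\<integral>x. indicator \<Omega> x *\<^sub>R (h x * ?\<phi> x) \<partial>lebesgue)"
          proof (rule integral_cong_AE)
            show "(\<lambda>x. ?\<phi> x * H x) \<in> borel_measurable lebesgue" by (rule measurable_completion[OF M])
            have "integrable (lebesgue_on \<Omega>) (\<lambda>x. h x * ?\<phi> x)"
              using test_function_mono[OF t ab] by (rule locally_integrable_mult[OF h \<Omega>])
            then show "(\<lambda>x. indicator \<Omega> x *\<^sub>R (h x * ?\<phi> x)) \<in> borel_measurable lebesgue"
              unfolding integrable_restrict_space[OF s] by (rule borel_measurable_integrable)
            show "AE x in lebesgue. ?\<phi> x * H x = indicator \<Omega> x *\<^sub>R (h x * ?\<phi> x)"
              using ae
            proof eventually_elim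
              case (elim x)
              show ?case
              proof (cases "x \<in> cbox a b")
                case True
                then show ?thesis using elim ab by (auto simp: indicator_def)
              next
                case False
                then have "?\<phi> x = 0" using cd box_subset_cbox by (intro box_cutoff_outside) auto
                then show ?thesis by simp
              qed
            qed
          qed
          also have "\<dots> = (LINT x|lebesgue_on \<Omega>. h x * ?\<phi> x)" by (simp only: integral_restrict_space[OF s])
          also have "\<dots> = 0" by (rule z[OF test_function_mono[OF t ab]])
          finally show ?thesis .
        qed
        have "(\<lambda>k. \<integral>x. box_cutoff (real (Suc k)) c d x * H x \<partial>lborel) \<longlonglongrightarrow> (\<integral>x. indicator (box c d) x * H x \<partial>lborel)"
        proof (rule integral_dominated_convergence[where w = "\<lambda>x. norm (H x)"])
          show "AE x in lborel. (\<lambda>k. box_cutoff (real (Suc k)) c d x * H x) \<longlonglongrightarrow> indicator (box c d) x * H x"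
            by (intro AE_I2 tendsto_mult box_cutoff_tendsto tendsto_const)
          show "AE x in lborel. norm (box_cutoff (real (Suc k)) c d x * H x) \<le> norm (H x)" for k
          proof (intro AE_I2)
            fix x
            show "norm (box_cutoff (real (Suc k)) c d x * H x) \<le> norm (H x)"
              using box_cutoff_bounds[of "real (Suc k)" c d x] mult_right_mono[of "box_cutoff (real (Suc k)) c d x" 1 "\<bar>H x\<bar>"]
              by (simp add: abs_mult)
          qed
          show "(\<lambda>x. box_cutoff (real (Suc k)) c d x * H x) \<in> borel_measurable lborel" for k
            using bbs_measurable[OF bbs_test_function[OF t[of k]]] by simp
        qed (use iH in auto)
        then have "(\<lambda>k::nat. 0 :: real) \<longlonglongrightarrow> (\<integral>x. indicator (box c d) x * H x \<partial>lborel)"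
          unfolding zero .
        from LIMSEQ_unique[OF this tendsto_const] show ?thesis .
      qed simp
    qed
    from AE_completion[OF this] ae have "AE x in lebesgue. x \<in> box a b \<longrightarrow> h x = 0"
      by eventually_elim (use box_subset_cbox[of a b] in \<open>auto simp: indicator_def split: if_splits\<close>)
    \<comment> \<open>The frontier of a box is negligible, which closes the gap between the open box
      and the closed boxes of the covering.\<close>
    moreover have "AE x in lebesgue. x \<notin> cbox a b - box a b"
      using negligible_frontier_interval[of a b] by (intro AE_not_in) (simp add: negligible_iff_null_sets)
    ultimately show ?thesis by eventually_elim auto
  qed
  obtain \<D> where D: "countable \<D>" "\<D> \<subseteq> Pow \<Omega>" "\<And>X. X \<in> \<D> \<Longrightarrow> \<exists>a b. X = cbox a b" "\<Union>\<D> = \<Omega>"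
    by (rule open_countable_Union_open_cbox[OF \<Omega>]) (rule that)
  have "AE x in lebesgue. \<forall>X\<in>\<D>. x \<in> X \<longrightarrow> h x = 0"
    unfolding AE_ball_countable[OF D(1)]
  proof
    fix X assume X: "X \<in> \<D>"
    then obtain a b where ab: "X = cbox a b" using D(3) by blast
    then show "AE x in lebesgue. x \<in> X \<longrightarrow> h x = 0" using local[of a b] X D(2) by auto
  qed
  then have "AE x in lebesgue. x \<in> \<Omega> \<longrightarrow> h x = 0"
    by eventually_elim (use D(4) in blast)
  then show ?thesis by (simp only: AE_restrict_space_iff[OF s])
qed

section \<open>Linearity and uniqueness of weak gradients\<close>

lemma locally_integrable_add:
  assumes "locally_integrable \<Omega> f" "locally_integrable \<Omega> g"
  shows "locally_integrable \<Omega> (\<lambda>x. f x + c *\<^sub>R g x)"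
  using assms by (auto simp: locally_integrable_def)

lemma locally_integrable_inner:
  assumes "locally_integrable \<Omega> g"
  shows "locally_integrable \<Omega> (\<lambda>x. g x \<bullet> i)"
  using assms by (auto simp: locally_integrable_def)

lemma is_weak_gradient_add:
  fixes u v :: "'a::euclidean_space \<Rightarrow> real"
  assumes u: "is_weak_gradient \<Omega> u g" and v: "is_weak_gradient \<Omega> v g'" and \<Omega>: "open \<Omega>"
  shows "is_weak_gradient \<Omega> (\<lambda>x. u x + c * v x) (\<lambda>x. g x + c *\<^sub>R g' x)"
  unfolding is_weak_gradient_def
proof (intro conjI allI impI)
  show "locally_integrable \<Omega> (\<lambda>x. u x + c * v x)" "locally_integrable \<Omega> (\<lambda>x. g x + c *\<^sub>R g' x)"
    using u v locally_integrable_add[of \<Omega> u v c] locally_integrable_add[of \<Omega> g g' c] by (auto simp: is_weak_gradient_def)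
  fix \<phi> i assume "test_function \<Omega> \<phi> \<and> i \<in> (Basis :: 'a set)"
  then have t: "test_function \<Omega> \<phi>" "i \<in> Basis" by auto
  note t' = test_function_deriv[OF t]
  have lu: "locally_integrable \<Omega> u" "locally_integrable \<Omega> v" "locally_integrable \<Omega> (\<lambda>x. g x \<bullet> i)" "locally_integrable \<Omega> (\<lambda>x. g' x \<bullet> i)"
    using u v by (auto simp: is_weak_gradient_def intro: locally_integrable_inner)
  note I = locally_integrable_mult[OF lu(1) \<Omega> t'] locally_integrable_mult[OF lu(2) \<Omega> t']
    locally_integrable_mult[OF lu(3) \<Omega> t(1)] locally_integrable_mult[OF lu(4) \<Omega> t(1)]
  have "(LINT x|lebesgue_on \<Omega>. (u x + c * v x) * frechet_derivative \<phi> (at x) i) =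
      (LINT x|lebesgue_on \<Omega>. u x * frechet_derivative \<phi> (at x) i) + c * (LINT x|lebesgue_on \<Omega>. v x * frechet_derivative \<phi> (at x) i)"
    using I(1,2) by (simp add: distrib_right mult.assoc)
  also have "\<dots> = - (LINT x|lebesgue_on \<Omega>. (g x \<bullet> i) * \<phi> x) - c * (LINT x|lebesgue_on \<Omega>. (g' x \<bullet> i) * \<phi> x)"
    using u v t by (simp add: is_weak_gradient_def)
  also have "\<dots> = - (LINT x|lebesgue_on \<Omega>. ((g x + c *\<^sub>R g' x) \<bullet> i) * \<phi> x)"
    using I(3,4) by (simp add: distrib_right inner_add_left mult.assoc)
  finally show "(LINT x|lebesgue_on \<Omega>. (u x + c * v x) * frechet_derivative \<phi> (at x) i) =
     - (LINT x|lebesgue_on \<Omega>. ((g x + c *\<^sub>R g' x) \<bullet> i) * \<phi> x)" .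
qed

text \<open>The difference of the two fields is a weak gradient of the zero function, so each of its
  coordinates integrates to 0 against all test functions.\<close>

lemma is_weak_gradient_unique:
  fixes u :: "'a::euclidean_space \<Rightarrow> real"
  assumes g: "is_weak_gradient \<Omega> u g" and g': "is_weak_gradient \<Omega> u g'" and \<Omega>: "open \<Omega>"
  shows "AE x in lebesgue_on \<Omega>. g x = g' x"
proof -
  have w: "is_weak_gradient \<Omega> (\<lambda>x. u x + (- 1) * u x) (\<lambda>x. g x + (- 1) *\<^sub>R g' x)"
    by (rule is_weak_gradient_add[OF g g' \<Omega>])
  have "AE x in lebesgue_on \<Omega>. (g x + (- 1) *\<^sub>R g' x) \<bullet> i = 0" if i: "i \<in> Basis" for i
  proof (rule fundamental_lemma[OF _ \<Omega>])
    show "locally_integrable \<Omega> (\<lambda>x. (g x + (- 1) *\<^sub>R g' x) \<bullet> i)"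
      using w by (intro locally_integrable_inner) (simp add: is_weak_gradient_def)
    show "(LINT x|lebesgue_on \<Omega>. ((g x + (- 1) *\<^sub>R g' x) \<bullet> i) * \<phi> x) = 0" if "test_function \<Omega> \<phi>" for \<phi>
    proof -
      have "(LINT x|lebesgue_on \<Omega>. (u x + (- 1) * u x) * frechet_derivative \<phi> (at x) i) = - (LINT x|lebesgue_on \<Omega>. ((g x + (- 1) *\<^sub>R g' x) \<bullet> i) * \<phi> x)"
        using w that i unfolding is_weak_gradient_def by blast
      then show ?thesis by simp
    qed
  qed
  then have "AE x in lebesgue_on \<Omega>. \<forall>i\<in>Basis. (g x + (- 1) *\<^sub>R g' x) \<bullet> i = 0"
    by (simp add: AE_ball_countable countable_finite)
  then show ?thesis
  proof eventually_elim
    case (elim x)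
    then show ?case by (rule_tac euclidean_eqI) (simp add: inner_diff_left)
  qed
qed

section \<open>Test functions as Sobolev functions\<close>

definition gradient :: "('a::euclidean_space \<Rightarrow> real) \<Rightarrow> 'a \<Rightarrow> 'a" where
  "gradient \<phi> x = (\<Sum>i\<in>Basis. frechet_derivative \<phi> (at x) i *\<^sub>R i)"

lemma gradient_inner: "test_function \<Omega> \<phi> \<Longrightarrow> gradient \<phi> x \<bullet> h = frechet_derivative \<phi> (at x) h"
  by (simp add: gradient_def inner_sum_left frechet_derivative_expand[of \<Omega> \<phi> x h] inner_commute[of h] mult.commute)

lemma gradient_continuous: "test_function \<Omega> \<phi> \<Longrightarrow> continuous_on UNIV (gradient \<phi>)"
  unfolding gradient_def[abs_def]
  by (intro continuous_on_sum continuous_on_scaleR frechet_derivative_continuous continuous_on_const)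

lemma locally_integrable_continuous:
  fixes f :: "'a::euclidean_space \<Rightarrow> 'b::euclidean_space"
  assumes "continuous_on \<Omega> f"
  shows "locally_integrable \<Omega> f"
  unfolding locally_integrable_def
proof (intro allI impI)
  fix K :: "'a set" assume K: "compact K \<and> K \<subseteq> \<Omega>"
  have k: "K \<inter> space lebesgue \<in> sets lebesgue" using K by (simp add: lmeasurable_compact fmeasurableD)
  have "integrable lborel (\<lambda>x. indicator K x *\<^sub>R f x)"
    using K assms by (intro borel_integrable_compact) (auto intro: continuous_on_subset)
  then have "integrable lebesgue (\<lambda>x. indicator K x *\<^sub>R f x)"
    using borel_measurable_integrable by (subst integrable_completion) auto
  then show "integrable (lebesgue_on K) f" by (simp only: integrable_restrict_space[OF k])
qed

text \<open>Integration by parts is the product rule together with the vanishing integral of a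
  derivative of the test function \<open>\<phi> x * \<psi> x\<close>.\<close>

lemma test_function_is_weak_gradient:
  assumes \<phi>: "test_function \<Omega> \<phi>" and \<Omega>: "open \<Omega>"
  shows "is_weak_gradient \<Omega> \<phi> (gradient \<phi>)"
  unfolding is_weak_gradient_def
proof (intro conjI allI impI)
  show "locally_integrable \<Omega> \<phi>"
    using continuous_on_subset[OF _ subset_UNIV, of \<phi>] test_function_C_k[OF \<phi>, of 0]
    by (auto intro: locally_integrable_continuous)
  show "locally_integrable \<Omega> (gradient \<phi>)" by (rule locally_integrable_continuous[OF continuous_on_subset[OF gradient_continuous[OF \<phi>] subset_UNIV]])
  fix \<psi> i assume "test_function \<Omega> \<psi> \<and> i \<in> (Basis :: 'a set)"
  then have \<psi>: "test_function \<Omega> \<psi>" "i \<in> Basis" by auto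
  have t: "test_function \<Omega> (\<lambda>x. \<phi> x * \<psi> x)"
    by (rule test_function_mult[OF \<psi>(1) test_function_C_k[OF \<phi>]])
  have d: "frechet_derivative (\<lambda>x. \<phi> x * \<psi> x) (at x) i = \<phi> x * frechet_derivative \<psi> (at x) i + frechet_derivative \<phi> (at x) i * \<psi> x" for x
    using frechet_derivative_at[OF has_derivative_mult[OF test_function_has_derivative[OF \<phi>] test_function_has_derivative[OF \<psi>(1)]], symmetric, of x]
    by simp
  have i1: "integrable lborel (\<lambda>x. \<phi> x * frechet_derivative \<psi> (at x) i)"
    by (intro bbs_integrable bbs_mult bbs_test_function[OF \<phi>] bbs_frechet_derivative[OF \<psi>(1)])
  have i2: "integrable lborel (\<lambda>x. frechet_derivative \<phi> (at x) i * \<psi> x)"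
    by (intro bbs_integrable bbs_mult bbs_test_function[OF \<psi>(1)] bbs_frechet_derivative[OF \<phi>])
  have out: "\<phi> x = 0" "\<psi> x = 0" if "x \<notin> \<Omega>" for x
    using that \<phi> \<psi> test_function_vanish(1)[of \<Omega> \<phi> x] test_function_vanish(1)[of \<Omega> \<psi> x] by (auto simp: test_function_def)
  have "(LINT x|lebesgue_on \<Omega>. \<phi> x * frechet_derivative \<psi> (at x) i) = (LINT x|lborel. \<phi> x * frechet_derivative \<psi> (at x) i)"
    by (rule lebesgue_on_eq_lborel(1)[OF \<Omega>]) (use borel_measurable_integrable[OF i1] out in auto)
  also have "\<dots> = - (LINT x|lborel. frechet_derivative \<phi> (at x) i * \<psi> x)"
    using test_function_integral_derivative[OF t, of i] i1 i2 unfolding d by simp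
  also have "(LINT x|lborel. frechet_derivative \<phi> (at x) i * \<psi> x) = (LINT x|lebesgue_on \<Omega>. frechet_derivative \<phi> (at x) i * \<psi> x)"
    by (rule lebesgue_on_eq_lborel(1)[OF \<Omega>, symmetric]) (use borel_measurable_integrable[OF i2] out in auto)
  finally show "(LINT x|lebesgue_on \<Omega>. \<phi> x * frechet_derivative \<psi> (at x) i) = - (LINT x|lebesgue_on \<Omega>. (gradient \<phi> x \<bullet> i) * \<psi> x)"
    unfolding gradient_inner[OF \<phi>] .
qed

section \<open>Sobolev functions\<close>

lemma integrable_mult_L2:
  fixes f g :: "'a \<Rightarrow> real"
  assumes [measurable]: "f \<in> borel_measurable M" "g \<in> borel_measurable M"
    and "integrable M (\<lambda>x. (f x)\<^sup>2)" "integrable M (\<lambda>x. (g x)\<^sup>2)"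
  shows "integrable M (\<lambda>x. f x * g x)"
proof (rule Bochner_Integration.integrable_bound)
  show "integrable M (\<lambda>x. (f x)\<^sup>2 + (g x)\<^sup>2)" using assms by simp
  have "\<bar>a * b\<bar> \<le> a\<^sup>2 + b\<^sup>2" for a b :: real
  proof -
    have "0 \<le> (\<bar>a\<bar> - \<bar>b\<bar>)\<^sup>2" by simp
    also have "\<dots> = a\<^sup>2 + b\<^sup>2 - 2 * \<bar>a * b\<bar>" by (simp add: power2_diff abs_mult)
    finally show ?thesis using abs_ge_zero[of "a * b"] by linarith
  qed
  then show "AE x in M. norm (f x * g x) \<le> norm ((f x)\<^sup>2 + (g x)\<^sup>2)" by simp
qed simp

lemma integrable_inner_L2:
  fixes f g :: "'a \<Rightarrow> 'b::euclidean_space"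
  assumes [measurable]: "f \<in> borel_measurable M" "g \<in> borel_measurable M"
    and "integrable M (\<lambda>x. (norm (f x))\<^sup>2)" "integrable M (\<lambda>x. (norm (g x))\<^sup>2)"
  shows "integrable M (\<lambda>x. f x \<bullet> g x)"
proof (rule Bochner_Integration.integrable_bound)
  show "integrable M (\<lambda>x. norm (f x) * norm (g x))" using assms by (intro integrable_mult_L2) auto
  show "AE x in M. norm (f x \<bullet> g x) \<le> norm (norm (f x) * norm (g x))"
    using Cauchy_Schwarz_ineq2 by (intro AE_I2) simp
qed simp

lemma norm_add_scaleR_power2:
  fixes x y :: "'b::euclidean_space"
  shows "(norm (x + c *\<^sub>R y))\<^sup>2 = (norm x)\<^sup>2 + 2 * c * (x \<bullet> y) + c\<^sup>2 * (norm y)\<^sup>2"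
  unfolding power2_norm_eq_inner by (simp add: inner_add_left inner_add_right inner_commute power2_eq_square algebra_simps)

lemma integrable_add_L2:
  fixes f g :: "'a \<Rightarrow> 'b::euclidean_space"
  assumes "f \<in> borel_measurable M" "g \<in> borel_measurable M"
    and "integrable M (\<lambda>x. (norm (f x))\<^sup>2)" "integrable M (\<lambda>x. (norm (g x))\<^sup>2)"
  shows "integrable M (\<lambda>x. (norm (f x + c *\<^sub>R g x))\<^sup>2)"
    and "(LINT x|M. (norm (f x + c *\<^sub>R g x))\<^sup>2) =
      (LINT x|M. (norm (f x))\<^sup>2) + 2 * c * (LINT x|M. f x \<bullet> g x) + c\<^sup>2 * (LINT x|M. (norm (g x))\<^sup>2)"
  unfolding norm_add_scaleR_power2 using assms integrable_inner_L2[OF assms] by simp_all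

text \<open>The choice in \<open>weak_gradient\<close> asks only for the weak equation.
  Measurability and square integrability are transferred from the witness in \<open>W12\<close> by
  almost everywhere uniqueness.\<close>

lemma W12_weak_gradient:
  fixes w :: "'a::euclidean_space \<Rightarrow> real"
  assumes w: "w \<in> W12 \<Omega>" and \<Omega>: "open \<Omega>"
  shows "is_weak_gradient \<Omega> w (weak_gradient \<Omega> w)"
    and "weak_gradient \<Omega> w \<in> borel_measurable (lebesgue_on \<Omega>)"
    and "integrable (lebesgue_on \<Omega>) (\<lambda>x. (norm (weak_gradient \<Omega> w x))\<^sup>2)"
proof -
  have s: "\<Omega> \<inter> space lebesgue \<in> sets lebesgue" using \<Omega> by simp
  obtain g where g: "is_weak_gradient \<Omega> w g" "g \<in> borel_measurable (lebesgue_on \<Omega>)"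
    "integrable (lebesgue_on \<Omega>) (\<lambda>x. (norm (g x))\<^sup>2)"
    using w unfolding W12_def by blast
  show 1: "is_weak_gradient \<Omega> w (weak_gradient \<Omega> w)"
    unfolding weak_gradient_def by (rule someI[of "is_weak_gradient \<Omega> w", OF g(1)])
  have ae: "AE x in lebesgue_on \<Omega>. g x = weak_gradient \<Omega> w x"
    by (rule is_weak_gradient_unique[OF g(1) 1 \<Omega>])
  \<comment> \<open>Completeness of Lebesgue measure lets measurability pass to an almost everywhere
    equal function.\<close>
  have m: "(\<lambda>x. indicator \<Omega> x *\<^sub>R weak_gradient \<Omega> w x) \<in> borel_measurable lebesgue"
  proof (rule borel_measurable_AE)
    show "(\<lambda>x. indicator \<Omega> x *\<^sub>R g x) \<in> borel_measurable lebesgue"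
      using g(2) by (simp only: borel_measurable_restrict_space_iff[OF s])
    show "AE x in lebesgue. indicator \<Omega> x *\<^sub>R g x = indicator \<Omega> x *\<^sub>R weak_gradient \<Omega> w x"
      using ae unfolding AE_restrict_space_iff[OF s] by eventually_elim (auto simp: indicator_def)
  qed
  then show 2: "weak_gradient \<Omega> w \<in> borel_measurable (lebesgue_on \<Omega>)"
    by (simp only: borel_measurable_restrict_space_iff[OF s])
  have "AE x in lebesgue_on \<Omega>. (norm (g x))\<^sup>2 = (norm (weak_gradient \<Omega> w x))\<^sup>2"
    using ae by eventually_elim simp
  moreover have "(\<lambda>x. (norm (weak_gradient \<Omega> w x))\<^sup>2) \<in> borel_measurable (lebesgue_on \<Omega>)"
    using 2 by measurable
  ultimately show "integrable (lebesgue_on \<Omega>) (\<lambda>x. (norm (weak_gradient \<Omega> w x))\<^sup>2)"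
    using g(3) integrable_cong_AE[OF borel_measurable_integrable[OF g(3)]] by blast
qed

lemma test_function_outside: "test_function \<Omega> \<phi> \<Longrightarrow> x \<notin> \<Omega> \<Longrightarrow> \<phi> x = 0"
  and gradient_outside: "test_function \<Omega> \<phi> \<Longrightarrow> x \<notin> \<Omega> \<Longrightarrow> gradient \<phi> x = 0"
proof -
  assume t: "test_function \<Omega> \<phi>" and x: "x \<notin> \<Omega>"
  then have x': "x \<notin> closure {x. \<phi> x \<noteq> 0}" by (auto simp: test_function_def)
  show "\<phi> x = 0" by (rule test_function_vanish(1)[OF t x'])
  show "gradient \<phi> x = 0" unfolding gradient_def test_function_vanish(2)[OF t x'] by simp
qed

lemma bbs_gradient_power2:
  assumes "test_function \<Omega> \<phi>" shows "bbs (\<lambda>x. (norm (gradient \<phi> x))\<^sup>2)"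
proof -
  have "bbs (\<lambda>x. \<Sum>i\<in>B. frechet_derivative \<phi> (at x) i * frechet_derivative \<phi> (at x) i)" if "finite B" for B
    using that
  proof (induction B)
    case empty
    show ?case by (rule bbsI[where C = 0 and R = 0]) auto
  next
    case (insert i B)
    then show ?case by (simp add: bbs_add bbs_mult bbs_frechet_derivative[OF assms])
  qed
  moreover have "(norm (gradient \<phi> x))\<^sup>2 = (\<Sum>i\<in>Basis. frechet_derivative \<phi> (at x) i * frechet_derivative \<phi> (at x) i)" for x
  proof -
    have "(norm (gradient \<phi> x))\<^sup>2 = (\<Sum>i\<in>Basis. (gradient \<phi> x \<bullet> i) * (gradient \<phi> x \<bullet> i))"
      unfolding power2_norm_eq_inner by (rule euclidean_inner)
    then show ?thesis by (simp add: gradient_inner[OF assms])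
  qed
  ultimately show ?thesis by simp
qed

lemma test_function_L2:
  assumes t: "test_function \<Omega> \<phi>" and \<Omega>: "open \<Omega>"
  shows "\<phi> \<in> borel_measurable (lebesgue_on \<Omega>)" "gradient \<phi> \<in> borel_measurable (lebesgue_on \<Omega>)"
    "integrable (lebesgue_on \<Omega>) (\<lambda>x. (\<phi> x)\<^sup>2)" "integrable (lebesgue_on \<Omega>) (\<lambda>x. (norm (gradient \<phi> x))\<^sup>2)"
proof -
  show "\<phi> \<in> borel_measurable (lebesgue_on \<Omega>)"
    by (rule lebesgue_on_measurable[OF bbs_measurable[OF bbs_test_function[OF t]]])
  show "gradient \<phi> \<in> borel_measurable (lebesgue_on \<Omega>)"
    using borel_measurable_continuous_onI[OF gradient_continuous[OF t]]
    by (intro measurable_restrict_space1 measurable_completion) simp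
  have b: "bbs (\<lambda>x. (\<phi> x)\<^sup>2)" by (rule bbs_power2[OF bbs_test_function[OF t]])
  show "integrable (lebesgue_on \<Omega>) (\<lambda>x. (\<phi> x)\<^sup>2)"
    using lebesgue_on_eq_lborel(2)[OF \<Omega> bbs_measurable[OF b]] test_function_outside[OF t] bbs_integrable[OF b] by simp
  note b = bbs_gradient_power2[OF t]
  show "integrable (lebesgue_on \<Omega>) (\<lambda>x. (norm (gradient \<phi> x))\<^sup>2)"
    using lebesgue_on_eq_lborel(2)[OF \<Omega> bbs_measurable[OF b]] gradient_outside[OF t] bbs_integrable[OF b] by simp
qed

lemma W12_add_test_function:
  assumes w: "w \<in> W12 \<Omega>" and t: "test_function \<Omega> \<phi>" and \<Omega>: "open \<Omega>"
  shows "(\<lambda>x. w x + c * \<phi> x) \<in> W12 \<Omega>"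
    and "AE x in lebesgue_on \<Omega>. weak_gradient \<Omega> (\<lambda>x. w x + c * \<phi> x) x = weak_gradient \<Omega> w x + c *\<^sub>R gradient \<phi> x"
proof -
  note G = W12_weak_gradient[OF w \<Omega>] and L = test_function_L2[OF t \<Omega>]
  have wm: "w \<in> borel_measurable (lebesgue_on \<Omega>)" "integrable (lebesgue_on \<Omega>) (\<lambda>x. (w x)\<^sup>2)"
    using w by (auto simp: W12_def)
  have g: "is_weak_gradient \<Omega> (\<lambda>x. w x + c * \<phi> x) (\<lambda>x. weak_gradient \<Omega> w x + c *\<^sub>R gradient \<phi> x)"
    by (rule is_weak_gradient_add[OF G(1) test_function_is_weak_gradient[OF t \<Omega>] \<Omega>])
  show W: "(\<lambda>x. w x + c * \<phi> x) \<in> W12 \<Omega>"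
    unfolding W12_def
  proof (intro CollectI conjI exI)
    show "(\<lambda>x. w x + c * \<phi> x) \<in> borel_measurable (lebesgue_on \<Omega>)" using wm(1) L(1) by measurable
    show "integrable (lebesgue_on \<Omega>) (\<lambda>x. (w x + c * \<phi> x)\<^sup>2)"
      using integrable_add_L2(1)[OF wm(1) L(1), of c] wm(2) L(3) by simp
    show "is_weak_gradient \<Omega> (\<lambda>x. w x + c * \<phi> x) (\<lambda>x. weak_gradient \<Omega> w x + c *\<^sub>R gradient \<phi> x)" by (rule g)
    show "(\<lambda>x. weak_gradient \<Omega> w x + c *\<^sub>R gradient \<phi> x) \<in> borel_measurable (lebesgue_on \<Omega>)" using G(2) L(2) by measurable
    show "integrable (lebesgue_on \<Omega>) (\<lambda>x. (norm (weak_gradient \<Omega> w x + c *\<^sub>R gradient \<phi> x))\<^sup>2)"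
      by (rule integrable_add_L2(1)[OF G(2) L(2) G(3) L(4)])
  qed
  show "AE x in lebesgue_on \<Omega>. weak_gradient \<Omega> (\<lambda>x. w x + c * \<phi> x) x = weak_gradient \<Omega> w x + c *\<^sub>R gradient \<phi> x"
    by (rule is_weak_gradient_unique[OF W12_weak_gradient(1)[OF W \<Omega>] g \<Omega>])
qed

lemma W12_norm_add:
  assumes w: "w \<in> W12 \<Omega>" and t: "test_function \<Omega> \<phi>" and \<Omega>: "open \<Omega>"
  shows "(W12_norm \<Omega> (\<lambda>x. w x - \<phi> x))\<^sup>2 =
      (LINT x|lebesgue_on \<Omega>. (w x - \<phi> x)\<^sup>2) + (LINT x|lebesgue_on \<Omega>. (norm (weak_gradient \<Omega> w x - gradient \<phi> x))\<^sup>2)"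
    and "integrable (lebesgue_on \<Omega>) (\<lambda>x. (w x - \<phi> x)\<^sup>2)"
    and "integrable (lebesgue_on \<Omega>) (\<lambda>x. (norm (weak_gradient \<Omega> w x - gradient \<phi> x))\<^sup>2)"
proof -
  have e: "(\<lambda>x. w x - \<phi> x) = (\<lambda>x. w x + (- 1) * \<phi> x)" by simp
  have e': "weak_gradient \<Omega> w x - gradient \<phi> x = weak_gradient \<Omega> w x + (- 1) *\<^sub>R gradient \<phi> x" for x by simp
  note A = W12_add_test_function[OF w t \<Omega>, of "- 1"]
  note G = W12_weak_gradient[OF w \<Omega>] and L = test_function_L2[OF t \<Omega>]
  note G' = W12_weak_gradient[OF A(1) \<Omega>]
  show i1: "integrable (lebesgue_on \<Omega>) (\<lambda>x. (w x - \<phi> x)\<^sup>2)" using A(1) by (simp add: W12_def)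
  show i2: "integrable (lebesgue_on \<Omega>) (\<lambda>x. (norm (weak_gradient \<Omega> w x - gradient \<phi> x))\<^sup>2)"
    unfolding e' by (rule integrable_add_L2(1)[OF G(2) L(2) G(3) L(4)])
  let ?g = "weak_gradient \<Omega> (\<lambda>x. w x + (- 1) * \<phi> x)"
  have "(LINT x|lebesgue_on \<Omega>. (norm (?g x))\<^sup>2) = (LINT x|lebesgue_on \<Omega>. (norm (weak_gradient \<Omega> w x - gradient \<phi> x))\<^sup>2)"
  proof (rule integral_cong_AE)
    show "AE x in lebesgue_on \<Omega>. (norm (?g x))\<^sup>2 = (norm (weak_gradient \<Omega> w x - gradient \<phi> x))\<^sup>2"
      using A(2) by eventually_elim (simp only: e')
  qed (rule borel_measurable_integrable[OF G'(3)] borel_measurable_integrable[OF i2])+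
  moreover have "(W12_norm \<Omega> (\<lambda>x. w x - \<phi> x))\<^sup>2 = (LINT x|lebesgue_on \<Omega>. (w x + (- 1) * \<phi> x)\<^sup>2 + (norm (?g x))\<^sup>2)"
    unfolding W12_norm_def e by (rule real_sqrt_pow2) (intro integral_nonneg_AE AE_I2 add_nonneg_nonneg zero_le_power2)
  ultimately show "(W12_norm \<Omega> (\<lambda>x. w x - \<phi> x))\<^sup>2 =
      (LINT x|lebesgue_on \<Omega>. (w x - \<phi> x)\<^sup>2) + (LINT x|lebesgue_on \<Omega>. (norm (weak_gradient \<Omega> w x - gradient \<phi> x))\<^sup>2)"
    using i1 G'(3) by simp
qed

section \<open>The sharp nonlocal energy bound for Sobolev functions\<close>

lemma mol_quadratic_moment:
  fixes a :: "'a::euclidean_space"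
  shows "(\<integral>\<^sup>+z. (\<integral>\<^sup>+z'. ennreal ((a \<bullet> (r *\<^sub>R (z' - z)))\<^sup>2) \<partial>mol_measure) \<partial>mol_measure) =
    ennreal (2 * second_moment TYPE('a) * r\<^sup>2 * (norm a)\<^sup>2)"
proof -
  define c where "c = second_moment TYPE('a)"
  have c: "0 < c" by (simp add: c_def second_moment_pos)
  have one: "measure (mol_measure :: 'a measure) UNIV = 1" by (metis mol.prob_space space_mol_measure)
  have b: "\<bar>a \<bullet> z\<bar> \<le> norm a" if "norm z < 1" for z
    using Cauchy_Schwarz_ineq2[of a z] mult_left_mono[of "norm z" 1 "norm a"] that by simp
  have i1: "integrable mol_measure (\<lambda>z. a \<bullet> z)"
    by (rule mol_integrable_bounded[where C = "norm a"]) (use b in auto)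
  have i2: "integrable mol_measure (\<lambda>z. (a \<bullet> z)\<^sup>2)"
  proof (rule mol_integrable_bounded[where C = "(norm a)\<^sup>2"])
    show "\<bar>(a \<bullet> z)\<^sup>2\<bar> \<le> (norm a)\<^sup>2" if "norm z < 1" for z
      using power_mono[OF b[OF that] abs_ge_zero, of 2] by simp
  qed auto
  \<comment> \<open>The vanishing first moment removes the cross term of the square, so each of the
    two independent displacements contributes r^2 c |a|^2.\<close>
  have m1: "(\<integral>z. a \<bullet> z \<partial>mol_measure) = 0" and m2: "(\<integral>z. (a \<bullet> z)\<^sup>2 \<partial>mol_measure) = (norm a)\<^sup>2 * c"
    by (simp_all add: mol_integral mollifier_first_moment mollifier_second_moment c_def)
  have sq: "(a \<bullet> (r *\<^sub>R (z' - z)))\<^sup>2 = r\<^sup>2 * (a \<bullet> z')\<^sup>2 - (2 * r\<^sup>2 * (a \<bullet> z)) * (a \<bullet> z') + r\<^sup>2 * (a \<bullet> z)\<^sup>2" for z z'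
    by (simp add: inner_diff_right power2_eq_square algebra_simps)
  have "(\<integral>\<^sup>+z'. ennreal ((a \<bullet> (r *\<^sub>R (z' - z)))\<^sup>2) \<partial>mol_measure) = ennreal (r\<^sup>2 * ((norm a)\<^sup>2 * c) + r\<^sup>2 * (a \<bullet> z)\<^sup>2)" for z
  proof -
    have i: "integrable mol_measure (\<lambda>z'. (a \<bullet> (r *\<^sub>R (z' - z)))\<^sup>2)" unfolding sq using i1 i2 by simp
    have "(\<integral>\<^sup>+z'. ennreal ((a \<bullet> (r *\<^sub>R (z' - z)))\<^sup>2) \<partial>mol_measure) = ennreal (\<integral>z'. (a \<bullet> (r *\<^sub>R (z' - z)))\<^sup>2 \<partial>mol_measure)"
      by (rule nn_integral_eq_integral[OF i]) simp
    also have "(\<integral>z'. (a \<bullet> (r *\<^sub>R (z' - z)))\<^sup>2 \<partial>mol_measure) = r\<^sup>2 * ((norm a)\<^sup>2 * c) + r\<^sup>2 * (a \<bullet> z)\<^sup>2"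
      unfolding sq using i1 i2 m1 m2 one by simp
    finally show ?thesis .
  qed
  then have "(\<integral>\<^sup>+z. (\<integral>\<^sup>+z'. ennreal ((a \<bullet> (r *\<^sub>R (z' - z)))\<^sup>2) \<partial>mol_measure) \<partial>mol_measure) =
      (\<integral>\<^sup>+z. ennreal (r\<^sup>2 * ((norm a)\<^sup>2 * c) + r\<^sup>2 * (a \<bullet> z)\<^sup>2) \<partial>mol_measure)" by simp
  also have "\<dots> = ennreal (\<integral>z. r\<^sup>2 * ((norm a)\<^sup>2 * c) + r\<^sup>2 * (a \<bullet> z)\<^sup>2 \<partial>mol_measure)"
    using i2 c by (intro nn_integral_eq_integral) auto
  also have "(\<integral>z. r\<^sup>2 * ((norm a)\<^sup>2 * c) + r\<^sup>2 * (a \<bullet> z)\<^sup>2 \<partial>mol_measure) = 2 * c * r\<^sup>2 * (norm a)\<^sup>2"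
    using i2 m2 one by simp
  finally show ?thesis by (simp add: c_def)
qed

text \<open>Each section is the energy of one shift r (z' - z) and is bounded by the corresponding
  directional derivative. Averaging the squared directional derivative over the displacements gives
  an isotropic multiple of the squared gradient.\<close>

lemma test_function_nonlocal_energy:
  fixes \<phi> :: "'a::euclidean_space \<Rightarrow> real"
  assumes t: "test_function \<Omega> \<phi>" and \<Omega>: "open \<Omega>"
  shows "nonlocal_energy UNIV r \<phi> \<le> ennreal (2 * second_moment TYPE('a) * r\<^sup>2 * (LINT x|lebesgue_on \<Omega>. (norm (gradient \<phi> x))\<^sup>2))"
proof -
  define c where "c = second_moment TYPE('a)"
  have c: "0 < c" by (simp add: c_def second_moment_pos)
  interpret pair_sigma_finite "lborel :: 'a measure" "mol_measure :: 'a measure" ..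
  interpret mm: pair_sigma_finite "mol_measure :: 'a measure" "lborel :: 'a measure" ..
  have [measurable]: "\<phi> \<in> borel_measurable borel" by (rule bbs_measurable[OF bbs_test_function[OF t]])
  have [measurable]: "gradient \<phi> \<in> borel_measurable borel"
    by (rule borel_measurable_continuous_onI[OF gradient_continuous[OF t]])
  let ?F = "\<lambda>x z z'. ennreal ((gradient \<phi> x \<bullet> (r *\<^sub>R (z' - z)))\<^sup>2)"
  have "nonlocal_energy UNIV r \<phi> = (\<integral>\<^sup>+z. (\<integral>\<^sup>+z'. section_energy UNIV r \<phi> z z' \<partial>mol_measure) \<partial>mol_measure)"
    by (rule nonlocal_energy_Tonelli) auto
  also have "\<dots> \<le> (\<integral>\<^sup>+z. (\<integral>\<^sup>+z'. (\<integral>\<^sup>+x. ?F x z z' \<partial>lborel) \<partial>mol_measure) \<partial>mol_measure)"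
  proof (intro nn_integral_mono)
    fix z z'
    have "section_energy UNIV r \<phi> z z' = (\<integral>\<^sup>+x. ennreal ((\<phi> (x + r *\<^sub>R (z' - z)) - \<phi> x)\<^sup>2) \<partial>lborel)"
      by (subst section_energy_UNIV) (auto simp: shift_energy_def)
    also have "\<dots> \<le> (\<integral>\<^sup>+x. ?F x z z' \<partial>lborel)"
      unfolding gradient_inner[OF t] by (rule test_function_translation_energy[OF t])
    finally show "section_energy UNIV r \<phi> z z' \<le> (\<integral>\<^sup>+x. ?F x z z' \<partial>lborel)" .
  qed
  also have "\<dots> = (\<integral>\<^sup>+z. (\<integral>\<^sup>+x. (\<integral>\<^sup>+z'. ?F x z z' \<partial>mol_measure) \<partial>lborel) \<partial>mol_measure)"
    by (intro nn_integral_cong Fubini') measurable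
  also have "\<dots> = (\<integral>\<^sup>+x. (\<integral>\<^sup>+z. (\<integral>\<^sup>+z'. ?F x z z' \<partial>mol_measure) \<partial>mol_measure) \<partial>lborel)"
    by (intro Fubini') measurable
  also have "\<dots> = (\<integral>\<^sup>+x. ennreal (2 * c * r\<^sup>2 * (norm (gradient \<phi> x))\<^sup>2) \<partial>lborel)"
    unfolding mol_quadratic_moment c_def ..
  also have "\<dots> = ennreal (\<integral>x. 2 * c * r\<^sup>2 * (norm (gradient \<phi> x))\<^sup>2 \<partial>lborel)"
    using bbs_integrable[OF bbs_gradient_power2[OF t]] c by (intro nn_integral_eq_integral) auto
  also have "(\<integral>x. 2 * c * r\<^sup>2 * (norm (gradient \<phi> x))\<^sup>2 \<partial>lborel) = 2 * c * r\<^sup>2 * (\<integral>x. (norm (gradient \<phi> x))\<^sup>2 \<partial>lborel)"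
    by simp
  also have "(\<integral>x. (norm (gradient \<phi> x))\<^sup>2 \<partial>lborel) = (LINT x|lebesgue_on \<Omega>. (norm (gradient \<phi> x))\<^sup>2)"
    using lebesgue_on_eq_lborel(1)[OF \<Omega> bbs_measurable[OF bbs_gradient_power2[OF t]]] gradient_outside[OF t] by simp
  finally show ?thesis by (simp add: c_def)
qed

lemma square_add_le: "0 < \<theta> \<Longrightarrow> (a + b)\<^sup>2 \<le> (1 + \<theta>) * a\<^sup>2 + (1 + 1 / \<theta>) * (b::real)\<^sup>2"
proof -
  assume \<theta>: "0 < \<theta>"
  have "(1 + \<theta>) * a\<^sup>2 + (1 + 1 / \<theta>) * b\<^sup>2 - (a + b)\<^sup>2 = (\<theta> * a - b)\<^sup>2 / \<theta>"
    using \<theta> by (simp add: power2_eq_square field_simps)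
  also have "\<dots> \<ge> 0" using \<theta> by simp
  finally show ?thesis by simp
qed

text \<open>For fixed r the nonlocal energy is continuous in L^2. The main term carries the factor 1
  + \<theta> with \<theta> free, since the sharp constant has to survive the approximation by test
  functions.\<close>

lemma nonlocal_energy_perturb:
  fixes f g :: "'a::euclidean_space \<Rightarrow> real"
  assumes [measurable]: "f \<in> borel_measurable borel" "g \<in> borel_measurable borel" and \<theta>: "0 < \<theta>"
  shows "nonlocal_energy UNIV r f \<le> ennreal (1 + \<theta>) * nonlocal_energy UNIV r g +
    ennreal (4 * (1 + 1 / \<theta>)) * (\<integral>\<^sup>+x. ennreal ((f x - g x)\<^sup>2) \<partial>lborel)"
proof -
  define k where "k = 2 * (1 + 1 / \<theta>)"
  have k: "0 < k" using \<theta> by (simp add: k_def add_pos_pos)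
  let ?d = "\<lambda>x. ennreal (k * (f x - g x)\<^sup>2)"
  have pt: "ennreal ((f x - f y)\<^sup>2) \<le> ennreal (1 + \<theta>) * ennreal ((g x - g y)\<^sup>2) + (?d x + ?d y)" for x y
  proof -
    have "(f x - f y)\<^sup>2 = ((g x - g y) + ((f x - g x) - (f y - g y)))\<^sup>2" by simp
    also have "\<dots> \<le> (1 + \<theta>) * (g x - g y)\<^sup>2 + (1 + 1 / \<theta>) * ((f x - g x) - (f y - g y))\<^sup>2"
      by (rule square_add_le[OF \<theta>])
    finally have 1: "(f x - f y)\<^sup>2 \<le> (1 + \<theta>) * (g x - g y)\<^sup>2 + (1 + 1 / \<theta>) * ((f x - g x) - (f y - g y))\<^sup>2" .
    have "((f x - g x) - (f y - g y))\<^sup>2 \<le> 2 * (f x - g x)\<^sup>2 + 2 * (f y - g y)\<^sup>2"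
      using square_le_two_squares[of "f x - g x" "f y - g y" 0] by (simp add: power2_commute[of "g y"])
    then have "(1 + 1 / \<theta>) * ((f x - g x) - (f y - g y))\<^sup>2 \<le> (1 + 1 / \<theta>) * (2 * (f x - g x)\<^sup>2 + 2 * (f y - g y)\<^sup>2)"
      using \<theta> by (intro mult_left_mono) (auto simp: add_nonneg_nonneg)
    also have "\<dots> = k * (f x - g x)\<^sup>2 + k * (f y - g y)\<^sup>2" unfolding k_def by (simp add: algebra_simps)
    finally have "(f x - f y)\<^sup>2 \<le> (1 + \<theta>) * (g x - g y)\<^sup>2 + (k * (f x - g x)\<^sup>2 + k * (f y - g y)\<^sup>2)"
      using 1 by linarith
    then have "ennreal ((f x - f y)\<^sup>2) \<le> ennreal ((1 + \<theta>) * (g x - g y)\<^sup>2 + (k * (f x - g x)\<^sup>2 + k * (f y - g y)\<^sup>2))"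
      by (rule ennreal_leI)
    also have "\<dots> = ennreal (1 + \<theta>) * ennreal ((g x - g y)\<^sup>2) + (?d x + ?d y)"
      using k \<theta> by (simp add: ennreal_mult[symmetric] del: ennreal_plus) (simp add: ennreal_plus[symmetric] del: ennreal_plus)
    finally show ?thesis .
  qed
  have d: "(\<integral>\<^sup>+x. ?d x \<partial>lborel) = ennreal k * (\<integral>\<^sup>+x. ennreal ((f x - g x)\<^sup>2) \<partial>lborel)"
    using k by (simp add: ennreal_mult nn_integral_cmult)
  have one: "emeasure (mol_measure :: 'a measure) UNIV = 1" by (metis mol.emeasure_space_1 space_mol_measure)
  have "nonlocal_energy UNIV r f \<le> (\<integral>\<^sup>+x. (\<integral>\<^sup>+z. (\<integral>\<^sup>+z'. ennreal (1 + \<theta>) * ennreal ((g (x + r *\<^sub>R z) - g (x + r *\<^sub>R z'))\<^sup>2) +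
      (?d (x + r *\<^sub>R z) + ?d (x + r *\<^sub>R z')) \<partial>mol_measure) \<partial>mol_measure) \<partial>lborel)"
    unfolding nonlocal_energy_def by (intro nn_integral_mono) (use pt in simp)
  also have "\<dots> = ennreal (1 + \<theta>) * nonlocal_energy UNIV r g +
     ((\<integral>\<^sup>+x. (\<integral>\<^sup>+z. ?d (x + r *\<^sub>R z) \<partial>mol_measure) \<partial>lborel) + (\<integral>\<^sup>+x. (\<integral>\<^sup>+z'. ?d (x + r *\<^sub>R z') \<partial>mol_measure) \<partial>lborel))"
    unfolding nonlocal_energy_def by (simp add: nn_integral_add nn_integral_cmult one)
  also have "(\<integral>\<^sup>+x. (\<integral>\<^sup>+z. ?d (x + r *\<^sub>R z) \<partial>mol_measure) \<partial>lborel) = (\<integral>\<^sup>+x. ?d x \<partial>lborel)"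
    by (rule nn_integral_avg) measurable
  also have "(\<integral>\<^sup>+x. ?d x \<partial>lborel) + (\<integral>\<^sup>+x. ?d x \<partial>lborel) = ennreal (2 * k) * (\<integral>\<^sup>+x. ennreal ((f x - g x)\<^sup>2) \<partial>lborel)"
  proof -
    have "ennreal (2 * k) = ennreal k + ennreal k" using k by (simp add: ennreal_plus[symmetric] del: ennreal_plus)
    then show ?thesis by (simp only: d distrib_right)
  qed
  finally show ?thesis by (simp add: k_def)
qed

text \<open>Approximation by test functions, with the extension by zero taken on the whole space.
  The constant stays the sharp one of the smooth case, as it will be compared with the eigenvalue at
  order r^2.\<close>

lemma W12_0_nonlocal_energy:
  fixes w :: "'a::euclidean_space \<Rightarrow> real"
  assumes w: "w \<in> W12_0 \<Omega>" and \<Omega>: "open \<Omega>" and m: "(\<lambda>x. indicator \<Omega> x * w x) \<in> borel_measurable borel"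
  shows "nonlocal_energy UNIV r (\<lambda>x. indicator \<Omega> x * w x) \<le>
    ennreal (2 * second_moment TYPE('a) * r\<^sup>2 * (LINT x|lebesgue_on \<Omega>. (norm (weak_gradient \<Omega> w x))\<^sup>2))"
proof -
  have w': "w \<in> W12 \<Omega>" using w by (simp add: W12_0_def)
  obtain \<phi> where t: "\<And>k::nat. test_function \<Omega> (\<phi> k)" and lim: "(\<lambda>k. W12_norm \<Omega> (\<lambda>x. w x - \<phi> k x)) \<longlonglongrightarrow> 0"
    using w unfolding W12_0_def by blast
  define c where "c = second_moment TYPE('a)"
  have c: "0 < c" by (simp add: c_def second_moment_pos)
  define e where "e k = (W12_norm \<Omega> (\<lambda>x. w x - \<phi> k x))\<^sup>2" for k
  have e: "e \<longlonglongrightarrow> 0" unfolding e_def using tendsto_power[OF lim, of 2] by simp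
  define D where "D = (LINT x|lebesgue_on \<Omega>. (norm (weak_gradient \<Omega> w x))\<^sup>2)"
  note G = W12_weak_gradient[OF w' \<Omega>]
  have bound: "nonlocal_energy UNIV r (\<lambda>x. indicator \<Omega> x * w x) \<le>
      ennreal ((1 + \<theta>) * (2 * c * r\<^sup>2 * ((1 + \<theta>) * D + (1 + 1 / \<theta>) * e k)) + 4 * (1 + 1 / \<theta>) * e k)" if \<theta>: "0 < \<theta>" for \<theta> k
  proof -
    note N = W12_norm_add[OF w' t[of k] \<Omega>] and L = test_function_L2[OF t[of k] \<Omega>]
    have n1: "0 \<le> (LINT x|lebesgue_on \<Omega>. (w x - \<phi> k x)\<^sup>2)" "0 \<le> (LINT x|lebesgue_on \<Omega>. (norm (weak_gradient \<Omega> w x - gradient (\<phi> k) x))\<^sup>2)"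
      by (intro integral_nonneg_AE AE_I2 zero_le_power2)+
    have [measurable]: "\<phi> k \<in> borel_measurable borel" by (rule bbs_measurable[OF bbs_test_function[OF t]])
    have "(\<integral>\<^sup>+x. ennreal ((indicator \<Omega> x * w x - \<phi> k x)\<^sup>2) \<partial>lborel) = (\<integral>\<^sup>+x. ennreal ((indicator \<Omega> x * w x - \<phi> k x)\<^sup>2) \<partial>lebesgue_on \<Omega>)"
      using m test_function_outside[OF t] by (intro lebesgue_on_eq_lborel(3)[OF \<Omega>, symmetric]) auto
    also have "\<dots> = (\<integral>\<^sup>+x. ennreal ((w x - \<phi> k x)\<^sup>2) \<partial>lebesgue_on \<Omega>)"
      by (intro nn_integral_cong) (simp add: space_restrict_space)
    also have "\<dots> = ennreal (LINT x|lebesgue_on \<Omega>. (w x - \<phi> k x)\<^sup>2)"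
      by (rule nn_integral_eq_integral[OF N(2)]) simp
    also have "\<dots> \<le> ennreal (e k)" using N(1) n1 by (intro ennreal_leI) (simp add: e_def)
    finally have d: "(\<integral>\<^sup>+x. ennreal ((indicator \<Omega> x * w x - \<phi> k x)\<^sup>2) \<partial>lborel) \<le> ennreal (e k)" .
    have "(LINT x|lebesgue_on \<Omega>. (norm (gradient (\<phi> k) x))\<^sup>2) \<le>
        (LINT x|lebesgue_on \<Omega>. (1 + \<theta>) * (norm (weak_gradient \<Omega> w x))\<^sup>2 + (1 + 1 / \<theta>) * (norm (weak_gradient \<Omega> w x - gradient (\<phi> k) x))\<^sup>2)"
    proof (rule integral_mono)
      fix x
      have "norm (gradient (\<phi> k) x) \<le> norm (weak_gradient \<Omega> w x) + norm (weak_gradient \<Omega> w x - gradient (\<phi> k) x)"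
        by (metis norm_minus_commute norm_triangle_sub)
      then have "(norm (gradient (\<phi> k) x))\<^sup>2 \<le> (norm (weak_gradient \<Omega> w x) + norm (weak_gradient \<Omega> w x - gradient (\<phi> k) x))\<^sup>2"
        by (rule power_mono) simp
      also have "\<dots> \<le> (1 + \<theta>) * (norm (weak_gradient \<Omega> w x))\<^sup>2 + (1 + 1 / \<theta>) * (norm (weak_gradient \<Omega> w x - gradient (\<phi> k) x))\<^sup>2"
        by (rule square_add_le[OF \<theta>])
      finally show "(norm (gradient (\<phi> k) x))\<^sup>2 \<le> (1 + \<theta>) * (norm (weak_gradient \<Omega> w x))\<^sup>2 + (1 + 1 / \<theta>) * (norm (weak_gradient \<Omega> w x - gradient (\<phi> k) x))\<^sup>2" .
    qed (use L(4) G(3) N(3) in auto)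
    also have "\<dots> = (1 + \<theta>) * D + (1 + 1 / \<theta>) * (LINT x|lebesgue_on \<Omega>. (norm (weak_gradient \<Omega> w x - gradient (\<phi> k) x))\<^sup>2)"
      using G(3) N(3) by (simp add: D_def)
    also have "\<dots> \<le> (1 + \<theta>) * D + (1 + 1 / \<theta>) * e k"
      using N(1) n1 \<theta> by (intro add_left_mono mult_left_mono) (auto simp: e_def add_nonneg_nonneg)
    finally have grad: "(LINT x|lebesgue_on \<Omega>. (norm (gradient (\<phi> k) x))\<^sup>2) \<le> (1 + \<theta>) * D + (1 + 1 / \<theta>) * e k" .
    have p: "0 \<le> D" "0 \<le> e k" "0 \<le> 1 + 1 / \<theta>" "0 \<le> 1 + \<theta>"
      using \<theta> by (auto simp: D_def e_def intro!: integral_nonneg_AE)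
    have "nonlocal_energy UNIV r (\<phi> k) \<le> ennreal (2 * c * r\<^sup>2 * (LINT x|lebesgue_on \<Omega>. (norm (gradient (\<phi> k) x))\<^sup>2))"
      unfolding c_def by (rule test_function_nonlocal_energy[OF t \<Omega>])
    also have "\<dots> \<le> ennreal (2 * c * r\<^sup>2 * ((1 + \<theta>) * D + (1 + 1 / \<theta>) * e k))"
      using grad c by (intro ennreal_leI mult_left_mono) auto
    finally have ne: "nonlocal_energy UNIV r (\<phi> k) \<le> ennreal (2 * c * r\<^sup>2 * ((1 + \<theta>) * D + (1 + 1 / \<theta>) * e k))" .
    have "nonlocal_energy UNIV r (\<lambda>x. indicator \<Omega> x * w x) \<le> ennreal (1 + \<theta>) * nonlocal_energy UNIV r (\<phi> k) +
      ennreal (4 * (1 + 1 / \<theta>)) * (\<integral>\<^sup>+x. ennreal ((indicator \<Omega> x * w x - \<phi> k x)\<^sup>2) \<partial>lborel)"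
      by (rule nonlocal_energy_perturb[OF m _ \<theta>]) measurable
    also have "\<dots> \<le> ennreal (1 + \<theta>) * ennreal (2 * c * r\<^sup>2 * ((1 + \<theta>) * D + (1 + 1 / \<theta>) * e k)) + ennreal (4 * (1 + 1 / \<theta>)) * ennreal (e k)"
      using ne d by (intro add_mono mult_left_mono) auto
    also have "\<dots> = ennreal ((1 + \<theta>) * (2 * c * r\<^sup>2 * ((1 + \<theta>) * D + (1 + 1 / \<theta>) * e k)) + 4 * (1 + 1 / \<theta>) * e k)"
      using p c by (subst ennreal_plus) (auto simp del: ennreal_plus simp: ennreal_mult intro!: mult_nonneg_nonneg add_nonneg_nonneg)
    finally show ?thesis .
  qed
  \<comment> \<open>For fixed \<theta> the approximation error vanishes as k grows; only afterwards
    is \<theta> = 1 / (n + 1) sent to 0.\<close>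
  have b2: "nonlocal_energy UNIV r (\<lambda>x. indicator \<Omega> x * w x) \<le> ennreal ((1 + \<theta>) * (2 * c * r\<^sup>2 * ((1 + \<theta>) * D)))" if \<theta>: "0 < \<theta>" for \<theta>
  proof (rule LIMSEQ_le_const)
    have "(\<lambda>k. (1 + \<theta>) * (2 * c * r\<^sup>2 * ((1 + \<theta>) * D + (1 + 1 / \<theta>) * e k)) + 4 * (1 + 1 / \<theta>) * e k) \<longlonglongrightarrow>
        (1 + \<theta>) * (2 * c * r\<^sup>2 * ((1 + \<theta>) * D + (1 + 1 / \<theta>) * 0)) + 4 * (1 + 1 / \<theta>) * 0"
      by (intro tendsto_intros e)
    then show "(\<lambda>k. ennreal ((1 + \<theta>) * (2 * c * r\<^sup>2 * ((1 + \<theta>) * D + (1 + 1 / \<theta>) * e k)) + 4 * (1 + 1 / \<theta>) * e k)) \<longlonglongrightarrow>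
        ennreal ((1 + \<theta>) * (2 * c * r\<^sup>2 * ((1 + \<theta>) * D)))"
      by (intro tendsto_ennrealI) simp
  qed (use bound[OF \<theta>] in blast)
  show ?thesis
  proof (rule LIMSEQ_le_const)
    have z: "(\<lambda>n. 1 / real (Suc n)) \<longlonglongrightarrow> 0" by (rule LIMSEQ_Suc[OF lim_1_over_n])
    have "(\<lambda>n. (1 + 1 / real (Suc n)) * (2 * c * r\<^sup>2 * ((1 + 1 / real (Suc n)) * D))) \<longlonglongrightarrow> (1 + 0) * (2 * c * r\<^sup>2 * ((1 + 0) * D))"
      by (intro tendsto_intros z)
    then show "(\<lambda>n. ennreal ((1 + 1 / real (Suc n)) * (2 * c * r\<^sup>2 * ((1 + 1 / real (Suc n)) * D)))) \<longlonglongrightarrow>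
        ennreal (2 * second_moment TYPE('a) * r\<^sup>2 * (LINT x|lebesgue_on \<Omega>. (norm (weak_gradient \<Omega> w x))\<^sup>2))"
      by (intro tendsto_ennrealI) (simp add: c_def D_def)
    show "\<exists>N. \<forall>n\<ge>N. nonlocal_energy UNIV r (\<lambda>x. indicator \<Omega> x * w x) \<le> ennreal ((1 + 1 / real (Suc n)) * (2 * c * r\<^sup>2 * ((1 + 1 / real (Suc n)) * D)))"
      by (intro exI[of _ 0] allI impI b2) simp
  qed
qed

section \<open>The Euler-Lagrange equation\<close>

lemma ext_integral_integrable:
  assumes "integrable M f"
  shows "ext_integral M f = ereal (integral\<^sup>L M f)"
proof -
  have fin: "(\<integral>\<^sup>+x. ennreal (f x) \<partial>M) \<noteq> \<infinity>" "(\<integral>\<^sup>+x. ennreal (- f x) \<partial>M) \<noteq> \<infinity>"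
    using integrableD(2,3)[OF assms] by auto
  have e: "enn2ereal a = ereal (enn2real a)" if "a \<noteq> \<infinity>" for a
    using that by (cases a) auto
  show ?thesis
    unfolding ext_integral_def e[OF fin(1)] e[OF fin(2)] real_lebesgue_integral_def[OF assms] by simp
qed

lemma integrable_of_ext_integral:
  fixes f :: "'a \<Rightarrow> real"
  assumes f: "f \<in> borel_measurable M" and neg: "(\<integral>\<^sup>+x. ennreal (- f x) \<partial>M) \<noteq> \<infinity>" and "ext_integral M f \<noteq> \<infinity>"
  shows "integrable M f"
proof -
  have "(\<integral>\<^sup>+x. ennreal (f x) \<partial>M) \<noteq> \<infinity>"
  proof
    assume "(\<integral>\<^sup>+x. ennreal (f x) \<partial>M) = \<infinity>"
    then have "ext_integral M f = \<infinity>"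
      unfolding ext_integral_def by (simp add: ereal_minus_eq_PInfty_iff)
    with assms(3) show False by simp
  qed
  then show ?thesis using f neg by (simp add: real_integrable_def)
qed

text \<open>Fix p with a ball in \<Omega>. Each x has an opposite point y in that ball such that p
  lies between y and x; convexity bounds V p by V y and V x, which gives a lower bound for V x
  because V is bounded on the ball.\<close>

lemma convex_on_bounded_below:
  fixes V :: "'a::euclidean_space \<Rightarrow> real"
  assumes \<Omega>: "open \<Omega>" "bounded \<Omega>" and V: "convex_on \<Omega> V"
  shows "\<exists>C\<ge>0. \<forall>x\<in>\<Omega>. - C \<le> V x"
proof (cases "\<Omega> = {}")
  case False
  then obtain p where p: "p \<in> \<Omega>" by blast
  then obtain \<rho> where \<rho>: "0 < \<rho>" "cball p \<rho> \<subseteq> \<Omega>" using open_contains_cball \<Omega>(1) by blast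
  have "continuous_on (cball p \<rho>) V"
    using convex_on_continuous[OF \<Omega>(1) V] \<rho>(2) by (rule continuous_on_subset)
  then have "bounded (V ` cball p \<rho>)" by (intro compact_imp_bounded compact_continuous_image) auto
  then obtain M where M': "\<forall>v\<in>V ` cball p \<rho>. norm v \<le> M" unfolding bounded_iff by blast
  have M: "\<bar>V y\<bar> \<le> M" if "y \<in> cball p \<rho>" for y using M' that by simp
  obtain R where R: "0 < R" "\<And>x. x \<in> \<Omega> \<Longrightarrow> dist p x \<le> R"
  proof -
    obtain e where "\<forall>x\<in>\<Omega>. dist p x \<le> e" using \<Omega>(2) bounded_any_center[of \<Omega> p] by blast
    then show ?thesis by (intro that[of "max e 1"]) (auto simp: le_max_iff_disj)
  qed
  define B where "B = ((R + \<rho>) * V p - R * M) / \<rho>"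
  have "B \<le> V x" if x: "x \<in> \<Omega>" for x
  proof -
    \<comment> \<open>Reflection of x at p, shrunk into the ball, so that p is the combination of y
      and x with weights R / (R + \<rho>) and \<rho> / (R + \<rho>).\<close>
    define y where "y = p - (\<rho> / R) *\<^sub>R (x - p)"
    have "dist p y = \<rho> / R * dist p x" using R \<rho> by (simp add: y_def dist_norm norm_minus_commute)
    also have "\<dots> \<le> \<rho> / R * R" using R \<rho> x by (intro mult_left_mono) auto
    finally have y: "y \<in> cball p \<rho>" using R by simp
    have "(1 - \<rho> / (R + \<rho>)) *\<^sub>R y + (\<rho> / (R + \<rho>)) *\<^sub>R x = p"
    proof -
      have c: "1 - \<rho> / (R + \<rho>) = R / (R + \<rho>)" using R \<rho> by (simp add: field_simps)
      have "(R / (R + \<rho>)) *\<^sub>R y = (R / (R + \<rho>)) *\<^sub>R p - (\<rho> / (R + \<rho>)) *\<^sub>R (x - p)"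
        using R by (simp add: y_def scaleR_diff_right)
      then have "(1 - \<rho> / (R + \<rho>)) *\<^sub>R y + (\<rho> / (R + \<rho>)) *\<^sub>R x = (R / (R + \<rho>)) *\<^sub>R p + (\<rho> / (R + \<rho>)) *\<^sub>R p"
        unfolding c by (simp add: scaleR_diff_right)
      also have "\<dots> = ((R + \<rho>) / (R + \<rho>)) *\<^sub>R p" by (simp only: scaleR_add_left[symmetric] add_divide_distrib[symmetric])
      finally show ?thesis using R \<rho> by simp
    qed
    then have "V p \<le> (1 - \<rho> / (R + \<rho>)) * V y + (\<rho> / (R + \<rho>)) * V x"
      using convex_onD[OF V, of "\<rho> / (R + \<rho>)" y x] R \<rho> x y by auto
    also have "\<dots> \<le> (1 - \<rho> / (R + \<rho>)) * M + (\<rho> / (R + \<rho>)) * V x"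
      using M[OF y] R \<rho> by (intro add_right_mono mult_left_mono) (auto simp: field_simps)
    also have "\<dots> = (R * M + \<rho> * V x) / (R + \<rho>)"
    proof -
      have "1 - \<rho> / (R + \<rho>) = R / (R + \<rho>)" using R \<rho> by (simp add: field_simps)
      then show ?thesis by (simp add: add_divide_distrib)
    qed
    finally have "V p * (R + \<rho>) \<le> R * M + \<rho> * V x" using R \<rho> by (simp add: le_divide_eq)
    then show ?thesis using \<rho> by (simp add: B_def divide_le_eq algebra_simps)
  qed
  then show ?thesis by (intro exI[of _ "\<bar>B\<bar>"]) (auto intro: order_trans[of "- \<bar>B\<bar>" B])
qed (auto intro: exI[of _ 0])

locale dirichlet_eigenfunction =
  fixes \<Omega> :: "'a::euclidean_space set" and V u :: "'a \<Rightarrow> real"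
  assumes open_\<Omega>: "open \<Omega>" and bounded_\<Omega>: "bounded \<Omega>" and convex_\<Omega>: "convex \<Omega>"
    and convex_V: "convex_on \<Omega> V"
    and eigenfunction: "first_dirichlet_eigenfunction \<Omega> V u"
begin

lemma continuous_V: "continuous_on \<Omega> V"
  by (rule convex_on_continuous[OF open_\<Omega> convex_V])

lemma continuous_u: "continuous_on \<Omega> u" and u_pos: "x \<in> \<Omega> \<Longrightarrow> 0 < u x"
  and u_W12_0: "u \<in> W12_0 \<Omega>" and u_nonzero: "\<not> (AE x in lebesgue_on \<Omega>. u x = 0)"
  using eigenfunction by (auto simp: first_dirichlet_eigenfunction_def W12_0_nonzero_def)

lemma u_W12: "u \<in> W12 \<Omega>"
  using u_W12_0 by (simp add: W12_0_def)

abbreviation "G \<equiv> weak_gradient \<Omega> u"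

lemmas G = W12_weak_gradient[OF u_W12 open_\<Omega>]

lemma indicator_measurable:
  assumes "continuous_on \<Omega> f"
  shows "(\<lambda>x. indicator \<Omega> x * f x :: real) \<in> borel_measurable borel"
  using borel_measurable_continuous_on_indicator[OF _ assms] open_\<Omega> by simp

lemma measurable_on:
  assumes "continuous_on \<Omega> f"
  shows "(f :: 'a \<Rightarrow> real) \<in> borel_measurable (lebesgue_on \<Omega>)"
proof -
  have "(\<lambda>x. indicator \<Omega> x * f x) \<in> borel_measurable (lebesgue_on \<Omega>)"
    by (rule lebesgue_on_measurable[OF indicator_measurable[OF assms]])
  then show ?thesis by (rule measurable_cong[THEN iffD1, rotated]) (simp add: space_restrict_space)
qed

lemma u_L2: "integrable (lebesgue_on \<Omega>) (\<lambda>x. (u x)\<^sup>2)"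
  using u_W12 by (simp add: W12_def)

definition mass :: real where "mass = (LINT x|lebesgue_on \<Omega>. (u x)\<^sup>2)"

lemma L2_pos:
  assumes "integrable (lebesgue_on \<Omega>) (\<lambda>x. (f x :: real)\<^sup>2)" "\<not> (AE x in lebesgue_on \<Omega>. f x = 0)"
  shows "0 < (LINT x|lebesgue_on \<Omega>. (f x)\<^sup>2)"
proof -
  have "(LINT x|lebesgue_on \<Omega>. (f x)\<^sup>2) \<noteq> 0"
    using assms integral_nonneg_eq_0_iff_AE[OF assms(1)] by simp
  moreover have "0 \<le> (LINT x|lebesgue_on \<Omega>. (f x)\<^sup>2)" by (intro integral_nonneg_AE) simp
  ultimately show ?thesis by linarith
qed

lemma mass_pos: "0 < mass"
  unfolding mass_def by (rule L2_pos[OF u_L2 u_nonzero])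

lemma integrable_local:
  assumes "continuous_on \<Omega> f" "test_function \<Omega> \<phi>"
  shows "integrable (lebesgue_on \<Omega>) (\<lambda>x. f x * \<phi> x)"
  by (rule locally_integrable_mult[OF locally_integrable_continuous[OF assms(1)] open_\<Omega> assms(2)])

lemma test_function_W12_0:
  assumes t: "test_function \<Omega> \<psi>" and w: "w \<in> W12_0 \<Omega>"
  shows "(\<lambda>x. w x + c * \<psi> x) \<in> W12_0 \<Omega>"
proof -
  have w': "w \<in> W12 \<Omega>" using w by (simp add: W12_0_def)
  obtain \<phi> where \<phi>: "\<And>k::nat. test_function \<Omega> (\<phi> k)" "(\<lambda>k. W12_norm \<Omega> (\<lambda>x. w x - \<phi> k x)) \<longlonglongrightarrow> 0"
    using w unfolding W12_0_def by blast
  have "test_function \<Omega> (\<lambda>x. \<phi> k x + c * \<psi> x)" for k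
    by (rule test_function_add[OF \<phi>(1) test_function_cmult[OF t]])
  moreover have "(\<lambda>k. W12_norm \<Omega> (\<lambda>x. (w x + c * \<psi> x) - (\<phi> k x + c * \<psi> x))) \<longlonglongrightarrow> 0"
    using \<phi>(2) by simp
  ultimately show ?thesis
    unfolding W12_0_def using W12_add_test_function(1)[OF w' t open_\<Omega>, of c] by (auto intro!: exI[of _ "\<lambda>k x. \<phi> k x + c * \<psi> x"])
qed

text \<open>Adding multiples of test functions to this element places the test functions themselves
  in the space, among them the competitor used to show that the eigenvalue is finite.\<close>

lemma zero_W12_0: "(\<lambda>x. 0) \<in> W12_0 \<Omega>"
proof -
  have t: "test_function \<Omega> (\<lambda>x. 0)" by (simp add: test_function_def C_k_const)
  have g: "gradient (\<lambda>x::'a. 0) = (\<lambda>x. 0)" by (simp add: gradient_def fun_eq_iff)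
  have W: "(\<lambda>x. 0) \<in> W12 \<Omega>"
    unfolding W12_def using test_function_is_weak_gradient[OF t open_\<Omega>] by (auto intro!: exI[of _ "\<lambda>x. 0"] simp: g)
  have "AE x in lebesgue_on \<Omega>. weak_gradient \<Omega> (\<lambda>x. 0) x = 0"
    using is_weak_gradient_unique[OF W12_weak_gradient(1)[OF W open_\<Omega>] test_function_is_weak_gradient[OF t open_\<Omega>] open_\<Omega>] by (simp add: g)
  then have "AE x in lebesgue_on \<Omega>. (norm (weak_gradient \<Omega> (\<lambda>x. 0) x - gradient (\<lambda>x. 0) x))\<^sup>2 = 0"
    unfolding g by eventually_elim simp
  then have "(LINT x|lebesgue_on \<Omega>. (norm (weak_gradient \<Omega> (\<lambda>x. 0) x - gradient (\<lambda>x. 0) x))\<^sup>2) = 0"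
    by (rule integral_eq_zero_AE)
  then have "W12_norm \<Omega> (\<lambda>x. 0 - 0) = 0"
    using W12_norm_add(1)[OF W t open_\<Omega>] by simp
  then show ?thesis unfolding W12_0_def using W t by (auto intro!: exI[of _ "\<lambda>k x. 0"])
qed

lemma potential_square_integrable_test:
  assumes t: "test_function \<Omega> \<psi>"
  shows "integrable (lebesgue_on \<Omega>) (\<lambda>x. V x * (\<psi> x)\<^sup>2)"
  using integrable_local[OF continuous_V test_function_mult[OF t test_function_C_k[OF t]]]
  by (simp add: power2_eq_square)

lemma rayleigh_eq:
  assumes "w \<in> W12 \<Omega>" "integrable (lebesgue_on \<Omega>) (\<lambda>x. V x * (w x)\<^sup>2)" "0 < (LINT x|lebesgue_on \<Omega>. (w x)\<^sup>2)"
  shows "rayleigh_quotient \<Omega> V w = ereal (((LINT x|lebesgue_on \<Omega>. (norm (weak_gradient \<Omega> w x))\<^sup>2) + (LINT x|lebesgue_on \<Omega>. V x * (w x)\<^sup>2))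
     / (LINT x|lebesgue_on \<Omega>. (w x)\<^sup>2))"
  using W12_weak_gradient(3)[OF assms(1) open_\<Omega>] assms(2,3)
  unfolding rayleigh_quotient_def by (simp add: ext_integral_integrable)

lemma eigenvalue_le:
  assumes "w \<in> W12_0_nonzero \<Omega>"
  shows "first_dirichlet_eigenvalue \<Omega> V \<le> rayleigh_quotient \<Omega> V w"
  unfolding first_dirichlet_eigenvalue_def using assms by (rule INF_lower)

lemma nonempty_\<Omega>: "\<Omega> \<noteq> {}"
proof
  assume "\<Omega> = {}"
  then have "AE x in lebesgue_on \<Omega>. u x = 0" by (intro AE_I2) (simp add: space_restrict_space)
  with u_nonzero show False by simp
qed

lemma eigenvalue_finite: "first_dirichlet_eigenvalue \<Omega> V \<noteq> \<infinity>"
proof -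
  obtain p where "p \<in> \<Omega>" using nonempty_\<Omega> by blast
  then obtain \<rho> where \<rho>: "0 < \<rho>" "cball p \<rho> \<subseteq> \<Omega>" using open_contains_cball open_\<Omega> by blast
  let ?\<psi> = "scaled_bump p \<rho>"
  have t: "test_function \<Omega> ?\<psi>" by (rule test_function_scaled_bump[OF \<rho>])
  have W: "?\<psi> \<in> W12_0 \<Omega>" using test_function_W12_0[OF t zero_W12_0, of 1] by simp
  have "0 < (\<integral>x. (?\<psi> x)\<^sup>2 \<partial>lborel)"
  proof (rule bbs_integral_pos[where a = p and r = "\<rho> / 2" and k = "(exp (- 3))\<^sup>2"])
    show "bbs (\<lambda>x. (?\<psi> x)\<^sup>2)" by (rule bbs_power2[OF bbs_test_function[OF t]])
    show "(exp (- 3))\<^sup>2 \<le> (?\<psi> x)\<^sup>2" if "x \<in> ball p (\<rho> / 2)" for x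
    proof -
      have "norm ((1 / \<rho>) *\<^sub>R (x - p)) \<le> 1 / 2" 
        unfolding norm_scaleR using that \<rho> by (simp add: dist_norm norm_minus_commute field_simps)
      from norm_half_profile(2)[OF disjI2[OF this]] have "exp (- 3) \<le> ?\<psi> x"
        using \<rho> by (simp add: scaled_bump_def power_divide)
      then show ?thesis by (rule power_mono) simp
    qed
  qed (use \<rho> in auto)
  also have "(\<integral>x. (?\<psi> x)\<^sup>2 \<partial>lborel) = (LINT x|lebesgue_on \<Omega>. (?\<psi> x)\<^sup>2)"
    using bbs_measurable[OF bbs_power2[OF bbs_test_function[OF t]]] test_function_outside[OF t]
    by (intro lebesgue_on_eq_lborel(1)[OF open_\<Omega>, symmetric]) auto
  finally have pos: "0 < (LINT x|lebesgue_on \<Omega>. (?\<psi> x)\<^sup>2)" .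
  have "\<not> (AE x in lebesgue_on \<Omega>. ?\<psi> x = 0)"
  proof
    assume "AE x in lebesgue_on \<Omega>. ?\<psi> x = 0"
    then have "AE x in lebesgue_on \<Omega>. (?\<psi> x)\<^sup>2 = 0" by eventually_elim simp
    then have "(LINT x|lebesgue_on \<Omega>. (?\<psi> x)\<^sup>2) = 0" by (rule integral_eq_zero_AE)
    with pos show False by simp
  qed
  then have "first_dirichlet_eigenvalue \<Omega> V \<le> rayleigh_quotient \<Omega> V ?\<psi>"
    using W by (intro eigenvalue_le) (simp add: W12_0_nonzero_def)
  moreover have "rayleigh_quotient \<Omega> V ?\<psi> \<noteq> \<infinity>"
    using W by (subst rayleigh_eq[OF _ potential_square_integrable_test[OF t] pos]) (auto simp: W12_0_def)
  ultimately show ?thesis by auto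
qed

text \<open>The eigenvalue is less than infinity by comparison with a bump, so the extended integral
  in the quotient of \<open>u\<close> is too. As V is bounded below, its negative part is at most a
  multiple of the integral of u^2, hence the integrand is integrable, and subtracting the gradient
  term leaves the potential term.\<close>

lemma potential_energy_integrable: "integrable (lebesgue_on \<Omega>) (\<lambda>x. V x * (u x)\<^sup>2)"
proof -
  let ?M = "lebesgue_on \<Omega>" and ?f = "\<lambda>x. (norm (G x))\<^sup>2 + V x * (u x)\<^sup>2"
  obtain C where C: "0 \<le> C" "\<And>x. x \<in> \<Omega> \<Longrightarrow> - C \<le> V x"
    using convex_on_bounded_below[OF open_\<Omega> bounded_\<Omega> convex_V] by blast
  note [measurable] = measurable_on[OF continuous_V] measurable_on[OF continuous_u] G(2)
  have "(\<integral>\<^sup>+x. ennreal (- ?f x) \<partial>?M) \<le> (\<integral>\<^sup>+x. ennreal (C * (u x)\<^sup>2) \<partial>?M)"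
  proof (intro nn_integral_mono ennreal_leI)
    fix x assume "x \<in> space ?M"
    then have "- C * (u x)\<^sup>2 \<le> V x * (u x)\<^sup>2"
      using C by (intro mult_right_mono) (auto simp: space_restrict_space)
    then show "- ?f x \<le> C * (u x)\<^sup>2" by (smt (verit) minus_mult_left zero_le_power2)
  qed
  also have "\<dots> = ennreal (LINT x|?M. C * (u x)\<^sup>2)"
    using u_L2 C by (intro nn_integral_eq_integral) auto
  finally have neg: "(\<integral>\<^sup>+x. ennreal (- ?f x) \<partial>?M) \<noteq> \<infinity>" by (auto simp: top_unique)
  have "ext_integral ?M ?f \<noteq> \<infinity>"
  proof
    assume "ext_integral ?M ?f = \<infinity>"
    then have "rayleigh_quotient \<Omega> V u = \<infinity>"
      using mass_pos by (simp add: rayleigh_quotient_def mass_def)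
    then show False using eigenvalue_finite eigenfunction by (simp add: first_dirichlet_eigenfunction_def)
  qed
  then have "integrable ?M ?f" by (intro integrable_of_ext_integral neg) measurable
  from Bochner_Integration.integrable_diff[OF this G(3)] show ?thesis by simp
qed

definition dirichlet_energy :: real where "dirichlet_energy = (LINT x|lebesgue_on \<Omega>. (norm (G x))\<^sup>2)"
definition potential_energy :: real where "potential_energy = (LINT x|lebesgue_on \<Omega>. V x * (u x)\<^sup>2)"
definition eigenvalue :: real where "eigenvalue = (dirichlet_energy + potential_energy) / mass"

lemma first_dirichlet_eigenvalue_eq: "first_dirichlet_eigenvalue \<Omega> V = ereal eigenvalue"
  using rayleigh_eq[OF u_W12 potential_energy_integrable] mass_pos eigenfunction
  by (simp add: first_dirichlet_eigenfunction_def eigenvalue_def mass_def dirichlet_energy_def potential_energy_def)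

lemma energy_balance: "dirichlet_energy + potential_energy = eigenvalue * mass"
  using mass_pos by (simp add: eigenvalue_def)

text \<open>Minimality along u + s \<psi> reads 0 \<le> 2 s b + s^2 d for all real s, where b is the
  first variation. The constant term is 0, so the discriminant inequality forces b = 0.\<close>

lemma Euler_Lagrange:
  assumes t: "test_function \<Omega> \<psi>"
  shows "(LINT x|lebesgue_on \<Omega>. G x \<bullet> gradient \<psi> x) + (LINT x|lebesgue_on \<Omega>. (V x * u x) * \<psi> x) = eigenvalue * (LINT x|lebesgue_on \<Omega>. u x * \<psi> x)"
proof -
  let ?M = "lebesgue_on \<Omega>"
  note L = test_function_L2[OF t open_\<Omega>]
  note um = measurable_on[OF continuous_u]
  define b where "b = (LINT x|?M. G x \<bullet> gradient \<psi> x) + (LINT x|?M. (V x * u x) * \<psi> x) - eigenvalue * (LINT x|?M. u x * \<psi> x)"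
  define d where "d = (LINT x|?M. (norm (gradient \<psi> x))\<^sup>2) + (LINT x|?M. V x * (\<psi> x)\<^sup>2) - eigenvalue * (LINT x|?M. (\<psi> x)\<^sup>2)"
  have i: "integrable ?M (\<lambda>x. (V x * u x) * \<psi> x)"
    by (rule integrable_local[OF continuous_on_mult[OF continuous_V continuous_u] t])
  have q: "0 \<le> 2 * s * b + s\<^sup>2 * d" for s
  proof -
    let ?v = "\<lambda>x. u x + s * \<psi> x"
    have v0: "?v \<in> W12_0 \<Omega>" by (rule test_function_W12_0[OF t u_W12_0])
    then have v: "?v \<in> W12 \<Omega>" by (simp add: W12_0_def)
    note Gv = W12_weak_gradient[OF v open_\<Omega>]
    have v2: "integrable ?M (\<lambda>x. (?v x)\<^sup>2)" using v by (simp add: W12_def)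
    have Vv: "V x * (?v x)\<^sup>2 = V x * (u x)\<^sup>2 + 2 * s * ((V x * u x) * \<psi> x) + s\<^sup>2 * (V x * (\<psi> x)\<^sup>2)" for x
      by (simp add: power2_eq_square algebra_simps)
    have iV: "integrable ?M (\<lambda>x. V x * (?v x)\<^sup>2)"
      unfolding Vv using potential_energy_integrable i potential_square_integrable_test[OF t] by simp
    have "(LINT x|?M. (norm (weak_gradient \<Omega> ?v x))\<^sup>2) = (LINT x|?M. (norm (G x + s *\<^sub>R gradient \<psi> x))\<^sup>2)"
    proof (rule integral_cong_AE)
      show "AE x in ?M. (norm (weak_gradient \<Omega> ?v x))\<^sup>2 = (norm (G x + s *\<^sub>R gradient \<psi> x))\<^sup>2"
        using W12_add_test_function(2)[OF u_W12 t open_\<Omega>, of s] by eventually_elim simp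
    qed (rule borel_measurable_integrable[OF Gv(3)] borel_measurable_integrable[OF integrable_add_L2(1)[OF G(2) L(2) G(3) L(4)]])+
    also have "\<dots> = dirichlet_energy + 2 * s * (LINT x|?M. G x \<bullet> gradient \<psi> x) + s\<^sup>2 * (LINT x|?M. (norm (gradient \<psi> x))\<^sup>2)"
      unfolding dirichlet_energy_def by (rule integrable_add_L2(2)[OF G(2) L(2) G(3) L(4)])
    finally have e1: "(LINT x|?M. (norm (weak_gradient \<Omega> ?v x))\<^sup>2) =
      dirichlet_energy + 2 * s * (LINT x|?M. G x \<bullet> gradient \<psi> x) + s\<^sup>2 * (LINT x|?M. (norm (gradient \<psi> x))\<^sup>2)" .
    have e2: "(LINT x|?M. V x * (?v x)\<^sup>2) = potential_energy + 2 * s * (LINT x|?M. (V x * u x) * \<psi> x) + s\<^sup>2 * (LINT x|?M. V x * (\<psi> x)\<^sup>2)"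
      unfolding Vv potential_energy_def using potential_energy_integrable i potential_square_integrable_test[OF t] by simp
    have e3: "(LINT x|?M. (?v x)\<^sup>2) = mass + 2 * s * (LINT x|?M. u x * \<psi> x) + s\<^sup>2 * (LINT x|?M. (\<psi> x)\<^sup>2)"
      using integrable_add_L2(2)[OF um L(1), of s] u_L2 L(3) by (simp add: mass_def mult.commute)
    have "eigenvalue * (LINT x|?M. (?v x)\<^sup>2) \<le> (LINT x|?M. (norm (weak_gradient \<Omega> ?v x))\<^sup>2) + (LINT x|?M. V x * (?v x)\<^sup>2)"
    \<comment> \<open>If u + s \<psi> vanishes almost everywhere its Rayleigh quotient is no
      competitor, but the inequality freed of the denominator is then trivial.\<close>
    proof (cases "AE x in ?M. ?v x = 0")
      case True
      then have "AE x in ?M. (?v x)\<^sup>2 = 0" by eventually_elim simp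
      moreover from True have "AE x in ?M. V x * (?v x)\<^sup>2 = 0" by eventually_elim simp
      ultimately have "(LINT x|?M. (?v x)\<^sup>2) = 0" "(LINT x|?M. V x * (?v x)\<^sup>2) = 0" by (auto intro: integral_eq_zero_AE)
      moreover have "0 \<le> (LINT x|?M. (norm (weak_gradient \<Omega> ?v x))\<^sup>2)" by (intro integral_nonneg_AE) simp
      ultimately show ?thesis by simp
    next
      case False
      have pos: "0 < (LINT x|?M. (?v x)\<^sup>2)" by (rule L2_pos[OF v2 False])
      have "first_dirichlet_eigenvalue \<Omega> V \<le> rayleigh_quotient \<Omega> V ?v"
        using v0 False by (intro eigenvalue_le) (simp add: W12_0_nonzero_def)
      then have "eigenvalue \<le> ((LINT x|?M. (norm (weak_gradient \<Omega> ?v x))\<^sup>2) + (LINT x|?M. V x * (?v x)\<^sup>2)) / (LINT x|?M. (?v x)\<^sup>2)"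
        unfolding first_dirichlet_eigenvalue_eq rayleigh_eq[OF v iV pos] by simp
      then show ?thesis using pos by (simp add: le_divide_eq)
    qed
    then show ?thesis unfolding e1 e2 e3 using energy_balance by (simp add: b_def d_def algebra_simps)
  qed
  \<comment> \<open>Add the inequalities for s = 1 and s = -1.\<close>
  have "0 \<le> d" using q[of 1] q[of "- 1"] by simp
  then have "b\<^sup>2 \<le> 0 * d" using q by (intro quadratic_discriminant) auto
  then have "b = 0" by simp
  then show ?thesis by (simp add: b_def)
qed

lemma weak_equation:
  assumes t: "test_function \<Omega> \<psi>"
  shows "(LINT x|lebesgue_on \<Omega>. u x * (\<Sum>i\<in>Basis. frechet_derivative (\<lambda>y. frechet_derivative \<psi> (at y) i) (at x) i)) =
    (LINT x|lebesgue_on \<Omega>. ((V x - eigenvalue) * u x) * \<psi> x)"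
proof -
  let ?M = "lebesgue_on \<Omega>"
  have ti: "test_function \<Omega> (\<lambda>x. frechet_derivative \<psi> (at x) i)" if "i \<in> Basis" for i
    by (rule test_function_deriv[OF t that])
  have i1: "integrable ?M (\<lambda>x. u x * frechet_derivative (\<lambda>y. frechet_derivative \<psi> (at y) i) (at x) i)" if "i \<in> Basis" for i
    by (rule integrable_local[OF continuous_u test_function_deriv[OF ti[OF that] that]])
  have i2: "integrable ?M (\<lambda>x. (G x \<bullet> i) * frechet_derivative \<psi> (at x) i)" if "i \<in> Basis" for i
    using G(1) by (intro locally_integrable_mult[OF locally_integrable_inner open_\<Omega> ti[OF that]]) (simp add: is_weak_gradient_def)
  have "(LINT x|?M. u x * (\<Sum>i\<in>Basis. frechet_derivative (\<lambda>y. frechet_derivative \<psi> (at y) i) (at x) i)) =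
      (\<Sum>i\<in>Basis. (LINT x|?M. u x * frechet_derivative (\<lambda>y. frechet_derivative \<psi> (at y) i) (at x) i))"
    unfolding sum_distrib_left by (rule Bochner_Integration.integral_sum) (rule i1)
  also have "\<dots> = (\<Sum>i\<in>Basis. - (LINT x|?M. (G x \<bullet> i) * frechet_derivative \<psi> (at x) i))"
  proof (rule sum.cong[OF refl])
    fix i :: 'a assume i: "i \<in> Basis"
    show "(LINT x|?M. u x * frechet_derivative (\<lambda>y. frechet_derivative \<psi> (at y) i) (at x) i) = - (LINT x|?M. (G x \<bullet> i) * frechet_derivative \<psi> (at x) i)"
      using G(1) ti[OF i] i unfolding is_weak_gradient_def by blast
  qed
  also have "\<dots> = - (\<Sum>i\<in>Basis. (LINT x|?M. (G x \<bullet> i) * frechet_derivative \<psi> (at x) i))"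
    by (rule sum_negf)
  also have "(\<Sum>i\<in>Basis. (LINT x|?M. (G x \<bullet> i) * frechet_derivative \<psi> (at x) i)) = (LINT x|?M. (\<Sum>i\<in>Basis. (G x \<bullet> i) * frechet_derivative \<psi> (at x) i))"
    by (rule Bochner_Integration.integral_sum[symmetric]) (rule i2)
  also have "(\<lambda>x. (\<Sum>i\<in>Basis. (G x \<bullet> i) * frechet_derivative \<psi> (at x) i)) = (\<lambda>x. G x \<bullet> gradient \<psi> x)"
  proof
    fix x
    show "(\<Sum>i\<in>Basis. (G x \<bullet> i) * frechet_derivative \<psi> (at x) i) = G x \<bullet> gradient \<psi> x"
      unfolding inner_commute[of "G x" "gradient \<psi> x"] gradient_inner[OF t] by (rule frechet_derivative_expand[OF t, symmetric])
  qed
  also have "- (LINT x|?M. G x \<bullet> gradient \<psi> x) = (LINT x|?M. (V x * u x) * \<psi> x) - eigenvalue * (LINT x|?M. u x * \<psi> x)"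
    using Euler_Lagrange[OF t] by simp
  also have "\<dots> = (LINT x|?M. (V x * u x) * \<psi> x - eigenvalue * (u x * \<psi> x))"
    using integrable_local[OF continuous_on_mult[OF continuous_V continuous_u] t] integrable_local[OF continuous_u t]
    by simp
  also have "\<dots> = (LINT x|?M. ((V x - eigenvalue) * u x) * \<psi> x)"
    by (intro Bochner_Integration.integral_cong refl) (simp add: algebra_simps)
  finally show ?thesis .
qed

end

section \<open>Averages of the eigenfunction\<close>

lemma lborel_integral_affine:
  fixes f :: "'a::euclidean_space \<Rightarrow> real"
  assumes [measurable]: "f \<in> borel_measurable borel" and c: "0 < c"
  shows "(\<integral>z. f (a + c *\<^sub>R z) \<partial>lborel) = (\<integral>x. f x \<partial>lborel) / c ^ DIM('a)"
proof -
  have "(\<integral>x. f x \<partial>lborel) = (\<integral>x. f x \<partial>density (distr lborel borel (\<lambda>x. a + c *\<^sub>R x)) (\<lambda>_. \<bar>c\<bar> ^ DIM('a)))"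
    using lborel_affine[of c a] c by simp
  also have "\<dots> = (\<integral>x. \<bar>c\<bar> ^ DIM('a) *\<^sub>R f x \<partial>distr lborel borel (\<lambda>x. a + c *\<^sub>R x))"
    by (rule integral_density) auto
  also have "\<dots> = (\<integral>z. \<bar>c\<bar> ^ DIM('a) *\<^sub>R f (a + c *\<^sub>R z) \<partial>lborel)"
    by (rule integral_distr) auto
  finally show ?thesis using c by simp
qed

section \<open>The Laplacian of the radial bump\<close>

lemma bump_profile_ge_1: "1 \<le> s \<Longrightarrow> bump_profile j s = 0"
  by (simp add: bump_profile_def)

lemma bump_profile_measurable [measurable]: "bump_profile j \<in> borel_measurable borel"
  by (rule borel_measurable_continuous_onI[OF bump_profile_continuous])

lemma bump_profile_bounded: "\<exists>C\<ge>0. \<forall>s\<ge>0. \<bar>bump_profile j s\<bar> \<le> C"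
proof -
  have "compact (bump_profile j ` {0..1})"
    by (rule compact_continuous_image[OF bump_profile_continuous]) simp
  from compact_imp_bounded[OF this] obtain C where C: "\<forall>y\<in>bump_profile j ` {0..1}. norm y \<le> C"
    unfolding bounded_iff by blast
  have "\<bar>bump_profile j s\<bar> \<le> \<bar>C\<bar>" if "0 \<le> s" for s
  proof (cases "s \<le> 1")
    case True
    then have "norm (bump_profile j s) \<le> C" using C that by simp
    then show ?thesis by simp
  qed (simp add: bump_profile_ge_1)
  then show ?thesis by (intro exI[of _ "\<bar>C\<bar>"]) simp
qed

text \<open>The radial profile of the Laplacian of \<open>y \<mapsto> bump_profile 0 (\<bar>y\<bar>\<^sup>2)\<close> in dimension \<open>n\<close>.\<close>

definition laplace_profile :: "real \<Rightarrow> real \<Rightarrow> real" where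
  "laplace_profile n s = 4 * (s * bump_profile 2 s) + 2 * n * bump_profile (Suc 0) s"

lemma laplace_profile_bounded:
  assumes "0 \<le> n" shows "\<exists>C\<ge>0. \<forall>s\<ge>0. \<bar>laplace_profile n s\<bar> \<le> C"
proof -
  obtain A where A: "A \<ge> 0" "\<And>s. 0 \<le> s \<Longrightarrow> \<bar>bump_profile 2 s\<bar> \<le> A" using bump_profile_bounded[of 2] by blast
  obtain B where B: "B \<ge> 0" "\<And>s. 0 \<le> s \<Longrightarrow> \<bar>bump_profile (Suc 0) s\<bar> \<le> B" using bump_profile_bounded[of "Suc 0"] by blast
  have "\<bar>laplace_profile n s\<bar> \<le> 4 * A + 2 * n * B" if s: "0 \<le> s" for s
  proof -
    have "\<bar>s * bump_profile 2 s\<bar> \<le> A"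
    proof (cases "s < 1")
      case True
      have "\<bar>s * bump_profile 2 s\<bar> = s * \<bar>bump_profile 2 s\<bar>" using s by (simp add: abs_mult)
      also have "\<dots> \<le> 1 * A" using True s A by (intro mult_mono) auto
      finally show ?thesis by simp
    qed (use A in \<open>simp add: bump_profile_ge_1\<close>)
    moreover have "\<bar>2 * n * bump_profile (Suc 0) s\<bar> \<le> 2 * n * B"
      using B(2)[OF s] assms by (simp add: abs_mult mult_left_mono)
    ultimately show ?thesis unfolding laplace_profile_def by linarith
  qed
  then show ?thesis using A(1) B(1) assms by (intro exI[of _ "4 * A + 2 * n * B"]) auto
qed

lemma laplace_profile_ge_1: "1 \<le> s \<Longrightarrow> laplace_profile n s = 0"
  by (simp add: laplace_profile_def bump_profile_ge_1)

lemma laplace_profile_measurable [measurable]: "laplace_profile n \<in> borel_measurable borel"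
  unfolding laplace_profile_def[abs_def] by measurable

lemma scaled_bump_second_derivative:
  assumes "0 < \<rho>"
  shows "frechet_derivative (\<lambda>y. frechet_derivative (scaled_bump x \<rho>) (at y) i) (at y) i =
    bump_profile 2 ((norm (y - x))\<^sup>2 / \<rho>\<^sup>2) * (2 * ((y - x) \<bullet> i) / \<rho>\<^sup>2)\<^sup>2 +
    bump_profile (Suc 0) ((norm (y - x))\<^sup>2 / \<rho>\<^sup>2) * (2 * (i \<bullet> i) / \<rho>\<^sup>2)"
proof -
  have 1: "frechet_derivative (scaled_bump x \<rho>) (at y) i = bump_profile (Suc 0) ((norm (y - x))\<^sup>2 / \<rho>\<^sup>2) * (2 * ((y - x) \<bullet> i) / \<rho>\<^sup>2)" for y
    using frechet_derivative_at[OF scaled_bump_frechet[OF assms, of 0 x y], symmetric]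
    unfolding scaled_bump_def[abs_def] by simp
  have lin: "((\<lambda>y. 2 * ((y - x) \<bullet> i) / \<rho>\<^sup>2) has_derivative (\<lambda>h. 2 * (h \<bullet> i) / \<rho>\<^sup>2)) (at y)"
  proof -
    have "((\<lambda>y. (y - x) \<bullet> i) has_derivative (\<lambda>h. h \<bullet> i)) (at y)"
      by (auto intro!: derivative_eq_intros)
    from has_derivative_mult_right[OF this, of "2 / \<rho>\<^sup>2"]
    have "((\<lambda>y. (2 / \<rho>\<^sup>2) * ((y - x) \<bullet> i)) has_derivative (\<lambda>h. (2 / \<rho>\<^sup>2) * (h \<bullet> i))) (at y)" .
    then show ?thesis by simp
  qed
  from frechet_derivative_at[OF has_derivative_mult[OF scaled_bump_frechet[OF assms, of "Suc 0" x y] lin], symmetric]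
  show ?thesis unfolding 1 by (simp add: power2_eq_square numeral_2_eq_2)
qed

lemma scaled_bump_laplacian:
  fixes x y :: "'a::euclidean_space"
  assumes "0 < \<rho>"
  shows "(\<Sum>i\<in>Basis. frechet_derivative (\<lambda>y. frechet_derivative (scaled_bump x \<rho>) (at y) i) (at y) i) =
    laplace_profile DIM('a) ((norm (y - x))\<^sup>2 / \<rho>\<^sup>2) / \<rho>\<^sup>2"
proof -
  define s where "s = (norm (y - x))\<^sup>2 / \<rho>\<^sup>2"
  have n: "(\<Sum>i\<in>Basis. ((y - x) \<bullet> i)\<^sup>2) = s * \<rho>\<^sup>2"
    using assms unfolding s_def power2_norm_eq_inner euclidean_inner[of "y - x" "y - x"] by (simp add: power2_eq_square)
  have "(\<Sum>i\<in>Basis. frechet_derivative (\<lambda>y. frechet_derivative (scaled_bump x \<rho>) (at y) i) (at y) i) =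
      (\<Sum>i\<in>(Basis::'a set). bump_profile 2 s * (4 / \<rho>\<^sup>2 / \<rho>\<^sup>2) * ((y - x) \<bullet> i)\<^sup>2 + bump_profile (Suc 0) s * (2 / \<rho>\<^sup>2))"
    unfolding scaled_bump_second_derivative[OF assms] s_def[symmetric]
    by (intro sum.cong refl) (simp add: power_divide power2_eq_square)
  also have "\<dots> = bump_profile 2 s * (4 / \<rho>\<^sup>2 / \<rho>\<^sup>2) * (s * \<rho>\<^sup>2) + DIM('a) * (bump_profile (Suc 0) s * (2 / \<rho>\<^sup>2))"
    unfolding sum.distrib sum_distrib_left[symmetric] n by simp
  also have "\<dots> = laplace_profile DIM('a) s / \<rho>\<^sup>2"
    using assms by (simp add: laplace_profile_def field_simps)
  finally show ?thesis by (simp add: s_def)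
qed

text \<open>Varying the radius of the rescaled mollifier produces \<rho>^(1 - n) times the Laplacian
  of the bump of radius \<rho>. This kernel identity converts radial derivatives of averages of
  \<open>u\<close> into the weak equation.\<close>

lemma rescaled_bump_derivative:
  assumes \<rho>: "0 < \<rho>" and n: "0 < n"
  shows "((\<lambda>\<rho>. - 2 * bump_profile (Suc 0) (w / \<rho>\<^sup>2) / \<rho> ^ n) has_real_derivative
    laplace_profile (real n) (w / \<rho>\<^sup>2) / \<rho> ^ Suc n) (at \<rho>)"
proof -
  have 1: "((\<lambda>\<rho>. w / \<rho>\<^sup>2) has_real_derivative (- 2 * w / \<rho> ^ 3)) (at \<rho>)"
    using \<rho> by (auto intro!: derivative_eq_intros simp: field_simps power2_eq_square power3_eq_cube)
  have 2: "((\<lambda>\<rho>. bump_profile (Suc 0) (w / \<rho>\<^sup>2)) has_real_derivative bump_profile 2 (w / \<rho>\<^sup>2) * (- 2 * w / \<rho> ^ 3)) (at \<rho>)"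
    using DERIV_chain2[OF bump_profile_deriv[of "Suc 0"] 1] by (simp add: numeral_2_eq_2)
  have 3: "((\<lambda>\<rho>. 1 / \<rho> ^ n) has_real_derivative (- real n / \<rho> ^ Suc n)) (at \<rho>)"
  proof -
    have "((\<lambda>\<rho>. inverse (\<rho> ^ n)) has_real_derivative - (inverse (\<rho> ^ n) * (real n * \<rho> ^ (n - 1)) * inverse (\<rho> ^ n))) (at \<rho>)"
      using \<rho> by (auto intro!: derivative_eq_intros)
    moreover have "- (inverse (\<rho> ^ n) * (real n * \<rho> ^ (n - 1)) * inverse (\<rho> ^ n)) = - real n / \<rho> ^ Suc n"
    proof -
      have "\<rho> ^ n = \<rho> * \<rho> ^ (n - 1)" using n by (metis power_eq_if not_gr_zero)
      then show ?thesis using \<rho> by (simp add: field_simps)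
    qed
    ultimately show ?thesis by (simp add: inverse_eq_divide)
  qed
  have "((\<lambda>\<rho>. - 2 * (bump_profile (Suc 0) (w / \<rho>\<^sup>2) * (1 / \<rho> ^ n))) has_real_derivative
      - 2 * (bump_profile 2 (w / \<rho>\<^sup>2) * (- 2 * w / \<rho> ^ 3) * (1 / \<rho> ^ n) + (- real n / \<rho> ^ Suc n) * bump_profile (Suc 0) (w / \<rho>\<^sup>2))) (at \<rho>)"
    by (intro DERIV_cmult DERIV_mult 2 3)
  moreover have "- 2 * (bump_profile 2 (w / \<rho>\<^sup>2) * (- 2 * w / \<rho> ^ 3) * (1 / \<rho> ^ n) + (- real n / \<rho> ^ Suc n) * bump_profile (Suc 0) (w / \<rho>\<^sup>2)) =
      laplace_profile (real n) (w / \<rho>\<^sup>2) / \<rho> ^ Suc n"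
  proof -
    have "- 2 * (b2 * (- 2 * w / \<rho> ^ 3) * (1 / P) + (- m / (\<rho> * P)) * b1) = (4 * (w / \<rho>\<^sup>2 * b2) + 2 * m * b1) / (\<rho> * P)"
      if "P \<noteq> 0" for b1 b2 m P :: real
      using that \<rho> by (simp add: field_simps power2_eq_square power3_eq_cube)
    from this[of "\<rho> ^ n"] show ?thesis using \<rho> unfolding laplace_profile_def power_Suc by simp
  qed
  moreover have "(\<lambda>\<rho>. - 2 * (bump_profile (Suc 0) (w / \<rho>\<^sup>2) * (1 / \<rho> ^ n))) = (\<lambda>\<rho>. - 2 * bump_profile (Suc 0) (w / \<rho>\<^sup>2) / \<rho> ^ n)"
    by (simp add: fun_eq_iff)
  ultimately show ?thesis by simp
qed

lemma integral_abs_le: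
  fixes f g :: "'b \<Rightarrow> real"
  assumes "integrable M f" "integrable M g" "\<And>x. \<bar>f x\<bar> \<le> g x"
  shows "\<bar>integral\<^sup>L M f\<bar> \<le> integral\<^sup>L M g"
proof -
  have "\<bar>integral\<^sup>L M f\<bar> \<le> (\<integral>x. \<bar>f x\<bar> \<partial>M)" by (rule integral_abs_bound)
  also have "\<dots> \<le> integral\<^sup>L M g" using assms by (intro integral_mono) auto
  finally show ?thesis .
qed

section \<open>Second-order expansion of averages from the weak equation\<close>

context dirichlet_eigenfunction
begin

definition U :: "'a \<Rightarrow> real" where "U x = indicator \<Omega> x * u x"
text \<open>By the weak equation this is the distributional Laplacian of \<open>u\<close> in
  \<Omega>, extended by zero.\<close>

definition H :: "'a \<Rightarrow> real" where "H x = indicator \<Omega> x * ((V x - eigenvalue) * u x)"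

lemma U_measurable [measurable]: "U \<in> borel_measurable borel"
  unfolding U_def[abs_def] by (rule indicator_measurable[OF continuous_u])

lemma continuous_H: "continuous_on \<Omega> (\<lambda>x. (V x - eigenvalue) * u x)"
  by (intro continuous_intros continuous_V continuous_u)

lemma H_measurable [measurable]: "H \<in> borel_measurable borel"
  unfolding H_def[abs_def] by (rule indicator_measurable[OF continuous_H])

lemma U_nonneg: "0 \<le> U x"
  using u_pos[of x] by (auto simp: U_def indicator_def)

lemma radial_equation:
  assumes \<rho>: "0 < \<rho>" and x: "cball x \<rho> \<subseteq> \<Omega>"
  shows "(\<integral>y. U y * laplace_profile DIM('a) ((norm (y - x))\<^sup>2 / \<rho>\<^sup>2) \<partial>lborel) =
    \<rho>\<^sup>2 * (\<integral>y. H y * scaled_bump x \<rho> y \<partial>lborel)"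
proof -
  have t: "test_function \<Omega> (scaled_bump x \<rho>)" by (rule test_function_scaled_bump[OF \<rho> x])
  have [measurable]: "scaled_bump x \<rho> \<in> borel_measurable borel" by (rule bbs_measurable[OF bbs_test_function[OF t]])
  let ?L = "\<lambda>y. laplace_profile DIM('a) ((norm (y - x))\<^sup>2 / \<rho>\<^sup>2)"
  have "(LINT y|lebesgue_on \<Omega>. U y * (?L y / \<rho>\<^sup>2)) = (LINT y|lebesgue_on \<Omega>. u y * (?L y / \<rho>\<^sup>2))"
    by (intro Bochner_Integration.integral_cong refl) (simp add: U_def space_restrict_space)
  also have "\<dots> = (LINT y|lebesgue_on \<Omega>. ((V y - eigenvalue) * u y) * scaled_bump x \<rho> y)"
    using weak_equation[OF t] unfolding scaled_bump_laplacian[OF \<rho>] .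
  also have "\<dots> = (LINT y|lebesgue_on \<Omega>. H y * scaled_bump x \<rho> y)"
    by (intro Bochner_Integration.integral_cong refl) (simp add: H_def space_restrict_space)
  also have "\<dots> = (\<integral>y. H y * scaled_bump x \<rho> y \<partial>lborel)"
  proof (rule lebesgue_on_eq_lborel(1)[OF open_\<Omega>])
    show "(\<lambda>y. H y * scaled_bump x \<rho> y) \<in> borel_measurable borel" by measurable
  qed (simp add: H_def)
  also have "(LINT y|lebesgue_on \<Omega>. U y * (?L y / \<rho>\<^sup>2)) = (\<integral>y. U y * (?L y / \<rho>\<^sup>2) \<partial>lborel)"
  proof (rule lebesgue_on_eq_lborel(1)[OF open_\<Omega>])
    show "(\<lambda>y. U y * (?L y / \<rho>\<^sup>2)) \<in> borel_measurable borel" by measurable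
  qed (simp add: U_def)
  also have "\<dots> = (\<integral>y. U y * ?L y \<partial>lborel) / \<rho>\<^sup>2" by simp
  finally show ?thesis using \<rho> by (simp add: field_simps)
qed

lemma bounded_on_compact:
  assumes "continuous_on \<Omega> f" "compact K" "K \<subseteq> \<Omega>"
  obtains B where "0 \<le> B" "\<And>x. x \<in> K \<Longrightarrow> \<bar>f x :: real\<bar> \<le> B"
proof -
  have "bounded (f ` K)"
    using assms by (intro compact_imp_bounded compact_continuous_image) (auto intro: continuous_on_subset)
  then obtain B where "\<forall>y\<in>f ` K. norm y \<le> B" unfolding bounded_iff by blast
  then show ?thesis by (intro that[of "\<bar>B\<bar>"]) auto
qed

text \<open>The average is an integral against the rescaled mollifier, whose radial derivative is a
  Laplacian of a bump. Fubini and the weak equation then replace \<open>U\<close> against the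
  Laplacian by \<open>H\<close> against the bump itself, so no derivative of \<open>u\<close>
  enters.\<close>

lemma avg_increment:
  assumes ab: "0 < a" "a < b" and x: "cball x b \<subseteq> \<Omega>"
  shows "avg b U x - avg a U x = (\<integral>\<rho>. \<rho> * (\<integral>z. potential z * H (x + \<rho> *\<^sub>R z) \<partial>lborel) * indicator {a..b} \<rho> \<partial>lborel)"
proof -
  define Z where "Z = bump_mass TYPE('a)"
  have Z: "0 < Z" by (simp add: Z_def bump_mass_pos)
  let ?n = "DIM('a)"
  let ?w = "\<lambda>y. (norm (y - x))\<^sup>2"
  \<comment> \<open>\<open>U\<close> has no global bound, but all kernels of radius at most b live
    in this ball, where \<open>u\<close> is bounded by compactness.\<close>
  define UB where "UB y = indicator (cball x b) y * U y" for y
  obtain B where B: "0 \<le> B" "\<And>y. y \<in> cball x b \<Longrightarrow> \<bar>u y\<bar> \<le> B"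
    using bounded_on_compact[OF continuous_u compact_cball x] by blast
  have [measurable]: "cball x b \<in> sets borel" by simp
  have [measurable]: "UB \<in> borel_measurable borel" unfolding UB_def[abs_def] by measurable
  have UB: "\<bar>UB y\<bar> \<le> B" for y using B x by (auto simp: UB_def U_def indicator_def)
  have q1: "1 \<le> ?w y / \<rho>\<^sup>2" if "y \<notin> cball x b" "0 < \<rho>" "\<rho> \<le> b" for y \<rho>
  proof -
    have "\<rho> \<le> norm (y - x)" using that by (simp add: dist_norm norm_minus_commute)
    then have "\<rho>\<^sup>2 \<le> ?w y" using that by (intro power_mono) auto
    then show ?thesis using that by simp
  qed
  have A: "avg \<rho> U x = (\<integral>y. UB y * (- 2 * bump_profile (Suc 0) (?w y / \<rho>\<^sup>2) / \<rho> ^ ?n) \<partial>lborel) / Z" if \<rho>: "0 < \<rho>" "\<rho> \<le> b" for \<rho>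
  proof -
    have "avg \<rho> U x = (\<integral>z. mollifier z * U (x + \<rho> *\<^sub>R z) \<partial>lborel)"
      unfolding avg_def by (rule mol_integral) measurable
    also have "\<dots> = (\<integral>z. - 2 * bump_profile (Suc 0) (?w (x + \<rho> *\<^sub>R z) / \<rho>\<^sup>2) * U (x + \<rho> *\<^sub>R z) \<partial>lborel) / Z"
      unfolding integral_divide_zero[symmetric] using \<rho>
      by (intro Bochner_Integration.integral_cong refl) (simp add: mollifier_def Z_def power_mult_distrib)
    also have "(\<integral>z. - 2 * bump_profile (Suc 0) (?w (x + \<rho> *\<^sub>R z) / \<rho>\<^sup>2) * U (x + \<rho> *\<^sub>R z) \<partial>lborel) =
        (\<integral>y. - 2 * bump_profile (Suc 0) (?w y / \<rho>\<^sup>2) * U y \<partial>lborel) / \<rho> ^ ?n"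
      by (rule lborel_integral_affine[OF _ \<rho>(1), where f = "\<lambda>y. - 2 * bump_profile (Suc 0) (?w y / \<rho>\<^sup>2) * U y"]) measurable
    also have "\<dots> = (\<integral>y. UB y * (- 2 * bump_profile (Suc 0) (?w y / \<rho>\<^sup>2) / \<rho> ^ ?n) \<partial>lborel)"
      unfolding integral_divide_zero[symmetric]
    proof (intro Bochner_Integration.integral_cong refl)
      fix y
      show "- 2 * bump_profile (Suc 0) (?w y / \<rho>\<^sup>2) * U y / \<rho> ^ ?n = UB y * (- 2 * bump_profile (Suc 0) (?w y / \<rho>\<^sup>2) / \<rho> ^ ?n)"
      proof (cases "y \<in> cball x b")
        case False
        then show ?thesis using q1[OF False \<rho>] by (simp add: bump_profile_ge_1)
      qed (simp add: UB_def)
    qed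
    finally show ?thesis .
  qed
  obtain C where C: "0 \<le> C" "\<And>s. 0 \<le> s \<Longrightarrow> \<bar>laplace_profile ?n s\<bar> \<le> C" using laplace_profile_bounded[of ?n] by auto
  let ?k = "\<lambda>y \<rho>. laplace_profile ?n (?w y / \<rho>\<^sup>2) / \<rho> ^ Suc ?n"
  \<comment> \<open>The interval is encoded as a finite measure on the whole line, to which the
    Fubini criterion for bounded functions applies.\<close>
  let ?N = "density lborel (\<lambda>\<rho>. ennreal (indicator {a..b} \<rho>))"
  have N: "finite_measure ?N"
    by (rule finite_measureI) (use ab in \<open>simp add: emeasure_density ennreal_indicator\<close>)
  then interpret N: finite_measure ?N .
  interpret P: pair_sigma_finite "lborel :: 'a measure" ?N ..
  have dN: "(\<integral>\<rho>. f \<rho> \<partial>?N) = (\<integral>\<rho>. f \<rho> * indicator {a..b} \<rho> \<partial>lborel)" if "f \<in> borel_measurable borel" for f :: "real \<Rightarrow> real"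
    using that by (subst integral_density) (auto simp: mult.commute)
  have inc: "(- 2 * bump_profile (Suc 0) (?w y / b\<^sup>2) / b ^ ?n) - (- 2 * bump_profile (Suc 0) (?w y / a\<^sup>2) / a ^ ?n) = (\<integral>\<rho>. ?k y \<rho> \<partial>?N)" for y
  proof -
    have "(\<integral>\<rho>. ?k y \<rho> * indicator {a..b} \<rho> \<partial>lborel) = (- 2 * bump_profile (Suc 0) (?w y / b\<^sup>2) / b ^ ?n) - (- 2 * bump_profile (Suc 0) (?w y / a\<^sup>2) / a ^ ?n)"
    proof (rule integral_FTC_Icc_real[where F = "\<lambda>\<rho>. - 2 * bump_profile (Suc 0) (?w y / \<rho>\<^sup>2) / \<rho> ^ ?n"])
      fix \<rho> assume "a \<le> \<rho>" "\<rho> \<le> b"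
      then have \<rho>: "0 < \<rho>" using ab by simp
      show "((\<lambda>\<rho>. - 2 * bump_profile (Suc 0) (?w y / \<rho>\<^sup>2) / \<rho> ^ ?n) has_real_derivative ?k y \<rho>) (at \<rho>)"
        by (rule rescaled_bump_derivative[OF \<rho>]) simp
      have iw: "isCont (\<lambda>\<rho>. ?w y / \<rho>\<^sup>2) \<rho>" using \<rho> by (intro isCont_divide isCont_power continuous_const continuous_ident) auto
      have c: "isCont (\<lambda>\<rho>. bump_profile j (?w y / \<rho>\<^sup>2)) \<rho>" for j
        by (rule isCont_o2[OF iw DERIV_isCont[OF bump_profile_deriv]])
      show "isCont (?k y) \<rho>"
        unfolding laplace_profile_def using \<rho>
        by (intro isCont_divide isCont_add isCont_mult isCont_power c iw continuous_const continuous_ident) auto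
    qed (use ab in simp)
    then show ?thesis by (subst dN) auto
  qed
  have int: "integrable lborel (\<lambda>y. UB y * (- 2 * bump_profile (Suc 0) (?w y / \<rho>\<^sup>2) / \<rho> ^ ?n))" for \<rho>
  proof -
    obtain A where A: "0 \<le> A" "\<And>s. 0 \<le> s \<Longrightarrow> \<bar>bump_profile (Suc 0) s\<bar> \<le> A" using bump_profile_bounded by blast
    have bU: "bbs UB"
      using bbs_mult_bounded[of "indicator (cball x b)" U B] bbs_indicator[of "cball x b"] B x
      by (auto simp: UB_def[abs_def] mult.commute U_def indicator_def split: if_splits)
    have "integrable lborel (\<lambda>y. UB y * bump_profile (Suc 0) (?w y / \<rho>\<^sup>2))"
      by (rule integrable_bounded_mult[OF bbs_integrable[OF bU], where C = A]) (auto intro!: A(2))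
    then have "integrable lborel (\<lambda>y. (- 2 / \<rho> ^ ?n) * (UB y * bump_profile (Suc 0) (?w y / \<rho>\<^sup>2)))" by simp
    then show ?thesis by (simp add: mult_ac)
  qed
  have "Z * (avg b U x - avg a U x) = (\<integral>y. UB y * (\<integral>\<rho>. ?k y \<rho> \<partial>?N) \<partial>lborel)"
    using Z ab int[of a] int[of b] unfolding A[OF less_trans[OF ab] order_refl] A[OF ab(1) less_imp_le[OF ab(2)]] inc[symmetric]
    by (simp add: right_diff_distrib diff_divide_distrib)
  \<comment> \<open>The additional indicator makes the integrand bounded for all real \<rho>;
    without it the kernel would be singular at \<rho> = 0.\<close>
  also have "\<dots> = (\<integral>y. (\<integral>\<rho>. indicator {a..b} \<rho> * (UB y * ?k y \<rho>) \<partial>?N) \<partial>lborel)"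
  proof (intro Bochner_Integration.integral_cong refl)
    fix y
    have "(\<integral>\<rho>. indicator {a..b} \<rho> * (UB y * ?k y \<rho>) \<partial>?N) = (\<integral>\<rho>. indicator {a..b} \<rho> * (UB y * ?k y \<rho>) * indicator {a..b} \<rho> \<partial>lborel)"
      by (rule dN) measurable
    also have "\<dots> = (\<integral>\<rho>. UB y * (?k y \<rho> * indicator {a..b} \<rho>) \<partial>lborel)"
      by (intro Bochner_Integration.integral_cong refl) (simp add: indicator_def)
    also have "\<dots> = UB y * (\<integral>\<rho>. ?k y \<rho> * indicator {a..b} \<rho> \<partial>lborel)" by (rule integral_mult_right_zero)
    also have "(\<integral>\<rho>. ?k y \<rho> * indicator {a..b} \<rho> \<partial>lborel) = (\<integral>\<rho>. ?k y \<rho> \<partial>?N)" by (rule dN[symmetric]) measurable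
    finally show "UB y * (\<integral>\<rho>. ?k y \<rho> \<partial>?N) = (\<integral>\<rho>. indicator {a..b} \<rho> * (UB y * ?k y \<rho>) \<partial>?N)" ..
  qed
  also have "\<dots> = (\<integral>\<rho>. (\<integral>y. indicator {a..b} \<rho> * (UB y * ?k y \<rho>) \<partial>lborel) \<partial>?N)"
  proof (rule P.Fubini_integral[symmetric], rule bbs_pair_integrable[OF N, where C = "B * (C / a ^ Suc ?n)" and R = "norm x + b"])
    fix y \<rho>
    have "\<bar>?k y \<rho>\<bar> \<le> C / a ^ Suc ?n" if "\<rho> \<in> {a..b}"
    proof -
      have "a ^ Suc ?n \<le> \<rho> ^ Suc ?n" using that ab by (intro power_mono) auto
      moreover have "0 < a ^ Suc ?n" using ab by simp
      moreover have "\<bar>?k y \<rho>\<bar> = \<bar>laplace_profile ?n (?w y / \<rho>\<^sup>2)\<bar> / \<rho> ^ Suc ?n" using that ab by (simp add: abs_divide)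
      ultimately show ?thesis using C by (auto intro!: frac_le)
    qed
    note kb = this
    have D0: "0 \<le> C / a ^ Suc ?n" using C ab by simp
    have "\<bar>indicator {a..b} \<rho> * (UB y * ?k y \<rho>)\<bar> \<le> B * (C / a ^ Suc ?n)"
    proof (cases "\<rho> \<in> {a..b}")
      case True
      have "\<bar>indicator {a..b} \<rho> * (UB y * ?k y \<rho>)\<bar> = \<bar>UB y\<bar> * \<bar>?k y \<rho>\<bar>" using True by (simp only: indicator_simps abs_mult)
      also have "\<dots> \<le> B * (C / a ^ Suc ?n)" using UB[of y] kb[OF True] B by (intro mult_mono) auto
      finally show ?thesis .
    qed (use mult_nonneg_nonneg[OF B(1) D0] in simp)
    then show "\<bar>case (y, \<rho>) of (y, \<rho>) \<Rightarrow> indicator {a..b} \<rho> * (UB y * ?k y \<rho>)\<bar> \<le> B * (C / a ^ Suc ?n)" by simp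
    assume "norm x + b < norm y"
    then have "y \<notin> cball x b" using norm_triangle_sub[of y x] by (auto simp: dist_norm norm_minus_commute)
    then show "(case (y, \<rho>) of (y, \<rho>) \<Rightarrow> indicator {a..b} \<rho> * (UB y * ?k y \<rho>)) = 0" by (simp add: UB_def)
  qed measurable
  also have "\<dots> = (\<integral>\<rho>. indicator {a..b} \<rho> * (Z * (\<rho> * (\<integral>z. potential z * H (x + \<rho> *\<^sub>R z) \<partial>lborel))) \<partial>?N)"
  proof (intro Bochner_Integration.integral_cong refl)
    fix \<rho>
    show "(\<integral>y. indicator {a..b} \<rho> * (UB y * ?k y \<rho>) \<partial>lborel) = indicator {a..b} \<rho> * (Z * (\<rho> * (\<integral>z. potential z * H (x + \<rho> *\<^sub>R z) \<partial>lborel)))"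
    proof (cases "\<rho> \<in> {a..b}")
      case True
      then have \<rho>: "0 < \<rho>" "\<rho> \<le> b" using ab by auto
      have x\<rho>: "cball x \<rho> \<subseteq> \<Omega>" using x \<rho> by (meson dual_order.trans subset_cball)
      have "(\<integral>y. UB y * ?k y \<rho> \<partial>lborel) = (\<integral>y. U y * laplace_profile ?n (?w y / \<rho>\<^sup>2) / \<rho> ^ Suc ?n \<partial>lborel)"
      proof (intro Bochner_Integration.integral_cong refl)
        fix y
        show "UB y * ?k y \<rho> = U y * laplace_profile ?n (?w y / \<rho>\<^sup>2) / \<rho> ^ Suc ?n"
        proof (cases "y \<in> cball x b")
          case False
          then show ?thesis using q1[OF False \<rho>] by (simp add: laplace_profile_ge_1)
        qed (simp add: UB_def)
      qed
      also have "\<dots> = \<rho>\<^sup>2 * (\<integral>y. H y * scaled_bump x \<rho> y \<partial>lborel) / \<rho> ^ Suc ?n"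
        unfolding integral_divide_zero radial_equation[OF \<rho>(1) x\<rho>] ..
      also have "\<dots> = \<rho> * ((\<integral>y. H y * scaled_bump x \<rho> y \<partial>lborel) / \<rho> ^ ?n)"
        using \<rho> by (simp add: power2_eq_square)
      also have "(\<integral>y. H y * scaled_bump x \<rho> y \<partial>lborel) / \<rho> ^ ?n = (\<integral>z. H (x + \<rho> *\<^sub>R z) * scaled_bump x \<rho> (x + \<rho> *\<^sub>R z) \<partial>lborel)"
      proof (rule lborel_integral_affine[symmetric, where f = "\<lambda>y. H y * scaled_bump x \<rho> y", OF _ \<rho>(1)])
        have [measurable]: "scaled_bump x \<rho> \<in> borel_measurable borel"
          by (rule bbs_measurable[OF bbs_test_function[OF test_function_scaled_bump[OF \<rho>(1) x\<rho>]]])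
        show "(\<lambda>y. H y * scaled_bump x \<rho> y) \<in> borel_measurable borel" by measurable
      qed
      also have "\<dots> = (\<integral>z. Z * (potential z * H (x + \<rho> *\<^sub>R z)) \<partial>lborel)"
        using \<rho> Z by (intro Bochner_Integration.integral_cong refl) (simp add: scaled_bump_def potential_def Z_def[symmetric] power_mult_distrib)
      also have "\<dots> = Z * (\<integral>z. potential z * H (x + \<rho> *\<^sub>R z) \<partial>lborel)" by simp
      finally show ?thesis using True by simp
    qed simp
  qed
  also have "\<dots> = Z * (\<integral>\<rho>. \<rho> * (\<integral>z. potential z * H (x + \<rho> *\<^sub>R z) \<partial>lborel) * indicator {a..b} \<rho> \<partial>lborel)"
  proof -
    let ?P = "\<lambda>\<rho>. \<rho> * (\<integral>z. potential z * H (x + \<rho> *\<^sub>R z) \<partial>lborel)"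
    have "(\<integral>\<rho>. indicator {a..b} \<rho> * (Z * ?P \<rho>) \<partial>?N) = (\<integral>\<rho>. indicator {a..b} \<rho> * (Z * ?P \<rho>) * indicator {a..b} \<rho> \<partial>lborel)"
      by (rule dN) measurable
    also have "\<dots> = (\<integral>\<rho>. Z * (?P \<rho> * indicator {a..b} \<rho>) \<partial>lborel)"
      by (intro Bochner_Integration.integral_cong refl) (simp add: indicator_def)
    also have "\<dots> = Z * (\<integral>\<rho>. ?P \<rho> * indicator {a..b} \<rho> \<partial>lborel)" by (rule integral_mult_right_zero)
    finally show ?thesis .
  qed
  finally show ?thesis using Z by simp
qed

text \<open>A Taylor expansion drawn from the equation instead of second derivatives: the radial
  increment is \<rho> c \<open>H x\<close> up to \<rho> c e, and integrating over radii up to r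
  gives c r^2 / 2 \<open>H x\<close> with error at most c e r^2 / 2. The lower radius tends to 0 by
  continuity of \<open>u\<close>.\<close>

lemma avg_expansion:
  assumes r: "0 < r" and x: "cball x r \<subseteq> \<Omega>" and e: "\<And>y. y \<in> cball x r \<Longrightarrow> \<bar>H y - H x\<bar> \<le> e"
  shows "\<bar>avg r U x - U x - second_moment TYPE('a) * r\<^sup>2 / 2 * H x\<bar> \<le> second_moment TYPE('a) * e * r\<^sup>2"
proof -
  define c where "c = second_moment TYPE('a)"
  have c: "0 < c" by (simp add: c_def second_moment_pos)
  have e0: "0 \<le> e" using e[of x] r by simp
  let ?P = "\<lambda>\<rho>. (\<integral>z. potential z * H (x + \<rho> *\<^sub>R z) \<partial>lborel)"
  have P: "\<bar>?P \<rho> - c * H x\<bar> \<le> c * e" if \<rho>: "0 < \<rho>" "\<rho> \<le> r" for \<rho>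
  proof -
    have ip: "integrable lborel (potential :: 'a \<Rightarrow> real)" by (rule bbs_integrable[OF bbs_potential])
    have near: "\<bar>potential z * H (x + \<rho> *\<^sub>R z) - potential z * H x\<bar> \<le> potential z * e" for z
    proof (cases "norm z < 1")
      case True
      have "\<rho> * norm z \<le> r * 1" using True \<rho> by (intro mult_mono) auto
      then have "x + \<rho> *\<^sub>R z \<in> cball x r" using \<rho> by (simp add: dist_norm)
      from e[OF this] have "potential z * \<bar>H (x + \<rho> *\<^sub>R z) - H x\<bar> \<le> potential z * e"
        using potential_nonneg by (rule mult_left_mono)
      then show ?thesis using potential_nonneg[of z] by (simp add: right_diff_distrib[symmetric] abs_mult)
    qed (simp add: potential_outside)
    have "integrable lborel (\<lambda>z. potential z * H x + (potential z * H (x + \<rho> *\<^sub>R z) - potential z * H x))"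
    proof (rule Bochner_Integration.integrable_add)
      show "integrable lborel (\<lambda>z. potential z * H (x + \<rho> *\<^sub>R z) - potential z * H x)"
      proof (rule Bochner_Integration.integrable_bound)
        show "integrable lborel (\<lambda>z::'a. potential z * e)" using ip by simp
        show "AE z in lborel. norm (potential z * H (x + \<rho> *\<^sub>R z) - potential z * H x) \<le> norm (potential z * e)"
          unfolding real_norm_def by (intro AE_I2 order_trans[OF near abs_ge_self])
      qed measurable
    qed (use ip in simp)
    then have i: "integrable lborel (\<lambda>z. potential z * H (x + \<rho> *\<^sub>R z))" by simp
    have ipH: "integrable lborel (\<lambda>z::'a. potential z * H x)" and ipe: "integrable lborel (\<lambda>z::'a. potential z * e)"
      by (rule integrable_mult_left[OF ip])+
    have "?P \<rho> - c * H x = (\<integral>z. potential z * H (x + \<rho> *\<^sub>R z) - potential z * H x \<partial>lborel)"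
      using i ip by (simp add: c_def second_moment_def)
    moreover have "\<bar>\<integral>z. potential z * H (x + \<rho> *\<^sub>R z) - potential z * H x \<partial>lborel\<bar> \<le> (\<integral>z. potential (z :: 'a) * e \<partial>lborel)"
    proof (rule integral_abs_le)
      show "integrable lborel (\<lambda>z. potential z * H (x + \<rho> *\<^sub>R z) - potential z * H x)"
        by (rule Bochner_Integration.integrable_diff[OF i ipH])
    qed (fact ipe near)+
    moreover have "(\<integral>z. potential (z :: 'a) * e \<partial>lborel) = c * e" by (simp add: c_def second_moment_def)
    ultimately show ?thesis by (simp only:)
  qed
  have inc: "\<bar>avg r U x - avg a U x - c * H x * ((r\<^sup>2 - a\<^sup>2) / 2)\<bar> \<le> c * e * ((r\<^sup>2 - a\<^sup>2) / 2)" if a: "0 < a" "a < r" for a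
  proof -
    have lin: "has_bochner_integral lborel (\<lambda>\<rho>::real. \<rho> * indicator {a..r} \<rho>) (r\<^sup>2 / 2 - a\<^sup>2 / 2)"
      by (rule has_bochner_integral_FTC_Icc_real[where F = "\<lambda>\<rho>. \<rho>\<^sup>2 / 2"])
         (use a in \<open>auto intro!: derivative_eq_intros\<close>)
    have near: "\<bar>\<rho> * ?P \<rho> * indicator {a..r} \<rho> - c * H x * (\<rho> * indicator {a..r} \<rho>)\<bar> \<le> c * e * (\<rho> * indicator {a..r} \<rho>)" for \<rho>
    proof (cases "\<rho> \<in> {a..r}")
      case True
      then have \<rho>: "0 < \<rho>" "\<rho> \<le> r" using a by auto
      have "\<bar>\<rho> * ?P \<rho> - c * H x * \<rho>\<bar> = \<rho> * \<bar>?P \<rho> - c * H x\<bar>"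
      proof -
        have "\<rho> * ?P \<rho> - c * H x * \<rho> = \<rho> * (?P \<rho> - c * H x)" by (simp add: right_diff_distrib mult.commute)
        then show ?thesis using \<rho> by (simp only: abs_mult abs_of_pos)
      qed
      also have "\<dots> \<le> \<rho> * (c * e)" using P[OF \<rho>] \<rho> by (intro mult_left_mono) auto
      finally show ?thesis using True by (simp add: mult_ac)
    qed simp
    have ic: "integrable lborel (\<lambda>\<rho>. c * e * (\<rho> * indicator {a..r} \<rho>))"
      by (rule integrable_mult_right[OF integrable.intros[OF lin]])
    have id: "integrable lborel (\<lambda>\<rho>. \<rho> * ?P \<rho> * indicator {a..r} \<rho> - c * H x * (\<rho> * indicator {a..r} \<rho>))"
    proof (rule Bochner_Integration.integrable_bound)
      show "integrable lborel (\<lambda>\<rho>. c * e * (\<rho> * indicator {a..r} \<rho>))" by (rule ic)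
      show "AE \<rho> in lborel. norm (\<rho> * ?P \<rho> * indicator {a..r} \<rho> - c * H x * (\<rho> * indicator {a..r} \<rho>)) \<le> norm (c * e * (\<rho> * indicator {a..r} \<rho>))"
        unfolding real_norm_def by (intro AE_I2 order_trans[OF near abs_ge_self])
    qed measurable
    have il: "integrable lborel (\<lambda>\<rho>. c * H x * (\<rho> * indicator {a..r} \<rho>))"
      by (rule integrable_mult_right[OF integrable.intros[OF lin]])
    have "integrable lborel (\<lambda>\<rho>. \<rho> * ?P \<rho> * indicator {a..r} \<rho>)"
      using Bochner_Integration.integrable_add[OF id il] by simp
    from Bochner_Integration.integral_diff[OF this il]
    have "(\<integral>\<rho>. \<rho> * ?P \<rho> * indicator {a..r} \<rho> - c * H x * (\<rho> * indicator {a..r} \<rho>) \<partial>lborel) =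
        (avg r U x - avg a U x) - c * H x * (r\<^sup>2 / 2 - a\<^sup>2 / 2)"
      unfolding avg_increment[OF a x, symmetric] integral_mult_right_zero has_bochner_integral_integral_eq[OF lin] .
    then have "avg r U x - avg a U x - c * H x * ((r\<^sup>2 - a\<^sup>2) / 2) = (\<integral>\<rho>. \<rho> * ?P \<rho> * indicator {a..r} \<rho> - c * H x * (\<rho> * indicator {a..r} \<rho>) \<partial>lborel)"
      by (simp only: diff_divide_distrib)
    moreover have "\<bar>\<integral>\<rho>. \<rho> * ?P \<rho> * indicator {a..r} \<rho> - c * H x * (\<rho> * indicator {a..r} \<rho>) \<partial>lborel\<bar> \<le> (\<integral>\<rho>. c * e * (\<rho> * indicator {a..r} \<rho>) \<partial>lborel)"
      by (rule integral_abs_le) (fact id ic near)+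
    moreover have "(\<integral>\<rho>. c * e * (\<rho> * indicator {a..r} \<rho>) \<partial>lborel) = c * e * ((r\<^sup>2 - a\<^sup>2) / 2)"
      unfolding integral_mult_right_zero has_bochner_integral_integral_eq[OF lin] diff_divide_distrib ..
    ultimately show ?thesis by (simp only:)
  qed
  have xin: "x \<in> \<Omega>" using x r by auto
  \<comment> \<open>The shift by 2 makes the radii r / (n + 2) strictly smaller than r already for n
    = 0.\<close>
  have Ux: "(\<lambda>n. avg (r / real (n + 2)) U x) \<longlonglongrightarrow> U x"
  proof (rule LIMSEQ_I)
    fix \<epsilon> :: real assume \<epsilon>: "0 < \<epsilon>"
    have "continuous (at x) u" using continuous_u open_\<Omega> xin by (simp add: continuous_on_eq_continuous_at)
    then obtain d where d: "0 < d" "\<And>y. dist y x < d \<Longrightarrow> dist (u y) (u x) < \<epsilon> / 2"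
      using \<epsilon> unfolding continuous_at_eps_delta by (metis half_gt_zero)
    have "(\<lambda>n. r / real (n + 2)) \<longlonglongrightarrow> 0" by real_asymp
    then have "\<forall>\<^sub>F n in sequentially. r / real (n + 2) < min d r" using d r by (intro order_tendstoD(2)) auto
    then obtain N where N: "\<And>n. N \<le> n \<Longrightarrow> r / real (n + 2) < min d r" unfolding eventually_sequentially by blast
    have "norm (avg (r / real (n + 2)) U x - U x) < \<epsilon>" if n: "N \<le> n" for n
    proof -
      define s where "s = r / real (n + 2)"
      have s: "0 < s" "s < d" "s < r" using N[OF n] r by (auto simp: s_def)
      have one: "measure (mol_measure :: 'a measure) UNIV = 1" by (metis mol.prob_space space_mol_measure)
      have near: "\<bar>U (x + s *\<^sub>R z) - U x\<bar> \<le> \<epsilon> / 2" if "norm z < 1" for z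
      proof -
        have sz: "s * norm z < s" using that s by simp
        have "s * norm z \<le> r" using sz s by linarith
        then have "x + s *\<^sub>R z \<in> cball x r" using s by (simp add: dist_norm)
        then have "x + s *\<^sub>R z \<in> \<Omega>" using x by blast
        moreover have "s * norm z < d" using sz s by linarith
        then have "dist (x + s *\<^sub>R z) x < d" using s by (simp add: dist_norm)
        ultimately show ?thesis using d(2)[of "x + s *\<^sub>R z"] xin by (simp add: U_def dist_real_def)
      qed
      have "integrable mol_measure (\<lambda>z. U (x + s *\<^sub>R z) - U x)"
        by (rule mol_integrable_bounded[where C = "\<epsilon> / 2"]) (use near in auto)
      from Bochner_Integration.integrable_add[OF this, of "\<lambda>z. U x"]
      have i: "integrable mol_measure (\<lambda>z. U (x + s *\<^sub>R z))" by simp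
      have "avg s U x - U x = avg s (\<lambda>y. U y - U x) x"
        unfolding avg_def using i one by simp
      also have "\<bar>\<dots>\<bar> \<le> \<epsilon> / 2"
      proof (rule avg_bound)
        show "\<bar>U y - U x\<bar> \<le> \<epsilon> / 2" if "dist x y < s" for y
        proof -
          have "norm ((1 / s) *\<^sub>R (y - x)) < 1" unfolding norm_scaleR using that s by (simp add: dist_norm norm_minus_commute)
          from near[OF this] show ?thesis using s by simp
        qed
      qed (use s in auto)
      finally show ?thesis using \<epsilon> by (simp add: s_def)
    qed
    then show "\<exists>N. \<forall>n\<ge>N. norm (avg (r / real (n + 2)) U x - U x) < \<epsilon>" by blast
  qed
  have z: "(\<lambda>n. r / real (n + 2)) \<longlonglongrightarrow> 0" by real_asymp
  have L: "(\<lambda>n. \<bar>avg r U x - avg (r / real (n + 2)) U x - c * H x * ((r\<^sup>2 - (r / real (n + 2))\<^sup>2) / 2)\<bar>) \<longlonglongrightarrow>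
      \<bar>avg r U x - U x - c * H x * ((r\<^sup>2 - 0\<^sup>2) / 2)\<bar>"
    by (intro tendsto_intros Ux z) auto
  have "\<bar>avg r U x - U x - c * H x * ((r\<^sup>2 - 0\<^sup>2) / 2)\<bar> \<le> c * e * r\<^sup>2"
  proof (rule LIMSEQ_le_const2[OF L], intro exI[of _ 0] allI impI)
    fix n :: nat
    have a: "0 < r / real (n + 2)" "r / real (n + 2) < r" using r add_pos_nonneg[of r "r * real n"] by (auto simp: field_simps)
    have "c * e * ((r\<^sup>2 - (r / real (n + 2))\<^sup>2) / 2) \<le> c * e * r\<^sup>2"
      using c e0 by (intro mult_left_mono) (auto simp: add_nonneg_nonneg intro: order_trans[of _ 0])
    with inc[OF a] show "\<bar>avg r U x - avg (r / real (n + 2)) U x - c * H x * ((r\<^sup>2 - (r / real (n + 2))\<^sup>2) / 2)\<bar> \<le> c * e * r\<^sup>2"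
      by linarith
  qed
  then show ?thesis by (simp add: c_def mult_ac)
qed

text \<open>Each of the two averages adds c r^2 / 2 (V - \<lambda>) u and the exponential adds - c
  r^2 V u, in total - c r^2 \<lambda> u. The remaining errors are small multiples of r^2 by uniform
  continuity on K, or of order r^4; both fit into c r^2 \<epsilon> u because u is bounded below on
  K.\<close>

lemma supersolution:
  assumes K: "compact K" "K \<subseteq> \<Omega>" and W: "0 < d" "\<And>x. x \<in> W \<Longrightarrow> cball x d \<subseteq> K" and \<epsilon>: "0 < \<epsilon>"
  shows "\<exists>r0>0. \<forall>r. 0 < r \<and> r < r0 \<longrightarrow> (\<forall>x\<in>W.
    avg r (\<lambda>z. (indicator \<Omega> z * exp (- (second_moment TYPE('a) * r\<^sup>2 * V z))) * avg r U z) x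
      \<le> (1 - second_moment TYPE('a) * r\<^sup>2 * (eigenvalue - \<epsilon>)) * u x)"
proof -
  define c where "c = second_moment TYPE('a)"
  have c: "0 < c" by (simp add: c_def second_moment_pos)
  obtain Bv where Bv: "0 \<le> Bv" "\<And>x. x \<in> K \<Longrightarrow> \<bar>V x\<bar> \<le> Bv" using bounded_on_compact[OF continuous_V K] by blast
  obtain Bu where Bu: "0 \<le> Bu" "\<And>x. x \<in> K \<Longrightarrow> \<bar>u x\<bar> \<le> Bu" using bounded_on_compact[OF continuous_u K] by blast
  obtain Bh where Bh: "0 \<le> Bh" "\<And>x. x \<in> K \<Longrightarrow> \<bar>(V x - eigenvalue) * u x\<bar> \<le> Bh" using bounded_on_compact[OF continuous_H K] by blast
  define B where "B = Bv + Bu + Bh + 1"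
  have B: "1 \<le> B" "\<And>x. x \<in> K \<Longrightarrow> \<bar>V x\<bar> \<le> B" "\<And>x. x \<in> K \<Longrightarrow> \<bar>u x\<bar> \<le> B" "\<And>x. x \<in> K \<Longrightarrow> \<bar>(V x - eigenvalue) * u x\<bar> \<le> B - 1"
  proof -
    show "1 \<le> B" using Bv(1) Bu(1) Bh(1) by (simp add: B_def)
    fix x assume x: "x \<in> K"
    show "\<bar>V x\<bar> \<le> B" using Bv(2)[OF x] Bv(1) Bu(1) Bh(1) unfolding B_def by linarith
    show "\<bar>u x\<bar> \<le> B" using Bu(2)[OF x] Bv(1) Bu(1) Bh(1) unfolding B_def by linarith
    show "\<bar>(V x - eigenvalue) * u x\<bar> \<le> B - 1" using Bh(2)[OF x] Bv(1) Bu(1) Bh(1) unfolding B_def by linarith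
  qed
  have "continuous_on \<Omega> (\<lambda>x. inverse (u x))"
    using continuous_u u_pos by (intro continuous_on_inverse) (auto simp: less_le)
  then obtain Bi where Bi: "0 \<le> Bi" "\<And>x. x \<in> K \<Longrightarrow> \<bar>inverse (u x)\<bar> \<le> Bi" using bounded_on_compact K by metis
  define u0 where "u0 = 1 / (Bi + 1)"
  have u0: "0 < u0" "\<And>x. x \<in> K \<Longrightarrow> u0 \<le> u x"
  proof -
    show "0 < u0" using Bi by (simp add: u0_def)
    fix x assume x: "x \<in> K"
    then have p: "0 < u x" using K u_pos by blast
    have "inverse (u x) \<le> Bi + 1" using Bi(2)[OF x] by linarith
    then show "u0 \<le> u x" using p Bi(1) by (simp add: u0_def field_simps)
  qed
  \<comment> \<open>The oscillation errors sum to 5/2 \<epsilon>' c r^2 and take half of c r^2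
    \<epsilon> u0; the terms of order r^4 take the other half.\<close>
  define \<epsilon>' where "\<epsilon>' = min 1 (\<epsilon> * u0 / 5)"
  have \<epsilon>': "0 < \<epsilon>'" "\<epsilon>' \<le> 1" "5 * \<epsilon>' \<le> \<epsilon> * u0" using \<epsilon> u0(1) by (auto simp: \<epsilon>'_def)
  \<comment> \<open>\<open>?J\<close> appears because (V - \<lambda>) u / 2 from the inner average
    minus V u from the exponential is - (V + \<lambda>) u / 2.\<close>
  let ?H = "\<lambda>x. (V x - eigenvalue) * u x" and ?J = "\<lambda>x. (V x + eigenvalue) * u x"
  have cH: "continuous_on K ?H" and cJ: "continuous_on K ?J"
    by (rule continuous_on_subset[OF _ K(2)], intro continuous_intros continuous_V continuous_u)+
  obtain d1 where d1: "0 < d1" "\<And>x y. x \<in> K \<Longrightarrow> y \<in> K \<Longrightarrow> dist y x < d1 \<Longrightarrow> dist (?H y) (?H x) < \<epsilon>'"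
    using compact_uniformly_continuous[OF cH K(1)] \<epsilon>'(1) unfolding uniformly_continuous_on_def by blast
  obtain d2 where d2: "0 < d2" "\<And>x y. x \<in> K \<Longrightarrow> y \<in> K \<Longrightarrow> dist y x < d2 \<Longrightarrow> dist (?J y) (?J x) < \<epsilon>'"
    using compact_uniformly_continuous[OF cJ K(1)] \<epsilon>'(1) unfolding uniformly_continuous_on_def by blast
  \<comment> \<open>One summand for each error product of (1 - t + t^2)(u + c r^2 h): t times c r^2
    h, t^2 times u, and t^2 times c r^2 h.\<close>
  define C where "C = c\<^sup>2 * B\<^sup>2 + c\<^sup>2 * B ^ 3 + c ^ 3 * B ^ 3"
  have C: "0 \<le> C" using c B(1) by (auto simp: C_def)
  define r0 where "r0 = Min {1, d / 2, d1, d2, 1 / (c * B), c * \<epsilon> * u0 / (2 * (C + 1))}"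
  have r0: "0 < r0" using W(1) d1(1) d2(1) c B(1) \<epsilon> u0(1) C by (auto simp: r0_def)
  have main: "avg r (\<lambda>z. (indicator \<Omega> z * exp (- (c * r\<^sup>2 * V z))) * avg r U z) x \<le> (1 - c * r\<^sup>2 * (eigenvalue - \<epsilon>)) * u x"
    if r: "0 < r" "r < r0" and x: "x \<in> W" for r x
  proof -
    have rr: "r \<le> 1" "r \<le> d / 2" "r < d1" "r < d2" "r \<le> 1 / (c * B)" "r \<le> c * \<epsilon> * u0 / (2 * (C + 1))"
      using r(2) by (auto simp: r0_def)
    have r2: "r\<^sup>2 \<le> r" using r rr(1) by (simp add: power2_eq_square mult_left_le)
    have crB: "c * r\<^sup>2 * B \<le> 1"
    proof -
      have "r\<^sup>2 * (c * B) \<le> 1 / (c * B) * (c * B)" using r2 rr(5) c B(1) by (intro mult_right_mono) auto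
      then show ?thesis using c B(1) by (simp add: mult_ac)
    qed
    have ball: "z \<in> K" "cball z r \<subseteq> K" if "dist x z \<le> r" for z
    proof -
      have "cball z r \<subseteq> cball x d"
        using that rr(2) dist_triangle[of x _ z] by (auto simp: subset_eq) (smt (verit, best) field_sum_of_halves)
      then show "cball z r \<subseteq> K" using W(2)[OF x] by blast
      then show "z \<in> K" using r(1) by auto
    qed
    have HK: "H z = ?H z" "U z = u z" if "z \<in> K" for z using that K(2) by (auto simp: H_def U_def indicator_def)
    have av: "avg r U z \<le> u z + c * r\<^sup>2 * (?H z / 2 + \<epsilon>')" if z: "dist x z \<le> r" for z
    proof -
      have "\<bar>avg r U z - U z - c * r\<^sup>2 / 2 * H z\<bar> \<le> c * \<epsilon>' * r\<^sup>2"
        unfolding c_def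
      proof (rule avg_expansion[OF r(1)])
        show "cball z r \<subseteq> \<Omega>" using ball(2)[OF z] K(2) by blast
        fix y assume y: "y \<in> cball z r"
        then have "dist (?H y) (?H z) < \<epsilon>'"
          using ball[OF z] rr(3) by (intro d1(2)) (auto simp: dist_commute)
        then show "\<bar>H y - H z\<bar> \<le> \<epsilon>'" using y ball[OF z] by (simp add: HK subset_eq dist_real_def)
      qed
      moreover have "H z = ?H z" "U z = u z" using HK ball(1)[OF z] by auto
      moreover have "c * r\<^sup>2 * (?H z / 2 + \<epsilon>') = c * r\<^sup>2 / 2 * ?H z + c * \<epsilon>' * r\<^sup>2" by (simp add: distrib_left)
      ultimately show ?thesis by (simp only: abs_le_iff) linarith
    qed
    define \<kappa> where "\<kappa> = c * r\<^sup>2 * (3 / 2 * \<epsilon>' - ?J x / 2) + r ^ 4 * C"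
    define g where "g z = (indicator \<Omega> z * exp (- (c * r\<^sup>2 * V z))) * avg r U z" for z
    have avU: "0 \<le> avg r U z" for z using U_nonneg by (rule avg_nonneg)
    have g: "0 \<le> g z" "g z \<le> U z + \<kappa>" if z: "dist x z \<le> r" for z
    proof -
      note zK = ball(1)[OF z]
      have zO: "z \<in> \<Omega>" using zK K(2) by blast
      show "0 \<le> g z" using avU by (simp add: g_def)
      define t where "t = c * r\<^sup>2 * V z"
      define h where "h = ?H z / 2 + \<epsilon>'"
      have t: "\<bar>t\<bar> \<le> c * r\<^sup>2 * B" using c r B(2)[OF zK] by (simp add: t_def abs_mult mult_left_mono)
      have h: "\<bar>h\<bar> \<le> B" using B(4)[OF zK] \<epsilon>' B(1) unfolding h_def by linarith
      \<comment> \<open>For t \<ge> 0 multiply by exp t \<ge> 1 + t and use (1 - t + t^2)(1 + t) = 1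
        + t^3; for negative t the bound |t| \<le> 1 is used.\<close>
      have ex: "exp (- t) \<le> 1 - t + t\<^sup>2"
      proof (cases "0 \<le> t")
        case True
        have "(1 - t + t\<^sup>2) * (1 + t) = 1 + t ^ 3" by (simp add: power2_eq_square power3_eq_cube algebra_simps)
        then have "1 \<le> (1 - t + t\<^sup>2) * (1 + t)" using True by simp
        also have "\<dots> \<le> (1 - t + t\<^sup>2) * exp t"
        proof (intro mult_left_mono exp_ge_add_one_self)
          have "0 \<le> (t - 1 / 2)\<^sup>2" by simp
          then show "0 \<le> 1 - t + t\<^sup>2" by (simp add: power2_eq_square algebra_simps)
        qed
        finally show ?thesis by (simp add: exp_minus field_simps)
      next
        case False
        then show ?thesis using exp_bound[of "- t"] t crB by simp
      qed
      have "g z = exp (- t) * avg r U z" using zO by (simp add: g_def t_def)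
      also have "\<dots> \<le> (1 - t + t\<^sup>2) * avg r U z" using ex avU by (rule mult_right_mono)
      also have "\<dots> \<le> (1 - t + t\<^sup>2) * (u z + c * r\<^sup>2 * h)"
        using av[OF z] order_trans[OF exp_ge_zero ex] unfolding h_def by (rule mult_left_mono)
      also have "\<dots> = u z + (c * r\<^sup>2 * h - t * u z) + (- (t * (c * r\<^sup>2 * h)) + t\<^sup>2 * u z + t\<^sup>2 * (c * r\<^sup>2 * h))"
        by (simp add: algebra_simps)
      also have "c * r\<^sup>2 * h - t * u z = c * r\<^sup>2 * (\<epsilon>' - ?J z / 2)"
        by (simp add: h_def t_def field_simps)
      also have "\<dots> \<le> c * r\<^sup>2 * (3 / 2 * \<epsilon>' - ?J x / 2)"
      proof (intro mult_left_mono)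
        have "x \<in> K" using ball(1)[of x] r by simp
        then have "dist (?J z) (?J x) < \<epsilon>'" using zK z rr(4) by (intro d2(2)) (auto simp: dist_commute)
        then show "\<epsilon>' - ?J z / 2 \<le> 3 / 2 * \<epsilon>' - ?J x / 2" by (simp add: dist_real_def)
      qed (use c in simp)
      also have "- (t * (c * r\<^sup>2 * h)) + t\<^sup>2 * u z + t\<^sup>2 * (c * r\<^sup>2 * h) \<le> r ^ 4 * C"
      proof -
        have t2: "t\<^sup>2 \<le> (c * r\<^sup>2 * B)\<^sup>2" using t by (metis abs_ge_zero power2_abs power_mono)
        have ch: "\<bar>c * r\<^sup>2 * h\<bar> \<le> c * r\<^sup>2 * B" using h c by (simp add: abs_mult mult_left_mono)
        have "\<bar>t * (c * r\<^sup>2 * h)\<bar> \<le> (c * r\<^sup>2 * B) * (c * r\<^sup>2 * B)"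
          unfolding abs_mult[of t] using t ch by (intro mult_mono) auto
        then have 1: "- (t * (c * r\<^sup>2 * h)) \<le> r ^ 4 * (c\<^sup>2 * B\<^sup>2)" by (simp add: abs_le_iff power2_eq_square power4_eq_xxxx mult_ac)
        have "t\<^sup>2 * u z \<le> (c * r\<^sup>2 * B)\<^sup>2 * B" using t2 B(3)[OF zK] u_pos[OF zO] B(1) by (intro mult_mono) auto
        then have 2: "t\<^sup>2 * u z \<le> r ^ 4 * (c\<^sup>2 * B ^ 3)" by (simp add: power2_eq_square power3_eq_cube power4_eq_xxxx mult_ac)
        have "t\<^sup>2 * (c * r\<^sup>2 * h) \<le> (c * r\<^sup>2 * B)\<^sup>2 * (c * 1 * B)"
        proof (rule order_trans[OF mult_left_mono mult_right_mono])
          show "c * r\<^sup>2 * h \<le> c * 1 * B"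
          proof -
            have "c * r\<^sup>2 * h \<le> c * r\<^sup>2 * B" using ch by linarith
            also have "\<dots> \<le> c * 1 * B" using c B(1) r2 rr(1) by (intro mult_right_mono mult_left_mono) auto
            finally show ?thesis .
          qed
        qed (use t2 c B(1) in auto)
        then have 3: "t\<^sup>2 * (c * r\<^sup>2 * h) \<le> r ^ 4 * (c ^ 3 * B ^ 3)" by (simp add: power2_eq_square power3_eq_cube power4_eq_xxxx mult_ac)
        show ?thesis using 1 2 3 unfolding C_def by (simp add: distrib_left)
      qed
      finally show "g z \<le> U z + \<kappa>" using zK by (simp add: \<kappa>_def HK)
    qed
    have near: "dist x (x + r *\<^sub>R z) \<le> r" if "norm z < 1" for z using that r by (simp add: dist_norm)
    have gm: "g \<in> borel_measurable borel"
    proof -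
      have "(\<lambda>z. indicator \<Omega> z * exp (- (c * r\<^sup>2 * V z))) \<in> borel_measurable borel"
        by (intro indicator_measurable continuous_intros continuous_V)
      then show ?thesis unfolding g_def[abs_def] by measurable
    qed
    have Ub: "\<bar>U (x + r *\<^sub>R z)\<bar> \<le> B" if "norm z < 1" for z
      using ball(1)[OF near[OF that]] B(3) HK(2) by auto
    have iU: "integrable mol_measure (\<lambda>z. U (x + r *\<^sub>R z))"
      by (rule mol_integrable_bounded[OF _ Ub]) simp
    have ig: "integrable mol_measure (\<lambda>z. g (x + r *\<^sub>R z))"
    proof (rule mol_integrable_bounded[where C = "B + \<bar>\<kappa>\<bar>"])
      show "(\<lambda>z. g (x + r *\<^sub>R z)) \<in> borel_measurable borel" using gm by measurable
      show "\<bar>g (x + r *\<^sub>R z)\<bar> \<le> B + \<bar>\<kappa>\<bar>" if "norm z < 1" for z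
        using g[OF near[OF that]] Ub[OF that] by linarith
    qed
    have one: "measure (mol_measure :: 'a measure) UNIV = 1" by (metis mol.prob_space space_mol_measure)
    have "avg r g x \<le> avg r (\<lambda>z. U z + \<kappa>) x"
      using g(2) iU by (intro avg_mono ig r) auto
    also have "\<dots> = avg r U x + \<kappa>" unfolding avg_def using iU one by simp
    also have "\<dots> \<le> (u x + c * r\<^sup>2 * (?H x / 2 + \<epsilon>')) + \<kappa>" using av[of x] r by simp
    \<comment> \<open>\<open>?H x / 2\<close> and \<open>- ?J x / 2\<close> combine to minus the
      eigenvalue times u, so V cancels.\<close>
    also have "\<dots> = u x - c * r\<^sup>2 * (eigenvalue * u x) + r\<^sup>2 * (c * (5 / 2 * \<epsilon>')) + r\<^sup>2 * (r\<^sup>2 * C)"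
      by (simp add: \<kappa>_def field_simps power2_eq_square power4_eq_xxxx)
    also have "r\<^sup>2 * (r\<^sup>2 * C) \<le> r\<^sup>2 * (c * (\<epsilon> * u0 / 2))"
    proof (intro mult_left_mono)
      have "r\<^sup>2 * C \<le> r * (C + 1)" using r2 C r by (intro mult_mono) auto
      also have "\<dots> \<le> c * \<epsilon> * u0 / (2 * (C + 1)) * (C + 1)" using rr(6) C by (intro mult_right_mono) auto
      also have "\<dots> = c * (\<epsilon> * u0 / 2)" using C by (simp add: field_simps)
      finally show "r\<^sup>2 * C \<le> c * (\<epsilon> * u0 / 2)" .
    qed simp
    also have "r\<^sup>2 * (c * (5 / 2 * \<epsilon>')) \<le> r\<^sup>2 * (c * (\<epsilon> * u0 / 2))"
      using \<epsilon>'(3) c by (intro mult_left_mono) auto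
    also have "u x - c * r\<^sup>2 * (eigenvalue * u x) + r\<^sup>2 * (c * (\<epsilon> * u0 / 2)) + r\<^sup>2 * (c * (\<epsilon> * u0 / 2)) = u x - c * r\<^sup>2 * (eigenvalue * u x) + c * r\<^sup>2 * (\<epsilon> * u0)"
      by (simp add: field_simps)
    also have "\<dots> \<le> u x - c * r\<^sup>2 * (eigenvalue * u x) + c * r\<^sup>2 * (\<epsilon> * u x)"
      using u0(2)[of x] ball(1)[of x] r c \<epsilon> by (intro add_left_mono mult_left_mono) auto
    also have "\<dots> = (1 - c * r\<^sup>2 * (eigenvalue - \<epsilon>)) * u x" by (simp add: algebra_simps)
    finally show ?thesis by (simp add: g_def[abs_def])
  qed
  show ?thesis unfolding c_def[symmetric] using r0 main by blast
qed

end

section \<open>Inner parallel sets and truncations\<close>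

context dirichlet_eigenfunction
begin

definition core :: "real \<Rightarrow> 'a set" where
  "core \<eta> = {x. \<forall>y. y \<notin> \<Omega> \<longrightarrow> \<eta> \<le> dist x y}"

lemma core_subset: "0 < \<eta> \<Longrightarrow> core \<eta> \<subseteq> \<Omega>"
  by (force simp: core_def)

lemma core_antimono: "\<eta> \<le> \<eta>' \<Longrightarrow> core \<eta>' \<subseteq> core \<eta>"
  by (force simp: core_def)

lemma closed_core: "closed (core \<eta>)"
proof -
  have "core \<eta> = (\<Inter>y\<in>- \<Omega>. {x. \<eta> \<le> dist x y})" by (auto simp: core_def)
  then show ?thesis by (auto intro!: closed_INT closed_Collect_le continuous_intros)
qed

lemma borel_core [measurable]: "core \<eta> \<in> sets borel"
  using closed_core by simp

lemma bounded_core: "0 < \<eta> \<Longrightarrow> bounded (core \<eta>)"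
  using core_subset bounded_\<Omega> bounded_subset by blast

lemma compact_core: "0 < \<eta> \<Longrightarrow> compact (core \<eta>)"
  using closed_core bounded_core by (simp add: compact_eq_bounded_closed)

text \<open>A point z within distance less than \<eta> of a combination of x and y is the same
  combination of x + v and y + v for one short vector v, and these translates lie in
  \<Omega>.\<close>

lemma convex_core: "convex (core \<eta>)"
proof (rule convexI)
  fix x y a b assume xy: "x \<in> core \<eta>" "y \<in> core \<eta>" and ab: "0 \<le> a" "0 \<le> b" "a + b = (1::real)"
  show "a *\<^sub>R x + b *\<^sub>R y \<in> core \<eta>"
    unfolding core_def
  proof (intro CollectI allI impI)
    fix z assume z: "z \<notin> \<Omega>"
    define v where "v = z - (a *\<^sub>R x + b *\<^sub>R y)"
    have zv: "z = a *\<^sub>R (x + v) + b *\<^sub>R (y + v)"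
      using scaleR_add_left[of a b v, symmetric] ab by (simp add: v_def algebra_simps)
    show "\<eta> \<le> dist (a *\<^sub>R x + b *\<^sub>R y) z"
    proof (rule ccontr)
      assume "\<not> ?thesis"
      then have nv: "norm v < \<eta>" by (simp add: v_def dist_norm norm_minus_commute)
      have "x + v \<in> \<Omega>" using xy(1) nv unfolding core_def by (force simp: dist_norm)
      moreover have "y + v \<in> \<Omega>" using xy(2) nv unfolding core_def by (force simp: dist_norm)
      ultimately have "z \<in> \<Omega>" unfolding zv using convex_\<Omega> ab by (intro convexD)
      with z show False by simp
    qed
  qed
qed

lemma core_nbhd:
  assumes "x \<in> core \<eta>" "dist x y \<le> r"
  shows "y \<in> core (\<eta> - r)"
  unfolding core_def
proof (intro CollectI allI impI)
  fix z assume "z \<notin> \<Omega>"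
  then have "\<eta> \<le> dist x z" using assms(1) by (simp add: core_def)
  then show "\<eta> - r \<le> dist y z" using dist_triangle[of x z y] assms(2) by linarith
qed

lemma cball_subset_core: "cball x \<eta> \<subseteq> \<Omega> \<Longrightarrow> x \<in> core \<eta>"
  by (force simp: core_def)

lemma mem_core:
  assumes "x \<in> \<Omega>"
  obtains \<eta> where "0 < \<eta>" "x \<in> core \<eta>"
  using assms open_\<Omega> open_contains_cball cball_subset_core by metis

section \<open>The exponential weight and truncations of the eigenfunction\<close>

definition weight :: "real \<Rightarrow> 'a \<Rightarrow> real" where
  "weight r x = indicator \<Omega> x * exp (- (second_moment TYPE('a) * r\<^sup>2 * V x))"

lemma weight_measurable [measurable]: "weight r \<in> borel_measurable borel"
  unfolding weight_def[abs_def] by (intro indicator_measurable continuous_intros continuous_V)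

lemma weight_nonneg: "0 \<le> weight r x"
  by (simp add: weight_def)

lemma weight_le:
  assumes "\<And>x. x \<in> \<Omega> \<Longrightarrow> - C \<le> V x"
  shows "weight r x \<le> exp (second_moment TYPE('a) * r\<^sup>2 * C)"
proof (cases "x \<in> \<Omega>")
  case True
  have "second_moment TYPE('a) * r\<^sup>2 * (- C) \<le> second_moment TYPE('a) * r\<^sup>2 * V x"
    using assms[OF True] second_moment_pos[where 'a='a] by (intro mult_left_mono) auto
  then show ?thesis using True by (simp add: weight_def)
qed (simp add: weight_def)

lemma log_concave_weight: "log_concave (weight r)"
  unfolding log_concave_def
proof (intro conjI allI impI)
  fix x y :: 'a and t :: real assume t: "0 < t" "t < 1"
  let ?k = "second_moment TYPE('a) * r\<^sup>2"
  let ?z = "(1 - t) *\<^sub>R x + t *\<^sub>R y"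
  show "weight r x powr (1 - t) * weight r y powr t \<le> weight r ?z"
  proof (cases "x \<in> \<Omega> \<and> y \<in> \<Omega>")
    case True
    then have z: "?z \<in> \<Omega>" using convex_\<Omega> t by (intro convexD) auto
    have "V ?z \<le> (1 - t) * V x + t * V y" using convex_onD[OF convex_V] t True by auto
    then have "?k * V ?z \<le> ?k * ((1 - t) * V x + t * V y)"
      using second_moment_pos[where 'a='a] by (intro mult_left_mono) auto
    then have "- (?k * V x) * (1 - t) + - (?k * V y) * t \<le> - (?k * V ?z)" by (simp add: algebra_simps)
    then show ?thesis using True z by (simp add: weight_def exp_powr_real exp_add[symmetric])
  qed (use weight_nonneg t in \<open>auto simp: weight_def\<close>)
qed (rule weight_nonneg)

lemma U_square_integrable: "integrable lborel (\<lambda>x. (U x)\<^sup>2)"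
  and mass_eq: "mass = (\<integral>x. (U x)\<^sup>2 \<partial>lborel)"
  and VU_integrable: "integrable lborel (\<lambda>x. indicator \<Omega> x * V x * (U x)\<^sup>2)"
  and potential_energy_eq: "potential_energy = (\<integral>x. indicator \<Omega> x * V x * (U x)\<^sup>2 \<partial>lborel)"
proof -
  have VM: "(\<lambda>x. indicator \<Omega> x * V x) \<in> borel_measurable borel" by (rule indicator_measurable[OF continuous_V])
  have m: "(\<lambda>x. (U x)\<^sup>2) \<in> borel_measurable borel" "(\<lambda>x. indicator \<Omega> x * V x * (U x)\<^sup>2) \<in> borel_measurable borel"
    using VM by measurable
  have z: "x \<notin> \<Omega> \<Longrightarrow> (U x)\<^sup>2 = 0" "x \<notin> \<Omega> \<Longrightarrow> indicator \<Omega> x * V x * (U x)\<^sup>2 = 0" for x by (simp_all add: U_def)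
  have e1: "(LINT x|lebesgue_on \<Omega>. (U x)\<^sup>2) = mass" and e2: "(LINT x|lebesgue_on \<Omega>. indicator \<Omega> x * V x * (U x)\<^sup>2) = potential_energy"
    unfolding mass_def potential_energy_def
    by (intro Bochner_Integration.integral_cong refl, simp add: U_def space_restrict_space)+
  have i1: "integrable (lebesgue_on \<Omega>) (\<lambda>x. (U x)\<^sup>2)" 
    by (rule Bochner_Integration.integrable_cong[THEN iffD1, OF refl _ u_L2]) (simp add: U_def space_restrict_space)
  have i2: "integrable (lebesgue_on \<Omega>) (\<lambda>x. indicator \<Omega> x * V x * (U x)\<^sup>2)"
    by (rule Bochner_Integration.integrable_cong[THEN iffD1, OF refl _ potential_energy_integrable]) (simp add: U_def space_restrict_space)
  show "integrable lborel (\<lambda>x. (U x)\<^sup>2)" using lebesgue_on_eq_lborel(2)[OF open_\<Omega> m(1)] z(1) i1 by blast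
  show "integrable lborel (\<lambda>x. indicator \<Omega> x * V x * (U x)\<^sup>2)" using lebesgue_on_eq_lborel(2)[OF open_\<Omega> m(2)] z(2) i2 by blast
  show "mass = (\<integral>x. (U x)\<^sup>2 \<partial>lborel)" using lebesgue_on_eq_lborel(1)[OF open_\<Omega> m(1) z(1)] e1 by simp
  show "potential_energy = (\<integral>x. indicator \<Omega> x * V x * (U x)\<^sup>2 \<partial>lborel)" using lebesgue_on_eq_lborel(1)[OF open_\<Omega> m(2) z(2)] e2 by simp
qed

lemma dirichlet_energy_nonneg: "0 \<le> dirichlet_energy"
  unfolding dirichlet_energy_def by (intro integral_nonneg_AE) simp

lemma bbs_truncation: "0 \<le> M \<Longrightarrow> bbs (\<lambda>x. min (U x) M)"
proof -
  assume M: "0 \<le> M"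
  obtain R where R: "\<And>x. x \<in> \<Omega> \<Longrightarrow> norm x \<le> R" using bounded_\<Omega> unfolding bounded_iff by blast
  show ?thesis
  proof (rule bbsI)
    show "\<bar>min (U x) M\<bar> \<le> M" for x using U_nonneg[of x] M by auto
    show "R < norm x \<Longrightarrow> min (U x) M = 0" for x using R[of x] M by (auto simp: U_def indicator_def)
  qed measurable
qed

text \<open>Truncation is 1-Lipschitz and therefore does not increase nonlocal energies, so the
  sharp bound for \<open>U\<close> passes to the bounded function \<open>b\<close>, to which the
  operator calculus applies.\<close>

lemma truncated_energy:
  assumes \<rho>: "0 < \<rho>" and M: "0 \<le> M"
  defines "b \<equiv> \<lambda>x. min (U x) M"
  shows "(\<integral>x. (b x)\<^sup>2 \<partial>lborel) - (\<integral>x. (avg \<rho> b x)\<^sup>2 \<partial>lborel) \<le> second_moment TYPE('a) * \<rho>\<^sup>2 * dirichlet_energy"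
proof -
  have b: "bbs b" unfolding b_def by (rule bbs_truncation[OF M])
  have "ennreal (2 * ((\<integral>x. (b x)\<^sup>2 \<partial>lborel) - (\<integral>x. (avg \<rho> b x)\<^sup>2 \<partial>lborel))) = nonlocal_energy UNIV \<rho> b"
    by (rule nonlocal_energy_UNIV(1)[OF b \<rho>, symmetric])
  also have "\<dots> \<le> nonlocal_energy UNIV \<rho> U"
    unfolding nonlocal_energy_def
  proof (intro nn_integral_mono ennreal_leI mult_left_mono)
    have "\<bar>min s M - min t M\<bar> \<le> \<bar>s - t\<bar>" for s t :: real by auto
    then show "(b y - b z)\<^sup>2 \<le> (U y - U z)\<^sup>2" for y z unfolding b_def by (simp only: abs_le_square_iff[symmetric])
  qed auto
  also have "\<dots> \<le> ennreal (2 * second_moment TYPE('a) * \<rho>\<^sup>2 * dirichlet_energy)"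
    using W12_0_nonlocal_energy[OF u_W12_0 open_\<Omega> indicator_measurable[OF continuous_u]]
    unfolding U_def[abs_def] dirichlet_energy_def .
  finally show ?thesis
    using dirichlet_energy_nonneg second_moment_pos[where 'a='a] by (subst (asm) ennreal_le_iff) auto
qed

lemma truncated_mass: "(\<lambda>M::nat. \<integral>x. (min (U x) (real M))\<^sup>2 \<partial>lborel) \<longlonglongrightarrow> mass"
  unfolding mass_eq
proof (rule integral_dominated_convergence[where w = "\<lambda>x. (U x)\<^sup>2"])
  show "AE x in lborel. (\<lambda>M. (min (U x) (real M))\<^sup>2) \<longlonglongrightarrow> (U x)\<^sup>2"
  proof (intro AE_I2 tendsto_eventually)
    fix x
    show "\<forall>\<^sub>F M in sequentially. (min (U x) (real M))\<^sup>2 = (U x)\<^sup>2"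
      using eventually_ge_at_top[of "nat \<lceil>U x\<rceil>"] by eventually_elim (simp add: min_absorb1 nat_ceiling_le_eq)
  qed
  show "AE x in lborel. norm ((min (U x) (real M))\<^sup>2) \<le> (U x)\<^sup>2" for M
    using U_nonneg by (intro AE_I2) (simp add: power_mono)
qed (use U_square_integrable in auto)

end

section \<open>Nearly optimal log-concave functions\<close>

context dirichlet_eigenfunction
begin

text \<open>Shrinking \<Omega> towards p by the factor s leaves a margin (1 - s) \<rho>: a point
  that close to the shrunken copy is a convex combination, with weights s and 1 - s, of a point of
  \<Omega> and a point of the ball about p.\<close>

lemma rescaled_truncation:
  fixes p :: 'a
  assumes p: "cball p \<rho> \<subseteq> \<Omega>" "0 < \<rho>" and s: "0 < s" "s < 1" and M: "0 \<le> M"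
  defines "b \<equiv> \<lambda>x. min (U x) M"
  defines "f \<equiv> \<lambda>x. b (p + (1 / s) *\<^sub>R (x - p))"
  shows "f \<in> borel_measurable borel" "0 \<le> f x" "f x \<le> M" "x \<notin> core ((1 - s) * \<rho>) \<Longrightarrow> f x = 0"
proof -
  have [measurable]: "b \<in> borel_measurable borel" unfolding b_def by measurable
  show "f \<in> borel_measurable borel" unfolding f_def by measurable
  show "0 \<le> f x" "f x \<le> M" using U_nonneg M by (auto simp: f_def b_def)
  assume x: "x \<notin> core ((1 - s) * \<rho>)"
  show "f x = 0"
  proof (rule ccontr)
    assume "f x \<noteq> 0"
    have y: "p + (1 / s) *\<^sub>R (x - p) \<in> \<Omega>"
    proof (rule ccontr)
      assume "\<not> ?thesis"
      then have "f x = 0" using M by (simp add: f_def b_def U_def)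
      with \<open>f x \<noteq> 0\<close> show False ..
    qed
    have "cball x ((1 - s) * \<rho>) \<subseteq> \<Omega>"
    proof
      fix z assume "z \<in> cball x ((1 - s) * \<rho>)"
      then have "norm (z - x) \<le> (1 - s) * \<rho>" by (simp add: dist_norm norm_minus_commute)
      then have "norm ((1 / (1 - s)) *\<^sub>R (z - x)) \<le> \<rho>" unfolding norm_scaleR using s by (simp add: field_simps)
      then have "p + (1 / (1 - s)) *\<^sub>R (z - x) \<in> \<Omega>" using p(1) by (auto simp: dist_norm)
      with y have "s *\<^sub>R (p + (1 / s) *\<^sub>R (x - p)) + (1 - s) *\<^sub>R (p + (1 / (1 - s)) *\<^sub>R (z - x)) \<in> \<Omega>"
        using convex_\<Omega> s by (intro convexD) auto
      moreover have "s *\<^sub>R (p + (1 / s) *\<^sub>R (x - p)) + (1 - s) *\<^sub>R (p + (1 / (1 - s)) *\<^sub>R (z - x)) = z"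
        using s by (simp add: scaleR_add_right) (simp add: algebra_simps)
      ultimately show "z \<in> \<Omega>" by simp
    qed
    then show False using x cball_subset_core by blast
  qed
qed

text \<open>Integrals scale by s^n, and an average of radius r becomes one of radius r / s, which is
  the origin of the factor 1 / s^2 at the Dirichlet energy of the competitor.\<close>

lemma rescaled_truncation_integrals:
  fixes p :: 'a
  assumes s: "0 < s" and M: "0 \<le> M"
  defines "b \<equiv> \<lambda>x. min (U x) M"
  defines "f \<equiv> \<lambda>x. b (p + (1 / s) *\<^sub>R (x - p))"
  shows "(\<integral>x. (f x)\<^sup>2 \<partial>lborel) = s ^ DIM('a) * (\<integral>x. (b x)\<^sup>2 \<partial>lborel)"
    and "(\<integral>x. (avg r f x)\<^sup>2 \<partial>lborel) = s ^ DIM('a) * (\<integral>x. (avg (r / s) b x)\<^sup>2 \<partial>lborel)"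
    and "g \<in> borel_measurable borel \<Longrightarrow>
      (\<integral>x. g x * (f x)\<^sup>2 \<partial>lborel) = s ^ DIM('a) * (\<integral>y. g (p + s *\<^sub>R (y - p)) * (b y)\<^sup>2 \<partial>lborel)"
proof -
  have [measurable]: "b \<in> borel_measurable borel" unfolding b_def by measurable
  let ?a = "p - (1 / s) *\<^sub>R p"
  have af: "p + (1 / s) *\<^sub>R (x - p) = ?a + (1 / s) *\<^sub>R x" for x by (simp add: algebra_simps)
  have aff: "(\<integral>x. F (?a + (1 / s) *\<^sub>R x) \<partial>lborel) = s ^ DIM('a) * (\<integral>x. F x \<partial>lborel)"
    if "F \<in> borel_measurable borel" for F :: "'a \<Rightarrow> real"
    using lborel_integral_affine[OF that, of "1 / s" ?a] s by (simp add: power_one_over)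
  show "(\<integral>x. (f x)\<^sup>2 \<partial>lborel) = s ^ DIM('a) * (\<integral>x. (b x)\<^sup>2 \<partial>lborel)"
    unfolding f_def af by (rule aff) measurable
  have "avg r f x = avg (r / s) b (?a + (1 / s) *\<^sub>R x)" for x
    unfolding avg_def f_def af by (simp add: scaleR_add_right add.assoc)
  then have "(\<integral>x. (avg r f x)\<^sup>2 \<partial>lborel) = (\<integral>x. (avg (r / s) b (?a + (1 / s) *\<^sub>R x))\<^sup>2 \<partial>lborel)" by simp
  also have "\<dots> = s ^ DIM('a) * (\<integral>x. (avg (r / s) b x)\<^sup>2 \<partial>lborel)" by (rule aff) measurable
  finally show "(\<integral>x. (avg r f x)\<^sup>2 \<partial>lborel) = s ^ DIM('a) * (\<integral>x. (avg (r / s) b x)\<^sup>2 \<partial>lborel)" .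
  assume [measurable]: "g \<in> borel_measurable borel"
  have "(\<integral>x. g x * (f x)\<^sup>2 \<partial>lborel) = (\<integral>x. g (p + s *\<^sub>R ((?a + (1 / s) *\<^sub>R x) - p)) * (b (?a + (1 / s) *\<^sub>R x))\<^sup>2 \<partial>lborel)"
  proof (intro Bochner_Integration.integral_cong refl)
    fix x
    have "p + s *\<^sub>R ((?a + (1 / s) *\<^sub>R x) - p) = x" using s by (simp add: algebra_simps)
    then show "g x * (f x)\<^sup>2 = g (p + s *\<^sub>R ((?a + (1 / s) *\<^sub>R x) - p)) * (b (?a + (1 / s) *\<^sub>R x))\<^sup>2"
      by (simp only: f_def af)
  qed
  also have "\<dots> = s ^ DIM('a) * (\<integral>y. g (p + s *\<^sub>R (y - p)) * (b y)\<^sup>2 \<partial>lborel)" by (rule aff) measurable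
  finally show "(\<integral>x. g x * (f x)\<^sup>2 \<partial>lborel) = s ^ DIM('a) * (\<integral>y. g (p + s *\<^sub>R (y - p)) * (b y)\<^sup>2 \<partial>lborel)" .
qed

text \<open>Averaging commutes with a potential up to its oscillation at scale \<open>r\<close>; the shift by \<open>C\<close> makes
  Jensen's inequality applicable.\<close>

lemma averaged_potential_energy:
  assumes f: "bbs f" "\<And>x. x \<notin> core d \<Longrightarrow> f x = 0" and d: "0 < d" and r: "0 < r" "r \<le> d / 2"
    and C: "\<And>x. x \<in> \<Omega> \<Longrightarrow> - C \<le> V x"
    and osc: "\<And>x y. x \<in> core d \<Longrightarrow> dist x y < r \<Longrightarrow> V y \<le> V x + \<epsilon>"
  defines "Vd \<equiv> \<lambda>x. indicator (core (d / 2)) x * V x"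
  shows "(\<integral>x. (f x)\<^sup>2 \<partial>lborel) - (\<integral>x. weight r x * (avg r f x)\<^sup>2 \<partial>lborel) \<le>
    ((\<integral>x. (f x)\<^sup>2 \<partial>lborel) - (\<integral>x. (avg r f x)\<^sup>2 \<partial>lborel)) + second_moment TYPE('a) * r\<^sup>2 *
      ((\<integral>x. Vd x * (f x)\<^sup>2 \<partial>lborel) + \<epsilon> * (\<integral>x. (f x)\<^sup>2 \<partial>lborel)
        + C * ((\<integral>x. (f x)\<^sup>2 \<partial>lborel) - (\<integral>x. (avg r f x)\<^sup>2 \<partial>lborel)))"
proof -
  let ?c = "second_moment TYPE('a)" and ?K = "core (d / 2)"
  have c: "0 < ?c" by (rule second_moment_pos)
  have K: "?K \<subseteq> \<Omega>" "compact ?K" using core_subset[of "d / 2"] compact_core[of "d / 2"] d by auto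
  obtain B where B: "0 \<le> B" "\<And>x. x \<in> ?K \<Longrightarrow> \<bar>V x\<bar> \<le> B" using bounded_on_compact[OF continuous_V K(2,1)] by blast
  have Vdm [measurable]: "Vd \<in> borel_measurable borel"
  proof -
    have "(\<lambda>x. indicator ?K x * (indicator \<Omega> x * V x)) \<in> borel_measurable borel"
      using indicator_measurable[OF continuous_V] by measurable
    also have "(\<lambda>x. indicator ?K x * (indicator \<Omega> x * V x)) = Vd" using K(1) by (auto simp: Vd_def indicator_def fun_eq_iff)
    finally show ?thesis .
  qed
  have Vdb: "\<bar>Vd x\<bar> \<le> B" for x using B by (auto simp: Vd_def indicator_def)
  define Y where "Y x = Vd x + C * indicator ?K x" for x
  have bY: "bbs Y"
  proof -
    have i: "bbs (indicator ?K :: 'a \<Rightarrow> real)" using d bounded_core by (intro bbs_indicator) auto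
    have "bbs (\<lambda>x. Vd x * indicator ?K x)" by (rule bbs_mult_bounded[OF i Vdm Vdb])
    then have "bbs Vd" by (rule back_subst[of bbs]) (auto simp: Vd_def indicator_def fun_eq_iff)
    then show ?thesis unfolding Y_def[abs_def] by (intro bbs_add bbs_cmult i)
  qed
  have Y0: "0 \<le> Y x" for x using C K(1) by (force simp: Y_def Vd_def indicator_def)
  let ?a = "avg r f"
  note ba = bbs_avg[OF f(1) r(1)]
  have a0: "?a x = 0" if "x \<notin> ?K" for x
  proof -
    have "\<bar>?a x\<bar> \<le> 0"
    proof (rule avg_bound[OF bbs_measurable[OF f(1)] r(1)])
      fix y assume "dist x y < r"
      then have "y \<notin> core d" using core_nbhd[of y d x "d / 2"] that r by (auto simp: dist_commute)
      then show "\<bar>f y\<bar> \<le> 0" using f(2) by simp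
    qed
    then show ?thesis by simp
  qed
  note [simp] = bbs_integrable[OF bbs_power2[OF ba]] bbs_integrable[OF bbs_power2[OF f(1)]]
  have iV: "integrable lborel (\<lambda>x. Vd x * (?a x)\<^sup>2)" "integrable lborel (\<lambda>x. Vd x * (f x)\<^sup>2)"
    by (rule bbs_integrable[OF bbs_mult_bounded[OF bbs_power2 Vdm Vdb]], rule ba f(1))+
  have w1: "(\<integral>x. (?a x)\<^sup>2 \<partial>lborel) - ?c * r\<^sup>2 * (\<integral>x. Vd x * (?a x)\<^sup>2 \<partial>lborel) \<le> (\<integral>x. weight r x * (?a x)\<^sup>2 \<partial>lborel)"
  proof -
    have "(\<integral>x. (?a x)\<^sup>2 - ?c * r\<^sup>2 * (Vd x * (?a x)\<^sup>2) \<partial>lborel) \<le> (\<integral>x. weight r x * (?a x)\<^sup>2 \<partial>lborel)"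
    proof (rule integral_mono)
      show "integrable lborel (\<lambda>x. (?a x)\<^sup>2 - ?c * r\<^sup>2 * (Vd x * (?a x)\<^sup>2))" using iV by simp
      have "\<bar>weight r x\<bar> \<le> exp (?c * r\<^sup>2 * C)" for x using weight_nonneg weight_le[OF C] by simp
      then show "integrable lborel (\<lambda>x. weight r x * (?a x)\<^sup>2)"
        by (intro bbs_integrable[OF bbs_mult_bounded[OF bbs_power2[OF ba] weight_measurable]])
      show "(?a x)\<^sup>2 - ?c * r\<^sup>2 * (Vd x * (?a x)\<^sup>2) \<le> weight r x * (?a x)\<^sup>2" for x
      proof (cases "x \<in> ?K")
        case True
        then have "1 - ?c * r\<^sup>2 * Vd x \<le> weight r x"
          using exp_ge_add_one_self[of "- (?c * r\<^sup>2 * V x)"] K(1) by (auto simp: weight_def Vd_def)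
        from mult_right_mono[OF this, of "(?a x)\<^sup>2"] show ?thesis by (simp add: algebra_simps)
      qed (simp add: a0)
    qed
    then show ?thesis using iV by simp
  qed
  have "(\<integral>x. Y x * (?a x)\<^sup>2 \<partial>lborel) \<le> (\<integral>x. Y x * avg r (\<lambda>x. (f x)\<^sup>2) x \<partial>lborel)"
  proof (rule integral_mono)
    show "integrable lborel (\<lambda>x. Y x * (?a x)\<^sup>2)" "integrable lborel (\<lambda>x. Y x * avg r (\<lambda>x. (f x)\<^sup>2) x)"
      by (intro bbs_integrable bbs_mult bY bbs_power2 bbs_avg f r)+
    have "0 \<le> (\<integral>z. (\<integral>z'. (f (x + r *\<^sub>R z) - f (x + r *\<^sub>R z'))\<^sup>2 \<partial>mol_measure) \<partial>mol_measure)" for x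
      by (intro integral_nonneg_AE AE_I2) auto
    then have "(?a x)\<^sup>2 \<le> avg r (\<lambda>x. (f x)\<^sup>2) x" for x unfolding avg_power2[OF f(1)] by simp
    then show "Y x * (?a x)\<^sup>2 \<le> Y x * avg r (\<lambda>x. (f x)\<^sup>2) x" for x using Y0 by (rule mult_left_mono)
  qed
  \<comment> \<open>Self-adjointness moves the average from f^2 to Y, where the oscillation of V on
    the scale r controls it.\<close>
  also have "\<dots> = (\<integral>x. avg r Y x * (f x)\<^sup>2 \<partial>lborel)"
    by (rule avg_self_adjoint[OF bY bbs_power2[OF f(1)] r(1), symmetric])
  also have "\<dots> \<le> (\<integral>x. Vd x * (f x)\<^sup>2 + (C + \<epsilon>) * (f x)\<^sup>2 \<partial>lborel)"
  proof (rule integral_mono)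
    show "integrable lborel (\<lambda>x. avg r Y x * (f x)\<^sup>2)" by (intro bbs_integrable bbs_mult bY bbs_power2 bbs_avg f r)
    show "integrable lborel (\<lambda>x. Vd x * (f x)\<^sup>2 + (C + \<epsilon>) * (f x)\<^sup>2)" using iV by simp
    show "avg r Y x * (f x)\<^sup>2 \<le> Vd x * (f x)\<^sup>2 + (C + \<epsilon>) * (f x)\<^sup>2" for x
    proof (cases "x \<in> core d")
      case True
      then have xK: "x \<in> ?K" using core_antimono[of "d / 2" d] d by auto
      have one: "measure (mol_measure :: 'a measure) UNIV = 1" by (metis mol.prob_space space_mol_measure)
      have "avg r Y x \<le> avg r (\<lambda>_. V x + \<epsilon> + C) x"
      proof (rule avg_mono[OF bbs_mol_integrable[OF bY] _ r(1)])
        fix y assume y: "dist x y < r"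
        then have "y \<in> core (d - d / 2)" using core_nbhd[OF True, of y "d / 2"] r by simp
        then have "y \<in> ?K" by simp
        then show "Y y \<le> V x + \<epsilon> + C" using osc[OF True y] by (simp add: Y_def Vd_def)
      qed simp
      also have "\<dots> = V x + \<epsilon> + C" by (simp add: avg_def one)
      finally have "avg r Y x \<le> V x + \<epsilon> + C" .
      from mult_right_mono[OF this, of "(f x)\<^sup>2"] show ?thesis using xK by (simp add: Vd_def algebra_simps)
    qed (simp add: f(2))
  qed
  also have "\<dots> = (\<integral>x. Vd x * (f x)\<^sup>2 \<partial>lborel) + (C + \<epsilon>) * (\<integral>x. (f x)\<^sup>2 \<partial>lborel)" using iV by simp
  finally have 1: "(\<integral>x. Y x * (?a x)\<^sup>2 \<partial>lborel) \<le> (\<integral>x. Vd x * (f x)\<^sup>2 \<partial>lborel) + (C + \<epsilon>) * (\<integral>x. (f x)\<^sup>2 \<partial>lborel)" .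
  have "(\<integral>x. Y x * (?a x)\<^sup>2 \<partial>lborel) = (\<integral>x. Vd x * (?a x)\<^sup>2 + C * (?a x)\<^sup>2 \<partial>lborel)"
    by (intro Bochner_Integration.integral_cong refl) (use a0 in \<open>auto simp: Y_def indicator_def algebra_simps\<close>)
  also have "\<dots> = (\<integral>x. Vd x * (?a x)\<^sup>2 \<partial>lborel) + C * (\<integral>x. (?a x)\<^sup>2 \<partial>lborel)" using iV by simp
  finally have "(\<integral>x. Vd x * (?a x)\<^sup>2 \<partial>lborel) \<le> (\<integral>x. Vd x * (f x)\<^sup>2 \<partial>lborel) + \<epsilon> * (\<integral>x. (f x)\<^sup>2 \<partial>lborel)
        + C * ((\<integral>x. (f x)\<^sup>2 \<partial>lborel) - (\<integral>x. (?a x)\<^sup>2 \<partial>lborel))"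
    using 1 by (simp add: algebra_simps)
  then have "?c * r\<^sup>2 * (\<integral>x. Vd x * (?a x)\<^sup>2 \<partial>lborel) \<le> ?c * r\<^sup>2 * ((\<integral>x. Vd x * (f x)\<^sup>2 \<partial>lborel) + \<epsilon> * (\<integral>x. (f x)\<^sup>2 \<partial>lborel)
        + C * ((\<integral>x. (f x)\<^sup>2 \<partial>lborel) - (\<integral>x. (?a x)\<^sup>2 \<partial>lborel)))"
    using c by (intro mult_left_mono) auto
  with w1 show ?thesis by linarith
qed

text \<open>Dilation brings the support into a core and truncation makes the function bounded. V may
  blow up at the boundary, yet convexity bounds its values at dilated points by (1 - s) V p + s V y,
  which is integrable against u^2. The costs vanish as s tends to 1 and the truncation level to
  infinity.\<close>

lemma competitor:
  assumes \<epsilon>: "0 < \<epsilon>"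
  obtains f C d r0 where "bbs f" "0 < C" "0 < d" "0 < r0" "\<And>x. 0 \<le> f x" "\<And>x. f x \<le> C * indicator (core d) x"
    "0 < (\<integral>x. (f x)\<^sup>2 \<partial>lborel)"
    "\<And>r. 0 < r \<Longrightarrow> r < r0 \<Longrightarrow> (1 - second_moment TYPE('a) * r\<^sup>2 * (eigenvalue + \<epsilon>)) * (\<integral>x. (f x)\<^sup>2 \<partial>lborel) < (\<integral>x. weight r x * (avg r f x)\<^sup>2 \<partial>lborel)"
proof -
  let ?c = "second_moment TYPE('a)" and ?n = "DIM('a)"
  have c: "0 < ?c" by (rule second_moment_pos)
  obtain C0 where C0: "0 \<le> C0" "\<And>x. x \<in> \<Omega> \<Longrightarrow> - C0 \<le> V x"
    using convex_on_bounded_below[OF open_\<Omega> bounded_\<Omega> convex_V] by blast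
  define mb where "mb M = (\<integral>x. (min (U x) (real M))\<^sup>2 \<partial>lborel)" for M :: nat
  have mb: "mb \<longlonglongrightarrow> mass" using truncated_mass by (simp add: mb_def[abs_def])
  \<comment> \<open>The level is chosen so that the lost mass, charged at the rate C0, is paid by
    \<epsilon> / 2 times the truncated mass.\<close>
  have "(\<lambda>M. (eigenvalue + \<epsilon> / 2) * mb M - C0 * (mass - mb M)) \<longlonglongrightarrow> (eigenvalue + \<epsilon> / 2) * mass - C0 * (mass - mass)"
    by (intro tendsto_intros mb)
  moreover have "eigenvalue * mass < (eigenvalue + \<epsilon> / 2) * mass - C0 * (mass - mass)"
    using mass_pos \<epsilon> by (simp add: distrib_right)
  ultimately have "\<forall>\<^sub>F M in sequentially. eigenvalue * mass < (eigenvalue + \<epsilon> / 2) * mb M - C0 * (mass - mb M)"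
    by (rule order_tendstoD(1))
  moreover have "\<forall>\<^sub>F M in sequentially. 0 < mb M" by (rule order_tendstoD(1)[OF mb mass_pos])
  moreover have "\<forall>\<^sub>F M in sequentially. 0 < M" by (rule eventually_gt_at_top)
  ultimately have "\<forall>\<^sub>F M in sequentially. (eigenvalue * mass < (eigenvalue + \<epsilon> / 2) * mb M - C0 * (mass - mb M) \<and> 0 < mb M) \<and> 0 < M"
    by (intro eventually_conj)
  then obtain M where M: "eigenvalue * mass < (eigenvalue + \<epsilon> / 2) * mb M - C0 * (mass - mb M)" "0 < mb M" "0 < M"
    using eventually_happens'[OF sequentially_bot] by blast
  define \<beta> where "\<beta> = mb M"
  obtain p where p: "p \<in> \<Omega>" using nonempty_\<Omega> by blast
  then obtain \<rho> where \<rho>: "0 < \<rho>" "cball p \<rho> \<subseteq> \<Omega>" using open_contains_cball open_\<Omega> by blast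
  \<comment> \<open>Energy bound for the truncated and dilated function, without the common factor
    s^n. At s = 1 it is the full energy plus the truncation charge.\<close>
  let ?E = "\<lambda>s. dirichlet_energy / s\<^sup>2 + s * (potential_energy + C0 * (mass - \<beta>)) + (1 - s) * V p * \<beta>"
  have "(?E \<longlongrightarrow> dirichlet_energy / 1\<^sup>2 + 1 * (potential_energy + C0 * (mass - \<beta>)) + (1 - 1) * V p * \<beta>) (at_left 1)"
    by (intro tendsto_intros) auto
  moreover have "dirichlet_energy / 1\<^sup>2 + 1 * (potential_energy + C0 * (mass - \<beta>)) + (1 - 1) * V p * \<beta> < (eigenvalue + \<epsilon> / 2) * \<beta>"
    using M(1) energy_balance by (simp add: \<beta>_def)
  ultimately have "\<forall>\<^sub>F s in at_left 1. ?E s < (eigenvalue + \<epsilon> / 2) * \<beta>" by (rule order_tendstoD(2))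
  moreover have "\<forall>\<^sub>F s::real in at_left 1. s \<in> {0<..<1}" by (rule eventually_at_left_real) simp
  ultimately have "\<forall>\<^sub>F s in at_left 1. ?E s < (eigenvalue + \<epsilon> / 2) * \<beta> \<and> s \<in> {0<..<1}" by (rule eventually_conj)
  then obtain s where s: "?E s < (eigenvalue + \<epsilon> / 2) * \<beta>" "0 < s" "s < 1"
    using eventually_happens'[OF trivial_limit_at_left_real] by fastforce
  define b where "b x = min (U x) (real M)" for x
  define f where "f x = b (p + (1 / s) *\<^sub>R (x - p))" for x
  define d where "d = (1 - s) * \<rho>"
  have d: "0 < d" using s \<rho> by (simp add: d_def)
  have M0: "0 \<le> real M" by simp
  note R = rescaled_truncation[OF \<rho>(2,1) s(2,3) M0, folded b_def, folded f_def d_def]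
  note I = rescaled_truncation_integrals[OF s(2) M0, where p = p, folded b_def, folded f_def]
  have fs: "f x \<le> real M * indicator (core d) x" for x using R(3,4)[of x] by (cases "x \<in> core d") auto
  obtain N where N: "\<And>x. x \<in> core d \<Longrightarrow> norm x \<le> N" using bounded_core[OF d] unfolding bounded_iff by blast
  have bf: "bbs f"
  proof (rule bbsI[OF R(1)])
    show "\<bar>f x\<bar> \<le> real M" for x using R(2,3)[of x] by simp
    show "N < norm x \<Longrightarrow> f x = 0" for x using N[of x] R(4)[of x] by force
  qed
  have sn: "0 < s ^ ?n" using s by simp
  have F: "(\<integral>x. (f x)\<^sup>2 \<partial>lborel) = s ^ ?n * \<beta>" unfolding I(1) \<beta>_def mb_def b_def ..
  let ?K = "core (d / 2)"
  have K: "?K \<subseteq> \<Omega>" "compact ?K" using core_subset[of "d / 2"] compact_core[of "d / 2"] d by auto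
  have "uniformly_continuous_on ?K V"
    using compact_uniformly_continuous[OF continuous_on_subset[OF continuous_V K(1)] K(2)] .
  then obtain r1 where r1: "0 < r1" "\<And>x y. x \<in> ?K \<Longrightarrow> y \<in> ?K \<Longrightarrow> dist y x < r1 \<Longrightarrow> dist (V y) (V x) < \<epsilon> / 4"
    using \<epsilon> unfolding uniformly_continuous_on_def by (metis zero_less_divide_iff zero_less_numeral)
  define Vd where "Vd x = indicator ?K x * V x" for x
  have Vdm [measurable]: "Vd \<in> borel_measurable borel"
  proof -
    have "(\<lambda>x. indicator ?K x * (indicator \<Omega> x * V x)) \<in> borel_measurable borel"
      using indicator_measurable[OF continuous_V] by measurable
    also have "(\<lambda>x. indicator ?K x * (indicator \<Omega> x * V x)) = Vd" using K(1) by (auto simp: Vd_def indicator_def fun_eq_iff)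
    finally show ?thesis .
  qed
  obtain B where B: "0 \<le> B" "\<And>x. x \<in> ?K \<Longrightarrow> \<bar>V x\<bar> \<le> B" using bounded_on_compact[OF continuous_V K(2,1)] by blast
  have bb: "bbs b" unfolding b_def[abs_def] by (rule bbs_truncation) simp
  have VF: "(\<integral>x. Vd x * (f x)\<^sup>2 \<partial>lborel) \<le> s ^ ?n * (s * (potential_energy + C0 * (mass - \<beta>)) + (1 - s) * V p * \<beta>)"
  proof -
    have i1: "integrable lborel (\<lambda>y. (b y)\<^sup>2)" by (rule bbs_integrable[OF bbs_power2[OF bb]])
    note i = i1 U_square_integrable VU_integrable
    have "(\<integral>y. Vd (p + s *\<^sub>R (y - p)) * (b y)\<^sup>2 \<partial>lborel) \<le>
        (\<integral>y. s * (indicator \<Omega> y * V y * (U y)\<^sup>2 + C0 * ((U y)\<^sup>2 - (b y)\<^sup>2)) + (1 - s) * V p * (b y)\<^sup>2 \<partial>lborel)"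
    proof (rule integral_mono)
      have "\<bar>Vd x\<bar> \<le> B" for x using B by (auto simp: Vd_def indicator_def)
      then show "integrable lborel (\<lambda>y. Vd (p + s *\<^sub>R (y - p)) * (b y)\<^sup>2)"
        by (intro bbs_integrable[OF bbs_mult_bounded[OF bbs_power2[OF bb]]]) measurable
      show "integrable lborel (\<lambda>y. s * (indicator \<Omega> y * V y * (U y)\<^sup>2 + C0 * ((U y)\<^sup>2 - (b y)\<^sup>2)) + (1 - s) * V p * (b y)\<^sup>2)"
        using i by simp
      fix y
      show "Vd (p + s *\<^sub>R (y - p)) * (b y)\<^sup>2 \<le> s * (indicator \<Omega> y * V y * (U y)\<^sup>2 + C0 * ((U y)\<^sup>2 - (b y)\<^sup>2)) + (1 - s) * V p * (b y)\<^sup>2"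
      proof (cases "y \<in> \<Omega>")
        case False
        then show ?thesis by (simp add: b_def U_def)
      next
        case True
        let ?x = "p + s *\<^sub>R (y - p)"
        have by0: "0 < b y" "b y \<le> U y" using True u_pos M(3) by (auto simp: b_def U_def)
        have "f ?x = b y" using s by (simp add: f_def)
        then have "?x \<in> core d" using R(4)[of ?x] by0 by force
        then have xK: "?x \<in> ?K" using core_antimono[of "d / 2" d] d by auto
        have "?x = (1 - s) *\<^sub>R p + s *\<^sub>R y" by (simp add: algebra_simps)
        then have "V ?x \<le> (1 - s) * V p + s * V y" using convex_onD[OF convex_V, where t = s and x = p and y = y] s True p by simp
        then have "Vd ?x * (b y)\<^sup>2 \<le> ((1 - s) * V p + s * V y) * (b y)\<^sup>2" using xK by (intro mult_right_mono) (auto simp: Vd_def)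
        \<comment> \<open>V b^2 may exceed V U^2 where V is negative; shifting V by C0 makes
          truncation monotone, and the shift is what the lost mass is charged for.\<close>
        moreover have "0 \<le> s * ((V y + C0) * ((U y)\<^sup>2 - (b y)\<^sup>2))"
        proof -
          have "(b y)\<^sup>2 \<le> (U y)\<^sup>2" using by0 by (intro power_mono) auto
          moreover have "0 \<le> V y + C0" using C0(2)[OF True] by simp
          ultimately show ?thesis using s by simp
        qed
        ultimately show ?thesis using True by (simp add: algebra_simps)
      qed
    qed
    also have "\<dots> = s * (potential_energy + C0 * (mass - \<beta>)) + (1 - s) * V p * \<beta>"
      using i by (simp add: potential_energy_eq mass_eq \<beta>_def mb_def b_def)
    finally show ?thesis unfolding I(3)[OF Vdm] using sn by (intro mult_left_mono) auto
  qed
  define gap where "gap = (eigenvalue + \<epsilon> / 2) * \<beta> - ?E s"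
  have gap: "0 < gap" using s(1) by (simp add: gap_def)
  \<comment> \<open>Coefficient of the r^4 term caused by the shift C0. The margin
    \<open>gap\<close> absorbs it, \<epsilon> / 4 pays for the oscillation of V, and the remaining
    \<epsilon> / 4 makes the inequality strict.\<close>
  define A where "A = C0 * (?c * (dirichlet_energy / s\<^sup>2))"
  have A: "0 \<le> A" using C0(1) c dirichlet_energy_nonneg by (simp add: A_def)
  define r0 where "r0 = Min {1, d / 2, r1, gap / (A + 1)}"
  have r0: "0 < r0" using d r1(1) gap A by (simp add: r0_def)
  have main: "(1 - ?c * r\<^sup>2 * (eigenvalue + \<epsilon>)) * (\<integral>x. (f x)\<^sup>2 \<partial>lborel) < (\<integral>x. weight r x * (avg r f x)\<^sup>2 \<partial>lborel)"
    if r: "0 < r" "r < r0" for r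
  proof -
    have rr: "r \<le> 1" "r \<le> d / 2" "r < r1" "r \<le> gap / (A + 1)" using r(2) by (auto simp: r0_def)
    have "r\<^sup>2 * A \<le> r * (A + 1)" using r rr(1) A by (intro mult_mono) (auto simp: power2_eq_square mult_left_le)
    also have "\<dots> \<le> gap" using rr(4) A by (simp add: pos_le_divide_eq)
    finally have rA: "A * r\<^sup>2 \<le> gap" by (simp add: mult.commute)
    define q where "q = (\<integral>x. (f x)\<^sup>2 \<partial>lborel) - (\<integral>x. (avg r f x)\<^sup>2 \<partial>lborel)"
    have rs: "0 < r / s" using r s by simp
    have "q = s ^ ?n * ((\<integral>x. (b x)\<^sup>2 \<partial>lborel) - (\<integral>x. (avg (r / s) b x)\<^sup>2 \<partial>lborel))"
      unfolding q_def I(1) I(2) by (simp add: right_diff_distrib)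
    also have "\<dots> \<le> s ^ ?n * (?c * (r / s)\<^sup>2 * dirichlet_energy)"
      using sn truncated_energy[OF rs M0, folded b_def] by (intro mult_left_mono) auto
    finally have q: "q \<le> s ^ ?n * (?c * r\<^sup>2 * (dirichlet_energy / s\<^sup>2))" by (simp add: power_divide)
    have "(\<integral>x. (f x)\<^sup>2 \<partial>lborel) - (\<integral>x. weight r x * (avg r f x)\<^sup>2 \<partial>lborel) \<le>
        q + ?c * r\<^sup>2 * ((\<integral>x. Vd x * (f x)\<^sup>2 \<partial>lborel) + \<epsilon> / 4 * (\<integral>x. (f x)\<^sup>2 \<partial>lborel) + C0 * q)"
      unfolding q_def Vd_def
    proof (rule averaged_potential_energy[OF bf R(4) d r(1) rr(2) C0(2)])
      fix x y assume x: "x \<in> core d" and y: "dist x y < r"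
      have "x \<in> ?K" using x core_antimono[of "d / 2" d] d by auto
      moreover have "y \<in> core (d - d / 2)" using core_nbhd[OF x, of y "d / 2"] y rr(2) by simp
      then have "y \<in> ?K" by simp
      ultimately have "dist (V y) (V x) < \<epsilon> / 4" using y rr(3) by (intro r1(2)) (auto simp: dist_commute)
      then show "V y \<le> V x + \<epsilon> / 4" unfolding dist_real_def by linarith
    qed
    also have "\<dots> \<le> s ^ ?n * (?c * r\<^sup>2 * (dirichlet_energy / s\<^sup>2)) + ?c * r\<^sup>2 * (s ^ ?n * (s * (potential_energy + C0 * (mass - \<beta>)) + (1 - s) * V p * \<beta>)
        + \<epsilon> / 4 * (s ^ ?n * \<beta>) + C0 * (s ^ ?n * (?c * r\<^sup>2 * (dirichlet_energy / s\<^sup>2))))"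
      unfolding F using q VF C0(1) c by (intro add_mono mult_left_mono order_refl) auto
    also have "\<dots> = ?c * r\<^sup>2 * s ^ ?n * (?E s + \<epsilon> / 4 * \<beta> + A * r\<^sup>2)"
      unfolding A_def by (simp add: algebra_simps)
    also have "\<dots> < ?c * r\<^sup>2 * s ^ ?n * ((eigenvalue + \<epsilon>) * \<beta>)"
    proof (intro mult_strict_left_mono)
      have "0 < \<epsilon> * \<beta>" using \<epsilon> M(2) by (simp add: \<beta>_def)
      then show "?E s + \<epsilon> / 4 * \<beta> + A * r\<^sup>2 < (eigenvalue + \<epsilon>) * \<beta>"
        using rA unfolding gap_def by (simp add: distrib_right)
    qed (use c r sn in simp)
    finally show ?thesis unfolding F by (simp add: algebra_simps)
  qed
  show ?thesis
  proof (rule that[OF bf _ d r0 R(2) fs _ main])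
    show "0 < (\<integral>x. (f x)\<^sup>2 \<partial>lborel)" unfolding F using sn M(2) by (simp add: \<beta>_def)
  qed (use M(3) in auto)
qed

text \<open>The competitor is supported in core d0, hence in every core d with d \<le> d0, and the
  indicator of core d dominates a multiple of it. Iteration started at this log-concave indicator is
  therefore near optimal. The radius r0 does not depend on d, so the core can be adapted
  afterwards.\<close>

lemma near_optimal:
  assumes \<epsilon>: "0 < \<epsilon>"
  shows "\<exists>d0>0. \<exists>r0>0. \<forall>d r. 0 < d \<longrightarrow> d \<le> d0 \<longrightarrow> 0 < r \<longrightarrow> r < r0 \<longrightarrow>
    (\<exists>g. bbs g \<and> log_concave g \<and> (\<forall>x. x \<notin> core d \<longrightarrow> g x = 0) \<and> 0 < (\<integral>x. (g x)\<^sup>2 \<partial>lborel) \<and>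
      (1 - second_moment TYPE('a) * r\<^sup>2 * (eigenvalue + \<epsilon>)) * (\<integral>x. (g x)\<^sup>2 \<partial>lborel) \<le> (\<integral>x. weight r x * (avg r g x)\<^sup>2 \<partial>lborel))"
proof -
  let ?c = "second_moment TYPE('a)"
  have c: "0 < ?c" by (rule second_moment_pos)
  obtain C0 where C0: "0 \<le> C0" "\<And>x. x \<in> \<Omega> \<Longrightarrow> - C0 \<le> V x"
    using convex_on_bounded_below[OF open_\<Omega> bounded_\<Omega> convex_V] by blast
  obtain f C d0 r1 where f: "bbs f" "0 < C" "0 < d0" "0 < r1" "\<And>x. 0 \<le> f x" "\<And>x. f x \<le> C * indicator (core d0) x"
    "0 < (\<integral>x. (f x)\<^sup>2 \<partial>lborel)"
    "\<And>r. 0 < r \<Longrightarrow> r < r1 \<Longrightarrow> (1 - ?c * r\<^sup>2 * (eigenvalue + \<epsilon>)) * (\<integral>x. (f x)\<^sup>2 \<partial>lborel) < (\<integral>x. weight r x * (avg r f x)\<^sup>2 \<partial>lborel)"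
    using competitor[OF \<epsilon>] by blast
  \<comment> \<open>For r below 1 / A the factor q is positive, as the power iteration
    demands.\<close>
  define A where "A = ?c * (\<bar>eigenvalue\<bar> + \<epsilon>) + 1"
  have A: "1 \<le> A" using c \<epsilon> by (simp add: A_def)
  define r0 where "r0 = min r1 (1 / A)"
  have r0: "0 < r0" using f(4) A by (simp add: r0_def)
  show ?thesis
  proof (rule exI[of _ d0], rule conjI[OF f(3)], rule exI[of _ r0], rule conjI[OF r0], intro allI impI)
    fix d r assume d: "0 < d" "d \<le> d0" and ru: "0 < r" "r < r0"
    let ?W = "core d"
    interpret smoothing_operator ?W "weight r" r "exp (?c * r\<^sup>2 * C0)"
      by standard (use bounded_core[OF d(1)] weight_nonneg weight_le[OF C0(2)] ru in auto)
    let ?q = "1 - ?c * r\<^sup>2 * (eigenvalue + \<epsilon>)"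
    have q: "0 < ?q"
    proof -
      have rA: "r < 1 / A" using ru by (simp add: r0_def)
      also have "1 / A \<le> 1" using A by simp
      finally have "r\<^sup>2 \<le> r" using ru by (simp add: power2_eq_square mult_left_le)
      have "?c * r\<^sup>2 * (eigenvalue + \<epsilon>) \<le> ?c * r\<^sup>2 * (\<bar>eigenvalue\<bar> + \<epsilon>)" using c by (intro mult_left_mono) auto
      also have "\<dots> \<le> r\<^sup>2 * A" using ru by (simp add: A_def algebra_simps)
      also have "\<dots> \<le> r * A" using \<open>r\<^sup>2 \<le> r\<close> A by (intro mult_right_mono) auto
      also have "\<dots> < 1" using rA A by (simp add: pos_less_divide_eq)
      finally show ?thesis by simp
    qed
    have W: "core d0 \<subseteq> ?W" by (rule core_antimono[OF d(2)])
    have bW: "bbs (indicator ?W :: 'a \<Rightarrow> real)" using bounded_core[OF d(1)] by (intro bbs_indicator) auto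
    have W0: "x \<notin> ?W \<Longrightarrow> indicator ?W x = (0::real)" for x by simp
    have f0: "f x = 0" if "x \<notin> ?W" for x using f(5,6)[of x] that W by (force simp: indicator_def)
    have "C * indicator (core d0) x \<le> C * indicator ?W x" for x
      using W f(2) by (intro mult_left_mono) (auto simp: indicator_def)
    then have fC: "f x \<le> C * indicator ?W x" for x by (rule order_trans[OF f(6)])
    have en: "energy h h = (\<integral>x. weight r x * (avg r h x)\<^sup>2 \<partial>lborel)" for h by (simp add: energy_def power2_eq_square)
    have "?q * (\<integral>x. (f x)\<^sup>2 \<partial>lborel) < energy f f" unfolding en using ru by (intro f(8)) (auto simp: r0_def)
    from power_iteration[OF bW W0 f(1) f0 f(5) fC f(2) q f(7) this]
    obtain N where N: "0 < (\<integral>x. ((T ^^ N) (indicator ?W) x)\<^sup>2 \<partial>lborel)"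
      "?q * (\<integral>x. ((T ^^ N) (indicator ?W) x)\<^sup>2 \<partial>lborel) \<le> energy ((T ^^ N) (indicator ?W)) ((T ^^ N) (indicator ?W))" by blast
    show "\<exists>g. bbs g \<and> log_concave g \<and> (\<forall>x. x \<notin> core d \<longrightarrow> g x = 0) \<and> 0 < (\<integral>x. (g x)\<^sup>2 \<partial>lborel) \<and>
        ?q * (\<integral>x. (g x)\<^sup>2 \<partial>lborel) \<le> (\<integral>x. weight r x * (avg r g x)\<^sup>2 \<partial>lborel)"
    proof (intro exI[of _ "(T ^^ N) (indicator ?W)"] conjI allI impI)
      show "log_concave ((T ^^ N) (indicator ?W))"
        by (rule log_concave_iterate[OF bW log_concave_indicator[OF convex_core] log_concave_weight convex_core])
      show "x \<notin> ?W \<Longrightarrow> (T ^^ N) (indicator ?W) x = 0" for x by (rule iterate_outside[OF W0])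
    qed (use N bbs_iterate[OF bW] en in auto)
  qed
qed

end

section \<open>The ratio to the eigenfunction\<close>

context dirichlet_eigenfunction
begin

text \<open>With \<open>w = g / U\<close>, Lagrange's identity writes the defect of \<open>g\<close> against the supersolution \<open>u\<close> as
  a nonlocal Dirichlet energy of \<open>w\<close>.\<close>

lemma ratio_energy:
  assumes d: "0 < d" and \<epsilon>: "0 < \<epsilon>"
  obtains r0 where "0 < r0"
    "\<And>r g P u0. 0 < r \<Longrightarrow> r < r0 \<Longrightarrow> bbs g \<Longrightarrow> (\<And>x. x \<notin> core d \<Longrightarrow> g x = 0) \<Longrightarrow>
      (1 - second_moment TYPE('a) * r\<^sup>2 * (eigenvalue + \<epsilon>)) * (\<integral>x. (g x)\<^sup>2 \<partial>lborel) \<le> (\<integral>x. weight r x * (avg r g x)\<^sup>2 \<partial>lborel) \<Longrightarrow>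
      P \<in> sets borel \<Longrightarrow> P \<subseteq> core d \<Longrightarrow> 0 < u0 \<Longrightarrow> (\<And>x. x \<in> P \<Longrightarrow> u0 \<le> u x) \<Longrightarrow>
      nonlocal_energy P r (\<lambda>x. g x / U x) \<le> ennreal (8 * second_moment TYPE('a) * \<epsilon> / u0\<^sup>2 * (\<integral>x. (g x)\<^sup>2 \<partial>lborel) * r\<^sup>2)"
proof -
  let ?c = "second_moment TYPE('a)" and ?K = "core (d / 2)" and ?W = "core d"
  have c: "0 < ?c" by (rule second_moment_pos)
  obtain C0 where C0: "0 \<le> C0" "\<And>x. x \<in> \<Omega> \<Longrightarrow> - C0 \<le> V x"
    using convex_on_bounded_below[OF open_\<Omega> bounded_\<Omega> convex_V] by blast
  have K: "compact ?K" "?K \<subseteq> \<Omega>" using core_subset[of "d / 2"] compact_core[of "d / 2"] d by auto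
  have WK: "?W \<subseteq> ?K" by (rule core_antimono) (use d in simp)
  have nbhd: "y \<in> ?K" if "x \<in> ?W" "dist x y \<le> d / 2" for x y
    using core_nbhd[OF that] by simp
  obtain Bv where Bv: "0 \<le> Bv" "\<And>x. x \<in> ?K \<Longrightarrow> \<bar>V x\<bar> \<le> Bv" using bounded_on_compact[OF continuous_V K] by blast
  obtain Bu where Bu: "0 \<le> Bu" "\<And>x. x \<in> ?K \<Longrightarrow> \<bar>u x\<bar> \<le> Bu" using bounded_on_compact[OF continuous_u K] by blast
  have "continuous_on \<Omega> (\<lambda>x. inverse (u x))"
    using continuous_u u_pos by (intro continuous_on_inverse) (auto simp: less_le)
  then obtain Bi where Bi: "0 \<le> Bi" "\<And>x. x \<in> ?K \<Longrightarrow> \<bar>inverse (u x)\<bar> \<le> Bi" using bounded_on_compact K by metis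
  have UK: "U x = u x" if "x \<in> ?K" for x using that K(2) by (auto simp: U_def indicator_def)
  have "0 < d / 2" using d by simp
  from supersolution[OF K this _ \<epsilon>, of ?W] nbhd
  obtain r1 where r1: "0 < r1" "\<And>r x. 0 < r \<Longrightarrow> r < r1 \<Longrightarrow> x \<in> ?W \<Longrightarrow>
      avg r (\<lambda>z. weight r z * avg r U z) x \<le> (1 - ?c * r\<^sup>2 * (eigenvalue - \<epsilon>)) * u x"
    unfolding weight_def by (auto simp: subset_eq)
  define r0 where "r0 = Min {1, r1, d / 4, 1 / (2 * ?c * (Bv + 1))}"
  have r0: "0 < r0" using r1(1) d c Bv(1) by (simp add: r0_def)
  show ?thesis
  proof (rule that[OF r0])
    fix r g P u0
    assume r: "0 < r" "r < r0" and g: "bbs g" "\<And>x. x \<notin> ?W \<Longrightarrow> g x = 0"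
      and opt: "(1 - ?c * r\<^sup>2 * (eigenvalue + \<epsilon>)) * (\<integral>x. (g x)\<^sup>2 \<partial>lborel) \<le> (\<integral>x. weight r x * (avg r g x)\<^sup>2 \<partial>lborel)"
      and P: "P \<in> sets borel" "P \<subseteq> ?W" and u0: "0 < u0" "\<And>x. x \<in> P \<Longrightarrow> u0 \<le> u x"
    have rr: "r \<le> 1" "r < r1" "r \<le> d / 4" "r \<le> 1 / (2 * ?c * (Bv + 1))" using r(2) by (auto simp: r0_def)
    \<comment> \<open>From 1 - s \<le> exp(- s): r is so small that c r^2 V is at most 1/2 on the
      larger core.\<close>
    have half: "1 / 2 \<le> weight r x" if "x \<in> ?K" for x
    proof -
      have r2: "r\<^sup>2 \<le> r" using r(1) rr(1) by (simp add: power2_eq_square mult_left_le)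
      have "?c * r\<^sup>2 * V x \<le> ?c * r\<^sup>2 * (Bv + 1)" using Bv(2)[OF that] c by (intro mult_left_mono) auto
      also have "\<dots> \<le> ?c * r * (Bv + 1)" using r2 c Bv(1) by (intro mult_right_mono mult_left_mono) auto
      also have "\<dots> \<le> 1 / 2"
      proof -
        have "0 < 2 * ?c * (Bv + 1)" using c Bv(1) by simp
        then have "r * (2 * ?c * (Bv + 1)) \<le> 1" using rr(4) by (simp only: pos_le_divide_eq)
        then show ?thesis by (simp add: algebra_simps)
      qed
      finally show ?thesis using exp_ge_add_one_self[of "- (?c * r\<^sup>2 * V x)"] that K(2) by (auto simp: weight_def)
    qed
    \<comment> \<open>Cutting \<open>U\<close> to the core makes it bounded with bounded support. It
      only decreases, so the supersolution inequality remains usable on the core.\<close>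
    define u1 where "u1 x = indicator ?W x * U x" for x
    define w where "w x = g x / U x" for x
    have [measurable]: "g \<in> borel_measurable borel" by (rule bbs_measurable[OF g(1)])
    have u1b: "\<bar>u1 x\<bar> \<le> Bu" for x using Bu WK UK by (auto simp: u1_def indicator_def)
    have u1n: "0 \<le> u1 x" for x using U_nonneg by (simp add: u1_def)
    have bi: "bbs (indicator ?W :: 'a \<Rightarrow> real)" using bounded_core[OF d] by (intro bbs_indicator) auto
    have bu1: "bbs u1"
    proof -
      have "bbs (\<lambda>x. U x * indicator ?W x)"
        by (rule bbs_mult_bounded[OF bi U_measurable, where B = Bu]) (use Bu WK UK in \<open>auto simp: indicator_def split: if_splits\<close>)
      then show ?thesis by (simp add: u1_def[abs_def] mult.commute)
    qed
    have bw: "bbs w"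
    proof -
      have "bbs (\<lambda>x. inverse (U x) * g x)"
      proof (rule bbs_mult_bounded[OF g(1), where B = Bi])
        fix x assume "g x \<noteq> 0"
        then have "x \<in> ?K" using g(2) WK by blast
        then show "\<bar>inverse (U x)\<bar> \<le> Bi" using Bi(2) UK by simp
      qed measurable
      then show ?thesis by (simp add: w_def[abs_def] divide_inverse mult.commute)
    qed
    have gw: "u1 x * w x = g x" for x
    proof (cases "x \<in> ?W")
      case True
      then have xK: "x \<in> ?K" using WK by blast
      then have "x \<in> \<Omega>" using K(2) by blast
      then have "0 < U x" using u_pos UK[OF xK] by simp
      then show ?thesis using True by (simp add: u1_def w_def)
    qed (simp add: g(2) w_def)
    \<comment> \<open>This is g^2 / u on the core, hence u times it is g^2. It pairs with
      \<open>u1\<close> in Lagrange's identity for g = u1 w.\<close>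
    let ?v = "\<lambda>x. u1 x * (w x)\<^sup>2"
    have bv: "bbs ?v" by (intro bbs_mult bu1 bbs_power2 bw)
    obtain Bw where Bw: "\<And>x. \<bar>w x\<bar> \<le> Bw" using bbsE[OF bw] by metis
    have [measurable]: "u1 \<in> borel_measurable borel" "w \<in> borel_measurable borel" using bu1 bw by (auto dest: bbs_measurable)
    define L where "L x = (\<integral>z. (\<integral>z'. u1 (x + r *\<^sub>R z) * u1 (x + r *\<^sub>R z') * (w (x + r *\<^sub>R z) - w (x + r *\<^sub>R z'))\<^sup>2 \<partial>mol_measure) \<partial>mol_measure)" for x
    have L0: "0 \<le> L x" for x unfolding L_def using u1n by (intro integral_nonneg_AE AE_I2) auto
    have lag: "(avg r g x)\<^sup>2 = avg r u1 x * avg r ?v x - L x / 2" for x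
    proof -
      have "\<bar>u1 y\<bar> \<le> max Bu Bw" "\<bar>w y\<bar> \<le> max Bu Bw" for y using u1b[of y] Bw[of y] by auto
      then have "(\<integral>z. u1 (x + r *\<^sub>R z) * w (x + r *\<^sub>R z) \<partial>mol_measure)\<^sup>2 = (\<integral>z. u1 (x + r *\<^sub>R z) \<partial>mol_measure) * (\<integral>z. u1 (x + r *\<^sub>R z) * (w (x + r *\<^sub>R z))\<^sup>2 \<partial>mol_measure)
        - L x / 2"
        unfolding L_def by (intro lagrange_identity[where C = "max Bu Bw"] mol.prob_space_axioms) auto
      then show ?thesis by (simp only: gw avg_def)
    qed
    have bL: "bbs L"
    proof -
      have "bbs (\<lambda>x. 2 * (avg r u1 x * avg r ?v x - (avg r g x)\<^sup>2))"
        by (intro bbs_cmult bbs_diff bbs_mult bbs_power2 bbs_avg bu1 bv g r(1))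
      then show ?thesis by (rule back_subst[of bbs]) (simp add: fun_eq_iff lag)
    qed
    have wb: "\<bar>weight r x\<bar> \<le> exp (?c * r\<^sup>2 * C0)" for x using weight_nonneg weight_le[OF C0(2)] by simp
    have iw: "integrable lborel (\<lambda>x. weight r x * f x)" if "bbs f" for f :: "'a \<Rightarrow> real"
      by (rule bbs_integrable[OF bbs_mult_bounded[OF that weight_measurable wb]])
    interpret S: smoothing_operator ?W "weight r" r "exp (?c * r\<^sup>2 * C0)"
      by standard (use bounded_core[OF d] weight_nonneg weight_le[OF C0(2)] r in auto)
    \<comment> \<open>Symmetry puts both averages on \<open>u1\<close>, where the supersolution
      inequality applies pointwise.\<close>
    have "(\<integral>x. weight r x * (avg r u1 x * avg r ?v x) \<partial>lborel) = (\<integral>x. S.T u1 x * ?v x \<partial>lborel)"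
      by (rule S.T_energy[OF bu1 bv, unfolded S.energy_def, symmetric]) (simp add: u1_def)
    also have "\<dots> \<le> (\<integral>x. (1 - ?c * r\<^sup>2 * (eigenvalue - \<epsilon>)) * (g x)\<^sup>2 \<partial>lborel)"
    proof (rule integral_mono)
      show "integrable lborel (\<lambda>x. S.T u1 x * ?v x)" by (intro bbs_integrable bbs_mult S.bbs_T bu1 bbs_power2 bw)
      show "integrable lborel (\<lambda>x. (1 - ?c * r\<^sup>2 * (eigenvalue - \<epsilon>)) * (g x)\<^sup>2)" by (intro bbs_integrable bbs_cmult bbs_power2 g)
      fix x
      show "S.T u1 x * ?v x \<le> (1 - ?c * r\<^sup>2 * (eigenvalue - \<epsilon>)) * (g x)\<^sup>2"
      proof (cases "x \<in> ?W")
        case True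
        have near: "y \<in> ?K" if "dist x y < 2 * r" for y using nbhd[OF True, of y] that rr(3) by simp
        have iU: "integrable mol_measure (\<lambda>z. U (y + r *\<^sub>R z))" if "dist x y < r" for y
        proof (rule mol_integrable_bounded[where C = Bu])
          fix z :: 'a assume "norm z < 1"
          then have "norm (r *\<^sub>R z) < r" using r(1) by simp
          then have "dist x (y + r *\<^sub>R z) < 2 * r" using that dist_triangle[of x "y + r *\<^sub>R z" y] by (simp add: dist_norm)
          then show "\<bar>U (y + r *\<^sub>R z)\<bar> \<le> Bu" using near Bu(2) UK by simp
        qed measurable
        have "avg r (\<lambda>y. weight r y * avg r u1 y) x \<le> avg r (\<lambda>y. weight r y * avg r U y) x"
        proof (rule avg_mono[OF bbs_mol_integrable[OF S.bbs_m_mult[OF bbs_avg[OF bu1 r(1)]]] _ r(1)])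
          show "integrable mol_measure (\<lambda>z. weight r (x + r *\<^sub>R z) * avg r U (x + r *\<^sub>R z))"
          proof (rule mol_integrable_bounded[where C = "exp (?c * r\<^sup>2 * C0) * Bu"])
            fix z :: 'a assume z: "norm z < 1"
            have "norm (r *\<^sub>R z) < r" using r(1) z by simp
            then have "\<bar>avg r U (x + r *\<^sub>R z)\<bar> \<le> Bu"
            proof (intro avg_bound[OF U_measurable r(1)])
              fix y assume "dist (x + r *\<^sub>R z) y < r" "norm (r *\<^sub>R z) < r"
              then have "dist x y < 2 * r" using dist_triangle[of x y "x + r *\<^sub>R z"] by (simp add: dist_norm)
              then show "\<bar>U y\<bar> \<le> Bu" using near Bu(2) UK by simp
            qed
            then show "\<bar>weight r (x + r *\<^sub>R z) * avg r U (x + r *\<^sub>R z)\<bar> \<le> exp (?c * r\<^sup>2 * C0) * Bu"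
              unfolding abs_mult using wb by (intro mult_mono) auto
          qed measurable
          fix y assume y: "dist x y < r"
          have "u1 z \<le> U z" for z using U_nonneg[of z] by (simp add: u1_def indicator_def)
          then have "avg r u1 y \<le> avg r U y" by (intro avg_mono bbs_mol_integrable[OF bu1] iU[OF y] r(1)) auto
          then show "weight r y * avg r u1 y \<le> weight r y * avg r U y" using weight_nonneg by (rule mult_left_mono)
        qed
        also have "\<dots> \<le> (1 - ?c * r\<^sup>2 * (eigenvalue - \<epsilon>)) * u x" by (rule r1(2)[OF r(1) rr(2) True])
        finally have "S.T u1 x \<le> (1 - ?c * r\<^sup>2 * (eigenvalue - \<epsilon>)) * u x" using True by (simp add: S.T_def)
        then have "S.T u1 x * ?v x \<le> (1 - ?c * r\<^sup>2 * (eigenvalue - \<epsilon>)) * u x * ?v x" using u1n by (intro mult_right_mono) auto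
        also have "u x * ?v x = (g x)\<^sup>2"
        proof -
          have "u x = u1 x" using True UK[OF subsetD[OF WK True]] by (simp add: u1_def)
          then show ?thesis unfolding gw[of x, symmetric] by (simp add: power2_eq_square mult_ac)
        qed
        then have "(1 - ?c * r\<^sup>2 * (eigenvalue - \<epsilon>)) * u x * ?v x = (1 - ?c * r\<^sup>2 * (eigenvalue - \<epsilon>)) * (g x)\<^sup>2" by (simp only: mult.assoc)
        finally show ?thesis .
      qed (simp add: u1_def g(2))
    qed
    finally have up: "(\<integral>x. weight r x * (avg r u1 x * avg r ?v x) \<partial>lborel) \<le> (1 - ?c * r\<^sup>2 * (eigenvalue - \<epsilon>)) * (\<integral>x. (g x)\<^sup>2 \<partial>lborel)" by simp
    have "(\<integral>x. weight r x * (avg r g x)\<^sup>2 \<partial>lborel) = (\<integral>x. weight r x * (avg r u1 x * avg r ?v x) - (weight r x * L x) / 2 \<partial>lborel)"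
      unfolding lag by (simp add: right_diff_distrib)
    also have "\<dots> = (\<integral>x. weight r x * (avg r u1 x * avg r ?v x) \<partial>lborel) - (\<integral>x. weight r x * L x \<partial>lborel) / 2"
      using iw[OF bL] iw[OF bbs_mult[OF bbs_avg[OF bu1 r(1)] bbs_avg[OF bv r(1)]]] by simp
    \<comment> \<open>The two factors 1 - c r^2 (\<lambda> - \<epsilon>) and 1 - c r^2 (\<lambda> +
      \<epsilon>) differ by 2 c r^2 \<epsilon>; the halving of L doubles this. The eigenvalue itself
      cancels.\<close>
    finally have Lint: "(\<integral>x. weight r x * L x \<partial>lborel) \<le> 4 * ?c * r\<^sup>2 * \<epsilon> * (\<integral>x. (g x)\<^sup>2 \<partial>lborel)"
      using opt up by (simp add: algebra_simps)
    \<comment> \<open>The factor 2 / u0^2 comes from weight at least 1/2 at the centre and from u at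
      least u0 at both displaced points.\<close>
    have "nonlocal_energy P r w \<le> (\<integral>\<^sup>+x. ennreal (2 / u0\<^sup>2 * (weight r x * L x)) \<partial>lborel)"
      unfolding nonlocal_energy_def
    proof (rule nn_integral_mono)
      fix x :: 'a
      let ?G = "\<lambda>z z'. indicator P x / u0\<^sup>2 * (u1 (x + r *\<^sub>R z) * u1 (x + r *\<^sub>R z') * (w (x + r *\<^sub>R z) - w (x + r *\<^sub>R z'))\<^sup>2)"
      have G0: "0 \<le> ?G z z'" for z z' using u1n by simp
      have "(\<integral>\<^sup>+z. (\<integral>\<^sup>+z'. ennreal (indicator P x * indicator P (x + r *\<^sub>R z) * indicator P (x + r *\<^sub>R z') *
          (w (x + r *\<^sub>R z) - w (x + r *\<^sub>R z'))\<^sup>2) \<partial>mol_measure) \<partial>mol_measure) \<le> (\<integral>\<^sup>+z. (\<integral>\<^sup>+z'. ennreal (?G z z') \<partial>mol_measure) \<partial>mol_measure)"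
      proof (intro nn_integral_mono ennreal_leI)
        fix z z' :: 'a
        let ?y = "x + r *\<^sub>R z" and ?y' = "x + r *\<^sub>R z'"
        show "indicator P x * indicator P ?y * indicator P ?y' * (w ?y - w ?y')\<^sup>2 \<le> ?G z z'"
        proof (cases "x \<in> P \<and> ?y \<in> P \<and> ?y' \<in> P")
          case True
          have "u1 y = u y" if "y \<in> P" for y
          proof -
            have y: "y \<in> ?W" using that P(2) by blast
            then show ?thesis using UK[OF subsetD[OF WK y]] by (simp add: u1_def)
          qed
          then have "u0 \<le> u1 ?y" "u0 \<le> u1 ?y'" using True u0(2) by auto
          then have "u0 * u0 \<le> u1 ?y * u1 ?y'" using u0(1) u1n by (intro mult_mono) auto
          then have "1 \<le> (u1 ?y * u1 ?y') / u0\<^sup>2" using u0(1) by (simp add: power2_eq_square)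
          from mult_right_mono[OF this, of "(w ?y - w ?y')\<^sup>2"] show ?thesis using True by simp
        next
          case False
          then have "indicator P x * indicator P ?y * indicator P ?y' * (w ?y - w ?y')\<^sup>2 = 0" by auto
          with G0[of z z'] show ?thesis by (simp only:)
        qed
      qed
      also have "\<dots> = ennreal (\<integral>z. (\<integral>z'. ?G z z' \<partial>mol_measure) \<partial>mol_measure)"
      proof (rule nn_integral_mol_double[where C = "1 / u0\<^sup>2 * (Bu * Bu * (2 * Bw)\<^sup>2)"])
        show "?G z z' \<le> 1 / u0\<^sup>2 * (Bu * Bu * (2 * Bw)\<^sup>2)" for z z'
        proof (rule mult_mono)
          have "\<bar>w y - w y'\<bar> \<le> \<bar>2 * Bw\<bar>" for y y' using Bw[of y] Bw[of y'] by linarith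
          then have "(w y - w y')\<^sup>2 \<le> (2 * Bw)\<^sup>2" for y y' by (simp only: abs_le_square_iff)
          then show "u1 (x + r *\<^sub>R z) * u1 (x + r *\<^sub>R z') * (w (x + r *\<^sub>R z) - w (x + r *\<^sub>R z'))\<^sup>2 \<le> Bu * Bu * (2 * Bw)\<^sup>2"
            using u1b u1n Bu(1) by (intro mult_mono) (auto simp: abs_le_iff)
          show "indicator P x / u0\<^sup>2 \<le> 1 / u0\<^sup>2" by (simp add: indicator_def)
        qed (use u1n in auto)
        show "(\<lambda>(z, z'). ?G z z') \<in> borel_measurable (borel \<Otimes>\<^sub>M borel)" by measurable
      qed (rule G0)
      also have "\<dots> \<le> ennreal (2 / u0\<^sup>2 * (weight r x * L x))"
      proof (rule ennreal_leI)
        have GL: "(\<integral>z. (\<integral>z'. ?G z z' \<partial>mol_measure) \<partial>mol_measure) = indicator P x / u0\<^sup>2 * L x"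
          unfolding L_def integral_mult_right_zero ..
        have "indicator P x / u0\<^sup>2 * L x = indicator P x * (L x / u0\<^sup>2)" by simp
        also have "\<dots> \<le> 2 * weight r x * (L x / u0\<^sup>2)"
          using half[of x] P(2) WK weight_nonneg[of r x] L0[of x] by (intro mult_right_mono) (auto simp: indicator_def)
        also have "2 * weight r x * (L x / u0\<^sup>2) = 2 / u0\<^sup>2 * (weight r x * L x)" by simp
        finally show "(\<integral>z. (\<integral>z'. ?G z z' \<partial>mol_measure) \<partial>mol_measure) \<le> 2 / u0\<^sup>2 * (weight r x * L x)" unfolding GL .
      qed
      finally show "(\<integral>\<^sup>+z. (\<integral>\<^sup>+z'. ennreal (indicator P x * indicator P (x + r *\<^sub>R z) * indicator P (x + r *\<^sub>R z') *
          (w (x + r *\<^sub>R z) - w (x + r *\<^sub>R z'))\<^sup>2) \<partial>mol_measure) \<partial>mol_measure) \<le> ennreal (2 / u0\<^sup>2 * (weight r x * L x))" .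
    qed
    also have "\<dots> = ennreal (\<integral>x. 2 / u0\<^sup>2 * (weight r x * L x) \<partial>lborel)"
      using iw[OF bL] weight_nonneg L0 by (intro nn_integral_eq_integral) auto
    also have "\<dots> \<le> ennreal (8 * ?c * \<epsilon> / u0\<^sup>2 * (\<integral>x. (g x)\<^sup>2 \<partial>lborel) * r\<^sup>2)"
    proof (rule ennreal_leI)
      have "(\<integral>x. 2 / u0\<^sup>2 * (weight r x * L x) \<partial>lborel) = 2 / u0\<^sup>2 * (\<integral>x. weight r x * L x \<partial>lborel)" by simp
      also have "\<dots> \<le> 2 / u0\<^sup>2 * (4 * ?c * r\<^sup>2 * \<epsilon> * (\<integral>x. (g x)\<^sup>2 \<partial>lborel))" by (intro mult_left_mono Lint) simp
      finally show "(\<integral>x. 2 / u0\<^sup>2 * (weight r x * L x) \<partial>lborel) \<le> 8 * ?c * \<epsilon> / u0\<^sup>2 * (\<integral>x. (g x)\<^sup>2 \<partial>lborel) * r\<^sup>2" by (simp add: mult_ac)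
    qed
    finally show "nonlocal_energy P r (\<lambda>x. g x / U x) \<le> ennreal (8 * ?c * \<epsilon> / u0\<^sup>2 * (\<integral>x. (g x)\<^sup>2 \<partial>lborel) * r\<^sup>2)"
      by (simp only: w_def[abs_def])
  qed
qed

end

section \<open>Tightness and nearly constant functions\<close>

text \<open>Integrating the squared distance of w from the constant w y over x and y in Q gives the
  integral of all shift energies, which is at most E times the volume of a ball. Some y in Q is no
  worse than the average.\<close>

lemma nearly_constant:
  fixes w :: "'a::euclidean_space \<Rightarrow> real"
  assumes [measurable]: "Q \<in> sets borel" "w \<in> borel_measurable borel"
    and Q: "Q \<subseteq> cball 0 R" and E: "0 \<le> E" "\<And>h. norm h \<le> 2 * R \<Longrightarrow> shift_energy Q w h \<le> ennreal E"
    and t: "E * measure lborel (cball (0::'a) (2 * R)) < t * measure lborel Q"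
  shows "\<exists>y\<in>Q. (\<integral>\<^sup>+x. ennreal (indicator Q x * (w x - w y)\<^sup>2) \<partial>lborel) \<le> ennreal t"
proof (rule ccontr)
  assume "\<not> ?thesis"
  then have *: "ennreal t \<le> (\<integral>\<^sup>+x. ennreal (indicator Q x * (w x - w y)\<^sup>2) \<partial>lborel)" if "y \<in> Q" for y
    using that by (meson linear)
  have t0: "0 \<le> t"
  proof -
    have "0 \<le> E * measure lborel (cball (0::'a) (2 * R))" using E(1) by simp
    then have "0 < t * measure lborel Q" using t by simp
    moreover have "t * measure lborel Q \<le> 0" if "t < 0" using that by (intro mult_nonpos_nonneg) auto
    ultimately show ?thesis by (meson not_le)
  qed
  have fin: "emeasure lborel A = ennreal (measure lborel A)" if "bounded A" for A :: "'a set"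
    using emeasure_bounded_finite[OF that] by (intro emeasure_eq_ennreal_measure) auto
  have bQ: "bounded Q" using Q bounded_cball bounded_subset by blast
  have "ennreal (t * measure lborel Q) = (\<integral>\<^sup>+y. ennreal t * indicator Q y \<partial>lborel)"
    by (simp add: nn_integral_cmult_indicator fin[OF bQ] ennreal_mult t0)
  also have "\<dots> \<le> (\<integral>\<^sup>+y. (\<integral>\<^sup>+h. ennreal (indicator Q y * indicator Q (y + h) * (w (y + h) - w y)\<^sup>2) \<partial>lborel) \<partial>lborel)"
  proof (rule nn_integral_mono)
    fix y
    show "ennreal t * indicator Q y \<le> (\<integral>\<^sup>+h. ennreal (indicator Q y * indicator Q (y + h) * (w (y + h) - w y)\<^sup>2) \<partial>lborel)"
    proof (cases "y \<in> Q")
      case True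
      have "(\<integral>\<^sup>+h. ennreal (indicator Q (h + y) * (w (h + y) - w y)\<^sup>2) \<partial>lborel) = (\<integral>\<^sup>+x. ennreal (indicator Q x * (w x - w y)\<^sup>2) \<partial>lborel)"
        by (rule lborel_nn_integral_translate[where f = "\<lambda>x. ennreal (indicator Q x * (w x - w y)\<^sup>2)"]) measurable
      then show ?thesis using *[OF True] True by (simp add: add.commute)
    qed simp
  qed
  also have "\<dots> = (\<integral>\<^sup>+h. shift_energy Q w h \<partial>lborel)"
    unfolding shift_energy_def by (rule lborel_pair.Fubini') measurable
  also have "\<dots> \<le> (\<integral>\<^sup>+h. ennreal E * indicator (cball (0::'a) (2 * R)) h \<partial>lborel)"
  proof (rule nn_integral_mono)
    fix h :: 'a
    show "shift_energy Q w h \<le> ennreal E * indicator (cball 0 (2 * R)) h"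
    \<comment> \<open>A shift longer than the diameter bound 2 R moves Q off itself, so its energy
      is 0.\<close>
    proof (cases "norm h \<le> 2 * R")
      case False
      have "indicator Q x * indicator Q (x + h) = (0::real)" for x
      proof (rule ccontr)
        assume "indicator Q x * indicator Q (x + h) \<noteq> (0::real)"
        then have "norm x \<le> R" "norm (x + h) \<le> R" using Q by (auto simp: indicator_def subset_eq split: if_splits)
        then show False using False norm_triangle_ineq4[of "x + h" x] by simp
      qed
      then have "indicator Q x * indicator Q (x + h) * (w (x + h) - w x)\<^sup>2 = 0" for x by (simp only: mult_zero_left)
      then have "shift_energy Q w h = 0" unfolding shift_energy_def by (simp only: ennreal_0) simp
      then show ?thesis by simp
    qed (use E in simp)
  qed
  also have "\<dots> = ennreal (E * measure lborel (cball (0::'a) (2 * R)))"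
    by (simp add: nn_integral_cmult_indicator fin[OF bounded_cball] ennreal_mult E)
  finally have "t * measure lborel Q \<le> E * measure lborel (cball (0::'a) (2 * R))"
    using E(1) by (subst (asm) ennreal_le_iff) auto
  with t show False by simp
qed

context dirichlet_eigenfunction
begin

text \<open>A point x + v is the mean of the n points x + n v_i e_i. If |v| \<le> \<delta> / n, each
  of them lies on the segment from x - \<delta> e_i to x + \<delta> e_i, so convexity of \<Omega>
  applies twice.\<close>

lemma mem_core_of_axis_shifts:
  assumes \<delta>: "0 < \<delta>" and x: "\<And>i. i \<in> Basis \<Longrightarrow> x + \<delta> *\<^sub>R i \<in> \<Omega> \<and> x - \<delta> *\<^sub>R i \<in> \<Omega>"
  shows "x \<in> core (\<delta> / DIM('a))"
proof (rule cball_subset_core, rule subsetI)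
  fix z assume z: "z \<in> cball x (\<delta> / DIM('a))"
  let ?n = "real DIM('a)"
  have n: "0 < ?n" by simp
  define v where "v = z - x"
  have in\<Omega>: "x + (?n * (v \<bullet> i)) *\<^sub>R i \<in> \<Omega>" if i: "i \<in> Basis" for i
  proof -
    define s where "s = ?n * (v \<bullet> i) / \<delta>"
    have "\<bar>v \<bullet> i\<bar> \<le> \<delta> / ?n"
      using Basis_le_norm[OF i, of v] z by (simp add: v_def dist_norm norm_minus_commute)
    then have "?n * \<bar>v \<bullet> i\<bar> \<le> \<delta>" using n by (simp add: field_simps)
    then have "\<bar>s\<bar> \<le> 1" using \<delta> by (simp add: s_def abs_mult)
    then have "((1 + s) / 2) *\<^sub>R (x + \<delta> *\<^sub>R i) + ((1 - s) / 2) *\<^sub>R (x - \<delta> *\<^sub>R i) \<in> \<Omega>"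
      using convex_\<Omega> x[OF i] by (intro convexD) (auto simp: field_simps)
    also have "((1 + s) / 2) *\<^sub>R (x + \<delta> *\<^sub>R i) + ((1 - s) / 2) *\<^sub>R (x - \<delta> *\<^sub>R i) =
        ((1 + s) / 2 + (1 - s) / 2) *\<^sub>R x + ((1 + s) / 2 * \<delta> - (1 - s) / 2 * \<delta>) *\<^sub>R i"
      by (simp add: scaleR_add_right scaleR_diff_right scaleR_add_left scaleR_diff_left del: scaleR_half_double)
    also have "(1 + s) / 2 + (1 - s) / 2 = 1" by (simp add: field_simps)
    also have "(1 + s) / 2 * \<delta> - (1 - s) / 2 * \<delta> = ?n * (v \<bullet> i)" using \<delta> by (simp add: s_def field_simps)
    finally show ?thesis by simp
  qed
  have "(\<Sum>i\<in>Basis. (1 / ?n) *\<^sub>R (x + (?n * (v \<bullet> i)) *\<^sub>R i)) \<in> \<Omega>"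
    by (rule convex_sum[OF finite_Basis convex_\<Omega>]) (use in\<Omega> in auto)
  also have "(\<Sum>i\<in>Basis. (1 / ?n) *\<^sub>R (x + (?n * (v \<bullet> i)) *\<^sub>R i)) = (\<Sum>i\<in>(Basis::'a set). (1 / ?n) *\<^sub>R x) + (\<Sum>i\<in>Basis. (v \<bullet> i) *\<^sub>R i)"
    using n by (simp add: scaleR_add_right sum.distrib)
  also have "\<dots> = x + v" by (simp add: euclidean_representation sum_constant_scaleR)
  finally show "z \<in> \<Omega>" by (simp add: v_def)
qed

text \<open>Near optimality bounds the nonlocal energy of g on the whole space, so shifts of length
  \<delta> change g little in L^2. A point outside the core has an axis shift that leaves \<Omega>,
  where g vanishes; its value is thus one of 2 n differences, and these together carry at most half
  of the mass. The constants are uniform in \<epsilon> \<le> 1, in r and in g.\<close>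

lemma tightness:
  obtains \<delta> \<eta> where "0 < \<delta>" "0 < \<eta>"
    "\<And>r \<epsilon> g. 0 < r \<Longrightarrow> r \<le> \<delta> \<Longrightarrow> \<epsilon> \<le> 1 \<Longrightarrow> bbs g \<Longrightarrow> (\<And>x. x \<notin> \<Omega> \<Longrightarrow> g x = 0) \<Longrightarrow>
      (1 - second_moment TYPE('a) * r\<^sup>2 * (eigenvalue + \<epsilon>)) * (\<integral>x. (g x)\<^sup>2 \<partial>lborel) \<le> (\<integral>x. weight r x * (avg r g x)\<^sup>2 \<partial>lborel) \<Longrightarrow>
      (\<integral>x. (g x)\<^sup>2 \<partial>lborel) \<le> 2 * (\<integral>x. indicator (core \<eta>) x * (g x)\<^sup>2 \<partial>lborel)"
proof -
  let ?c = "second_moment TYPE('a)" and ?n = "real DIM('a)"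
  have c: "0 < ?c" by (rule second_moment_pos)
  have n: "0 < ?n" by simp
  obtain C0 where C0: "0 \<le> C0" "\<And>x. x \<in> \<Omega> \<Longrightarrow> - C0 \<le> V x"
    using convex_on_bounded_below[OF open_\<Omega> bounded_\<Omega> convex_V] by blast
  obtain K where K: "0 < K" "\<And>(P :: 'a set) Q f r \<eta> h. P \<in> sets borel \<Longrightarrow> Q \<in> sets borel \<Longrightarrow> convex Q \<Longrightarrow>
     f \<in> borel_measurable borel \<Longrightarrow> 0 < r \<Longrightarrow> 0 \<le> \<eta> \<Longrightarrow> (\<forall>x\<in>Q. \<forall>y. dist x y \<le> r \<longrightarrow> y \<in> P) \<Longrightarrow>
     nonlocal_energy P r f \<le> ennreal (\<eta> * r\<^sup>2) \<Longrightarrow> shift_energy Q f h \<le> ennreal (K * \<eta> * (norm h + r)\<^sup>2)"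
    using chain_inequality[where 'a = 'a] by blast
  define A where "A = 2 * ?c * (C0 + \<bar>eigenvalue\<bar> + 1)"
  have A: "0 < A" using c C0(1) by (auto simp: A_def intro!: mult_pos_pos)
  \<comment> \<open>Chosen such that K A (2 \<delta>)^2 = 1 / (4 n); the 2 n axis shifts then
    account for at most half of the mass.\<close>
  define \<delta> where "\<delta> = sqrt (1 / (16 * ?n * (K * A)))"
  have \<delta>: "0 < \<delta>" using A K(1) n by (simp add: \<delta>_def)
  have \<delta>2: "\<delta>\<^sup>2 = 1 / (16 * ?n * (K * A))" using A K(1) n by (simp add: \<delta>_def)
  show ?thesis
  proof (rule that[OF \<delta>, of "\<delta> / ?n"])
    show "0 < \<delta> / ?n" using \<delta> by simp
    fix r \<epsilon> g
    assume r: "0 < r" "r \<le> \<delta>" and \<epsilon>: "\<epsilon> \<le> 1" and g: "bbs g" "\<And>x. x \<notin> \<Omega> \<Longrightarrow> g x = 0"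
      and opt: "(1 - ?c * r\<^sup>2 * (eigenvalue + \<epsilon>)) * (\<integral>x. (g x)\<^sup>2 \<partial>lborel) \<le> (\<integral>x. weight r x * (avg r g x)\<^sup>2 \<partial>lborel)"
    define S where "S = (\<integral>x. (g x)\<^sup>2 \<partial>lborel)"
    define q where "q = (\<integral>x. (avg r g x)\<^sup>2 \<partial>lborel)"
    have S0: "0 \<le> S" "0 \<le> q" by (auto simp: S_def q_def intro!: integral_nonneg_AE)
    have ba: "bbs (avg r g)" by (rule bbs_avg[OF g(1) r(1)])
    have [measurable]: "g \<in> borel_measurable borel" by (rule bbs_measurable[OF g(1)])
    define k where "k = ?c * r\<^sup>2 * C0"
    define l where "l = ?c * r\<^sup>2 * (\<bar>eigenvalue\<bar> + 1)"
    have kl: "0 \<le> k" "0 \<le> l" using c C0(1) by (auto simp: k_def l_def)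
    \<comment> \<open>The weight is at most exp k, so q \<ge> exp(- k) (1 - l) S \<ge> (1 - k)(1 -
      l) S when l \<le> 1; for l > 1 the right side already exceeds S.\<close>
    have q: "S - q \<le> (k + l) * S"
    proof (cases "l \<le> 1")
      case False
      then have "S * 1 \<le> S * (k + l)" using S0 kl by (intro mult_left_mono) auto
      then show ?thesis using S0 by (simp add: mult.commute)
    next
      case True
      have "(1 - l) * S \<le> (1 - ?c * r\<^sup>2 * (eigenvalue + \<epsilon>)) * S"
      proof (rule mult_right_mono[OF _ S0(1)])
        have "?c * r\<^sup>2 * (eigenvalue + \<epsilon>) \<le> l" unfolding l_def using c \<epsilon> by (intro mult_left_mono) auto
        then show "1 - l \<le> 1 - ?c * r\<^sup>2 * (eigenvalue + \<epsilon>)" by simp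
      qed
      also have "\<dots> \<le> (\<integral>x. weight r x * (avg r g x)\<^sup>2 \<partial>lborel)" using opt by (simp only: S_def)
      also have "\<dots> \<le> (\<integral>x. exp k * (avg r g x)\<^sup>2 \<partial>lborel)"
      proof (rule integral_mono)
        have wk: "\<bar>weight r x\<bar> \<le> exp k" for x using weight_nonneg weight_le[OF C0(2)] by (simp add: k_def)
        show "integrable lborel (\<lambda>x. weight r x * (avg r g x)\<^sup>2)"
          by (rule bbs_integrable[OF bbs_mult_bounded[OF bbs_power2[OF ba] weight_measurable wk]])
        show "integrable lborel (\<lambda>x. exp k * (avg r g x)\<^sup>2)" by (intro bbs_integrable bbs_cmult bbs_power2 ba)
        show "weight r x * (avg r g x)\<^sup>2 \<le> exp k * (avg r g x)\<^sup>2" for x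
          using wk[of x] by (intro mult_right_mono) auto
      qed
      also have "\<dots> = exp k * q" by (simp add: q_def)
      finally have "exp (- k) * ((1 - l) * S) \<le> exp (- k) * (exp k * q)" by (intro mult_left_mono) auto
      then have "exp (- k) * ((1 - l) * S) \<le> q" by (simp add: mult.assoc[symmetric] exp_add[symmetric])
      moreover have "(1 - k) * ((1 - l) * S) \<le> exp (- k) * ((1 - l) * S)"
        using exp_ge_add_one_self[of "- k"] True S0 by (intro mult_right_mono) auto
      moreover have "0 \<le> k * l * S" using kl S0 by simp
      ultimately show ?thesis by (simp add: algebra_simps)
    qed
    have nl: "nonlocal_energy UNIV r g \<le> ennreal (A * S * r\<^sup>2)"
      unfolding nonlocal_energy_UNIV(1)[OF g(1) r(1)]
    proof (rule ennreal_leI)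
      have "2 * (S - q) \<le> 2 * ((k + l) * S)" using q by simp
      also have "\<dots> = A * S * r\<^sup>2" by (simp add: A_def k_def l_def algebra_simps)
      finally show "2 * ((\<integral>x. (g x)\<^sup>2 \<partial>lborel) - (\<integral>x. (avg r g x)\<^sup>2 \<partial>lborel)) \<le> A * S * r\<^sup>2" by (simp only: S_def q_def)
    qed
    have sh: "(\<integral>\<^sup>+x. ennreal ((g (x + h) - g x)\<^sup>2) \<partial>lborel) \<le> ennreal (S / (4 * ?n))" if h: "norm h = \<delta>" for h
    proof -
      have "shift_energy UNIV g h \<le> ennreal (K * (A * S) * (norm h + r)\<^sup>2)"
        by (rule K(2)[OF _ _ _ _ r(1) _ _ nl]) (use A S0 in auto)
      also have "\<dots> \<le> ennreal (S / (4 * ?n))"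
      proof (rule ennreal_leI)
        have "(norm h + r)\<^sup>2 \<le> (2 * \<delta>)\<^sup>2" using r h by (intro power_mono) auto
        then have "K * (A * S) * (norm h + r)\<^sup>2 \<le> K * (A * S) * (2 * \<delta>)\<^sup>2" using K(1) A S0 by (intro mult_left_mono) auto
        also have "\<dots> = S / (4 * ?n)" using K(1) A n by (simp add: power_mult_distrib \<delta>2)
        finally show "K * (A * S) * (norm h + r)\<^sup>2 \<le> S / (4 * ?n)" .
      qed
      finally show ?thesis by (simp add: shift_energy_def)
    qed
    let ?C = "core (\<delta> / ?n)"
    let ?D = "\<lambda>h x. ennreal ((g (x + h) - g x)\<^sup>2)"
    have ig: "integrable lborel (\<lambda>x. (g x)\<^sup>2)" by (rule bbs_integrable[OF bbs_power2[OF g(1)]])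
    have iC: "integrable lborel (\<lambda>x. indicator ?C x * (g x)\<^sup>2)"
      by (rule bbs_integrable[OF bbs_mult_bounded[OF bbs_power2[OF g(1)], where B = 1]]) (auto simp: indicator_def)
    have "ennreal (\<integral>x. (g x)\<^sup>2 - indicator ?C x * (g x)\<^sup>2 \<partial>lborel) = (\<integral>\<^sup>+x. ennreal ((g x)\<^sup>2 - indicator ?C x * (g x)\<^sup>2) \<partial>lborel)"
      using ig iC by (intro nn_integral_eq_integral[symmetric]) (auto simp: indicator_def)
    also have "\<dots> \<le> (\<integral>\<^sup>+x. (\<Sum>i\<in>Basis. ?D (\<delta> *\<^sub>R i) x + ?D (- (\<delta> *\<^sub>R i)) x) \<partial>lborel)"
    proof (rule nn_integral_mono)
      fix x :: 'a
      show "ennreal ((g x)\<^sup>2 - indicator ?C x * (g x)\<^sup>2) \<le> (\<Sum>i\<in>Basis. ?D (\<delta> *\<^sub>R i) x + ?D (- (\<delta> *\<^sub>R i)) x)"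
      proof (cases "x \<in> ?C")
        case False
        then obtain i where i: "i \<in> Basis" "x + \<delta> *\<^sub>R i \<notin> \<Omega> \<or> x - \<delta> *\<^sub>R i \<notin> \<Omega>"
          using mem_core_of_axis_shifts[OF \<delta>, of x] by blast
        have "ennreal ((g x)\<^sup>2) \<le> ?D (\<delta> *\<^sub>R i) x + ?D (- (\<delta> *\<^sub>R i)) x"
          using i(2) g(2)[of "x + \<delta> *\<^sub>R i"] g(2)[of "x - \<delta> *\<^sub>R i"] by (auto simp: add_increasing add_increasing2)
        also have "\<dots> \<le> (\<Sum>i\<in>Basis. ?D (\<delta> *\<^sub>R i) x + ?D (- (\<delta> *\<^sub>R i)) x)"
          by (rule member_le_sum[OF i(1)]) auto
        finally show ?thesis using False by simp
      qed simp
    qed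
    also have "\<dots> = (\<Sum>i\<in>Basis. (\<integral>\<^sup>+x. ?D (\<delta> *\<^sub>R i) x \<partial>lborel) + (\<integral>\<^sup>+x. ?D (- (\<delta> *\<^sub>R i)) x \<partial>lborel))"
      by (subst nn_integral_sum) (auto intro!: sum.cong nn_integral_add)
    also have "\<dots> \<le> (\<Sum>i\<in>(Basis :: 'a set). ennreal (S / (2 * ?n)))"
    proof (rule sum_mono)
      fix i :: 'a assume i: "i \<in> Basis"
      then have "norm (\<delta> *\<^sub>R i) = \<delta>" "norm (- (\<delta> *\<^sub>R i)) = \<delta>" using \<delta> by auto
      from add_mono[OF sh[OF this(1)] sh[OF this(2)]]
      have "(\<integral>\<^sup>+x. ?D (\<delta> *\<^sub>R i) x \<partial>lborel) + (\<integral>\<^sup>+x. ?D (- (\<delta> *\<^sub>R i)) x \<partial>lborel) \<le> ennreal (S / (4 * ?n)) + ennreal (S / (4 * ?n))" .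
      also have "\<dots> = ennreal (S / (2 * ?n))" using S0 n by (subst ennreal_plus[symmetric]) (auto simp: field_simps)
      finally show "(\<integral>\<^sup>+x. ?D (\<delta> *\<^sub>R i) x \<partial>lborel) + (\<integral>\<^sup>+x. ?D (- (\<delta> *\<^sub>R i)) x \<partial>lborel) \<le> ennreal (S / (2 * ?n))" .
    qed
    also have "\<dots> = ennreal (\<Sum>i\<in>(Basis :: 'a set). S / (2 * ?n))" by (rule sum_ennreal) (use S0 in auto)
    also have "(\<Sum>i\<in>(Basis :: 'a set). S / (2 * ?n)) = S / 2" using n by simp
    finally have "(\<integral>x. (g x)\<^sup>2 - indicator ?C x * (g x)\<^sup>2 \<partial>lborel) \<le> S / 2"
      using S0 by (subst (asm) ennreal_le_iff) auto
    then show "(\<integral>x. (g x)\<^sup>2 \<partial>lborel) \<le> 2 * (\<integral>x. indicator ?C x * (g x)\<^sup>2 \<partial>lborel)"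
      using ig iC by (simp add: S_def)
  qed
qed

end

section \<open>Log-concavity of the eigenfunction\<close>

context dirichlet_eigenfunction
begin

text \<open>By continuity a strict failure persists under a common small translation of the three
  points, with a uniform factor \<theta> < 1. A ball of translations is needed because g is compared
  with \<open>u\<close> only in L^2.\<close>

lemma log_concavity_defect:
  assumes x: "x0 \<in> \<Omega>" "x1 \<in> \<Omega>" and t: "0 < t" "t < 1"
    and less: "u ((1 - t) *\<^sub>R x0 + t *\<^sub>R x1) < u x0 powr (1 - t) * u x1 powr t"
  obtains \<theta> \<rho> where "0 < \<theta>" "\<theta> < 1" "0 < \<rho>"
    "\<And>h. norm h < \<rho> \<Longrightarrow> u ((1 - t) *\<^sub>R x0 + t *\<^sub>R x1 + h) < \<theta> * (u (x0 + h) powr (1 - t) * u (x1 + h) powr t)"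
proof -
  let ?xt = "(1 - t) *\<^sub>R x0 + t *\<^sub>R x1"
  have xt: "?xt \<in> \<Omega>" using convex_\<Omega> x t by (intro convexD) auto
  have lim: "((\<lambda>h. u (y + h)) \<longlongrightarrow> u y) (at 0)" if "y \<in> \<Omega>" for y
  proof -
    have "isCont u y" using continuous_u open_\<Omega> that by (simp add: continuous_on_eq_continuous_at)
    then show ?thesis by (simp add: isCont_iff)
  qed
  let ?G = "\<lambda>h. u (x0 + h) powr (1 - t) * u (x1 + h) powr t"
  define v where "v = u ?xt / ?G 0"
  \<comment> \<open>Midpoint between the ratio v at the given points and 1.\<close>
  define \<theta> where "\<theta> = (v + 1) / 2"
  have pos: "0 < u x0" "0 < u x1" "0 < u ?xt" using u_pos x xt by auto
  have G0: "0 < ?G 0" using pos by simp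
  have v: "v < 1" using less G0 by (simp add: v_def pos_divide_less_eq)
  have v0: "0 < v" unfolding v_def by (rule divide_pos_pos[OF pos(3) G0])
  have th: "0 < \<theta>" "\<theta> < 1" "v < \<theta>" using v v0 by (auto simp: \<theta>_def)
  have limG: "(?G \<longlongrightarrow> u x0 powr (1 - t) * u x1 powr t) (at 0)"
    using pos by (intro tendsto_mult tendsto_powr lim x tendsto_const) auto
  have "((\<lambda>h. \<theta> * ?G h - u (?xt + h)) \<longlongrightarrow> \<theta> * (u x0 powr (1 - t) * u x1 powr t) - u ?xt) (at 0)"
    by (intro tendsto_diff tendsto_mult_left limG lim xt)
  moreover have d0: "0 < \<theta> * (u x0 powr (1 - t) * u x1 powr t) - u ?xt"
    using th(3) G0 by (simp add: v_def pos_divide_less_eq)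
  ultimately have "\<forall>\<^sub>F h in at 0. 0 < \<theta> * ?G h - u (?xt + h)" by (rule order_tendstoD(1))
  then obtain \<rho> where \<rho>: "0 < \<rho>" "\<And>h. h \<noteq> 0 \<Longrightarrow> dist h 0 < \<rho> \<Longrightarrow> 0 < \<theta> * ?G h - u (?xt + h)"
    unfolding eventually_at by auto
  show ?thesis
  proof (rule that[OF th(1,2) \<rho>(1)])
    fix h :: 'a assume h: "norm h < \<rho>"
    show "u (?xt + h) < \<theta> * ?G h"
    proof (cases "h = 0")
      case True
      then show ?thesis using d0 by simp
    next
      case False
      then show ?thesis using \<rho>(2)[OF False] h by (simp add: dist_norm)
    qed
  qed
qed

text \<open>If all three ratios were within \<tau> a of a, log-concavity of g would give (1 -
  \<tau>) a G < (1 + \<tau>) a \<theta> G, with G the geometric mean of the values of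
  \<open>u\<close>. The value of \<tau> is the one with 1 - \<tau> = (1 + \<tau>) \<theta>.\<close>

lemma ratio_defect:
  assumes g: "g ((1 - t) *\<^sub>R y0 + t *\<^sub>R y1) \<ge> g y0 powr (1 - t) * g y1 powr t"
    and t: "0 < t" "t < 1" and y: "y0 \<in> \<Omega>" "y1 \<in> \<Omega>" "(1 - t) *\<^sub>R y0 + t *\<^sub>R y1 \<in> \<Omega>"
    and \<theta>: "0 < \<theta>" "\<theta> < 1" "u ((1 - t) *\<^sub>R y0 + t *\<^sub>R y1) < \<theta> * (u y0 powr (1 - t) * u y1 powr t)"
    and a: "0 \<le> a"
  defines "w \<equiv> \<lambda>x. g x / U x" and "\<tau> \<equiv> (1 - \<theta>) / (1 + \<theta>)"
  shows "(\<tau> * a)\<^sup>2 \<le> (w y0 - a)\<^sup>2 + (w y1 - a)\<^sup>2 + (w ((1 - t) *\<^sub>R y0 + t *\<^sub>R y1) - a)\<^sup>2"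
proof (rule ccontr)
  assume *: "\<not> ?thesis"
  let ?yt = "(1 - t) *\<^sub>R y0 + t *\<^sub>R y1"
  have \<tau>: "0 < \<tau>" "\<tau> < 1" "\<tau> * (1 + \<theta>) = 1 - \<theta>" using \<theta> by (auto simp: \<tau>_def)
  have near: "\<bar>w y - a\<bar> < \<tau> * a" if "(w y - a)\<^sup>2 < (\<tau> * a)\<^sup>2" for y
    using power2_less_imp_less[of "\<bar>w y - a\<bar>" "\<tau> * a"] that \<tau> a by simp
  have sq: "0 \<le> (w y - a)\<^sup>2" for y by simp
  have n: "\<bar>w y0 - a\<bar> < \<tau> * a" "\<bar>w y1 - a\<bar> < \<tau> * a" "\<bar>w ?yt - a\<bar> < \<tau> * a"
    using * sq[of y0] sq[of y1] sq[of ?yt] by (intro near; linarith)+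
  have "0 < \<tau> * a" using n(1) by linarith
  then have a0: "0 < a" using \<tau> by (simp add: zero_less_mult_iff)
  have gy: "g y = w y * u y" if "y \<in> \<Omega>" for y using u_pos[OF that] that by (simp add: w_def U_def)
  define b where "b = (1 - \<tau>) * a"
  have b: "0 < b" using \<tau> a0 by (simp add: b_def)
  have wb: "b \<le> w y0" "b \<le> w y1" "w ?yt \<le> (1 + \<tau>) * a"
    using n unfolding b_def by (auto simp: abs_less_iff algebra_simps)
  note up = u_pos[OF y(1)] u_pos[OF y(2)] u_pos[OF y(3)]
  let ?G = "u y0 powr (1 - t) * u y1 powr t"
  have G: "0 < ?G" using up by simp
  have "b * ?G = (b * u y0) powr (1 - t) * (b * u y1) powr t"
  proof -
    have "b powr (1 - t) * b powr t = b" using b by (simp add: powr_add[symmetric])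
    then show ?thesis using b up by (simp add: powr_mult mult_ac)
  qed
  also have "\<dots> \<le> g y0 powr (1 - t) * g y1 powr t"
    unfolding gy[OF y(1)] gy[OF y(2)] using wb b up t
    by (intro mult_mono powr_mono2 mult_right_mono) auto
  also have "\<dots> \<le> w ?yt * u ?yt" using g unfolding gy[OF y(3)] .
  also have "\<dots> \<le> (1 + \<tau>) * a * u ?yt" using wb(3) up by (intro mult_right_mono) auto
  also have "\<dots> < (1 + \<tau>) * a * (\<theta> * ?G)" using \<tau> a0 \<theta> by (intro mult_strict_left_mono) auto
  finally have "b * ?G < ((1 + \<tau>) * a * \<theta>) * ?G" by (simp only: mult.assoc)
  then have "b < (1 + \<tau>) * a * \<theta>" by (simp only: mult_less_cancel_right_pos[OF G])
  then have "(1 - \<tau>) * a < ((1 + \<tau>) * \<theta>) * a" by (simp add: b_def mult_ac)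
  then have "1 - \<tau> < (1 + \<tau>) * \<theta>" by (simp only: mult_less_cancel_right_pos[OF a0])
  with \<tau>(3) show False by (simp add: algebra_simps)
qed

text \<open>Two demands on the constant a near g / u collide. The defect on a ball of translations
  forces a^2 to be of order \<kappa> S, with S the mass of g, and near constancy then makes the mass
  of g on Q of order \<kappa> S as well; tightness says that this mass is at least S / 2. A small
  \<kappa> is contradictory.\<close>

lemma log_concave_eigenfunction:
  assumes x: "x0 \<in> \<Omega>" "x1 \<in> \<Omega>" and t: "0 < t" "t < 1"
  shows "u x0 powr (1 - t) * u x1 powr t \<le> u ((1 - t) *\<^sub>R x0 + t *\<^sub>R x1)"
proof (rule ccontr)
  assume "\<not> ?thesis"
  then have less: "u ((1 - t) *\<^sub>R x0 + t *\<^sub>R x1) < u x0 powr (1 - t) * u x1 powr t" by simp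
  let ?c = "second_moment TYPE('a)"
  let ?xt = "(1 - t) *\<^sub>R x0 + t *\<^sub>R x1"
  have c: "0 < ?c" by (rule second_moment_pos)
  obtain \<theta> \<rho>0 where \<theta>: "0 < \<theta>" "\<theta> < 1" and \<rho>0: "0 < \<rho>0"
    "\<And>h. norm h < \<rho>0 \<Longrightarrow> u (?xt + h) < \<theta> * (u (x0 + h) powr (1 - t) * u (x1 + h) powr t)"
    using log_concavity_defect[OF x t less] by metis
  obtain \<delta> \<eta>0 where \<delta>: "0 < \<delta>" "0 < \<eta>0" and tight:
    "\<And>r \<epsilon> g. 0 < r \<Longrightarrow> r \<le> \<delta> \<Longrightarrow> \<epsilon> \<le> 1 \<Longrightarrow> bbs g \<Longrightarrow> (\<And>x. x \<notin> \<Omega> \<Longrightarrow> g x = 0) \<Longrightarrow>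
      (1 - ?c * r\<^sup>2 * (eigenvalue + \<epsilon>)) * (\<integral>x. (g x)\<^sup>2 \<partial>lborel) \<le> (\<integral>x. weight r x * (avg r g x)\<^sup>2 \<partial>lborel) \<Longrightarrow>
      (\<integral>x. (g x)\<^sup>2 \<partial>lborel) \<le> 2 * (\<integral>x. indicator (core \<eta>0) x * (g x)\<^sup>2 \<partial>lborel)"
    using tightness by blast
  obtain \<eta>1 where \<eta>1: "0 < \<eta>1" "x0 \<in> core \<eta>1" using mem_core[OF x(1)] by blast
  obtain \<eta>2 where \<eta>2: "0 < \<eta>2" "x1 \<in> core \<eta>2" using mem_core[OF x(2)] by blast
  \<comment> \<open>Halving the minimum leaves room to translate the three points by less than
    \<eta> inside Q, and Q still contains the core from tightness.\<close>
  define \<eta> where "\<eta> = Min {\<eta>0, \<eta>1, \<eta>2} / 2"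
  have \<eta>: "0 < \<eta>" "2 * \<eta> \<le> \<eta>0" "2 * \<eta> \<le> \<eta>1" "2 * \<eta> \<le> \<eta>2" using \<delta> \<eta>1 \<eta>2 by (auto simp: \<eta>_def)
  define Q where "Q = core \<eta>"
  define P where "P = core (\<eta> / 2)"
  have in2: "x0 \<in> core (2 * \<eta>)" "x1 \<in> core (2 * \<eta>)"
    using core_antimono[OF \<eta>(3)] core_antimono[OF \<eta>(4)] \<eta>1 \<eta>2 by auto
  then have "?xt \<in> core (2 * \<eta>)" using convex_core t by (intro convexD) auto
  note in2 = in2 this
  have inQ: "y + h \<in> Q" if "y \<in> core (2 * \<eta>)" "norm h < \<eta>" for y h
    using core_nbhd[OF that(1), of "y + h" \<eta>] that(2) by (simp add: Q_def dist_norm)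
  have Q: "Q \<in> sets borel" "convex Q" "bounded Q" "Q \<subseteq> \<Omega>" and P: "P \<in> sets borel" "P \<subseteq> \<Omega>" "compact P" and QP: "Q \<subseteq> P"
    using core_subset[of \<eta>] core_subset[of "\<eta> / 2"] bounded_core[of \<eta>] compact_core[of "\<eta> / 2"] convex_core core_antimono[of "\<eta> / 2" \<eta>] \<eta>(1)
    by (auto simp: Q_def P_def)
  obtain R where R: "0 \<le> R" "Q \<subseteq> cball 0 R"
  proof -
    obtain R where R: "\<And>x. x \<in> Q \<Longrightarrow> norm x \<le> R" using Q(3) unfolding bounded_iff by blast
    have "norm x0 \<le> R" using R[OF inQ[OF in2(1), of 0]] \<eta>(1) by simp
    then have "0 \<le> R" using norm_ge_zero[of x0] by linarith
    then show ?thesis by (intro that[of R]) (use R in \<open>auto simp: subset_eq\<close>)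
  qed
  obtain Bu where Bu: "0 \<le> Bu" "\<And>x. x \<in> P \<Longrightarrow> \<bar>u x\<bar> \<le> Bu" using bounded_on_compact[OF continuous_u P(3,2)] by blast
  have "continuous_on \<Omega> (\<lambda>x. inverse (u x))"
    using continuous_u u_pos by (intro continuous_on_inverse) (auto simp: less_le)
  then obtain Bi where Bi: "0 \<le> Bi" "\<And>x. x \<in> P \<Longrightarrow> \<bar>inverse (u x)\<bar> \<le> Bi" using bounded_on_compact P(2,3) by metis
  define u0 where "u0 = 1 / (Bi + 1)"
  have u0: "0 < u0" "\<And>x. x \<in> P \<Longrightarrow> u0 \<le> u x"
  proof -
    show "0 < u0" using Bi by (simp add: u0_def)
    fix x assume x: "x \<in> P"
    then have p: "0 < u x" using P u_pos by blast
    have "inverse (u x) \<le> Bi + 1" using Bi(2)[OF x] by linarith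
    then show "u0 \<le> u x" using p Bi(1) by (simp add: u0_def field_simps)
  qed
  obtain K where K: "0 < K" "\<And>(P :: 'a set) Q f r \<eta> h. P \<in> sets borel \<Longrightarrow> Q \<in> sets borel \<Longrightarrow> convex Q \<Longrightarrow>
     f \<in> borel_measurable borel \<Longrightarrow> 0 < r \<Longrightarrow> 0 \<le> \<eta> \<Longrightarrow> (\<forall>x\<in>Q. \<forall>y. dist x y \<le> r \<longrightarrow> y \<in> P) \<Longrightarrow>
     nonlocal_energy P r f \<le> ennreal (\<eta> * r\<^sup>2) \<Longrightarrow> shift_energy Q f h \<le> ennreal (K * \<eta> * (norm h + r)\<^sup>2)"
    using chain_inequality[where 'a = 'a] by blast
  define \<rho> where "\<rho> = min \<rho>0 \<eta>"
  have \<rho>: "0 < \<rho>" "\<rho> \<le> \<rho>0" "\<rho> \<le> \<eta>" using \<rho>0 \<eta> by (auto simp: \<rho>_def)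
  define \<tau> where "\<tau> = (1 - \<theta>) / (1 + \<theta>)"
  have \<tau>: "0 < \<tau>" using \<theta> by (simp add: \<tau>_def)
  define q where "q = measure lborel Q"
  define \<beta> where "\<beta> = measure lborel (ball (0::'a) \<rho>)"
  define m where "m = measure lborel (cball (0::'a) (2 * R))"
  have fin: "emeasure lborel A = ennreal (measure lborel A)" if "bounded A" for A :: "'a set"
    using emeasure_bounded_finite[OF that] by (intro emeasure_eq_ennreal_measure) auto
  have \<beta>: "0 < \<beta>" unfolding \<beta>_def using content_ball_pos[OF \<rho>(1), of "0::'a"] by simp
  have q: "0 < q"
  proof -
    have "ball x0 \<eta> \<subseteq> Q"
    proof
      fix y assume "y \<in> ball x0 \<eta>"
      then have "norm (y - x0) < \<eta>" by (simp add: dist_norm norm_minus_commute)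
      from inQ[OF in2(1) this] show "y \<in> Q" by simp
    qed
    then have "measure lborel (ball x0 \<eta>) \<le> q"
      unfolding q_def using Q(1) emeasure_bounded_finite[OF Q(3)] by (intro measure_mono_fmeasurable fmeasurableI) auto
    with content_ball_pos[OF \<eta>(1), of x0] show ?thesis by linarith
  qed
  \<comment> \<open>Collects the final estimate S \<le> 4 Bu^2 \<kappa> S + 4 Bu^2 q a^2 with a^2
    \<le> 3 \<kappa> S / (\<tau>^2 \<beta>), so that it reads S \<le> \<kappa> Y S.\<close>
  define Y where "Y = 4 * Bu\<^sup>2 + 12 * Bu\<^sup>2 * q / (\<tau>\<^sup>2 * \<beta>)"
  have Y: "0 \<le> Y" using q \<tau> \<beta> by (simp add: Y_def)
  define \<kappa> where "\<kappa> = 1 / (Y + 1)"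
  have \<kappa>: "0 < \<kappa>" "\<kappa> * Y < 1" using Y by (auto simp: \<kappa>_def)
  \<comment> \<open>Arranged so that E m = \<epsilon> Z S for the bound E on shift energies below; 2
    R + 1 bounds |h| + r for the relevant shifts.\<close>
  define Z where "Z = K * (8 * ?c / u0\<^sup>2) * (2 * R + 1)\<^sup>2 * m"
  have Z: "0 \<le> Z" using K(1) c by (simp add: Z_def m_def)
  \<comment> \<open>All constants entering here depend on P and Q only. The core that carries g is
    chosen after \<epsilon>.\<close>
  define \<epsilon> where "\<epsilon> = min 1 (\<kappa> * q / (Z + 1))"
  have \<epsilon>: "0 < \<epsilon>" "\<epsilon> \<le> 1" using \<kappa> q Z by (auto simp: \<epsilon>_def)
  have \<epsilon>Z: "\<epsilon> * Z < \<kappa> * q"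
  proof -
    have "\<epsilon> * (Z + 1) \<le> \<kappa> * q / (Z + 1) * (Z + 1)" using Z by (intro mult_right_mono) (auto simp: \<epsilon>_def)
    also have "\<dots> = \<kappa> * q" using Z by simp
    finally show ?thesis using \<epsilon> by (simp add: distrib_left)
  qed
  obtain d0 r1 where d0: "0 < d0" "0 < r1" and opt:
    "\<forall>d r. 0 < d \<longrightarrow> d \<le> d0 \<longrightarrow> 0 < r \<longrightarrow> r < r1 \<longrightarrow>
    (\<exists>g. bbs g \<and> log_concave g \<and> (\<forall>x. x \<notin> core d \<longrightarrow> g x = 0) \<and> 0 < (\<integral>x. (g x)\<^sup>2 \<partial>lborel) \<and>
      (1 - ?c * r\<^sup>2 * (eigenvalue + \<epsilon>)) * (\<integral>x. (g x)\<^sup>2 \<partial>lborel) \<le> (\<integral>x. weight r x * (avg r g x)\<^sup>2 \<partial>lborel))"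
    using near_optimal[OF \<epsilon>(1)] by (elim exE conjE) (rule that)
  \<comment> \<open>d \<le> \<eta> / 2 makes P a subset of core d, as the ratio estimate requires,
    while its lower bound u0 depends on P alone.\<close>
  define d where "d = min d0 (\<eta> / 2)"
  have d: "0 < d" "d \<le> d0" "d \<le> \<eta> / 2" using d0 \<eta> by (auto simp: d_def)
  obtain r2 where r2: "0 < r2" and ratio:
    "\<And>r g P u0. 0 < r \<Longrightarrow> r < r2 \<Longrightarrow> bbs g \<Longrightarrow> (\<And>x. x \<notin> core d \<Longrightarrow> g x = 0) \<Longrightarrow>
      (1 - ?c * r\<^sup>2 * (eigenvalue + \<epsilon>)) * (\<integral>x. (g x)\<^sup>2 \<partial>lborel) \<le> (\<integral>x. weight r x * (avg r g x)\<^sup>2 \<partial>lborel) \<Longrightarrow>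
      P \<in> sets borel \<Longrightarrow> P \<subseteq> core d \<Longrightarrow> 0 < u0 \<Longrightarrow> (\<And>x. x \<in> P \<Longrightarrow> u0 \<le> u x) \<Longrightarrow>
      nonlocal_energy P r (\<lambda>x. g x / U x) \<le> ennreal (8 * ?c * \<epsilon> / u0\<^sup>2 * (\<integral>x. (g x)\<^sup>2 \<partial>lborel) * r\<^sup>2)"
    using ratio_energy[OF d(1) \<epsilon>(1)] by blast
  define r where "r = Min {r1, r2, \<delta>, \<eta> / 2, 1} / 2"
  have r0: "0 < Min {r1, r2, \<delta>, \<eta> / 2, 1}" using d0 r2 \<delta> \<eta> by simp
  have r: "0 < r" "r < r1" "r < r2" "r \<le> \<delta>" "r \<le> \<eta> / 2" "r \<le> 1"
  proof -
    have "r < Min {r1, r2, \<delta>, \<eta> / 2, 1}" "0 < r" using r0 unfolding r_def by linarith+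
    then show "0 < r" "r < r1" "r < r2" "r \<le> \<delta>" "r \<le> \<eta> / 2" "r \<le> 1" by simp_all
  qed
  obtain g where g: "bbs g" "log_concave g" "\<And>x. x \<notin> core d \<Longrightarrow> g x = 0" "0 < (\<integral>x. (g x)\<^sup>2 \<partial>lborel)"
    "(1 - ?c * r\<^sup>2 * (eigenvalue + \<epsilon>)) * (\<integral>x. (g x)\<^sup>2 \<partial>lborel) \<le> (\<integral>x. weight r x * (avg r g x)\<^sup>2 \<partial>lborel)"
    using opt[rule_format, OF d(1,2) r(1,2)] by (elim exE conjE) (rule that; simp)
  define S where "S = (\<integral>x. (g x)\<^sup>2 \<partial>lborel)"
  have S: "0 < S" using g(4) by (simp add: S_def)
  define w where "w x = g x / U x" for x
  have [measurable]: "g \<in> borel_measurable borel" by (rule bbs_measurable[OF g(1)])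
  have wm [measurable]: "w \<in> borel_measurable borel" unfolding w_def[abs_def] by measurable
  have [measurable]: "Q \<in> sets borel" by (rule Q(1))
  have Pd: "P \<subseteq> core d" unfolding P_def by (rule core_antimono[OF d(3)])
  have g\<Omega>: "g x = 0" if "x \<notin> \<Omega>" for x using g(3) core_subset[OF d(1)] that by blast
  have SQ: "S \<le> 2 * (\<integral>x. indicator Q x * (g x)\<^sup>2 \<partial>lborel)"
  proof -
    have "S \<le> 2 * (\<integral>x. indicator (core \<eta>0) x * (g x)\<^sup>2 \<partial>lborel)"
      unfolding S_def by (rule tight[OF r(1,4) \<epsilon>(2) g(1) g\<Omega> g(5)])
    also have "(\<integral>x. indicator (core \<eta>0) x * (g x)\<^sup>2 \<partial>lborel) \<le> (\<integral>x. indicator Q x * (g x)\<^sup>2 \<partial>lborel)"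
    proof (rule integral_mono)
      show "integrable lborel (\<lambda>x. indicator (core \<eta>0) x * (g x)\<^sup>2)" "integrable lborel (\<lambda>x. indicator Q x * (g x)\<^sup>2)"
        by (rule bbs_integrable[OF bbs_mult_bounded[OF bbs_power2[OF g(1)], where B = 1]]; auto simp: indicator_def)+
      have "core \<eta>0 \<subseteq> Q" unfolding Q_def by (rule core_antimono) (use \<eta> in simp)
      then show "indicator (core \<eta>0) x * (g x)\<^sup>2 \<le> indicator Q x * (g x)\<^sup>2" for x by (auto simp: indicator_def)
    qed
    finally show ?thesis by simp
  qed
  have nlP: "nonlocal_energy P r w \<le> ennreal (8 * ?c * \<epsilon> / u0\<^sup>2 * S * r\<^sup>2)"
    unfolding w_def[abs_def] S_def by (rule ratio[OF r(1,3) g(1,3,5) P(1) Pd u0])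
  define E where "E = K * (8 * ?c * \<epsilon> / u0\<^sup>2 * S) * (2 * R + 1)\<^sup>2"
  have E0: "0 \<le> 8 * ?c * \<epsilon> / u0\<^sup>2 * S" using c \<epsilon> S by simp
  have KE0: "0 \<le> K * (8 * ?c * \<epsilon> / u0\<^sup>2 * S)" by (rule mult_nonneg_nonneg[OF less_imp_le[OF K(1)] E0])
  have E: "0 \<le> E" unfolding E_def by (rule mult_nonneg_nonneg[OF KE0 zero_le_power2])
  have sh: "shift_energy Q w h \<le> ennreal E" if "norm h \<le> 2 * R" for h
  proof -
    have nb: "\<forall>x\<in>Q. \<forall>y. dist x y \<le> r \<longrightarrow> y \<in> P"
    proof (intro ballI allI impI)
      fix x y assume "x \<in> Q" "dist x y \<le> r"
      then have "y \<in> core (\<eta> - \<eta> / 2)" using core_nbhd[of x \<eta> y "\<eta> / 2"] r(5) by (simp add: Q_def)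
      then show "y \<in> P" by (simp add: P_def)
    qed
    have "shift_energy Q w h \<le> ennreal (K * (8 * ?c * \<epsilon> / u0\<^sup>2 * S) * (norm h + r)\<^sup>2)"
      by (rule K(2)[OF P(1) Q(1,2) wm r(1) E0 nb nlP])
    also have "\<dots> \<le> ennreal E"
      unfolding E_def
    proof (intro ennreal_leI mult_left_mono[OF _ KE0] power_mono)
      show "norm h + r \<le> 2 * R + 1" using that r(6) by simp
    qed (use r(1) in simp)
    finally show ?thesis .
  qed
  have "E * m < (\<kappa> * S) * q"
  proof -
    have "E * m = (\<epsilon> * Z) * S" by (simp add: E_def Z_def mult_ac)
    also have "\<dots> < (\<kappa> * q) * S" using \<epsilon>Z S by (rule mult_strict_right_mono)
    finally show ?thesis by (simp add: mult_ac)
  qed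
  then have "E * measure lborel (cball (0::'a) (2 * R)) < (\<kappa> * S) * measure lborel Q" by (simp only: m_def q_def)
  then have "\<exists>y\<in>Q. (\<integral>\<^sup>+x. ennreal (indicator Q x * (w x - w y)\<^sup>2) \<partial>lborel) \<le> ennreal (\<kappa> * S)"
    by (intro nearly_constant[OF Q(1) wm R(2) E sh])
  then obtain y where y: "y \<in> Q" "(\<integral>\<^sup>+x. ennreal (indicator Q x * (w x - w y)\<^sup>2) \<partial>lborel) \<le> ennreal (\<kappa> * S)" by (elim bexE) (rule that)
  define a where "a = w y"
  have a: "0 \<le> a" using log_concave_nonneg[OF g(2), of y] U_nonneg[of y] by (simp add: a_def w_def)
  define D where "D = (\<integral>\<^sup>+x. ennreal (indicator Q x * (w x - a)\<^sup>2) \<partial>lborel)"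
  have D: "D \<le> ennreal (\<kappa> * S)" using y(2) by (simp only: D_def a_def)
  have \<kappa>S: "0 \<le> \<kappa> * S" using \<kappa> S by simp
  have lower: "(\<tau> * a)\<^sup>2 * \<beta> \<le> 3 * (\<kappa> * S)"
  proof -
    let ?F = "\<lambda>z h. ennreal (indicator Q (z + h) * (w (z + h) - a)\<^sup>2)"
    have F: "(\<integral>\<^sup>+h. ?F z h \<partial>lborel) = D" for z
      unfolding D_def add.commute[of z]
      by (rule lborel_nn_integral_translate[where f = "\<lambda>x. ennreal (indicator Q x * (w x - a)\<^sup>2)"]) measurable
    have "ennreal ((\<tau> * a)\<^sup>2 * \<beta>) = (\<integral>\<^sup>+h. ennreal ((\<tau> * a)\<^sup>2) * indicator (ball (0::'a) \<rho>) h \<partial>lborel)"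
      by (simp add: nn_integral_cmult_indicator fin ennreal_mult \<beta>_def)
    \<comment> \<open>The defect holds for each translation h in the ball. Integrating over h
      replaces three pointwise deviations by three copies of the L^2 deviation D.\<close>
    also have "\<dots> \<le> (\<integral>\<^sup>+h. ?F x0 h + ?F x1 h + ?F ?xt h \<partial>lborel)"
    proof (rule nn_integral_mono)
      fix h :: 'a
      show "ennreal ((\<tau> * a)\<^sup>2) * indicator (ball 0 \<rho>) h \<le> ?F x0 h + ?F x1 h + ?F ?xt h"
      proof (cases "norm h < \<rho>")
        case True
        then have h: "norm h < \<rho>0" "norm h < \<eta>" using \<rho> by auto
        have eq: "(1 - t) *\<^sub>R (x0 + h) + t *\<^sub>R (x1 + h) = ?xt + h" by (simp add: algebra_simps)
        note Qs = inQ[OF in2(1) h(2)] inQ[OF in2(2) h(2)] inQ[OF in2(3) h(2)]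
        have \<Omega>s: "x0 + h \<in> \<Omega>" "x1 + h \<in> \<Omega>" "?xt + h \<in> \<Omega>" using Qs Q(4) by auto
        have "(\<tau> * a)\<^sup>2 \<le> (w (x0 + h) - a)\<^sup>2 + (w (x1 + h) - a)\<^sup>2 + (w (?xt + h) - a)\<^sup>2"
        proof -
          have 1: "g (x0 + h) powr (1 - t) * g (x1 + h) powr t \<le> g ((1 - t) *\<^sub>R (x0 + h) + t *\<^sub>R (x1 + h))"
            by (rule log_concaveD[OF g(2) t])
          have 2: "(1 - t) *\<^sub>R (x0 + h) + t *\<^sub>R (x1 + h) \<in> \<Omega>"
            "u ((1 - t) *\<^sub>R (x0 + h) + t *\<^sub>R (x1 + h)) < \<theta> * (u (x0 + h) powr (1 - t) * u (x1 + h) powr t)"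
            unfolding eq by (rule \<Omega>s(3), rule \<rho>0(2)[OF h(1)])
          from ratio_defect[OF 1 t \<Omega>s(1,2) 2(1) \<theta> 2(2) a] show ?thesis unfolding eq w_def \<tau>_def .
        qed
        then have "ennreal ((\<tau> * a)\<^sup>2) \<le> ennreal ((w (x0 + h) - a)\<^sup>2) + ennreal ((w (x1 + h) - a)\<^sup>2) + ennreal ((w (?xt + h) - a)\<^sup>2)"
          by (subst ennreal_plus[symmetric], simp, simp)+ (rule ennreal_leI)
        then show ?thesis using True Qs by simp
      qed simp
    qed
    also have "\<dots> = D + D + D" by (simp add: nn_integral_add F)
    also have "\<dots> \<le> ennreal (\<kappa> * S) + ennreal (\<kappa> * S) + ennreal (\<kappa> * S)" by (intro add_mono D)
    also have "\<dots> = ennreal (\<kappa> * S + \<kappa> * S + \<kappa> * S)"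
      using \<kappa>S by (simp only: ennreal_plus add_nonneg_nonneg)
    also have "\<kappa> * S + \<kappa> * S + \<kappa> * S = 3 * (\<kappa> * S)" by simp
    finally show ?thesis using \<kappa>S by (subst (asm) ennreal_le_iff) auto
  qed
  \<comment> \<open>On Q one has g = w u with u at most Bu, and w splits into its deviation from a
    and the constant a.\<close>
  have upper: "(\<integral>x. indicator Q x * (g x)\<^sup>2 \<partial>lborel) \<le> 2 * Bu\<^sup>2 * (\<kappa> * S) + 2 * Bu\<^sup>2 * a\<^sup>2 * q"
  proof -
    have "integrable lborel (\<lambda>x. indicator Q x * (g x)\<^sup>2)"
      by (rule bbs_integrable[OF bbs_mult_bounded[OF bbs_power2[OF g(1)], where B = 1]]) (auto simp: indicator_def)
    then have "ennreal (\<integral>x. indicator Q x * (g x)\<^sup>2 \<partial>lborel) = (\<integral>\<^sup>+x. ennreal (indicator Q x * (g x)\<^sup>2) \<partial>lborel)"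
      by (intro nn_integral_eq_integral[symmetric]) auto
    also have "\<dots> \<le> (\<integral>\<^sup>+x. ennreal (2 * Bu\<^sup>2) * ennreal (indicator Q x * (w x - a)\<^sup>2) + ennreal (2 * Bu\<^sup>2 * a\<^sup>2) * indicator Q x \<partial>lborel)"
    proof (rule nn_integral_mono)
      fix x :: 'a
      show "ennreal (indicator Q x * (g x)\<^sup>2) \<le> ennreal (2 * Bu\<^sup>2) * ennreal (indicator Q x * (w x - a)\<^sup>2) + ennreal (2 * Bu\<^sup>2 * a\<^sup>2) * indicator Q x"
      proof (cases "x \<in> Q")
        case True
        then have x\<Omega>: "x \<in> \<Omega>" and xP: "x \<in> P" using Q(4) QP by auto
        have "g x = w x * u x" using u_pos[OF x\<Omega>] x\<Omega> by (simp add: w_def U_def)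
        then have "(g x)\<^sup>2 = (u x)\<^sup>2 * (w x)\<^sup>2" by (simp add: power_mult_distrib)
        also have "\<dots> \<le> Bu\<^sup>2 * (2 * (w x - a)\<^sup>2 + 2 * a\<^sup>2)"
        proof (rule mult_mono)
          show "(u x)\<^sup>2 \<le> Bu\<^sup>2" using Bu(2)[OF xP] Bu(1) by (simp add: abs_le_square_iff[symmetric])
          show "(w x)\<^sup>2 \<le> 2 * (w x - a)\<^sup>2 + 2 * a\<^sup>2" using square_le_two_squares[of "w x" 0 a] by simp
        qed auto
        finally have "(g x)\<^sup>2 \<le> 2 * Bu\<^sup>2 * (w x - a)\<^sup>2 + 2 * Bu\<^sup>2 * a\<^sup>2" by (simp add: algebra_simps)
        then show ?thesis using True by (simp add: ennreal_plus[symmetric] ennreal_mult[symmetric] del: ennreal_plus)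
      qed simp
    qed
    also have "\<dots> = ennreal (2 * Bu\<^sup>2) * D + ennreal (2 * Bu\<^sup>2 * a\<^sup>2) * ennreal q"
      by (simp add: nn_integral_add nn_integral_cmult nn_integral_cmult_indicator fin[OF Q(3)] D_def q_def)
    also have "\<dots> \<le> ennreal (2 * Bu\<^sup>2) * ennreal (\<kappa> * S) + ennreal (2 * Bu\<^sup>2 * a\<^sup>2) * ennreal q"
      by (intro add_mono mult_left_mono D) auto
    also have "\<dots> = ennreal (2 * Bu\<^sup>2 * (\<kappa> * S)) + ennreal (2 * Bu\<^sup>2 * a\<^sup>2 * q)"
      using \<kappa>S q by (simp only: ennreal_mult'[symmetric] zero_le_mult_iff zero_le_numeral zero_le_power2 simp_thms)
    also have "\<dots> = ennreal (2 * Bu\<^sup>2 * (\<kappa> * S) + 2 * Bu\<^sup>2 * a\<^sup>2 * q)"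
      using \<kappa>S q by (intro ennreal_plus[symmetric]) (auto intro!: mult_nonneg_nonneg)
    finally show ?thesis using \<kappa>S q by (subst (asm) ennreal_le_iff) (auto intro!: add_nonneg_nonneg mult_nonneg_nonneg)
  qed
  have "a\<^sup>2 \<le> 3 * (\<kappa> * S) / (\<tau>\<^sup>2 * \<beta>)"
    using lower \<tau> \<beta> by (simp add: power_mult_distrib pos_le_divide_eq mult_ac)
  then have "4 * Bu\<^sup>2 * q * a\<^sup>2 \<le> 4 * Bu\<^sup>2 * q * (3 * (\<kappa> * S) / (\<tau>\<^sup>2 * \<beta>))" using q by (intro mult_left_mono) auto
  then have "S \<le> 4 * Bu\<^sup>2 * (\<kappa> * S) + 4 * Bu\<^sup>2 * q * (3 * (\<kappa> * S) / (\<tau>\<^sup>2 * \<beta>))"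
    using SQ upper by (simp add: algebra_simps)
  also have "\<dots> = (\<kappa> * Y) * S" by (simp add: Y_def algebra_simps)
  also have "\<dots> < 1 * S" using \<kappa>(2) S by (rule mult_strict_right_mono)
  finally show False by simp
qed

end

theorem theorem1p3:
  fixes \<Omega> :: "'a::euclidean_space set" and V u :: "'a \<Rightarrow> real"
  assumes "domain \<Omega>" and "bounded \<Omega>" and "convex \<Omega>"
    and "convex_on \<Omega> V"
    and "first_dirichlet_eigenfunction \<Omega> V u"
  shows "\<forall>x0\<in>\<Omega>. \<forall>x1\<in>\<Omega>. \<forall>t\<in>{0..1}.
    u ((1 - t) *\<^sub>R x0 + t *\<^sub>R x1) \<ge> u x0 powr (1 - t) * u x1 powr t"
proof (intro ballI)
  fix x0 x1 and t :: real
  assume x: "x0 \<in> \<Omega>" "x1 \<in> \<Omega>" and t: "t \<in> {0..1}"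
  interpret dirichlet_eigenfunction \<Omega> V u
    by standard (use assms in \<open>auto simp: Defs.domain_def\<close>)
  \<comment> \<open>At the end points both sides agree: \<open>powr 0\<close> of a positive value is
    1.\<close>
  consider "t = 0" | "t = 1" | "0 < t" "t < 1" using t by force
  then show "u x0 powr (1 - t) * u x1 powr t \<le> u ((1 - t) *\<^sub>R x0 + t *\<^sub>R x1)"
  proof cases
    case 3
    then show ?thesis by (rule log_concave_eigenfunction[OF x])
  qed (use u_pos[OF x(1)] u_pos[OF x(2)] in auto)
qed

end
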